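(* Let $n\in\mathbb{N}$ ($n\ge1$) and $s\in(0,1)$. Let $\Omega\subset\mathbb{R}^n$ be an open, bounded and smooth domain. Let $W\subset\Omega_e:=\mathbb{R}^n\setminus\overline\Omega$ be nonempty and open with $\overline\Omega\cap\overline W=\emptyset$. Let $q\in L^\infty(\Omega)$ (zero being allowed to be a Dirichlet eigenvalue of $(-\Delta)^s+q$ in $\Omega$). Then the set $$\mathcal R:=\{r_\Omega P_qf+z:\ f\in H_1,\ z\in Z_2\}$$ is dense in $L^2(\Omega)$.
   Context: All functions are real valued. $(-\Delta)^s$ is the Fourier multiplier with symbol $|\xi|^{2s}$. For an open set $V\subset\mathbb{R}^n$, $\widetilde H^s(V)$ is the closure of $C_c^\infty(V)$ in $H^s(\mathbb{R}^n)$; $H^{-s}(V)$ (restrictions to $V$ of $H^{-s}(\mathbb{R}^n)$) is its dual, and $(\cdot,\cdot)_V$ denotes the corresponding pairing. $r_\Omega$ denotes restriction to $\Omega$. Given $f\in\widetilde H^s(W)$ (extended by zero), a (weak) solution of $((-\Delta)^s+q)u=0$ in $\Omega$, $u=f$ in $\Omega_e$, is $u\in H^s(\mathbb{R}^n)$ with $u-f\in\widetilde H^s(\Omega)$ and $((-\Delta)^{s/2}u,(-\Delta)^{s/2}w)_{L^2(\mathbb{R}^n)}+(qu,w)_{L^2(\Omega)}=0$ for all $w\in\widetilde H^s(\Omega)$. $Z_2:=\{z\in\widetilde H^s(\Omega):((-\Delta)^s+q)z=0\text{ in }\Omega\}$, a finite dimensional subspace of $L^2(\Omega)$ (also of $H^s(\mathbb{R}^n)$);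 $H_2$ is its orthogonal complement in $L^2(\Omega)$. $H_1:=\{y\in\widetilde H^s(W):(y,(-\Delta)^sz)_W=0\text{ for all }z\in Z_2\}$; by the Fredholm alternative the exterior Dirichlet problem $((-\Delta)^s+q)u=0$ in $\Omega$, $u=f$ in $\Omega_e$, with $f\in\widetilde H^s(W)$ is solvable if and only if $f\in H_1$, and solutions are unique up to adding elements of $Z_2$. The Poisson operator $P_q:H_1\to H^s(\mathbb{R}^n)/Z_2$ maps $f$ to the class $[u]$ of solutions with exterior data $f$; this class is identified with its unique representative $u$ with $r_\Omega u\in H_2$. *)

theory Defs
  imports "HOL-Analysis.Analysis"
begin

text \<open>
  Elements of \<open>L\<^sup>2\<close> and of Sobolev spaces are represented by functions rather than by classes modulo
  equality almost everywhere; these spaces are invariant under changes on null sets, and norms are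
  accordingly seminorms.
\<close>

section \<open>Square integrable functions\<close>

definition L2_space :: "'a measure \<Rightarrow> ('a \<Rightarrow> 'b::{banach, second_countable_topology}) set" where
  "L2_space M = {u. u \<in> borel_measurable M \<and> integrable M (\<lambda>x. (norm (u x))\<^sup>2)}"

definition L2_seminorm :: "'a measure \<Rightarrow> ('a \<Rightarrow> 'b::{banach, second_countable_topology}) \<Rightarrow> real" where
  "L2_seminorm M u = sqrt (\<integral>x. (norm (u x))\<^sup>2 \<partial>M)"

definition dense_in_L2 :: "'a measure \<Rightarrow> ('a \<Rightarrow> real) set \<Rightarrow> bool" where
  "dense_in_L2 M A \<longleftrightarrow> A \<subseteq> L2_space M \<and>
     (\<forall>v\<in>L2_space M. \<forall>e>0. \<exists>r\<in>A. L2_seminorm M (\<lambda>x. v x - r x) < e)"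

definition Linfty_space :: "'a measure \<Rightarrow> ('a \<Rightarrow> real) set" where
  "Linfty_space M = {q. q \<in> borel_measurable M \<and> (\<exists>C. AE x in M. \<bar>q x\<bar> \<le> C)}"

section \<open>Smooth functions, test functions, smooth domains\<close>

fun iterated_partial :: "'a list \<Rightarrow> ('a::euclidean_space \<Rightarrow> 'b::real_normed_vector) \<Rightarrow> 'a \<Rightarrow> 'b" where
  "iterated_partial [] f = f"
| "iterated_partial (i # is) f = iterated_partial is (\<lambda>x. frechet_derivative f (at x) i)"

definition smooth :: "('a::euclidean_space \<Rightarrow> 'b::real_normed_vector) \<Rightarrow> bool" where
  "smooth f \<longleftrightarrow> (\<forall>is\<in>lists Basis. \<forall>x. iterated_partial is f differentiable (at x))"

definition test_functions :: "'a::euclidean_space set \<Rightarrow> ('a \<Rightarrow> real) set" where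
  "test_functions V =
     {\<phi>. smooth \<phi> \<and> compact (closure {x. \<phi> x \<noteq> 0}) \<and> closure {x. \<phi> x \<noteq> 0} \<subseteq> V}"

definition schwartz :: "('a::euclidean_space \<Rightarrow> complex) set" where
  "schwartz = {\<phi>. smooth \<phi> \<and> (\<forall>is\<in>lists Basis. \<forall>k::nat.
     bounded (range (\<lambda>x. norm x ^ k *\<^sub>R iterated_partial is \<phi> x)))}"

text \<open>
  Near every boundary point \<open>V\<close> is the part above the graph of a smooth function, in the direction of
  some unit vector \<open>e\<close>. The function \<open>\<gamma>\<close> is only evaluated on the hyperplane orthogonal to \<open>e\<close>, so it
  stands for a smooth function of \<open>n - 1\<close> variables.
\<close>

definition smooth_boundary :: "'a::euclidean_space set \<Rightarrow> bool" where
  "smooth_boundary V \<longleftrightarrow> (\<forall>x\<in>frontier V. \<exists>e r. \<exists>\<gamma>::'a \<Rightarrow> real.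
     norm e = 1 \<and> 0 < r \<and> smooth \<gamma> \<and>
     V \<inter> ball x r = {y \<in> ball x r. \<gamma> (y - (y \<bullet> e) *\<^sub>R e) < y \<bullet> e})"

section \<open>Fourier transform and Sobolev spaces\<close>

definition fourier :: "('a::euclidean_space \<Rightarrow> complex) \<Rightarrow> 'a \<Rightarrow> complex" where
  "fourier \<phi> \<xi> = (\<integral>x. cis (- (x \<bullet> \<xi>)) * \<phi> x \<partial>lebesgue)"

definition inv_fourier :: "('a::euclidean_space \<Rightarrow> complex) \<Rightarrow> 'a \<Rightarrow> complex" where
  "inv_fourier \<phi> x = (1 / (2 * pi) ^ DIM('a)) *\<^sub>R (\<integral>\<xi>. cis (x \<bullet> \<xi>) * \<phi> \<xi> \<partial>lebesgue)"

text \<open>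
  The Fourier transform of \<open>u \<in> L\<^sup>2\<close> is its Fourier transform as a tempered distribution, which is
  given by a function in \<open>L\<^sup>2\<close> that is unique up to null sets.
\<close>

definition fourier_L2 :: "('a::euclidean_space \<Rightarrow> real) \<Rightarrow> 'a \<Rightarrow> complex" where
  "fourier_L2 u = (SOME g. g \<in> L2_space lebesgue \<and>
     (\<forall>\<phi>\<in>schwartz. (\<integral>\<xi>. g \<xi> * \<phi> \<xi> \<partial>lebesgue) =
                    (\<integral>x. complex_of_real (u x) * fourier \<phi> x \<partial>lebesgue)))"

text \<open>The Sobolev space of real valued functions on the whole space, for nonnegative order \<open>s\<close>.\<close>

definition Hs :: "real \<Rightarrow> ('a::euclidean_space \<Rightarrow> real) set" where
  "Hs s = {u \<in> L2_space lebesgue.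
     (\<lambda>\<xi>. (1 + (norm \<xi>)\<^sup>2) powr (s / 2) *\<^sub>R fourier_L2 u \<xi>) \<in> L2_space lebesgue}"

definition Hs_seminorm :: "real \<Rightarrow> ('a::euclidean_space \<Rightarrow> real) \<Rightarrow> real" where
  "Hs_seminorm s u =
     L2_seminorm lebesgue (\<lambda>\<xi>. (1 + (norm \<xi>)\<^sup>2) powr (s / 2) *\<^sub>R fourier_L2 u \<xi>)"

definition Hs_tilde :: "real \<Rightarrow> 'a::euclidean_space set \<Rightarrow> ('a \<Rightarrow> real) set" where
  "Hs_tilde s V = {u \<in> Hs s. \<forall>e>0. \<exists>\<phi>\<in>test_functions V. Hs_seminorm s (\<lambda>x. u x - \<phi> x) < e}"

section \<open>The fractional Laplacian\<close>

text \<open>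
  The tempered distribution \<open>(-\<Delta>)\<^sup>a u\<close>, i.e. the inverse Fourier transform of
  \<open>\<xi> \<mapsto> \<bar>\<xi>\<bar>\<^bsup>2a\<^esup> fourier_L2 u \<xi>\<close>, as a functional on Schwartz functions. It is meant for \<open>u\<close> in \<open>L\<^sup>2\<close>
  and \<open>a > 0\<close>; for \<open>u \<in> H\<^sup>s\<close> and \<open>a = s\<close> it belongs to \<open>H\<^bsup>-s\<^esup>\<close>.
\<close>

definition frac_laplace ::
    "real \<Rightarrow> ('a::euclidean_space \<Rightarrow> real) \<Rightarrow> ('a \<Rightarrow> complex) \<Rightarrow> complex" where
  "frac_laplace a u \<phi> =
     (\<integral>\<xi>. (norm \<xi> powr (2 * a) *\<^sub>R fourier_L2 u \<xi>) * inv_fourier \<phi> \<xi> \<partial>lebesgue)"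

text \<open>
  The real \<open>L\<^sup>2\<close> function representing that distribution; it exists whenever \<open>u \<in> H\<^bsup>2a\<^esup>\<close>.
\<close>

definition frac_laplace_L2 ::
    "real \<Rightarrow> ('a::euclidean_space \<Rightarrow> real) \<Rightarrow> 'a \<Rightarrow> real" where
  "frac_laplace_L2 a u = (SOME v. v \<in> L2_space lebesgue \<and>
     (\<forall>\<phi>\<in>schwartz. (\<integral>x. complex_of_real (v x) * \<phi> x \<partial>lebesgue) = frac_laplace a u \<phi>))"

text \<open>
  The pairing \<open>(y, T)\<^sub>V\<close> of \<open>y \<in> Hs_tilde s V\<close> with (the restriction to \<open>V\<close> of) a real distribution \<open>T\<close>
  in \<open>H\<^bsup>-s\<^esup>\<close>: the extension by continuity of \<open>\<phi> \<mapsto> T \<phi>\<close> from test functions on \<open>V\<close>.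
\<close>

definition dual_pairing ::
    "real \<Rightarrow> 'a::euclidean_space set \<Rightarrow> ('a \<Rightarrow> real) \<Rightarrow> (('a \<Rightarrow> complex) \<Rightarrow> complex) \<Rightarrow> real" where
  "dual_pairing s V y T = (THE c. \<forall>\<phi>.
     (\<forall>k::nat. \<phi> k \<in> test_functions V) \<and>
     (\<lambda>k. Hs_seminorm s (\<lambda>x. \<phi> k x - y x)) \<longlonglongrightarrow> 0 \<longrightarrow>
     (\<lambda>k. T (\<lambda>x. complex_of_real (\<phi> k x))) \<longlonglongrightarrow> complex_of_real c)"

section \<open>The exterior Dirichlet problem\<close>

definition weak_equation ::
    "real \<Rightarrow> 'a::euclidean_space set \<Rightarrow> ('a \<Rightarrow> real) \<Rightarrow> ('a \<Rightarrow> real) \<Rightarrow> bool" where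
  "weak_equation s \<Omega> q u \<longleftrightarrow> (\<forall>w\<in>Hs_tilde s \<Omega>.
     (\<integral>x. frac_laplace_L2 (s / 2) u x * frac_laplace_L2 (s / 2) w x \<partial>lebesgue)
     + (\<integral>x. q x * u x * w x \<partial>lebesgue_on \<Omega>) = 0)"

definition weak_solution ::
    "real \<Rightarrow> 'a::euclidean_space set \<Rightarrow> ('a \<Rightarrow> real) \<Rightarrow> ('a \<Rightarrow> real) \<Rightarrow> ('a \<Rightarrow> real) \<Rightarrow> bool" where
  "weak_solution s \<Omega> q f u \<longleftrightarrow>
     u \<in> Hs s \<and> (\<lambda>x. u x - f x) \<in> Hs_tilde s \<Omega> \<and> weak_equation s \<Omega> q u"

definition Z2 :: "real \<Rightarrow> 'a::euclidean_space set \<Rightarrow> ('a \<Rightarrow> real) \<Rightarrow> ('a \<Rightarrow> real) set" where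
  "Z2 s \<Omega> q = {z \<in> Hs_tilde s \<Omega>. weak_equation s \<Omega> q z}"

definition H2 :: "real \<Rightarrow> 'a::euclidean_space set \<Rightarrow> ('a \<Rightarrow> real) \<Rightarrow> ('a \<Rightarrow> real) set" where
  "H2 s \<Omega> q = {v \<in> L2_space (lebesgue_on \<Omega>).
     \<forall>z\<in>Z2 s \<Omega> q. (\<integral>x. v x * z x \<partial>lebesgue_on \<Omega>) = 0}"

definition H1 ::
    "real \<Rightarrow> 'a::euclidean_space set \<Rightarrow> 'a set \<Rightarrow> ('a \<Rightarrow> real) \<Rightarrow> ('a \<Rightarrow> real) set" where
  "H1 s \<Omega> W q = {y \<in> Hs_tilde s W. \<forall>z\<in>Z2 s \<Omega> q. dual_pairing s W y (frac_laplace s z) = 0}"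

text \<open>
  The class of all solutions with exterior data \<open>f\<close> (a coset of \<open>Z2\<close>), and its representative whose
  restriction to \<open>\<Omega>\<close> lies in \<open>H2\<close>; the latter is unique up to null sets.
\<close>

definition poisson_class ::
    "real \<Rightarrow> 'a::euclidean_space set \<Rightarrow> ('a \<Rightarrow> real) \<Rightarrow> ('a \<Rightarrow> real) \<Rightarrow> ('a \<Rightarrow> real) set" where
  "poisson_class s \<Omega> q f = {u. weak_solution s \<Omega> q f u}"

definition poisson ::
    "real \<Rightarrow> 'a::euclidean_space set \<Rightarrow> ('a \<Rightarrow> real) \<Rightarrow> ('a \<Rightarrow> real) \<Rightarrow> 'a \<Rightarrow> real" where
  "poisson s \<Omega> q f = (SOME u. u \<in> poisson_class s \<Omega> q f \<and> restrict u \<Omega> \<in> H2 s \<Omega> q)"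

end

theory Submission
  imports Defs "HOL-Probability.Probability"
begin

text \<open>
  Multiplying Fourier transforms by \<open>(1 + \<bar>\<xi>\<bar>\<^sup>2)\<^bsup>s/2\<^esup>\<close> identifies \<open>H\<^sup>s\<close> with a part of \<open>L\<^sup>2\<close>, so that \<open>Hs_tilde s \<Omega>\<close> and
  \<open>Hs_tilde s W\<close> become closed subspaces \<open>X\<close>, \<open>Y\<close> of a Hilbert space and the weak equation becomes \<open>b u = 0\<close> on \<open>X\<close>
  for a bounded symmetric form \<open>b\<close>. Functions in \<open>X\<close> have Lipschitz Fourier transforms, hence \<open>b\<close> is coercive on the
  part of \<open>X\<close> where the transform vanishes on a fine finite grid, which gives the Fredholm alternative.
  If \<open>v \<in> L\<^sup>2(\<Omega>)\<close> is orthogonal to \<open>Z2\<close> and to all solutions, some \<open>x \<in> X\<close> satisfies \<open>b x = (v, \<cdot>)\<close> on \<open>X\<close>, and testing with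
  solutions gives \<open>b x y = 0\<close> for all data \<open>y\<close> in \<open>H1\<close>; as \<open>H1\<close> is cut out of \<open>Y\<close> by the finitely many functionals
  \<open>b z\<close>, \<open>z \<in> Z2\<close>, correcting \<open>x\<close> by an element of \<open>Z2\<close> gives \<open>b x y = 0\<close> for all \<open>y \<in> Y\<close>. Then \<open>(-\<Delta>)\<^sup>s x = 0\<close> in \<open>W\<close>,
  and unique continuation gives \<open>x = 0\<close>, hence \<open>v = 0\<close>.
  For the unique continuation, \<open>\<bar>\<xi>\<bar>\<^bsup>2s\<^esup> = c \<integral> (1 - exp (-t\<bar>\<xi>\<bar>\<^sup>2)) t\<^bsup>-1-s\<^esup> dt\<close> turns the hypothesis into
  \<open>\<integral> x(z) \<bar>z - y\<bar>\<^bsup>-n-2s\<^esup> dz = 0\<close> for \<open>y \<in> W\<close>. Derivatives in \<open>y\<close> produce all monomials in the inverted variable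
  \<open>(z - y) / \<bar>z - y\<bar>\<^sup>2\<close>, and the Stone-Weierstrass theorem applies.
\<close>

section \<open>Symmetric forms on Hilbert spaces\<close>

text \<open>The Fourier transform of L2 functions, \<open>frac_laplace_L2\<close> and
  \<open>poisson\<close> are choices of functions determined only up to null sets. The analysis
  therefore takes place on classes, where they become bounded linear maps, and functions return only
  at the end. For \<open>f\<close> in \<open>H1\<close> the functions P f + z with \<open>z\<close>
  in \<open>Z2\<close> are, up to null sets, all solutions with data \<open>f\<close>; density thus
  concerns the set of all solutions, and \<open>H2\<close> merely selects one of them. When zero is
  an eigenvalue, testing with solutions gives information on \<open>H1\<close> only, and finiteness
  of the conditions that cut out \<open>H1\<close> is what allows one to return to all data. In the
  heat representation of the symbol neither 1 nor the Gaussian can be integrated against t^(-1-s)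
  alone. The 1 drops out because \<open>x\<close> and the test functions on \<open>W\<close> have
  disjoint supports, and the positive distance of these supports makes the heat kernel small enough
  near t = 0. The inverted variable is dictated by homogeneity: a derivative of order m of
  |v|^(-n-2s) has the degree of |v|^(-n-2s) times m factors v/|v|^2.\<close>

lemma minimize_form:
  fixes b :: "'h::{real_inner,complete_space} \<Rightarrow> 'h \<Rightarrow> real" and l :: "'h \<Rightarrow> real"
  assumes X: "subspace X" "closed X"
    and b: "bounded_bilinear b" and sym: "\<And>x y. x \<in> X \<Longrightarrow> y \<in> X \<Longrightarrow> b x y = b y x"
    and c: "c > 0" "\<And>x. x \<in> X \<Longrightarrow> c * (norm x)\<^sup>2 \<le> b x x"
    and l: "bounded_linear l"
  shows "\<exists>x\<in>X. \<forall>y\<in>X. b x y = l y"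
proof -
  interpret b: bounded_bilinear b by fact
  interpret l: bounded_linear l by fact
  \<comment> \<open>The quadratic energy whose critical points on \<open>X\<close> solve
    \<open>b x y = l y\<close>. Coercivity bounds it below, by completing the square.\<close>
  define E where "E x = b x x - 2 * l x" for x
  obtain K where K: "K > 0" "\<And>x. norm (l x) \<le> norm x * K" using l.pos_bounded by blast
  have low: "E x \<ge> - (K\<^sup>2 / c)" if "x \<in> X" for x
  proof -
    have "E x \<ge> c * (norm x)\<^sup>2 - 2 * (norm x * K)"
      using c(2)[OF that] K(2)[of x] unfolding E_def by (simp add: abs_le_iff)
    moreover have "c * (norm x)\<^sup>2 - 2 * (norm x * K) + K\<^sup>2 / c = (c * norm x - K)\<^sup>2 / c"
      using c(1) by (simp add: field_simps power2_eq_square)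
    moreover have "(c * norm x - K)\<^sup>2 / c \<ge> 0" using c(1) by simp
    ultimately show ?thesis by linarith
  qed
  define m where "m = Inf (E ` X)"
  have X0: "0 \<in> X" using X(1) by (rule subspace_0)
  have bdd: "bdd_below (E ` X)" using low by (intro bdd_belowI2[where m="- (K\<^sup>2 / c)"])
  have mle: "m \<le> E x" if "x \<in> X" for x unfolding m_def using that bdd by (intro cInf_lower) auto
  have "\<exists>x\<in>X. E x < m + 1 / Suc n" for n
  proof -
    have "Inf (E ` X) < m + 1 / Suc n" unfolding m_def by simp
    then show ?thesis using X0 bdd by (subst (asm) cInf_less_iff) auto
  qed
  then obtain x where x: "\<And>n. x n \<in> X" "\<And>n. E (x n) < m + 1 / Suc n" by metis
  \<comment> \<open>Parallelogram identity for \<open>b\<close>: the midpoint of \<open>u\<close>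
    and \<open>v\<close> has energy at least \<open>m\<close>, so near-minimizers are close to each
    other.\<close>
  have par: "c * (norm (u - v))\<^sup>2 \<le> 2 * (E u - m) + 2 * (E v - m)" if "u \<in> X" "v \<in> X" for u v
  proof -
    have "(1/2) *\<^sub>R (u + v) \<in> X" using X(1) that by (simp add: subspace_add subspace_scale)
    then have "m \<le> E ((1/2) *\<^sub>R (u + v))" by (rule mle)
    moreover have "c * (norm (u - v))\<^sup>2 \<le> b (u - v) (u - v)"
      by (rule c(2)) (use X(1) that in \<open>simp add: subspace_diff\<close>)
    moreover have "b v u = b u v" using sym that by simp
    ultimately show ?thesis
      unfolding E_def by (simp add: b.add_left b.add_right b.diff_left b.diff_right b.scaleR_left
          b.scaleR_right l.add l.scaleR field_simps)
  qed
  have "Cauchy x"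
  proof (rule metric_CauchyI)
    fix e :: real assume e: "e > 0"
    then have "c * e\<^sup>2 / 4 > 0" using c by simp
    then obtain N where N: "1 / Suc N < c * e\<^sup>2 / 4" using nat_approx_posE by blast
    show "\<exists>M. \<forall>p\<ge>M. \<forall>n\<ge>M. dist (x p) (x n) < e"
    proof (intro exI allI impI)
      fix p n assume pn: "N \<le> p" "N \<le> n"
      have *: "E (x p) - m < c * e\<^sup>2 / 4" if "N \<le> p" for p
      proof -
        have "1 / real (Suc p) \<le> 1 / Suc N" using that by (simp add: field_simps)
        then show ?thesis using x(2)[of p] N by linarith
      qed
      have "c * (norm (x p - x n))\<^sup>2 < c * e\<^sup>2"
        using par[OF x(1) x(1), of p n] *[OF pn(1)] *[OF pn(2)] by argo
      then have "(norm (x p - x n))\<^sup>2 < e\<^sup>2" using c by simp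
      then show "dist (x p) (x n) < e" using e unfolding dist_norm by (simp add: power_less_imp_less_base)
    qed
  qed
  then obtain x0 where lim: "x \<longlonglongrightarrow> x0" using Cauchy_convergent convergent_def by blast
  have x0: "x0 \<in> X" using X(2) x(1) lim closed_sequentially by blast
  have "(\<lambda>n. E (x n)) \<longlonglongrightarrow> E x0" unfolding E_def
    by (intro tendsto_intros b.tendsto l.tendsto lim)
  moreover have "(\<lambda>n. m + 1 / real (Suc n)) \<longlonglongrightarrow> m + 0"
    by (intro tendsto_intros LIMSEQ_Suc[OF lim_1_over_n])
  ultimately have "E x0 \<le> m + 0" by (rule LIMSEQ_le) (use x(2) less_imp_le in blast)
  then have min: "E x0 \<le> E y" if "y \<in> X" for y using mle[OF that] by simp
  have "b x0 y = l y" if y: "y \<in> X" for y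
  proof (rule ccontr)
    assume ne: "b x0 y \<noteq> l y"
    define d where "d = b x0 y - l y"
    have d: "d \<noteq> 0" using ne d_def by simp
    have quad: "0 \<le> 2 * t * d + t\<^sup>2 * b y y" for t
    proof -
      have "x0 + t *\<^sub>R y \<in> X" using X(1) x0 y by (simp add: subspace_add subspace_scale)
      from min[OF this] show ?thesis unfolding E_def d_def
        using sym[OF y x0]
        by (simp add: b.add_left b.add_right b.scaleR_left b.scaleR_right l.add l.scaleR
            power2_eq_square algebra_simps)
    qed
    define B where "B = \<bar>b y y\<bar> + 1"
    have B: "B > 0" "b y y \<le> B" unfolding B_def by auto
    \<comment> \<open>The value \<open>t = - d / B\<close> minimizes the quadratic with
      \<open>b y y\<close> replaced by its bound \<open>B\<close>; the summand 1 in \<open>B\<close>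
      keeps it positive when \<open>b y y = 0\<close>.\<close>
    have "0 \<le> 2 * (- d / B) * d + (- d / B)\<^sup>2 * b y y" by (rule quad)
    also have "\<dots> \<le> 2 * (- d / B) * d + (- d / B)\<^sup>2 * B"
      using B by (intro add_left_mono mult_left_mono) auto
    also have "\<dots> = - (d\<^sup>2 / B)" using B by (simp add: field_simps power2_eq_square)
    finally show False using d B by (simp add: divide_le_0_iff)
  qed
  then show ?thesis using x0 by blast
qed

text \<open>The same minimization with the inner product as form: the projection represents the
  functional \<open>inner v\<close> on \<open>X\<close>.\<close>

lemma orthogonal_projection_exists:
  fixes X :: "'h::{real_inner,complete_space} set"
  assumes "subspace X" "closed X"
  shows "\<exists>p\<in>X. \<forall>y\<in>X. inner (v - p) y = 0"
proof -
  obtain p where "p \<in> X" "\<forall>y\<in>X. inner p y = inner v y"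
    using minimize_form[OF assms bounded_bilinear_inner, of 1 "inner v"]
    by (auto simp: inner_commute power2_norm_eq_inner bounded_linear_inner_right)
  then show ?thesis by (intro bexI[of _ p]) (auto simp: inner_diff_left)
qed

lemma subspace_closure_real_normed:
  fixes S :: "'v::real_normed_vector set"
  assumes "subspace S"
  shows "subspace (closure S)"
  unfolding subspace_def
proof (intro conjI allI ballI)
  show "0 \<in> closure S" using assms subspace_0 closure_subset by blast
next
  fix x y assume "x \<in> closure S" "y \<in> closure S"
  then obtain f g where "\<And>n. f n \<in> S" "f \<longlonglongrightarrow> x" "\<And>n. g n \<in> S" "g \<longlonglongrightarrow> y"
    unfolding closure_sequential by blast
  then show "x + y \<in> closure S" unfolding closure_sequential
    using assms by (intro exI[of _ "\<lambda>n. f n + g n"]) (auto intro: subspace_add tendsto_add)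
next
  fix c :: real and x assume "x \<in> closure S"
  then obtain f where "\<And>n. f n \<in> S" "f \<longlonglongrightarrow> x" unfolding closure_sequential by blast
  then show "c *\<^sub>R x \<in> closure S" unfolding closure_sequential
    using assms by (intro exI[of _ "\<lambda>n. c *\<^sub>R f n"]) (auto intro: subspace_scale tendsto_intros)
qed

text \<open>Density criterion relative to a closed subspace \<open>K\<close>. It is stated for a
  subspace because real functions on the domain will be embedded in complex functions on the whole
  space.\<close>

lemma closure_subspace_eq_if_orthogonal:
  fixes S K :: "'h::{real_inner,complete_space} set"
  assumes "subspace S" "subspace K" "closed K" "S \<subseteq> K"
    and "\<And>v. v \<in> K \<Longrightarrow> (\<And>x. x \<in> S \<Longrightarrow> inner v x = 0) \<Longrightarrow> v = 0"
  shows "closure S = K"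
proof
  show "closure S \<subseteq> K" using assms closure_minimal by blast
  show "K \<subseteq> closure S"
  proof
    fix v assume v: "v \<in> K"
    obtain p where p: "p \<in> closure S" "\<forall>y\<in>closure S. inner (v - p) y = 0"
      using orthogonal_projection_exists[of "closure S" v] assms(1) closed_closure subspace_closure_real_normed by blast
    have "v - p = 0"
    proof (rule assms(5))
      show "v - p \<in> K" using v p \<open>closure S \<subseteq> K\<close> assms(2) by (auto intro: subspace_diff)
      show "inner (v - p) x = 0" if "x \<in> S" for x using p that closure_subset by blast
    qed
    then show "v \<in> closure S" using p by simp
  qed
qed

text \<open>Elimination of one functional at a time. In the uses below the functionals come from
  vectors \<open>e\<close>, so that the combination of these vectors with the coefficients
  \<open>c\<close> is the correction that is sought.\<close>

lemma functional_in_span_of_functionals: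
  fixes f :: "'i \<Rightarrow> 'v::real_vector \<Rightarrow> real"
  assumes "finite I" "subspace S" "\<And>i. i \<in> I \<Longrightarrow> linear (f i)" "linear g"
    and "\<And>x. x \<in> S \<Longrightarrow> (\<And>i. i \<in> I \<Longrightarrow> f i x = 0) \<Longrightarrow> g x = 0"
  shows "\<exists>c. \<forall>x\<in>S. g x = (\<Sum>i\<in>I. c i * f i x)"
  using assms
proof (induction I arbitrary: S rule: finite_induct)
  case empty
  then show ?case by simp
next
  case (insert i I)
  define S' where "S' = {x \<in> S. f i x = 0}"
  have li: "linear (f i)" using insert.prems(2) by simp
  have "subspace S'" unfolding S'_def using insert.prems(1) li
    by (auto simp: subspace_def linear_0 linear_add linear_scale)
  then have "\<exists>c. \<forall>x\<in>S'. g x = (\<Sum>i\<in>I. c i * f i x)"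
    using insert.prems by (intro insert.IH) (auto simp: S'_def)
  then obtain c where c: "\<And>x. x \<in> S' \<Longrightarrow> g x = (\<Sum>i\<in>I. c i * f i x)" by blast
  show ?case
  proof (cases "\<exists>e\<in>S. f i e \<noteq> 0")
    case False
    then have "S' = S" by (auto simp: S'_def)
    then have "g x = (\<Sum>j\<in>insert i I. (c(i:=0)) j * f j x)" if "x \<in> S" for x
      using c[of x] that insert.hyps by (auto intro!: sum.cong)
    then show ?thesis by blast
  next
    case True
    then obtain e where e: "e \<in> S" "f i e \<noteq> 0" by blast
    \<comment> \<open>\<open>k\<close> makes both sides agree at \<open>e\<close>; every
      \<open>x\<close> differs from a multiple of \<open>e\<close> by an element of
      \<open>S'\<close>, where the claim is known.\<close>
    define k where "k = (g e - (\<Sum>j\<in>I. c j * f j e)) / f i e"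
    have "g x = (\<Sum>j\<in>insert i I. (c(i:=k)) j * f j x)" if "x \<in> S" for x
    proof -
      define a where "a = f i x / f i e"
      have "x - a *\<^sub>R e \<in> S'" unfolding S'_def using that e insert.prems(1) li
        by (auto simp: a_def linear_diff linear_scale intro!: subspace_diff subspace_scale)
      then have "g (x - a *\<^sub>R e) = (\<Sum>j\<in>I. c j * f j (x - a *\<^sub>R e))" by (rule c)
      also have "\<dots> = (\<Sum>j\<in>I. c j * (f j x - a * f j e))"
        using insert.prems(2) by (intro sum.cong) (auto simp: linear_diff linear_scale)
      also have "\<dots> = (\<Sum>j\<in>I. c j * f j x) - a * (\<Sum>j\<in>I. c j * f j e)"
        by (simp add: right_diff_distrib sum_subtractf sum_distrib_left mult_ac)
      finally have "g x = (\<Sum>j\<in>I. c j * f j x) + a * (g e - (\<Sum>j\<in>I. c j * f j e))"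
        using insert.prems(3) by (simp add: linear_diff linear_scale algebra_simps)
      also have "a * (g e - (\<Sum>j\<in>I. c j * f j e)) = k * f i x"
        unfolding a_def k_def by (simp add: mult.commute)
      also have "(\<Sum>j\<in>I. c j * f j x) = (\<Sum>j\<in>I. (c(i:=k)) j * f j x)"
        using insert.hyps by (intro sum.cong) auto
      finally show ?thesis using insert.hyps by simp
    qed
    then show ?thesis by blast
  qed
qed

text \<open>Finitely many functionals that separate points bound the dimension. Kernels thus become
  finite-dimensional as soon as the form is coercive on a subspace of finite codimension.\<close>

lemma finite_spanning_if_separated:
  fixes f :: "'i \<Rightarrow> 'v::real_vector \<Rightarrow> real"
  assumes "finite I" "subspace V" "\<And>i. i \<in> I \<Longrightarrow> linear (f i)"
    and "\<And>x. x \<in> V \<Longrightarrow> (\<And>i. i \<in> I \<Longrightarrow> f i x = 0) \<Longrightarrow> x = 0"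
  shows "\<exists>B. finite B \<and> B \<subseteq> V \<and> V \<subseteq> span B"
  using assms
proof (induction I arbitrary: V rule: finite_induct)
  case empty
  then show ?case by (intro exI[of _ "{}"]) auto
next
  case (insert i I)
  define V' where "V' = {x \<in> V. f i x = 0}"
  have li: "linear (f i)" using insert.prems(2) by simp
  have "subspace V'" unfolding V'_def using insert.prems(1) li
    by (auto simp: subspace_def linear_0 linear_add linear_scale)
  then have "\<exists>B. finite B \<and> B \<subseteq> V' \<and> V' \<subseteq> span B"
    using insert.prems by (intro insert.IH) (auto simp: V'_def)
  then obtain B where B: "finite B" "B \<subseteq> V'" "V' \<subseteq> span B" by blast
  show ?case
  proof (cases "\<exists>e\<in>V. f i e \<noteq> 0")
    case False
    then have "V' = V" by (auto simp: V'_def)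
    then show ?thesis using B by blast
  next
    case True
    then obtain e where e: "e \<in> V" "f i e \<noteq> 0" by blast
    have "x \<in> span (insert e B)" if "x \<in> V" for x
    proof -
      have "x - (f i x / f i e) *\<^sub>R e \<in> V'" unfolding V'_def using that e insert.prems(1) li
        by (auto simp: linear_diff linear_scale intro!: subspace_diff subspace_scale)
      then show ?thesis using B(3) by (auto simp: span_breakdown_eq)
    qed
    then show ?thesis using B e by (intro exI[of _ "insert e B"]) (auto simp: V'_def)
  qed
qed

text \<open>\<open>X0\<close> is the subspace of finite codimension on which \<open>b\<close> is
  coercive, and \<open>X1\<close> is its \<open>b\<close>-orthogonal complement in \<open>X\<close>.
  Solving on \<open>X0\<close> decomposes \<open>X\<close> into \<open>X0\<close> and
  \<open>X1\<close>. Coercivity lets them meet only in 0, so the \<open>f i\<close> separate the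
  points of \<open>X1\<close>, which is therefore finite-dimensional. The equation is solved by
  minimization on \<open>X0\<close> and by linear algebra on \<open>X1\<close>.\<close>

lemma fredholm_symmetric_form:
  fixes b :: "'h::{real_inner,complete_space} \<Rightarrow> 'h \<Rightarrow> real" and f :: "'i \<Rightarrow> 'h \<Rightarrow> real"
  assumes X: "subspace X" "closed X"
    and b: "bounded_bilinear b" and sym: "\<And>x y. x \<in> X \<Longrightarrow> y \<in> X \<Longrightarrow> b x y = b y x"
    and I: "finite I" "\<And>i. i \<in> I \<Longrightarrow> bounded_linear (f i)"
    and c: "c > 0" "\<And>x. x \<in> X \<Longrightarrow> (\<And>i. i \<in> I \<Longrightarrow> f i x = 0) \<Longrightarrow> c * (norm x)\<^sup>2 \<le> b x x"
  defines "Z \<equiv> {x \<in> X. \<forall>y\<in>X. b x y = 0}"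
  shows "\<exists>B. finite B \<and> B \<subseteq> Z \<and> Z \<subseteq> span B"
    and "bounded_linear l \<Longrightarrow> (\<And>z. z \<in> Z \<Longrightarrow> l z = 0) \<Longrightarrow> \<exists>x\<in>X. \<forall>y\<in>X. b x y = l y"
proof -
  interpret b: bounded_bilinear b by fact
  define X0 where "X0 = {x \<in> X. \<forall>i\<in>I. f i x = 0}"
  define X1 where "X1 = {x \<in> X. \<forall>y\<in>X0. b x y = 0}"
  have lin: "linear (f i)" if "i \<in> I" for i using I(2)[OF that] bounded_linear.linear by blast
  have X0: "subspace X0" unfolding X0_def using X(1) lin
    by (auto simp: subspace_def linear_0 linear_add linear_scale)
  have "X0 = X \<inter> (\<Inter>i\<in>I. f i -` {0})" unfolding X0_def by auto
  moreover have "closed (f i -` {0})" if "i \<in> I" for i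
    using I(2)[OF that] by (intro closed_vimage) (auto simp: linear_continuous_on)
  ultimately have X0c: "closed X0" using X(2) by auto
  have X0X: "X0 \<subseteq> X" by (auto simp: X0_def)
  have X1: "subspace X1" unfolding X1_def using X(1)
    by (auto simp: subspace_def b.zero_left b.add_left b.scaleR_left)
  have Z: "subspace Z" unfolding Z_def using X(1)
    by (auto simp: subspace_def b.zero_left b.add_left b.scaleR_left)
  \<comment> \<open>Besides solving the equation on \<open>X0\<close>, this is applied to
    \<open>l = b y\<close> in order to split off the component of \<open>y\<close> in
    \<open>X0\<close>.\<close>
  have repr: "\<exists>x\<in>X0. \<forall>y\<in>X0. b x y = l y" if "bounded_linear l" for l
    by (rule minimize_form[OF X0 X0c b _ c(1) _ that]) (use sym c X0X in \<open>auto simp: X0_def\<close>)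
  have X10: "x = 0" if "x \<in> X1" "\<And>i. i \<in> I \<Longrightarrow> f i x = 0" for x
  proof -
    have "x \<in> X0" using that by (auto simp: X0_def X1_def)
    then have "b x x = 0" using that by (auto simp: X1_def)
    then show "x = 0" using c(2)[of x] that c(1) by (auto simp: X1_def mult_le_0_iff)
  qed
  show "\<exists>B. finite B \<and> B \<subseteq> Z \<and> Z \<subseteq> span B"
    by (rule finite_spanning_if_separated[OF I(1) Z lin X10]) (auto simp: Z_def X1_def X0_def)
  have "\<exists>B. finite B \<and> B \<subseteq> X1 \<and> X1 \<subseteq> span B"
    by (rule finite_spanning_if_separated[OF I(1) X1 lin X10])
  then obtain B where B: "finite B" "B \<subseteq> X1" "X1 \<subseteq> span B" by (elim exE conjE)
  assume l: "bounded_linear l" and lZ: "\<And>z. z \<in> Z \<Longrightarrow> l z = 0"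
  have bl: "linear (b x)" for x by (rule bounded_linear.linear[OF b.bounded_linear_right])
  \<comment> \<open>An element of \<open>X1\<close> that \<open>b\<close> annihilates against
    \<open>X1\<close> is annihilated against all of \<open>X\<close>, so it lies in
    \<open>Z\<close>, where \<open>l\<close> vanishes by the compatibility condition.\<close>
  have "\<exists>k. \<forall>x\<in>X1. l x = (\<Sum>e\<in>B. k e * b e x)"
  proof (rule functional_in_span_of_functionals[OF B(1) X1 bl])
    show "linear l" using l bounded_linear.linear by blast
    fix x assume x: "x \<in> X1" and 0: "\<And>e. e \<in> B \<Longrightarrow> b e x = 0"
    have xX: "x \<in> X" using x by (auto simp: X1_def)
    have "b e x = 0" if "e \<in> span B" for e using that
      by (induction rule: span_induct_alt) (auto simp: b.zero_left b.add_left b.scaleR_left 0)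
    then have 1: "b x e = 0" if "e \<in> X1" for e using that B(3) sym xX by (auto simp: X1_def)
    have "b x y = 0" if y: "y \<in> X" for y
    proof -
      obtain y0 where y0: "y0 \<in> X0" "\<forall>w\<in>X0. b y0 w = b y w" using repr[OF b.bounded_linear_right[of y]] by blast
      have "y - y0 \<in> X1" using y y0 X0X X(1) by (auto simp: X1_def b.diff_left intro: subspace_diff)
      then have "b x (y - y0) = 0" by (rule 1)
      moreover have "b x y0 = 0" using x y0 by (auto simp: X1_def)
      ultimately show ?thesis by (simp add: b.diff_right)
    qed
    then show "l x = 0" using lZ xX by (auto simp: Z_def)
  qed
  then obtain k where k: "\<And>x. x \<in> X1 \<Longrightarrow> l x = (\<Sum>e\<in>B. k e * b e x)" by blast
  define x1 where "x1 = (\<Sum>e\<in>B. k e *\<^sub>R e)"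
  have x1: "x1 \<in> X1" unfolding x1_def using X1 B(2) by (auto intro!: subspace_sum subspace_scale)
  obtain x0 where x0: "x0 \<in> X0" "\<forall>y\<in>X0. b x0 y = l y" using repr[OF l] by blast
  show "\<exists>x\<in>X. \<forall>y\<in>X. b x y = l y"
  proof (intro bexI[of _ "x0 + x1"] ballI)
    show "x0 + x1 \<in> X" using x0 x1 X(1) by (auto simp: X0_def X1_def subspace_add)
    fix y assume y: "y \<in> X"
    obtain y0 where y0: "y0 \<in> X0" "\<forall>w\<in>X0. b y0 w = b y w" using repr[OF b.bounded_linear_right[of y]] by blast
    define y1 where "y1 = y - y0"
    have y1: "y1 \<in> X1" using y y0 X0X X(1) by (auto simp: y1_def X1_def b.diff_left intro: subspace_diff)
    have yy: "y = y0 + y1" by (simp add: y1_def)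
    have 1: "b x1 y0 = 0" using x1 y0 by (auto simp: X1_def)
    have "b x0 y1 = b y1 x0" using x0 y1 by (intro sym) (auto simp: X0_def X1_def)
    then have 2: "b x0 y1 = 0" using x0 y1 by (auto simp: X1_def)
    have 3: "b x1 y1 = l y1" unfolding k[OF y1] x1_def by (simp add: b.sum_left b.scaleR_left)
    have "l y = l y0 + l y1" unfolding yy using l by (simp add: linear_simps)
    then show "b (x0 + x1) y = l y" using x0 y0 1 2 3 unfolding yy by (simp add: b.add_left b.add_right)
  qed
qed

text \<open>Runge approximation by duality: \<open>J\<close> is restriction to the domain,
  \<open>K\<close> its L2 space, \<open>Z\<close> and \<open>H\<close> are the counterparts of
  \<open>Z2\<close> and \<open>H1\<close>, and \<open>ucp\<close> is unique continuation. As
  \<open>J\<close> vanishes on \<open>Y\<close>, an inner product with \<open>J u\<close> equals one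
  with \<open>J (u - y)\<close>, and this the solution \<open>p\<close> of the dual problem
  expresses through \<open>b\<close>.\<close>

lemma abstract_runge:
  fixes b :: "'h::{real_inner,complete_space} \<Rightarrow> 'h \<Rightarrow> real" and f :: "'i \<Rightarrow> 'h \<Rightarrow> real"
    and J :: "'h \<Rightarrow> 'l::{real_inner,complete_space}"
  assumes X: "subspace X" "closed X" and Y: "subspace Y"
    and b: "bounded_bilinear b" and sym: "\<And>x y. b x y = b y x"
    and I: "finite I" "\<And>i. i \<in> I \<Longrightarrow> bounded_linear (f i)"
    and c: "c > 0" "\<And>x. x \<in> X \<Longrightarrow> (\<And>i. i \<in> I \<Longrightarrow> f i x = 0) \<Longrightarrow> c * (norm x)\<^sup>2 \<le> b x x"
    and J: "bounded_linear J" "\<And>y. y \<in> Y \<Longrightarrow> J y = 0"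
    and K: "subspace K" "closed K" "J ` X \<subseteq> K"
    and dense: "\<And>v. v \<in> K \<Longrightarrow> (\<And>x. x \<in> X \<Longrightarrow> inner v (J x) = 0) \<Longrightarrow> v = 0"
    and ucp: "\<And>x. x \<in> X \<Longrightarrow> (\<And>y. y \<in> Y \<Longrightarrow> b x y = 0) \<Longrightarrow> x = 0"
  defines "Z \<equiv> {x \<in> X. \<forall>y\<in>X. b x y = 0}"
  defines "H \<equiv> {y \<in> Y. \<forall>z\<in>Z. b z y = 0}"
  shows "y \<in> H \<Longrightarrow> \<exists>u. u - y \<in> X \<and> (\<forall>x\<in>X. b u x = 0) \<and> (\<forall>z\<in>Z. inner (J u) (J z) = 0)"
    and "closure {J u | u y. y \<in> H \<and> u - y \<in> X \<and> (\<forall>x\<in>X. b u x = 0)} = K"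
proof -
  interpret b: bounded_bilinear b by fact
  interpret J: bounded_linear J by fact
  have fred1: "\<exists>B. finite B \<and> B \<subseteq> Z \<and> Z \<subseteq> span B" unfolding Z_def
    by (rule fredholm_symmetric_form(1)[OF X b sym I c])
  have fred2: "\<exists>x\<in>X. \<forall>y\<in>X. b x y = l y"
    if "bounded_linear l" "\<And>z. z \<in> Z \<Longrightarrow> l z = 0" for l
    by (rule fredholm_symmetric_form(2)[OF X b sym I c that[unfolded Z_def]])
  have Zs: "subspace Z" unfolding Z_def using X(1)
    by (auto simp: subspace_def b.zero_left b.add_left b.scaleR_left)
  have Hs: "subspace H" unfolding H_def using Y
    by (auto simp: subspace_def b.zero_right b.add_right b.scaleR_right)
  obtain B where B: "finite B" "B \<subseteq> Z" "Z \<subseteq> span B" using fred1 by (elim exE conjE)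
  have ex: "\<exists>u. u - y \<in> X \<and> (\<forall>x\<in>X. b u x = 0)" if y: "y \<in> H" for y
  proof -
    have "\<exists>x\<in>X. \<forall>w\<in>X. b x w = - b y w"
    proof (rule fred2)
      show "bounded_linear (\<lambda>w. - b y w)" by (intro bounded_linear_minus b.bounded_linear_right)
      show "- b y z = 0" if "z \<in> Z" for z using that y sym[of y z] by (simp add: H_def)
    qed
    then obtain x where "x \<in> X" "\<forall>w\<in>X. b x w = - b y w" by blast
    then show ?thesis by (intro exI[of _ "x + y"]) (auto simp: b.add_left)
  qed
  {
    assume y: "y \<in> H"
    obtain u where u: "u - y \<in> X" "\<forall>x\<in>X. b u x = 0" using ex[OF y] by blast
    have lin: "linear (\<lambda>x. inner (J w) (J x))" for w
      by (rule bounded_linear.linear[OF bounded_linear_compose[OF bounded_linear_inner_right J(1)]])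
    \<comment> \<open>Orthogonal projection of \<open>J u\<close> onto the image of \<open>Z\<close>
      under \<open>J\<close>, expressed by functionals: an \<open>x\<close> in \<open>Z\<close> with
      \<open>J x\<close> orthogonal to that image has \<open>J x = 0\<close>.\<close>
    have "\<exists>k. \<forall>x\<in>Z. inner (J u) (J x) = (\<Sum>e\<in>B. k e * inner (J e) (J x))"
    proof (rule functional_in_span_of_functionals[OF B(1) Zs lin lin])
      fix x assume x: "x \<in> Z" and 0: "\<And>e. e \<in> B \<Longrightarrow> inner (J e) (J x) = 0"
      have "inner (J e) (J x) = 0" if "e \<in> span B" for e using that
        by (induction rule: span_induct_alt) (auto simp: J.zero J.add J.scaleR inner_add_left 0)
      then have "J x = 0" using x B(3) by (metis inner_eq_zero_iff subsetD)
      then show "inner (J u) (J x) = 0" by simp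
    qed
    then obtain k where k: "\<And>x. x \<in> Z \<Longrightarrow> inner (J u) (J x) = (\<Sum>e\<in>B. k e * inner (J e) (J x))" by blast
    define z where "z = (\<Sum>e\<in>B. k e *\<^sub>R e)"
    have z: "z \<in> Z" unfolding z_def using Zs B(2) by (auto intro!: subspace_sum subspace_scale)
    have "u - y - z \<in> X" using z by (intro subspace_diff[OF X(1) u(1)]) (auto simp: Z_def)
    moreover have "b (u - z) x = 0" if "x \<in> X" for x
      using u(2) z that by (auto simp: Z_def b.diff_left)
    moreover have "inner (J (u - z)) (J x) = 0" if "x \<in> Z" for x
      using k[OF that] by (simp add: z_def J.diff J.sum J.scaleR inner_diff_left inner_sum_left)
    ultimately show "\<exists>u. u - y \<in> X \<and> (\<forall>x\<in>X. b u x = 0) \<and> (\<forall>z\<in>Z. inner (J u) (J z) = 0)"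
      by (intro exI[of _ "u - z"]) (auto simp: algebra_simps)
  }
  define S where "S = {J u | u y. y \<in> H \<and> u - y \<in> X \<and> (\<forall>x\<in>X. b u x = 0)}"
  have SI: "J u \<in> S" if "y \<in> H" "u - y \<in> X" "\<And>x. x \<in> X \<Longrightarrow> b u x = 0" for u y
    using that unfolding S_def by blast
  \<comment> \<open>Elements of \<open>Z\<close> are solutions with data 0.\<close>
  have ZS: "J z \<in> S" if "z \<in> Z" for z
    by (rule SI[of 0]) (use that Hs in \<open>auto simp: Z_def subspace_0\<close>)
  have "closure S = K"
  proof (rule closure_subspace_eq_if_orthogonal[OF _ K(1,2)])
    show "subspace S" unfolding subspace_def
    proof (intro conjI ballI allI)
      show "0 \<in> S" using ZS[of 0] subspace_0[OF Zs] by (simp add: J.zero)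
    next
      fix v w assume "v \<in> S" "w \<in> S"
      then obtain u y u' y' where "v = J u" "w = J u'" "y \<in> H" "y' \<in> H" "u - y \<in> X" "u' - y' \<in> X"
        and b0: "\<And>x. x \<in> X \<Longrightarrow> b u x = 0" "\<And>x. x \<in> X \<Longrightarrow> b u' x = 0" unfolding S_def by blast
      moreover from this have "(u + u') - (y + y') \<in> X"
        using subspace_add[OF X(1), of "u - y" "u' - y'"] by (simp add: algebra_simps)
      ultimately show "v + w \<in> S"
        using SI[of "y + y'" "u + u'"] Hs by (simp add: subspace_add J.add b.add_left)
    next
      fix r :: real and v assume "v \<in> S"
      then obtain u y where "v = J u" "y \<in> H" "u - y \<in> X"
        and b0: "\<And>x. x \<in> X \<Longrightarrow> b u x = 0" unfolding S_def by blast
      moreover from this have "r *\<^sub>R u - r *\<^sub>R y \<in> X"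
        using subspace_scale[OF X(1), of "u - y" r] by (simp add: algebra_simps)
      ultimately show "r *\<^sub>R v \<in> S"
        using SI[of "r *\<^sub>R y" "r *\<^sub>R u"] Hs by (simp add: subspace_scale J.scaleR b.scaleR_left)
    qed
    show "S \<subseteq> K"
    proof
      fix v assume "v \<in> S"
      then obtain u y where u: "v = J u" "y \<in> H" "u - y \<in> X" unfolding S_def by blast
      then have "v = J (u - y)" using J(2) by (simp add: J.diff H_def)
      then show "v \<in> K" using K(3) u by blast
    qed
    fix v assume v: "v \<in> K" and orth: "\<And>x. x \<in> S \<Longrightarrow> inner v x = 0"
    \<comment> \<open>The dual problem is solvable because \<open>v\<close> is orthogonal to the
      image of \<open>Z\<close>, which is the compatibility condition.\<close>
    have "\<exists>p\<in>X. \<forall>x\<in>X. b p x = inner v (J x)"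
      by (rule fred2) (use orth ZS J(1) in \<open>auto intro: bounded_linear_compose[OF bounded_linear_inner_right]\<close>)
    then obtain p where p: "p \<in> X" "\<And>x. x \<in> X \<Longrightarrow> b p x = inner v (J x)" by blast
    have lin: "linear (b x)" for x by (rule bounded_linear.linear[OF b.bounded_linear_right])
    \<comment> \<open>Only data in \<open>H\<close> admit solutions, so testing with solutions shows
      merely that \<open>b p\<close> vanishes where all \<open>b e\<close> with \<open>e\<close> in
      \<open>B\<close> vanish.\<close>
    have "\<exists>k. \<forall>y\<in>Y. b p y = (\<Sum>e\<in>B. k e * b e y)"
    proof (rule functional_in_span_of_functionals[OF B(1) Y lin lin])
      fix y assume y: "y \<in> Y" and 0: "\<And>e. e \<in> B \<Longrightarrow> b e y = 0"
      have "b e y = 0" if "e \<in> span B" for e using that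
        by (induction rule: span_induct_alt) (auto simp: b.zero_left b.add_left b.scaleR_left 0)
      then have yH: "y \<in> H" using y B(3) by (auto simp: H_def)
      obtain u where u: "u - y \<in> X" "\<forall>x\<in>X. b u x = 0" using ex[OF yH] by blast
      have "0 = inner v (J u)" using orth[OF SI[OF yH u(1)]] u(2) by auto
      also have "J u = J (u - y)" using J(2)[OF y] by (simp add: J.diff)
      also have "inner v \<dots> = b p (u - y)" using p(2)[OF u(1)] by simp
      also have "\<dots> = - b p y" using u(2) p(1) sym[of p u] by (simp add: b.diff_right)
      finally show "b p y = 0" by simp
    qed
    then obtain k where k: "\<And>y. y \<in> Y \<Longrightarrow> b p y = (\<Sum>e\<in>B. k e * b e y)" by blast
    define z where "z = (\<Sum>e\<in>B. k e *\<^sub>R e)"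
    have z: "z \<in> Z" unfolding z_def using Zs B(2) by (auto intro!: subspace_sum subspace_scale)
    have "p - z = 0"
    proof (rule ucp)
      show "p - z \<in> X" using p(1) z X(1) by (intro subspace_diff) (auto simp: Z_def)
      show "b (p - z) y = 0" if "y \<in> Y" for y
        using k[OF that] by (simp add: z_def b.diff_left b.sum_left b.scaleR_left)
    qed
    \<comment> \<open>Now \<open>p\<close> equals the element \<open>z\<close> of \<open>Z\<close>,
      so \<open>b p\<close>, and with it \<open>inner v (J x)\<close>, vanishes on
      \<open>X\<close>.\<close>
    then have "inner v (J x) = 0" if "x \<in> X" for x using p(2)[OF that] z that by (auto simp: Z_def)
    then show "v = 0" by (rule dense[OF v])
  qed
  then show "closure {J u | u y. y \<in> H \<and> u - y \<in> X \<and> (\<forall>x\<in>X. b u x = 0)} = K" unfolding S_def .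
qed

section \<open>The Hilbert space of square integrable functions\<close>

lemma L2_spaceI: "f \<in> borel_measurable M \<Longrightarrow> integrable M (\<lambda>x. (norm (f x))\<^sup>2) \<Longrightarrow> f \<in> L2_space M"
  by (simp add: L2_space_def)

lemma L2_space_measurable[measurable_dest]: "f \<in> L2_space M \<Longrightarrow> f \<in> borel_measurable M"
  by (simp add: L2_space_def)

lemma L2_space_integrable_square: "f \<in> L2_space M \<Longrightarrow> integrable M (\<lambda>x. (norm (f x))\<^sup>2)"
  by (simp add: L2_space_def)

lemma L2_space_bound:
  fixes f :: "'a \<Rightarrow> 'b::{banach, second_countable_topology}" and g :: "'a \<Rightarrow> 'c::{banach, second_countable_topology}"
  assumes f: "f \<in> L2_space M" and g: "g \<in> borel_measurable M" and le: "AE x in M. norm (g x) \<le> C * norm (f x)"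
  shows "g \<in> L2_space M"
proof (rule L2_spaceI[OF g])
  show "integrable M (\<lambda>x. (norm (g x))\<^sup>2)"
  proof (rule Bochner_Integration.integrable_bound[OF integrable_mult_right[of "C\<^sup>2", OF L2_space_integrable_square[OF f]]])
    show "AE x in M. norm ((norm (g x))\<^sup>2) \<le> norm (C\<^sup>2 * (norm (f x))\<^sup>2)" using le
    proof eventually_elim
      case (elim x)
      then have "(norm (g x))\<^sup>2 \<le> (C * norm (f x))\<^sup>2" by (intro power_mono) auto
      then show ?case by (simp add: power_mult_distrib)
    qed
  qed (use g in measurable)
qed

lemma L2_space_add:
  fixes f g :: "'a \<Rightarrow> 'b::{banach, second_countable_topology}"
  assumes f: "f \<in> L2_space M" and g: "g \<in> L2_space M"
  shows "(\<lambda>x. f x + g x) \<in> L2_space M"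
proof (rule L2_spaceI)
  show "(\<lambda>x. f x + g x) \<in> borel_measurable M" using f g by (auto simp: L2_space_def)
  show "integrable M (\<lambda>x. (norm (f x + g x))\<^sup>2)"
  proof (rule Bochner_Integration.integrable_bound)
    show "integrable M (\<lambda>x. 2 * (norm (f x))\<^sup>2 + 2 * (norm (g x))\<^sup>2)"
      using f g by (auto simp: L2_space_def)
    have "(norm (a + b))\<^sup>2 \<le> 2 * (norm a)\<^sup>2 + 2 * (norm b)\<^sup>2" for a b :: 'b
    proof -
      have "(norm (a + b))\<^sup>2 \<le> (norm a + norm b)\<^sup>2" by (intro power_mono norm_triangle_ineq) auto
      also have "\<dots> \<le> 2 * (norm a)\<^sup>2 + 2 * (norm b)\<^sup>2"
        using sum_squares_bound[of "norm a" "norm b"] by (simp add: power2_sum)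
      finally show ?thesis .
    qed
    then show "AE x in M. norm ((norm (f x + g x))\<^sup>2) \<le> norm (2 * (norm (f x))\<^sup>2 + 2 * (norm (g x))\<^sup>2)"
      by (auto intro!: AE_I2)
  qed (use f g in \<open>auto simp: L2_space_def\<close>)
qed

lemma L2_space_scaleR:
  fixes f :: "'a \<Rightarrow> 'b::{banach, second_countable_topology}"
  shows "f \<in> L2_space M \<Longrightarrow> (\<lambda>x. c *\<^sub>R f x) \<in> L2_space M"
  by (rule L2_space_bound[of f M _ "\<bar>c\<bar>"]) (auto simp: L2_space_def)

lemma L2_space_minus:
  fixes f :: "'a \<Rightarrow> 'b::{banach, second_countable_topology}"
  shows "f \<in> L2_space M \<Longrightarrow> (\<lambda>x. - f x) \<in> L2_space M"
  using L2_space_scaleR[of f M "-1"] by simp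

lemma L2_space_diff:
  fixes f g :: "'a \<Rightarrow> 'b::{banach, second_countable_topology}"
  shows "f \<in> L2_space M \<Longrightarrow> g \<in> L2_space M \<Longrightarrow> (\<lambda>x. f x - g x) \<in> L2_space M"
  using L2_space_add[OF _ L2_space_minus, of f M g] by simp

lemma L2_space_zero: "(\<lambda>x. 0) \<in> L2_space M"
  by (auto simp: L2_space_def)

lemma L2_space_AE:
  fixes f g :: "'a \<Rightarrow> 'b::{banach, second_countable_topology}"
  shows "f \<in> L2_space M \<Longrightarrow> g \<in> borel_measurable M \<Longrightarrow> AE x in M. f x = g x \<Longrightarrow> g \<in> L2_space M"
  by (rule L2_space_bound[of f M _ 1]) auto

lemma L2_space_integrable_bilinear:
  fixes f :: "'a \<Rightarrow> 'b::{banach, second_countable_topology}" and g :: "'a \<Rightarrow> 'c::{banach, second_countable_topology}"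
    and h :: "'a \<Rightarrow> 'd::{banach, second_countable_topology}"
  assumes f: "f \<in> L2_space M" and g: "g \<in> L2_space M" and h: "h \<in> borel_measurable M"
    and le: "\<And>x. norm (h x) \<le> norm (f x) * norm (g x)"
  shows "integrable M h"
proof (rule Bochner_Integration.integrable_bound)
  show "integrable M (\<lambda>x. (norm (f x))\<^sup>2 + (norm (g x))\<^sup>2)" using f g by (auto simp: L2_space_def)
  have "norm (h x) \<le> (norm (f x))\<^sup>2 + (norm (g x))\<^sup>2" for x
  proof -
    have "2 * (norm (f x) * norm (g x)) \<le> (norm (f x))\<^sup>2 + (norm (g x))\<^sup>2"
      using sum_squares_bound[of "norm (f x)" "norm (g x)"] by simp
    moreover have "0 \<le> norm (f x) * norm (g x)" by simp
    ultimately show ?thesis using le[of x] by linarith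
  qed
  then show "AE x in M. norm (h x) \<le> norm ((norm (f x))\<^sup>2 + (norm (g x))\<^sup>2)" by (auto intro!: AE_I2)
qed fact

lemma L2_space_integrable_mult:
  fixes f g :: "'a \<Rightarrow> 'b::{banach, second_countable_topology, real_normed_algebra}"
  shows "f \<in> L2_space M \<Longrightarrow> g \<in> L2_space M \<Longrightarrow> integrable M (\<lambda>x. f x * g x)"
  by (rule L2_space_integrable_bilinear[of f M g]) (auto simp: L2_space_def norm_mult_ineq)

lemma L2_space_integrable_inner:
  fixes f g :: "'a \<Rightarrow> complex"
  shows "f \<in> L2_space M \<Longrightarrow> g \<in> L2_space M \<Longrightarrow> integrable M (\<lambda>x. inner (f x) (g x))"
  by (rule L2_space_integrable_bilinear[of f M g]) (auto simp: L2_space_def Cauchy_Schwarz_ineq2)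

text \<open>A partial equivalence: functions that are not square integrable are not related even to
  themselves, so the quotient consists of L2 classes only. Values are complex because Fourier
  transforms are.\<close>

definition l2_eq :: "('a::euclidean_space \<Rightarrow> complex) \<Rightarrow> ('a \<Rightarrow> complex) \<Rightarrow> bool" where
  "l2_eq f g \<longleftrightarrow> f \<in> L2_space lebesgue \<and> g \<in> L2_space lebesgue \<and> (AE x in lebesgue. f x = g x)"

lemma part_equivp_l2_eq: "part_equivp l2_eq"
proof (rule part_equivpI)
  show "\<exists>x. l2_eq x x" using L2_space_zero by (auto simp: l2_eq_def)
  show "symp l2_eq" by (auto simp: symp_def l2_eq_def elim: eventually_mono)
  show "transp l2_eq" unfolding transp_def l2_eq_def by (auto elim: eventually_elim2)
qed

quotient_type (overloaded) 'a l2 = "'a::euclidean_space \<Rightarrow> complex" / partial: l2_eq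
  by (rule part_equivp_l2_eq)

definition cl :: "('a::euclidean_space \<Rightarrow> complex) \<Rightarrow> 'a l2" where "cl = abs_l2"

definition rp :: "'a::euclidean_space l2 \<Rightarrow> 'a \<Rightarrow> complex" where "rp = rep_l2"

lemma rp_L2: "rp v \<in> L2_space lebesgue"
  using Quotient_rep_reflp[OF Quotient_l2, of v] by (auto simp: l2_eq_def rp_def)

lemma cl_rp [simp]: "cl (rp v) = v"
  using Quotient_abs_rep[OF Quotient_l2] by (simp add: cl_def rp_def)

lemma cl_eq_iff: "f \<in> L2_space lebesgue \<Longrightarrow> g \<in> L2_space lebesgue \<Longrightarrow>
    cl f = cl g \<longleftrightarrow> (AE x in lebesgue. f x = g x)"
  using Quotient_rel[OF Quotient_l2, of f g] by (auto simp: l2_eq_def cl_def)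

lemma rp_cl: "f \<in> L2_space lebesgue \<Longrightarrow> AE x in lebesgue. rp (cl f) x = f x"
  using cl_eq_iff[OF rp_L2, of f "cl f"] by simp

lemma l2_cases: obtains f where "f \<in> L2_space lebesgue" "v = cl f"
  using rp_L2[of v] cl_rp[of v] by metis

text \<open>Scalars are real and the inner product is the real part of the Hermitian one. A real
  Hilbert space is the setting of the variational argument; the complex valued pairing is introduced
  separately as \<open>pair_l2\<close>.\<close>

instantiation l2 :: (euclidean_space) real_inner
begin

lift_definition zero_l2 :: "'a l2" is "\<lambda>x. 0" by (simp add: l2_eq_def L2_space_zero)
lift_definition plus_l2 :: "'a l2 \<Rightarrow> 'a l2 \<Rightarrow> 'a l2" is "\<lambda>f g x. f x + g x"
  by (auto simp: l2_eq_def L2_space_add elim: eventually_elim2)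
lift_definition minus_l2 :: "'a l2 \<Rightarrow> 'a l2 \<Rightarrow> 'a l2" is "\<lambda>f g x. f x - g x"
  by (auto simp: l2_eq_def L2_space_diff elim: eventually_elim2)
lift_definition uminus_l2 :: "'a l2 \<Rightarrow> 'a l2" is "\<lambda>f x. - f x"
  by (auto simp: l2_eq_def L2_space_minus)
lift_definition scaleR_l2 :: "real \<Rightarrow> 'a l2 \<Rightarrow> 'a l2" is "\<lambda>c f x. c *\<^sub>R f x"
  by (auto simp: l2_eq_def L2_space_scaleR simp del: complex_scaleR elim: eventually_mono)
lift_definition inner_l2 :: "'a l2 \<Rightarrow> 'a l2 \<Rightarrow> real" is "\<lambda>f g. \<integral>x. inner (f x) (g x) \<partial>lebesgue"
proof -
  fix f f' g g' :: "'a \<Rightarrow> complex" assume a: "l2_eq f f'" "l2_eq g g'"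
  then have "AE x in lebesgue. inner (f x) (g x) = inner (f' x) (g' x)"
    by (auto simp: l2_eq_def elim: eventually_elim2)
  then show "(\<integral>x. inner (f x) (g x) \<partial>lebesgue) = (\<integral>x. inner (f' x) (g' x) \<partial>lebesgue)"
    using a by (intro integral_cong_AE) (auto simp: l2_eq_def L2_space_def)
qed
definition norm_l2 :: "'a l2 \<Rightarrow> real" where "norm_l2 v = sqrt (inner v v)"
definition dist_l2 :: "'a l2 \<Rightarrow> 'a l2 \<Rightarrow> real" where "dist_l2 v w = norm (v - w)"
definition sgn_l2 :: "'a l2 \<Rightarrow> 'a l2" where "sgn_l2 v = scaleR (inverse (norm v)) v"
definition uniformity_l2 :: "('a l2 \<times> 'a l2) filter" where
  "uniformity_l2 = (INF e\<in>{0<..}. principal {(x, y). dist x y < e})"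
definition open_l2 :: "'a l2 set \<Rightarrow> bool" where
  "open_l2 U = (\<forall>x\<in>U. \<forall>\<^sub>F (x', y) in uniformity. x' = x \<longrightarrow> y \<in> U)"

instance
proof
  fix a b c :: "'a l2" and r s :: real
  show "a + b + c = a + (b + c)" by transfer (auto simp: l2_eq_def L2_space_add add.assoc)
  show "a + b = b + a" by transfer (auto simp: l2_eq_def L2_space_add add.commute)
  show "0 + a = a" by transfer (auto simp: l2_eq_def)
  show "- a + a = 0" by transfer (auto simp: l2_eq_def L2_space_zero)
  show "a - b = a + - b" by transfer (auto simp: l2_eq_def L2_space_diff)
  show "r *\<^sub>R (a + b) = r *\<^sub>R a + r *\<^sub>R b"
    by transfer (auto simp: l2_eq_def L2_space_add L2_space_scaleR scaleR_add_right simp del: complex_scaleR)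
  show "(r + s) *\<^sub>R a = r *\<^sub>R a + s *\<^sub>R a"
    by transfer (auto simp: l2_eq_def L2_space_add L2_space_scaleR scaleR_add_left simp del: complex_scaleR)
  show "r *\<^sub>R s *\<^sub>R a = (r * s) *\<^sub>R a"
    by transfer (auto simp: l2_eq_def L2_space_scaleR simp del: complex_scaleR)
  show "1 *\<^sub>R a = a" by transfer (auto simp: l2_eq_def)
  show "dist a b = norm (a - b)" by (simp add: dist_l2_def)
  show "sgn a = scaleR (inverse (norm a)) a" by (simp add: sgn_l2_def)
  show "uniformity = (INF e\<in>{0<..}. principal {(x, y :: 'a l2). dist x y < e})" by (rule uniformity_l2_def)
  show "open U = (\<forall>x\<in>U. \<forall>\<^sub>F (x', y) in uniformity. x' = x \<longrightarrow> y \<in> U)" for U :: "'a l2 set" by (rule open_l2_def)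
  show "inner a b = inner b a" by transfer (simp add: inner_commute)
  show "inner (a + b) c = inner a c + inner b c"
    by transfer (auto simp: l2_eq_def inner_add_left L2_space_integrable_inner)
  show "inner (r *\<^sub>R a) b = r * inner a b" by transfer simp
  show "0 \<le> inner a a" by transfer simp
  show "inner a a = 0 \<longleftrightarrow> a = 0"
  proof transfer
    fix f :: "'a \<Rightarrow> complex" assume "l2_eq f f"
    then have f: "f \<in> L2_space lebesgue" by (simp add: l2_eq_def)
    have "(\<integral>x. inner (f x) (f x) \<partial>lebesgue) = 0 \<longleftrightarrow> (AE x in lebesgue. inner (f x) (f x) = 0)"
      using L2_space_integrable_inner[OF f f] by (intro integral_nonneg_eq_0_iff_AE) auto
    then show "(\<integral>x. inner (f x) (f x) \<partial>lebesgue) = 0 \<longleftrightarrow> l2_eq f (\<lambda>x. 0)"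
      using f by (auto simp: l2_eq_def L2_space_zero)
  qed
  show "norm a = sqrt (inner a a)" by (simp add: norm_l2_def)
qed

end

lemma cl_zero: "cl (\<lambda>x. 0) = 0"
  by (simp add: cl_def zero_l2.abs_eq)

lemma cl_add: "f \<in> L2_space lebesgue \<Longrightarrow> g \<in> L2_space lebesgue \<Longrightarrow> cl (\<lambda>x. f x + g x) = cl f + cl g"
  by (simp add: cl_def plus_l2.abs_eq l2_eq_def)

lemma cl_diff: "f \<in> L2_space lebesgue \<Longrightarrow> g \<in> L2_space lebesgue \<Longrightarrow> cl (\<lambda>x. f x - g x) = cl f - cl g"
  by (simp add: cl_def minus_l2.abs_eq l2_eq_def)

lemma cl_scaleR: "f \<in> L2_space lebesgue \<Longrightarrow> cl (\<lambda>x. c *\<^sub>R f x) = c *\<^sub>R cl f"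
  by (simp add: cl_def scaleR_l2.abs_eq l2_eq_def)

lemma inner_cl: "f \<in> L2_space lebesgue \<Longrightarrow> g \<in> L2_space lebesgue \<Longrightarrow>
    inner (cl f) (cl g) = (\<integral>x. inner (f x) (g x) \<partial>lebesgue)"
  by (simp add: cl_def inner_l2.abs_eq l2_eq_def)

lemma norm_cl: "f \<in> L2_space lebesgue \<Longrightarrow> norm (cl f) = L2_seminorm lebesgue f"
  by (simp add: norm_eq_sqrt_inner inner_cl L2_seminorm_def power2_norm_eq_inner)

lemma norm_cl_power2: "f \<in> L2_space lebesgue \<Longrightarrow> (norm (cl f))\<^sup>2 = (\<integral>x. (norm (f x))\<^sup>2 \<partial>lebesgue)"
  by (simp add: power2_norm_eq_inner inner_cl)

lemma nn_integral_L2: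
  "f \<in> L2_space lebesgue \<Longrightarrow> (\<integral>\<^sup>+x. ennreal ((norm (f x))\<^sup>2) \<partial>lebesgue) = ennreal ((norm (cl f))\<^sup>2)"
  by (simp add: norm_cl_power2 nn_integral_eq_integral L2_space_integrable_square)

lemma L2_spaceI_nn_integral:
  assumes "f \<in> borel_measurable M" "(\<integral>\<^sup>+x. ennreal ((norm (f x))\<^sup>2) \<partial>M) < \<infinity>"
  shows "f \<in> L2_space M"
  using assms by (intro L2_spaceI integrableI_bounded) auto

text \<open>Fatou's lemma. The bound is required eventually because it will be a tail estimate of a
  Cauchy sequence.\<close>

lemma AE_limit_L2:
  fixes f :: "nat \<Rightarrow> 'a::euclidean_space \<Rightarrow> complex"
  assumes f: "\<And>n. f n \<in> L2_space lebesgue" and g: "g \<in> borel_measurable lebesgue"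
    and lim: "AE x in lebesgue. (\<lambda>n. f n x) \<longlonglongrightarrow> g x"
    and bd: "\<forall>\<^sub>F n in sequentially. norm (cl (f n)) \<le> C"
  shows "g \<in> L2_space lebesgue" "norm (cl g) \<le> C"
proof -
  have C: "0 \<le> C" using eventually_happens[OF bd] norm_ge_zero by (metis order_trans trivial_limit_sequentially)
  have "(\<integral>\<^sup>+x. ennreal ((norm (g x))\<^sup>2) \<partial>lebesgue) = (\<integral>\<^sup>+x. liminf (\<lambda>n. ennreal ((norm (f n x))\<^sup>2)) \<partial>lebesgue)"
  proof (rule nn_integral_cong_AE)
    show "AE x in lebesgue. ennreal ((norm (g x))\<^sup>2) = liminf (\<lambda>n. ennreal ((norm (f n x))\<^sup>2))"
      using lim
    proof eventually_elim
      case (elim x)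
      then have "(\<lambda>n. ennreal ((norm (f n x))\<^sup>2)) \<longlonglongrightarrow> ennreal ((norm (g x))\<^sup>2)"
        by (intro tendsto_ennrealI tendsto_intros)
      then show ?case using lim_imp_Liminf[OF sequentially_bot] by metis
    qed
  qed
  also have "\<dots> \<le> liminf (\<lambda>n. \<integral>\<^sup>+x. ennreal ((norm (f n x))\<^sup>2) \<partial>lebesgue)"
    by (rule nn_integral_liminf) (use f in \<open>auto simp: L2_space_def\<close>)
  also have "\<dots> \<le> ennreal (C\<^sup>2)"
  proof (rule Liminf_le)
    show "\<forall>\<^sub>F n in sequentially. (\<integral>\<^sup>+x. ennreal ((norm (f n x))\<^sup>2) \<partial>lebesgue) \<le> ennreal (C\<^sup>2)"
      using bd by eventually_elim (auto simp: nn_integral_L2[OF f] intro!: ennreal_leI power_mono)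
  qed simp
  finally have le: "(\<integral>\<^sup>+x. ennreal ((norm (g x))\<^sup>2) \<partial>lebesgue) \<le> ennreal (C\<^sup>2)" .
  then show gL: "g \<in> L2_space lebesgue"
    using g by (intro L2_spaceI_nn_integral) (auto intro: le_less_trans)
  have "(norm (cl g))\<^sup>2 \<le> C\<^sup>2" using le unfolding nn_integral_L2[OF gL] by simp
  then show "norm (cl g) \<le> C" using C by (rule power2_le_imp_le)
qed

text \<open>Riesz-Fischer: a rapidly converging subsequence has a limit almost everywhere, and
  Fatou's lemma shows that it is the limit in norm of the whole sequence.\<close>

instance l2 :: (euclidean_space) complete_space
proof
  fix X :: "nat \<Rightarrow> 'a l2" assume X: "Cauchy X"
  define f where "f n = rp (X n)" for n
  have f: "f n \<in> L2_space lebesgue" "cl (f n) = X n" for n by (simp_all add: f_def rp_L2)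
  \<comment> \<open>The rate 8^(-k) leaves room for weights: \<open>4^k\<close> times the squared
    norm is still summable, and finiteness of the weighted sum at a point forces increments of order
    2^(-k) there.\<close>
  have "\<exists>N. \<forall>m\<ge>N. \<forall>n\<ge>N. dist (X m) (X n) < (1/8)^k" for k
    by (rule metric_CauchyD[OF X]) simp
  then obtain r where r: "\<And>k m n. m \<ge> r k \<Longrightarrow> n \<ge> r k \<Longrightarrow> dist (X m) (X n) < (1/8)^k" by metis
  \<comment> \<open>Summing the thresholds makes the subsequence of indices monotone while keeping
    \<open>r k \<le> s k\<close>.\<close>
  define s where "s k = (\<Sum>j\<le>k. r j)" for k
  have sr: "r k \<le> s k" for k unfolding s_def by (rule member_le_sum) auto
  have ss: "s k \<le> s (Suc k)" for k unfolding s_def by simp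
  have smono: "s j \<le> s k" if "j \<le> k" for j k using lift_Suc_mono_le[of s, OF ss that] .
  define d where "d k x = f (s (Suc k)) x - f (s k) x" for k x
  have dL: "d k \<in> L2_space lebesgue" for k unfolding d_def using L2_space_diff[OF f(1) f(1)] by simp
  have fM [measurable]: "f k \<in> borel_measurable lebesgue" for k using f(1) by (rule L2_space_measurable)
  have dM [measurable]: "d k \<in> borel_measurable lebesgue" for k using dL by (rule L2_space_measurable)
  have dn: "norm (cl (d k)) \<le> (1/8)^k" for k
  proof -
    have "cl (d k) = X (s (Suc k)) - X (s k)" unfolding d_def by (simp add: cl_diff f)
    then show ?thesis using r[of k "s (Suc k)" "s k"] sr[of k] ss[of k] by (simp add: dist_norm)
  qed
  have "(\<integral>\<^sup>+x. (\<Sum>k. ennreal (4^k * (norm (d k x))\<^sup>2)) \<partial>lebesgue)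
      = (\<Sum>k. \<integral>\<^sup>+x. ennreal (4^k * (norm (d k x))\<^sup>2) \<partial>lebesgue)"
    by (intro nn_integral_suminf) measurable
  also have "\<dots> = (\<Sum>k. ennreal (4^k * (norm (cl (d k)))\<^sup>2))"
    by (simp add: ennreal_mult nn_integral_cmult nn_integral_L2[OF dL])
  also have "\<dots> \<le> (\<Sum>k. ennreal ((1/2)^k))"
  proof (intro suminf_le ennreal_leI summableI)
    fix k
    have "(4::real)^k * (norm (cl (d k)))\<^sup>2 \<le> 4^k * ((1/8)^k)\<^sup>2" using dn by (intro mult_left_mono power_mono) auto
    also have "\<dots> = (1/16)^k" by (simp add: power2_eq_square power_mult_distrib[symmetric])
    also have "\<dots> \<le> (1/2)^k" by (intro power_mono) auto
    finally show "4^k * (norm (cl (d k)))\<^sup>2 \<le> (1/2::real)^k" .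
  qed
  also have "\<dots> < \<infinity>"
    by (subst suminf_ennreal2) (auto intro: summable_geometric)
  finally have fin: "(\<integral>\<^sup>+x. (\<Sum>k. ennreal (4^k * (norm (d k x))\<^sup>2)) \<partial>lebesgue) \<noteq> \<infinity>" by simp
  have "AE x in lebesgue. (\<Sum>k. ennreal (4^k * (norm (d k x))\<^sup>2)) \<noteq> \<infinity>"
    by (rule nn_integral_PInf_AE[OF _ fin]) measurable
  then have conv: "AE x in lebesgue. convergent (\<lambda>k. f (s k) x)"
  proof eventually_elim
    case (elim x)
    then have "(\<Sum>k. ennreal (4^k * (norm (d k x))\<^sup>2)) < top" by (simp add: less_top)
    then obtain C where C: "C \<ge> 0" "(\<Sum>k. ennreal (4^k * (norm (d k x))\<^sup>2)) = ennreal C"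
      unfolding less_top_ennreal by blast
    have bd: "norm (d k x) \<le> sqrt C * (1/2)^k" for k
    proof -
      have "ennreal (4^k * (norm (d k x))\<^sup>2) \<le> ennreal C"
        using sum_le_suminf[of "\<lambda>k. ennreal (4^k * (norm (d k x))\<^sup>2)" "{k}"] C(2) by simp
      then have "4^k * (norm (d k x))\<^sup>2 \<le> C" using C(1) by (simp add: ennreal_le_iff)
      then have "sqrt (4^k * (norm (d k x))\<^sup>2) \<le> sqrt C" by (rule real_sqrt_le_mono)
      moreover have "sqrt ((4::real)^k) = 2^k"
        by (rule real_sqrt_unique) (auto simp: power2_eq_square simp flip: power_mult_distrib)
      ultimately have "2^k * norm (d k x) \<le> sqrt C" by (simp add: real_sqrt_mult)
      then show ?thesis by (simp add: power_one_over field_simps)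
    qed
    have "summable (\<lambda>k. d k x)"
    proof (rule summable_comparison_test'[of "\<lambda>k. sqrt C * (1/2)^k" 0])
      show "summable (\<lambda>k. sqrt C * (1/2)^k)" by (intro summable_mult summable_geometric) simp
    qed (rule bd)
    then have "convergent (\<lambda>n. \<Sum>k<n. d k x)" by (simp add: summable_iff_convergent)
    moreover have "(\<Sum>k<n. d k x) = f (s n) x - f (s 0) x" for n
      unfolding d_def by (rule sum_lessThan_telescope)
    ultimately have "convergent (\<lambda>n. f (s n) x - f (s 0) x)" by simp
    from convergent_add[OF this convergent_const[of "f (s 0) x"]] show ?case by simp
  qed
  \<comment> \<open>Where the subsequence diverges \<open>lim\<close> is arbitrary, which concerns a
    null set only.\<close>
  define g where "g x = lim (\<lambda>k. f (s k) x)" for x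
  have g: "g \<in> borel_measurable lebesgue" unfolding g_def
    by measurable
  have lim: "AE x in lebesgue. (\<lambda>k. f (s k) x) \<longlonglongrightarrow> g x"
    using conv by eventually_elim (simp add: g_def convergent_LIMSEQ_iff)
  have le: "(\<lambda>x. f n x - g x) \<in> L2_space lebesgue \<and> norm (cl (\<lambda>x. f n x - g x)) \<le> (1/8)^k" if "n \<ge> r k" for n k
  proof -
    have 1: "\<And>m. (\<lambda>x. f n x - f (s m) x) \<in> L2_space lebesgue" using L2_space_diff f by blast
    have 2: "(\<lambda>x. f n x - g x) \<in> borel_measurable lebesgue" using L2_space_measurable[OF f(1)] g by (intro borel_measurable_diff)
    have 3: "AE x in lebesgue. (\<lambda>m. f n x - f (s m) x) \<longlonglongrightarrow> f n x - g x"
      using lim by eventually_elim (intro tendsto_intros)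
    have 4: "\<forall>\<^sub>F m in sequentially. norm (cl (\<lambda>x. f n x - f (s m) x)) \<le> (1/8)^k"
      using eventually_ge_at_top[of k]
    proof eventually_elim
      case (elim m)
      then have "r k \<le> s m" using sr[of k] smono[of k m] by simp
      then show ?case using r[OF that, of "s m"] by (simp add: cl_diff f dist_norm)
    qed
    show ?thesis using AE_limit_L2[OF 1 2 3 4] by simp
  qed
  have gL: "g \<in> L2_space lebesgue"
    using L2_space_diff[OF f(1)[of "r 0"] conjunct1[OF le[of 0 "r 0"]]] by simp
  have "X \<longlonglongrightarrow> cl g"
  proof (rule metric_LIMSEQ_I)
    fix e :: real assume "e > 0"
    then obtain k where k: "(1/8)^k < e" using real_arch_pow_inv[of e "1/8"] by auto
    have "dist (X n) (cl g) < e" if "n \<ge> r k" for n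
    proof -
      have "X n - cl g = cl (\<lambda>x. f n x - g x)" using f gL by (simp add: cl_diff)
      then show ?thesis using le[OF that] k unfolding dist_norm by simp
    qed
    then show "\<exists>no. \<forall>n\<ge>no. dist (X n) (cl g) < e" by blast
  qed
  then show "convergent X" by (auto simp: convergent_def)
qed

section \<open>Lebesgue measure and multipliers\<close>

lemma ident_lebesgue_borel [measurable]: "(\<lambda>x. x) \<in> lebesgue \<rightarrow>\<^sub>M (borel :: 'a::euclidean_space measure)"
  by (rule measurable_completion) simp

lemma sigma_finite_lebesgue: "sigma_finite_measure (lebesgue :: 'a::euclidean_space measure)"
proof
  show "\<exists>A::'a set set. countable A \<and> A \<subseteq> sets lebesgue \<and> \<Union>A = space lebesgue \<and> (\<forall>a\<in>A. emeasure lebesgue a \<noteq> \<infinity>)"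
  proof (intro exI[of _ "range (\<lambda>n::nat. cball 0 (real n))"] conjI)
    show "\<Union> (range (\<lambda>n::nat. cball 0 (real n))) = space (lebesgue :: 'a measure)"
      using real_arch_simple by (auto)
    show "\<forall>a\<in>range (\<lambda>n::nat. cball (0::'a) (real n)). emeasure lebesgue a \<noteq> \<infinity>"
      using emeasure_compact_finite[OF compact_cball, where ?'a='a] by (auto simp: less_top)
  qed auto
qed

interpretation lebesgue: sigma_finite_measure "lebesgue :: 'a::euclidean_space measure"
  by (rule sigma_finite_lebesgue)

interpretation lebesgue_pair: pair_sigma_finite "lebesgue :: 'a::euclidean_space measure" "lebesgue :: 'b::euclidean_space measure" ..

text \<open>Most exchanges of integrals below have a majorant that is a product of a function of
  each variable.\<close>

lemma (in pair_sigma_finite) integrable_bound_product: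
  fixes f :: "'a \<times> 'b \<Rightarrow> 'c::{banach, second_countable_topology}"
  assumes f: "f \<in> borel_measurable (M1 \<Otimes>\<^sub>M M2)" and g: "integrable M1 g" and h: "integrable M2 h"
    and le: "\<And>x y. norm (f (x, y)) \<le> g x * (h y :: real)"
  shows "integrable (M1 \<Otimes>\<^sub>M M2) f"
proof (rule Fubini_integrable[OF f])
  have meas: "(\<lambda>y. f (x, y)) \<in> borel_measurable M2" if "x \<in> space M1" for x
    using measurable_compose[OF measurable_Pair1'[OF that] f] .
  have int2: "integrable M2 (\<lambda>y. f (x, y))" if "x \<in> space M1" for x
    by (rule Bochner_Integration.integrable_bound[OF integrable_mult_right[OF h, of "g x"] meas[OF that]])
       (use le in \<open>auto intro!: AE_I2 order_trans[OF le]\<close>)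
  then show "AE x in M1. integrable M2 (\<lambda>y. f (x, y))" by (rule AE_I2)
  show "integrable M1 (\<lambda>x. \<integral>y. norm (f (x, y)) \<partial>M2)"
  proof (rule Bochner_Integration.integrable_bound[OF integrable_mult_left[OF g, of "integral\<^sup>L M2 h"]])
    have "(\<lambda>(x, y). norm (f (x, y))) \<in> borel_measurable (M1 \<Otimes>\<^sub>M M2)" using f by auto
    then show "(\<lambda>x. \<integral>y. norm (f (x, y)) \<partial>M2) \<in> borel_measurable M1"
      by (rule M2.borel_measurable_lebesgue_integral)
    show "AE x in M1. norm (\<integral>y. norm (f (x, y)) \<partial>M2) \<le> norm (g x * integral\<^sup>L M2 h)"
    proof (rule AE_I2)
      fix x assume x: "x \<in> space M1"
      have "(\<integral>y. norm (f (x, y)) \<partial>M2) \<le> (\<integral>y. g x * h y \<partial>M2)"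
        by (rule integral_mono[OF integrable_norm[OF int2[OF x]] integrable_mult_right[OF h] le])
      then show "norm (\<integral>y. norm (f (x, y)) \<partial>M2) \<le> norm (g x * integral\<^sup>L M2 h)"
        by simp
    qed
  qed
qed

lemma
  fixes t :: "'a::euclidean_space" and c :: real
  assumes c: "c \<noteq> 0"
  shows lebesgue_affine: "lebesgue = density (distr lebesgue lebesgue (\<lambda>x::'a. t + c *\<^sub>R x)) (\<lambda>_. \<bar>c\<bar> ^ DIM('a))"
    and affine_measurable_lebesgue: "(\<lambda>x::'a. t + c *\<^sub>R x) \<in> lebesgue \<rightarrow>\<^sub>M lebesgue"
proof -
  have "(\<lambda>x. t + (\<Sum>j\<in>Basis. (c * (x \<bullet> j)) *\<^sub>R j)) = (\<lambda>x. t + c *\<^sub>R x)"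
    by (simp add: euclidean_representation scaleR_sum_right[symmetric] flip: scaleR_scaleR)
  then show "lebesgue = density (distr lebesgue lebesgue (\<lambda>x::'a. t + c *\<^sub>R x)) (\<lambda>_. \<bar>c\<bar> ^ DIM('a))"
    "(\<lambda>x::'a. t + c *\<^sub>R x) \<in> lebesgue \<rightarrow>\<^sub>M lebesgue"
    using lebesgue_affine_euclidean[of "\<lambda>_. c" t] lebesgue_affine_measurable[of "\<lambda>_. c" t] c by auto
qed

lemma
  fixes f :: "'a::euclidean_space \<Rightarrow> 'b::{banach, second_countable_topology}"
  assumes c: "c \<noteq> 0" and f: "f \<in> borel_measurable lebesgue"
  shows integral_affine_lebesgue: "(\<integral>x. f x \<partial>lebesgue) = \<bar>c\<bar> ^ DIM('a) *\<^sub>R (\<integral>x. f (t + c *\<^sub>R x) \<partial>lebesgue)"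
    and integrable_affine_lebesgue: "integrable lebesgue f \<longleftrightarrow> integrable lebesgue (\<lambda>x. f (t + c *\<^sub>R x))"
proof -
  note [measurable] = affine_measurable_lebesgue[OF c, of t] f
  let ?D = "distr lebesgue lebesgue (\<lambda>x::'a. t + c *\<^sub>R x)"
  have f': "f \<in> borel_measurable ?D" by simp
  have "(\<integral>x. f x \<partial>lebesgue) = (\<integral>x. f x \<partial>density ?D (\<lambda>_. \<bar>c\<bar> ^ DIM('a)))"
    using lebesgue_affine[OF c, of t] by simp
  also have "\<dots> = \<bar>c\<bar> ^ DIM('a) *\<^sub>R (\<integral>x. f x \<partial>?D)"
    by (subst integral_density) (auto simp: f)
  also have "(\<integral>x. f x \<partial>?D) = (\<integral>x. f (t + c *\<^sub>R x) \<partial>lebesgue)"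
    by (rule integral_distr) measurable
  finally show "(\<integral>x. f x \<partial>lebesgue) = \<bar>c\<bar> ^ DIM('a) *\<^sub>R (\<integral>x. f (t + c *\<^sub>R x) \<partial>lebesgue)" .
  have "integrable lebesgue f \<longleftrightarrow> integrable (density ?D (\<lambda>_. \<bar>c\<bar> ^ DIM('a))) f"
    using lebesgue_affine[OF c, of t] by simp
  also have "\<dots> \<longleftrightarrow> integrable ?D (\<lambda>x. \<bar>c\<bar> ^ DIM('a) *\<^sub>R f x)" by (subst integrable_density) (auto simp: f)
  also have "\<dots> \<longleftrightarrow> integrable ?D f"
  proof
    assume "integrable ?D (\<lambda>x. \<bar>c\<bar> ^ DIM('a) *\<^sub>R f x)"
    from integrable_scaleR_right[OF this, of "inverse (\<bar>c\<bar> ^ DIM('a))"] c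
    show "integrable ?D f" by simp
  qed (rule integrable_scaleR_right)
  also have "\<dots> \<longleftrightarrow> integrable lebesgue (\<lambda>x. f (t + c *\<^sub>R x))"
    by (rule integrable_distr_eq) measurable
  finally show "integrable lebesgue f \<longleftrightarrow> integrable lebesgue (\<lambda>x. f (t + c *\<^sub>R x))" .
qed

lemma AE_affine_lebesgue:
  fixes t :: "'a::euclidean_space" and c :: real
  assumes c: "c \<noteq> 0" and P: "AE x in lebesgue. P x"
  shows "AE x in lebesgue. P (t + c *\<^sub>R x)"
proof -
  obtain N where N: "N \<in> null_sets lebesgue" "{x. \<not> P x} \<subseteq> N" using P by (auto simp: eventually_ae_filter)
  have "AE x in density (distr lebesgue lebesgue (\<lambda>x::'a. t + c *\<^sub>R x)) (\<lambda>_. \<bar>c\<bar> ^ DIM('a)). x \<notin> N"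
    using AE_not_in[OF N(1)] unfolding lebesgue_affine[OF c, of t, symmetric] .
  then have "AE x in distr lebesgue lebesgue (\<lambda>x::'a. t + c *\<^sub>R x). x \<notin> N"
    using c by (subst (asm) AE_density) auto
  then have "AE x in lebesgue. t + c *\<^sub>R x \<notin> N"
    using affine_measurable_lebesgue[OF c, of t] sets.compl_sets[of N lebesgue] N(1)
    by (subst (asm) AE_distr_iff) (auto simp: null_sets_def Compl_eq_Diff_UNIV[symmetric] Compl_eq)
  then show ?thesis by eventually_elim (use N(2) in auto)
qed

lemma uminus_measurable_lebesgue [measurable]: "uminus \<in> lebesgue \<rightarrow>\<^sub>M (lebesgue :: 'a::euclidean_space measure)"
proof -
  have "(\<lambda>x::'a. 0 + (- 1) *\<^sub>R x) = uminus" by auto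
  then show ?thesis using affine_measurable_lebesgue[of "-1" "0::'a"] by simp
qed

lemma
  fixes f :: "'a::euclidean_space \<Rightarrow> 'b::{banach, second_countable_topology}"
  assumes "f \<in> borel_measurable lebesgue"
  shows integral_uminus_lebesgue: "(\<integral>x. f (- x) \<partial>lebesgue) = (\<integral>x. f x \<partial>lebesgue)"
    and integrable_uminus_lebesgue: "integrable lebesgue (\<lambda>x. f (- x)) \<longleftrightarrow> integrable lebesgue f"
  using integral_affine_lebesgue[of "-1" f 0] integrable_affine_lebesgue[of "-1" f 0] assms by auto

section \<open>Multiplication, conjugation and reflection on classes\<close>

definition mult_l2 :: "('a::euclidean_space \<Rightarrow> complex) \<Rightarrow> 'a l2 \<Rightarrow> 'a l2" where
  "mult_l2 m v = cl (\<lambda>x. m x * rp v x)"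

definition multiplier :: "('a::euclidean_space \<Rightarrow> complex) \<Rightarrow> bool" where
  "multiplier m \<longleftrightarrow> m \<in> borel_measurable lebesgue \<and> (\<exists>C. \<forall>x. norm (m x) \<le> C)"

lemma multiplier_L2:
  assumes "multiplier m" "f \<in> L2_space lebesgue"
  shows "(\<lambda>x. m x * f x) \<in> L2_space lebesgue"
proof -
  obtain C where "m \<in> borel_measurable lebesgue" "\<And>x. norm (m x) \<le> C" using assms by (auto simp: multiplier_def)
  then show ?thesis using assms(2)
    by (intro L2_space_bound[OF assms(2), of _ C]) (auto simp: norm_mult L2_space_def intro!: AE_I2 mult_right_mono)
qed

lemma mult_l2_cl:
  assumes "multiplier m" "f \<in> L2_space lebesgue"
  shows "mult_l2 m (cl f) = cl (\<lambda>x. m x * f x)"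
  unfolding mult_l2_def
  by (subst cl_eq_iff) (use rp_cl[OF assms(2)] in \<open>auto simp: multiplier_L2 assms rp_L2\<close>)

lemma bounded_linear_mult_l2:
  assumes m: "multiplier m"
  shows "bounded_linear (mult_l2 m)"
proof -
  obtain C where C: "\<And>x. norm (m x) \<le> C" using m by (auto simp: multiplier_def)
  have C0: "0 \<le> C" using C[of 0] norm_ge_zero order_trans by blast
  show ?thesis
  proof (rule bounded_linear_intro[of _ C])
    fix v w :: "'a l2" and r
    obtain f where f: "f \<in> L2_space lebesgue" "v = cl f" by (rule l2_cases)
    obtain g where g: "g \<in> L2_space lebesgue" "w = cl g" by (rule l2_cases)
    show "mult_l2 m (v + w) = mult_l2 m v + mult_l2 m w"
      using f g m by (simp add: mult_l2_cl multiplier_L2 L2_space_add distrib_left flip: cl_add)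
    show "mult_l2 m (r *\<^sub>R v) = r *\<^sub>R mult_l2 m v"
      using f m by (simp add: mult_l2_cl multiplier_L2 L2_space_scaleR flip: cl_scaleR)
    have "(\<integral>x. (norm (m x * f x))\<^sup>2 \<partial>lebesgue) \<le> (\<integral>x. C\<^sup>2 * (norm (f x))\<^sup>2 \<partial>lebesgue)"
      using C f m multiplier_L2[OF m f(1)] unfolding norm_mult power_mult_distrib
      by (intro integral_mono mult_right_mono power_mono)
         (auto simp: L2_space_def norm_mult power_mult_distrib)
    then have "(norm (mult_l2 m v))\<^sup>2 \<le> (C * norm v)\<^sup>2"
      using f m by (simp add: mult_l2_cl norm_cl_power2 multiplier_L2 power_mult_distrib)
    then show "norm (mult_l2 m v) \<le> norm v * C" using C0
      by (subst mult.commute) (rule power2_le_imp_le, auto)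
  qed
qed

definition cnj_l2 :: "'a::euclidean_space l2 \<Rightarrow> 'a l2" where "cnj_l2 v = cl (\<lambda>x. cnj (rp v x))"

definition refl_l2 :: "'a::euclidean_space l2 \<Rightarrow> 'a l2" where "refl_l2 v = cl (\<lambda>x. rp v (- x))"

lemma cnj_borel_measurable [measurable]: "cnj \<in> borel_measurable borel"
  by (intro borel_measurable_continuous_onI continuous_intros)

lemma L2_cnj:
  assumes "f \<in> L2_space M"
  shows "(\<lambda>x. cnj (f x)) \<in> L2_space M"
proof (rule L2_space_bound[OF assms, of _ 1])
  have [measurable]: "f \<in> borel_measurable M" using assms by (rule L2_space_measurable)
  show "(\<lambda>x. cnj (f x)) \<in> borel_measurable M" by measurable
qed simp

lemma L2_refl:
  fixes f :: "'a::euclidean_space \<Rightarrow> 'b::{banach, second_countable_topology}"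
  assumes "f \<in> L2_space lebesgue"
  shows "(\<lambda>x. f (- x)) \<in> L2_space lebesgue"
proof -
  have [measurable]: "f \<in> borel_measurable lebesgue" using assms by (rule L2_space_measurable)
  have "(\<lambda>x. f (- x)) \<in> borel_measurable lebesgue" by measurable
  moreover have "integrable lebesgue (\<lambda>x. (norm (f (- x)))\<^sup>2)"
    using integrable_uminus_lebesgue[of "\<lambda>x. (norm (f x))\<^sup>2"] L2_space_integrable_square[OF assms] by simp
  ultimately show ?thesis by (rule L2_spaceI)
qed

lemma cnj_l2_cl: "f \<in> L2_space lebesgue \<Longrightarrow> cnj_l2 (cl f) = cl (\<lambda>x. cnj (f x))"
  unfolding cnj_l2_def using rp_cl[of f] by (subst cl_eq_iff) (auto simp: L2_cnj rp_L2 elim: eventually_mono)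

lemma refl_l2_cl: "f \<in> L2_space lebesgue \<Longrightarrow> refl_l2 (cl f) = cl (\<lambda>x. f (- x))"
  unfolding refl_l2_def using AE_affine_lebesgue[OF _ rp_cl, of "-1" f 0]
  by (subst cl_eq_iff) (auto simp: L2_refl rp_L2)

lemma norm_cnj_l2 [simp]: "norm (cnj_l2 v) = norm v"
  by (rule l2_cases[of v]) (simp add: cnj_l2_cl norm_cl L2_cnj L2_seminorm_def)

lemma norm_refl_l2 [simp]: "norm (refl_l2 v) = norm v"
proof (rule l2_cases[of v])
  fix f assume f: "f \<in> L2_space lebesgue" "v = cl f"
  have [measurable]: "f \<in> borel_measurable lebesgue" using f(1) by (rule L2_space_measurable)
  show ?thesis using f integral_uminus_lebesgue[of "\<lambda>x. (norm (f x))\<^sup>2"]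
    by (simp add: refl_l2_cl norm_cl L2_refl L2_seminorm_def)
qed

lemma bounded_linear_cnj_l2: "bounded_linear cnj_l2"
proof (rule bounded_linear_intro[of _ 1])
  fix v w :: "'a l2" and r
  obtain f where f: "f \<in> L2_space lebesgue" "v = cl f" by (rule l2_cases)
  obtain g where g: "g \<in> L2_space lebesgue" "w = cl g" by (rule l2_cases)
  show "cnj_l2 (v + w) = cnj_l2 v + cnj_l2 w" "cnj_l2 (r *\<^sub>R v) = r *\<^sub>R cnj_l2 v"
    using f g by (simp_all add: cnj_l2_cl L2_space_add L2_space_scaleR L2_cnj flip: cl_add cl_scaleR)
qed simp

lemma bounded_linear_refl_l2: "bounded_linear refl_l2"
proof (rule bounded_linear_intro[of _ 1])
  fix v w :: "'a l2" and r
  obtain f where f: "f \<in> L2_space lebesgue" "v = cl f" by (rule l2_cases)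
  obtain g where g: "g \<in> L2_space lebesgue" "w = cl g" by (rule l2_cases)
  show "refl_l2 (v + w) = refl_l2 v + refl_l2 w" "refl_l2 (r *\<^sub>R v) = r *\<^sub>R refl_l2 v"
    using f g by (simp_all add: refl_l2_cl L2_space_add L2_space_scaleR L2_refl flip: cl_add cl_scaleR)
qed simp

lemma refl_refl_l2 [simp]: "refl_l2 (refl_l2 v) = v"
  by (rule l2_cases[of v]) (simp add: refl_l2_cl L2_refl)

lemma cnj_cnj_l2 [simp]: "cnj_l2 (cnj_l2 v) = v"
  by (rule l2_cases[of v]) (simp add: cnj_l2_cl L2_cnj)

lemma cnj_refl_l2: "cnj_l2 (refl_l2 v) = refl_l2 (cnj_l2 v)"
  by (rule l2_cases[of v]) (simp add: cnj_l2_cl L2_cnj refl_l2_cl L2_refl)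

text \<open>The pairing without conjugation is the one by which functions act on Schwartz functions
  as distributions, and the Fourier transform is symmetric for it.\<close>

definition pair_l2 :: "'a::euclidean_space l2 \<Rightarrow> 'a l2 \<Rightarrow> complex" where
  "pair_l2 v w = (\<integral>x. rp v x * rp w x \<partial>lebesgue)"

lemma pair_l2_cl:
  assumes f: "f \<in> L2_space lebesgue" and g: "g \<in> L2_space lebesgue"
  shows "pair_l2 (cl f) (cl g) = (\<integral>x. f x * g x \<partial>lebesgue)"
  unfolding pair_l2_def
proof (rule integral_cong_AE)
  show "AE x in lebesgue. rp (cl f) x * rp (cl g) x = f x * g x"
    using rp_cl[OF f] rp_cl[OF g] by eventually_elim simp
qed (use rp_L2[of "cl f"] rp_L2[of "cl g"] f g in \<open>auto simp: L2_space_def\<close>)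

lemma Re_pair_l2: "Re (pair_l2 v w) = inner v (cnj_l2 w)"
proof (rule l2_cases[of v], rule l2_cases[of w])
  fix f g assume fg: "g \<in> L2_space lebesgue" "v = cl g" "f \<in> L2_space lebesgue" "w = cl f"
  then show ?thesis
    using integral_Re[OF L2_space_integrable_mult[of g lebesgue f]]
    by (simp add: pair_l2_cl cnj_l2_cl inner_cl L2_cnj inner_complex_def)
qed

lemma pair_l2_commute: "pair_l2 v w = pair_l2 w v"
  by (simp add: pair_l2_def mult.commute)

lemma bounded_bilinear_pair_l2: "bounded_bilinear (pair_l2 :: 'a::euclidean_space l2 \<Rightarrow> _)"
proof
  fix v v' w :: "'a l2" and r
  obtain f where f: "f \<in> L2_space lebesgue" "v = cl f" by (rule l2_cases)
  obtain f' where f': "f' \<in> L2_space lebesgue" "v' = cl f'" by (rule l2_cases)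
  obtain g where g: "g \<in> L2_space lebesgue" "w = cl g" by (rule l2_cases)
  have "pair_l2 (v + v') w = (\<integral>x. (f x + f' x) * g x \<partial>lebesgue)"
    using f f' g by (simp add: pair_l2_cl L2_space_add flip: cl_add)
  also have "\<dots> = pair_l2 v w + pair_l2 v' w"
    using f f' g by (simp add: pair_l2_cl distrib_right L2_space_integrable_mult)
  finally show a: "pair_l2 (v + v') w = pair_l2 v w + pair_l2 v' w" .
  then show "pair_l2 w (v + v') = pair_l2 w v + pair_l2 w v'" by (simp add: pair_l2_commute)
  show "pair_l2 (r *\<^sub>R v) w = r *\<^sub>R pair_l2 v w"
    using f g by (simp add: pair_l2_cl L2_space_scaleR flip: cl_scaleR)
  then show "pair_l2 w (r *\<^sub>R v) = r *\<^sub>R pair_l2 w v" by (simp add: pair_l2_commute)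
next
  have le: "\<bar>Re (pair_l2 v w)\<bar> \<le> norm v * norm w" for v w :: "'a l2"
    unfolding Re_pair_l2 using Cauchy_Schwarz_ineq2[of v "cnj_l2 w"] by simp
  have im: "\<bar>Im (pair_l2 v w)\<bar> \<le> norm v * norm w" for v w :: "'a l2"
  proof -
    obtain f where f: "f \<in> L2_space lebesgue" "v = cl f" by (rule l2_cases)
    obtain g where g: "g \<in> L2_space lebesgue" "w = cl g" by (rule l2_cases)
    have m: "multiplier (\<lambda>x::'a. - \<i>)" by (auto simp: multiplier_def)
    \<comment> \<open>Multiplication by \<open>- \<i>\<close> turns imaginary parts into real parts,
      so that the real Cauchy-Schwarz inequality covers both.\<close>
    define v' where "v' = mult_l2 (\<lambda>x. - \<i>) v"
    have v': "v' = cl (\<lambda>x. - \<i> * f x)" unfolding v'_def using f m by (simp add: mult_l2_cl)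
    have L: "(\<lambda>x. - \<i> * f x) \<in> L2_space lebesgue" by (rule multiplier_L2[OF m f(1)])
    have "pair_l2 v' w = - \<i> * pair_l2 v w"
      unfolding v' f(2) g(2) pair_l2_cl[OF L g(1)] pair_l2_cl[OF f(1) g(1)]
      by (simp add: mult.assoc)
    then have "Im (pair_l2 v w) = Re (pair_l2 v' w)" by simp
    moreover have "norm v' = norm v" unfolding v' f(2) norm_cl[OF L] norm_cl[OF f(1)]
      by (simp add: L2_seminorm_def norm_mult)
    ultimately show ?thesis using le[of v' w] by simp
  qed
  have "norm (pair_l2 v w) \<le> norm v * norm w * 2" for v w :: "'a l2"
    using cmod_le[of "pair_l2 v w"] le[of v w] im[of v w] by linarith
  then show "\<exists>K. \<forall>a b :: 'a l2. norm (pair_l2 a b) \<le> norm a * norm b * K" by blast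
qed

lemma inner_mult_l2:
  assumes "multiplier (\<lambda>x. of_real (m x))"
  shows "inner (mult_l2 (\<lambda>x. of_real (m x)) v) w = inner v (mult_l2 (\<lambda>x. of_real (m x)) w)"
proof -
  obtain f where f: "f \<in> L2_space lebesgue" "v = cl f" by (rule l2_cases)
  obtain g where g: "g \<in> L2_space lebesgue" "w = cl g" by (rule l2_cases)
  show ?thesis using f g assms
    by (simp add: mult_l2_cl multiplier_L2[OF assms] inner_cl inner_complex_def mult.assoc mult.left_commute)
qed

section \<open>Test functions\<close>

text \<open>\<open>iterated_partial\<close> differentiates the function before it recurses, so
  induction has to range over a whole family of functions that is closed under partial
  derivatives.\<close>

lemma smooth_coinduct:
  assumes S: "f \<in> S"
    and diff: "\<And>f x. f \<in> S \<Longrightarrow> f differentiable (at x)"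
    and step: "\<And>f i. f \<in> S \<Longrightarrow> i \<in> Basis \<Longrightarrow> (\<lambda>x. frechet_derivative f (at x) i) \<in> S"
  shows "smooth f"
proof -
  have "iterated_partial is f differentiable (at x)" if "is \<in> lists Basis" "f \<in> S" for "is" x f
    using that by (induction "is" f rule: iterated_partial.induct) (auto intro: diff step)
  then show ?thesis using S by (auto simp: smooth_def)
qed

lemma smooth_differentiable: "smooth f \<Longrightarrow> f differentiable (at x)"
  unfolding smooth_def by (drule bspec[of _ _ "[]"]) auto

lemma smooth_partial:
  assumes "smooth f" "i \<in> Basis"
  shows "smooth (\<lambda>x. frechet_derivative f (at x) i)"
  unfolding smooth_def
proof (intro ballI allI)
  fix "is" x assume "is \<in> lists (Basis :: 'a set)"
  then have "i # is \<in> lists Basis" using assms(2) by simp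
  then show "iterated_partial is (\<lambda>x. frechet_derivative f (at x) i) differentiable (at x)"
    using bspec[OF assms(1)[unfolded smooth_def], of "i # is"] by simp
qed

lemma smooth_iterated_partial:
  "smooth f \<Longrightarrow> is \<in> lists Basis \<Longrightarrow> smooth (iterated_partial is f)"
  by (induction "is" f rule: iterated_partial.induct) (auto intro: smooth_partial)

lemma smooth_has_derivative: "smooth f \<Longrightarrow> (f has_derivative frechet_derivative f (at x)) (at x)"
  by (rule frechet_derivative_works[THEN iffD1, OF smooth_differentiable])

lemma smooth_continuous: "smooth f \<Longrightarrow> continuous_on S f"
  by (intro continuous_at_imp_continuous_on ballI has_derivative_continuous[OF smooth_has_derivative])

lemma smooth_const: "smooth (\<lambda>x. c)"
  by (rule smooth_coinduct[of _ "range (\<lambda>c x. c)"]) auto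

lemma smooth_add:
  fixes f g :: "'a::euclidean_space \<Rightarrow> 'b::real_normed_vector"
  assumes "smooth f" "smooth g"
  shows "smooth (\<lambda>x. f x + g x)"
proof (rule smooth_coinduct[of _ "{(\<lambda>x. f x + g x) | f g. smooth f \<and> smooth g}"])
  fix h :: "'a \<Rightarrow> 'b" and i :: 'a assume "h \<in> {(\<lambda>x. f x + g x) | f g. smooth f \<and> smooth g}" "i \<in> Basis"
  then obtain f g where h: "h = (\<lambda>x. f x + g x)" "smooth f" "smooth g" by blast
  have "frechet_derivative h (at x) = (\<lambda>v. frechet_derivative f (at x) v + frechet_derivative g (at x) v)" for x
    unfolding h(1) using h(2,3)
    by (intro frechet_derivative_at[symmetric] has_derivative_add smooth_has_derivative)
  then show "(\<lambda>x. frechet_derivative h (at x) i) \<in> {(\<lambda>x. f x + g x) | f g. smooth f \<and> smooth g}"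
    using smooth_partial[OF h(2) \<open>i \<in> Basis\<close>] smooth_partial[OF h(3) \<open>i \<in> Basis\<close>] by auto
qed (use assms in \<open>auto intro: differentiable_add smooth_differentiable\<close>)

text \<open>Products alone are not closed under differentiation; finite sums of products are, by the
  product rule.\<close>

inductive_set smooth_products :: "('a::euclidean_space \<Rightarrow> 'b::real_normed_algebra) set" where
  mult: "smooth f \<Longrightarrow> smooth g \<Longrightarrow> (\<lambda>x. f x * g x) \<in> smooth_products"
| add: "f \<in> smooth_products \<Longrightarrow> g \<in> smooth_products \<Longrightarrow> (\<lambda>x. f x + g x) \<in> smooth_products"

lemma smooth_mult:
  fixes f g :: "'a::euclidean_space \<Rightarrow> 'b::real_normed_algebra"
  assumes "smooth f" "smooth g"
  shows "smooth (\<lambda>x. f x * g x)"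
proof -
  have *: "h differentiable (at x) \<and> (i \<in> Basis \<longrightarrow> (\<lambda>x. frechet_derivative h (at x) i) \<in> smooth_products)"
    if "h \<in> smooth_products" for h :: "'a \<Rightarrow> 'b" and x i
    using that
  proof (induction arbitrary: x)
    case (mult f g)
    have d: "((\<lambda>x. f x * g x) has_derivative
        (\<lambda>v. f x * frechet_derivative g (at x) v + frechet_derivative f (at x) v * g x)) (at x)" for x
      by (intro has_derivative_mult smooth_has_derivative mult)
    have "frechet_derivative (\<lambda>x. f x * g x) (at x) =
        (\<lambda>v. f x * frechet_derivative g (at x) v + frechet_derivative f (at x) v * g x)" for x
      by (rule frechet_derivative_at[OF d, symmetric])
    then have "(\<lambda>x. frechet_derivative (\<lambda>x. f x * g x) (at x) i) \<in> smooth_products" if "i \<in> Basis"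
      using smooth_products.add[OF smooth_products.mult[OF mult.hyps(1) smooth_partial[OF mult.hyps(2) that]]
          smooth_products.mult[OF smooth_partial[OF mult.hyps(1) that] mult.hyps(2)]] by simp
    then show ?case using d[of x] unfolding differentiable_def by blast
  next
    case (add f g)
    have d: "((\<lambda>x. f x + g x) has_derivative
        (\<lambda>v. frechet_derivative f (at x) v + frechet_derivative g (at x) v)) (at x)" for x
      using add.IH(1)[of x] add.IH(2)[of x]
      by (intro has_derivative_add) (auto simp: frechet_derivative_works)
    have "frechet_derivative (\<lambda>x. f x + g x) (at x) =
        (\<lambda>v. frechet_derivative f (at x) v + frechet_derivative g (at x) v)" for x
      by (rule frechet_derivative_at[OF d, symmetric])
    then have "(\<lambda>x. frechet_derivative (\<lambda>x. f x + g x) (at x) i) \<in> smooth_products" if "i \<in> Basis"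
      using smooth_products.add[of "\<lambda>x. frechet_derivative f (at x) i" "\<lambda>x. frechet_derivative g (at x) i"]
        add.IH that by simp
    then show ?case using d[of x] unfolding differentiable_def by blast
  qed
  show ?thesis
    by (rule smooth_coinduct[of _ smooth_products]) (use * assms in \<open>auto intro: smooth_products.mult\<close>)
qed

lemma smooth_prod:
  fixes f :: "'i \<Rightarrow> 'a::euclidean_space \<Rightarrow> 'b::{real_normed_algebra, comm_ring_1}"
  shows "finite I \<Longrightarrow> (\<And>i. i \<in> I \<Longrightarrow> smooth (f i)) \<Longrightarrow> smooth (\<lambda>x. \<Prod>i\<in>I. f i x)"
  by (induction I rule: finite_induct) (auto intro: smooth_const smooth_mult)

lemma smooth_bounded_linear_compose:
  assumes L: "bounded_linear L" and f: "smooth f"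
  shows "smooth (\<lambda>x. L (f x))"
proof (rule smooth_coinduct[of _ "{(\<lambda>x. L (f x)) | f. smooth f}"])
  fix h i x assume "h \<in> {(\<lambda>x. L (f x)) | f. smooth f}"
  then obtain f where h: "h = (\<lambda>x. L (f x))" "smooth f" by blast
  have d: "(h has_derivative (\<lambda>v. L (frechet_derivative f (at x) v))) (at x)" for x
    unfolding h(1) using bounded_linear.has_derivative[OF L smooth_has_derivative[OF h(2)]] .
  then show "h differentiable (at x)" by (auto simp: differentiable_def)
  have "frechet_derivative h (at x) = (\<lambda>v. L (frechet_derivative f (at x) v))" for x
    by (rule frechet_derivative_at[OF d, symmetric])
  then show "(\<lambda>x. frechet_derivative h (at x) i) \<in> {(\<lambda>x. L (f x)) | f. smooth f}" if "i \<in> Basis"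
    using smooth_partial[OF h(2) that] by auto
qed (use f in auto)

text \<open>The complement of \<open>K\<close> is open, so the function is locally zero near each of
  its points, and so are the derivatives.\<close>

lemma iterated_partial_support:
  assumes "is \<in> lists Basis" "closed K" "\<And>x. x \<notin> K \<Longrightarrow> f x = 0" "x \<notin> K"
  shows "iterated_partial is f x = 0"
  using assms(1,3,4)
proof (induction "is" f arbitrary: x rule: iterated_partial.induct)
  case (2 i "is" f)
  have "frechet_derivative f (at x) i = 0" if "x \<notin> K" for x
  proof -
    have "(f has_derivative (\<lambda>v. 0)) (at x)"
    proof (rule has_derivative_transform_within_open)
      show "((\<lambda>x. 0) has_derivative (\<lambda>v. 0)) (at x)" by simp
      show "open (- K)" using assms(2) by auto
    qed (use that 2(3) in auto)
    from frechet_derivative_at[OF this] show ?thesis by metis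
  qed
  then show ?case using 2 by auto
qed auto

text \<open>The polynomial factor makes this family closed under differentiation.\<close>

definition flat_exp :: "real poly \<Rightarrow> real \<Rightarrow> real" where
  "flat_exp p t = (if t > 0 then poly p (1 / t) * exp (- (1 / t)) else 0)"

lemma poly_mult_exp_tendsto_0: "((\<lambda>y. poly p y * exp (- y)) \<longlongrightarrow> (0::real)) at_top"
proof -
  have "((\<lambda>y. \<Sum>i\<le>degree p. coeff p i * (y ^ i / exp y)) \<longlongrightarrow> (\<Sum>i\<le>degree p. coeff p i * 0)) at_top"
    by (intro tendsto_intros tendsto_power_div_exp_0)
  moreover have "(\<lambda>y. \<Sum>i\<le>degree p. coeff p i * (y ^ i / exp y)) = (\<lambda>y. poly p y * exp (- y))"
    by (auto simp: poly_altdef sum_distrib_right exp_minus field_simps sum_divide_distrib)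
  ultimately show ?thesis by simp
qed

text \<open>With y = 1/t, differentiation in t is - y^2 d/dy, which takes p(y) exp(-y) to y^2 (p -
  p')(y) exp(-y); the polynomial \<open>[:0,0,1:]\<close> is y^2. At 0 the exponential beats every
  power of y.\<close>

lemma flat_exp_has_derivative:
  "(flat_exp p has_field_derivative flat_exp ([:0,0,1:] * (p - pderiv p)) t) (at t)"
proof (cases t "0 :: real" rule: linorder_cases)
  case less
  have "((\<lambda>t. 0) has_field_derivative 0) (at t)" by simp
  then have "(flat_exp p has_field_derivative 0) (at t)"
    by (rule has_field_derivative_transform_within_open[of _ _ _ "{..<0}"]) (use less in \<open>auto simp: flat_exp_def\<close>)
  then show ?thesis using less by (simp add: flat_exp_def)
next
  case greater
  have "((\<lambda>t. poly p (1 / t) * exp (- (1 / t))) has_field_derivative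
      flat_exp ([:0,0,1:] * (p - pderiv p)) t) (at t)"
    using greater by (auto intro!: derivative_eq_intros poly_DERIV[THEN DERIV_chain2]
        simp: flat_exp_def field_simps power2_eq_square)
  then show ?thesis
    by (rule has_field_derivative_transform_within_open[of _ _ _ "{0<..}"]) (use greater in \<open>auto simp: flat_exp_def\<close>)
next
  case equal
  have r: "((\<lambda>h. flat_exp p h / h) \<longlongrightarrow> 0) (at_right 0)"
  proof -
    \<comment> \<open>Division by \<open>h\<close> multiplies a polynomial in 1/h by its variable,
      hence \<open>pCons 0 p\<close>.\<close>
    have "((\<lambda>h. poly (pCons 0 p) (inverse h) * exp (- inverse h)) \<longlongrightarrow> 0) (at_right (0::real))"
      by (rule filterlim_compose[OF poly_mult_exp_tendsto_0 filterlim_inverse_at_top_right])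
    moreover have "\<forall>\<^sub>F h in at_right 0. poly (pCons 0 p) (inverse h) * exp (- inverse h) = flat_exp p h / h"
      using eventually_at_right_less[of "0::real"]
      by eventually_elim (simp add: flat_exp_def field_simps)
    ultimately show ?thesis by (rule Lim_transform_eventually)
  qed
  have l: "((\<lambda>h. flat_exp p h / h) \<longlongrightarrow> 0) (at_left 0)"
  proof (rule Lim_transform_eventually[of "\<lambda>_. 0"])
    show "\<forall>\<^sub>F h in at_left 0. 0 = flat_exp p h / h"
      by (simp add: eventually_at_filter flat_exp_def)
  qed simp
  have "((\<lambda>h. flat_exp p h / h) \<longlongrightarrow> 0) (at 0)" using l r filterlim_split_at by blast
  then show ?thesis unfolding equal
    by (simp add: has_field_derivative_iff flat_exp_def)
qed

lemma smooth_flat_exp: "smooth (\<lambda>x::'a::euclidean_space. flat_exp p (x \<bullet> v + c))"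
proof (rule smooth_coinduct[of _ "range (\<lambda>p x. flat_exp p (x \<bullet> v + c))"])
  fix f :: "'a \<Rightarrow> real" and x i assume "f \<in> range (\<lambda>p x. flat_exp p (x \<bullet> v + c))"
  then obtain p where f: "f = (\<lambda>x. flat_exp p (x \<bullet> v + c))" by blast
  define q where "q = [:0,0,1:] * (p - pderiv p)"
  have d: "(f has_derivative (\<lambda>h. flat_exp q (x \<bullet> v + c) * (h \<bullet> v))) (at x)" for x
  proof -
    have "((\<lambda>x. x \<bullet> v + c) has_derivative (\<lambda>h. h \<bullet> v)) (at x)"
      by (auto intro!: derivative_eq_intros)
    from has_derivative_compose[OF this flat_exp_has_derivative[of p, unfolded has_field_derivative_def]]
    show ?thesis unfolding f q_def by simp
  qed
  then show "f differentiable (at x)" by (auto simp: differentiable_def)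
  have "frechet_derivative f (at x) = (\<lambda>h. flat_exp q (x \<bullet> v + c) * (h \<bullet> v))" for x
    by (rule frechet_derivative_at[OF d, symmetric])
  then have "(\<lambda>x. frechet_derivative f (at x) i) = (\<lambda>x. flat_exp (smult (i \<bullet> v) q) (x \<bullet> v + c))"
    by (auto simp: flat_exp_def)
  then show "(\<lambda>x. frechet_derivative f (at x) i) \<in> range (\<lambda>p x. flat_exp p (x \<bullet> v + c))" by blast
qed auto

text \<open>In each coordinate, two one-sided flat exponentials that vanish beyond the two faces of
  the box. The factor \<open>Suc k\<close> steepens them, so that inside the open box the values
  tend to 1.\<close>

definition bump :: "'a::euclidean_space \<Rightarrow> 'a \<Rightarrow> nat \<Rightarrow> 'a \<Rightarrow> real" where
  "bump a b k x = (\<Prod>i\<in>Basis. flat_exp 1 (x \<bullet> (real (Suc k) *\<^sub>R i) + - real (Suc k) * (a \<bullet> i))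
     * flat_exp 1 (x \<bullet> (- real (Suc k) *\<^sub>R i) + real (Suc k) * (b \<bullet> i)))"

lemma flat_exp_1: "flat_exp 1 t = (if t > 0 then exp (- (1 / t)) else 0)"
  by (simp add: flat_exp_def)

lemma bump_alt: "bump a b k x = (\<Prod>i\<in>Basis. flat_exp 1 (real (Suc k) * (x \<bullet> i - a \<bullet> i))
    * flat_exp 1 (real (Suc k) * (b \<bullet> i - x \<bullet> i)))"
  unfolding bump_def by (intro prod.cong) (auto simp: algebra_simps)

lemma bump_eq_0:
  assumes "x \<notin> box a b"
  shows "bump a b k x = 0"
proof -
  obtain i where "i \<in> Basis" "x \<bullet> i \<le> a \<bullet> i \<or> b \<bullet> i \<le> x \<bullet> i"
    using assms by (auto simp: mem_box not_less)
  then show ?thesis unfolding bump_alt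
    by (intro prod_zero bexI[of _ i]) (auto simp: flat_exp_1 zero_less_mult_iff)
qed

lemma bump_test_function:
  assumes "cbox a b \<subseteq> V"
  shows "bump a b k \<in> test_functions V"
proof -
  have "{x. bump a b k x \<noteq> 0} \<subseteq> cbox a b" using bump_eq_0 box_subset_cbox by blast
  then have sub: "closure {x. bump a b k x \<noteq> 0} \<subseteq> cbox a b" by (rule closure_minimal[OF _ closed_cbox])
  then have "compact (closure {x. bump a b k x \<noteq> 0})"
    by (meson bounded_cbox bounded_subset closed_closure compact_eq_bounded_closed)
  moreover have "smooth (bump a b k)" unfolding bump_def[abs_def]
    by (intro smooth_prod smooth_mult smooth_flat_exp) simp
  ultimately show ?thesis using sub assms by (auto simp: test_functions_def)
qed

lemma bump_bounds: "0 \<le> bump a b k x" "bump a b k x \<le> 1"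
  unfolding bump_def by (auto simp: flat_exp_1 intro!: prod_nonneg prod_le_1 mult_le_one)

lemma bump_tendsto: "(\<lambda>k. bump a b k x) \<longlonglongrightarrow> indicator (box a b) x"
proof (cases "x \<in> box a b")
  case False
  then show ?thesis by (simp add: bump_eq_0)
next
  case True
  have E: "(\<lambda>k. flat_exp 1 (real (Suc k) * d)) \<longlonglongrightarrow> 1" if "d > 0" for d
  proof -
    have "(\<lambda>k. exp (- (inverse (real (Suc k)) * inverse d))) \<longlonglongrightarrow> exp (- (0 * inverse d))"
      by (intro tendsto_intros LIMSEQ_inverse_real_of_nat)
    moreover have "flat_exp 1 (real (Suc k) * d) = exp (- (inverse (real (Suc k)) * inverse d))" for k
      using that by (auto simp: flat_exp_1 zero_less_mult_iff divide_inverse simp del: of_nat_Suc)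
    ultimately show ?thesis by simp
  qed
  have "(\<lambda>k. \<Prod>i\<in>Basis. flat_exp 1 (real (Suc k) * (x \<bullet> i - a \<bullet> i)) * flat_exp 1 (real (Suc k) * (b \<bullet> i - x \<bullet> i)))
      \<longlonglongrightarrow> (\<Prod>i\<in>(Basis :: 'a set). 1 * 1)"
    using True by (intro tendsto_prod tendsto_mult E) (auto simp: mem_box)
  then show ?thesis using True by (simp add: bump_alt)
qed

section \<open>The fundamental lemma of the calculus of variations\<close>

lemma AE_cbox_box: "AE x in lebesgue. x \<in> cbox a b \<longrightarrow> x \<in> box a (b::'a::euclidean_space)"
proof -
  have "cbox a b - box a b \<in> null_sets lebesgue"
    using negligible_frontier_interval negligible_iff_null_sets by blast
  from AE_not_in[OF this] show ?thesis by eventually_elim auto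
qed

text \<open>Boxes generate the Borel sets and are stable under intersection, so Dynkin's lemma
  applies; the integral over the whole space enters in the step to complements. A Lebesgue set
  differs from its Borel \<open>main_part\<close> by a null set.\<close>

lemma AE_zero_if_box_integrals_zero:
  fixes h :: "'a::euclidean_space \<Rightarrow> complex"
  assumes h: "integrable lebesgue h" and z: "(\<integral>x. h x \<partial>lebesgue) = 0"
    and box: "\<And>a b. (\<integral>x. indicator (box a b) x *\<^sub>R h x \<partial>lebesgue) = 0"
  shows "AE x in lebesgue. h x = 0"
proof (rule lebesgue.density_zero[OF h])
  have borel: "(\<integral>x. indicator A x *\<^sub>R h x \<partial>lebesgue) = 0" if "A \<in> sets borel" for A
  proof -
    define G where "G = range (\<lambda>(a, b). box a b :: 'a set)"
    have A: "A \<in> sigma_sets UNIV G" using that unfolding borel_eq_box G_def by simp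
    have int: "integrable lebesgue (\<lambda>x. indicator B x *\<^sub>R h x)" if "B \<in> sigma_sets UNIV G" for B
    proof -
      have "B \<in> sets borel" using that unfolding borel_eq_box G_def by simp
      then show ?thesis by (intro integrable_mult_indicator h) simp
    qed
    have "Int_stable G" unfolding G_def Int_stable_def by (auto simp: box_Int_box)
    moreover have "G \<subseteq> Pow UNIV" by simp
    ultimately show ?thesis using A
    proof (induction rule: sigma_sets_induct_disjoint)
      case (basic A)
      then show ?case using box by (auto simp: G_def)
    next
      case (compl A)
      have "(\<integral>x. indicator (UNIV - A) x *\<^sub>R h x \<partial>lebesgue) = (\<integral>x. h x - indicator A x *\<^sub>R h x \<partial>lebesgue)"
        by (intro Bochner_Integration.integral_cong) (auto simp: indicator_def)
      also have "\<dots> = 0" using compl z h int by simp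
      finally show ?case .
    next
      case (union A)
      have bor: "A i \<in> sets lebesgue" for i
      proof -
        have "A i \<in> sigma_sets UNIV G" using union by blast
        then have "A i \<in> sets borel" unfolding borel_eq_box G_def by simp
        then show ?thesis by simp
      qed
      have "(\<integral>x. indicator (\<Union>i. A i) x *\<^sub>R h x \<partial>lebesgue) = (\<Sum>i. \<integral>x. indicator (A i) x *\<^sub>R h x \<partial>lebesgue)"
      proof -
        have U: "set_integrable lebesgue (\<Union>i. A i) h" unfolding set_integrable_def
          by (intro integrable_mult_indicator h) (use bor in auto)
        have "A i \<inter> A j = {}" if "i \<noteq> j" for i j using union(1) that by (auto simp: disjoint_family_on_def)
        from lebesgue_integral_countable_add[OF bor this U] show ?thesis
          by (simp add: set_lebesgue_integral_def)
      qed
      then show ?case using union by simp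
    qed auto
  qed
  fix A :: "'a set" assume A: "A \<in> sets lebesgue"
  have "AE x in lebesgue. x \<in> main_part lborel A \<longleftrightarrow> x \<in> A"
    using AE_in_main_part[OF A] by (rule AE_completion)
  moreover have mp: "main_part lborel A \<in> sets borel" using main_part_sets[OF A] by simp
  ultimately have "(\<integral>x. indicator A x *\<^sub>R h x \<partial>lebesgue) = (\<integral>x. indicator (main_part lborel A) x *\<^sub>R h x \<partial>lebesgue)"
    using h A by (intro integral_cong_AE) (auto simp: indicator_def intro!: borel_measurable_scaleR borel_measurable_indicator)
  then show "set_lebesgue_integral lebesgue A h = 0"
    using borel[OF mp] by (simp add: set_lebesgue_integral_def)
qed

text \<open>Integrability is asked only on closed boxes inside \<open>V\<close>, so that functions
  controlled merely locally qualify. Bumps converge to indicators of boxes, and countably many boxes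
  cover \<open>V\<close>.\<close>

lemma AE_zero_if_test_integrals_zero:
  fixes g :: "'a::euclidean_space \<Rightarrow> complex"
  assumes V: "open V"
    and int: "\<And>a b. cbox a b \<subseteq> V \<Longrightarrow> integrable lebesgue (\<lambda>x. indicator (cbox a b) x *\<^sub>R g x)"
    and test: "\<And>\<phi>. \<phi> \<in> test_functions V \<Longrightarrow> (\<integral>x. g x * of_real (\<phi> x) \<partial>lebesgue) = 0"
  shows "AE x in lebesgue. x \<in> V \<longrightarrow> g x = 0"
proof -
  have box: "(\<integral>x. indicator (box a b) x *\<^sub>R g x \<partial>lebesgue) = 0" if ab: "cbox a b \<subseteq> V" for a b
  proof -
    let ?g = "\<lambda>x. indicator (cbox a b) x *\<^sub>R g x"
    have "(\<lambda>k. \<integral>x. of_real (bump a b k x) * ?g x \<partial>lebesgue) \<longlonglongrightarrow> (\<integral>x. of_real (indicator (box a b) x) * ?g x \<partial>lebesgue)"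
    proof (rule integral_dominated_convergence[where w="\<lambda>x. norm (?g x)"])
      show "integrable lebesgue (\<lambda>x. norm (?g x))" using int[OF ab] by (rule integrable_norm)
      have m: "?g \<in> borel_measurable lebesgue" using int[OF ab] by (rule borel_measurable_integrable)
      show "(\<lambda>x. of_real (indicator (box a b) x) * ?g x) \<in> borel_measurable lebesgue" using m
        by (intro borel_measurable_times borel_measurable_of_real borel_measurable_indicator) auto
      have "bump a b k \<in> borel_measurable borel" for k
        using bump_test_function[of a b UNIV k] smooth_continuous
        by (intro borel_measurable_continuous_onI) (auto simp: test_functions_def)
      then have "bump a b k \<in> borel_measurable lebesgue" for k by (intro measurable_completion) simp
      then show "\<And>k. (\<lambda>x. of_real (bump a b k x) * ?g x) \<in> borel_measurable lebesgue" using m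
        by (intro borel_measurable_times borel_measurable_of_real) auto
      show "AE x in lebesgue. (\<lambda>k. of_real (bump a b k x) * ?g x) \<longlonglongrightarrow> of_real (indicator (box a b) x) * ?g x"
        by (intro AE_I2 tendsto_intros bump_tendsto)
      show "\<And>k. AE x in lebesgue. norm (of_real (bump a b k x) * ?g x) \<le> norm (?g x)"
      proof (rule AE_I2)
        fix k x
        have "norm (of_real (bump a b k x) * ?g x) = bump a b k x * norm (?g x)"
          using bump_bounds(1)[of a b k x] by (simp only: norm_mult norm_of_real abs_of_nonneg)
        also have "\<dots> \<le> 1 * norm (?g x)" by (intro mult_right_mono bump_bounds norm_ge_zero)
        finally show "norm (of_real (bump a b k x) * ?g x) \<le> norm (?g x)" by simp
      qed
    qed
    moreover have "(\<integral>x. of_real (bump a b k x) * ?g x \<partial>lebesgue) = 0" for k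
    proof -
      have "of_real (bump a b k x) * ?g x = g x * of_real (bump a b k x)" for x
        using bump_eq_0[of x a b k] box_subset_cbox[of a b] by (cases "x \<in> cbox a b") auto
      then show ?thesis using test[OF bump_test_function[OF ab]] by simp
    qed
    moreover have "of_real (indicator (box a b) x) * ?g x = indicator (box a b) x *\<^sub>R g x" for x
      using box_subset_cbox[of a b] by (auto simp: indicator_def)
    ultimately show ?thesis by (simp add: LIMSEQ_const_iff)
  qed
  have cb: "AE x in lebesgue. x \<in> cbox c d \<longrightarrow> g x = 0" if cd: "cbox c d \<subseteq> V" for c d
  proof -
    \<comment> \<open>Cutting off by an open box makes the function integrable on the whole space;
      its integral over any box is again one over a box, because boxes intersect in boxes.\<close>
    define h where "h x = indicator (box c d) x *\<^sub>R g x" for x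
    have "AE x in lebesgue. h x = 0"
    proof (rule AE_zero_if_box_integrals_zero)
      have "(\<lambda>x. indicator (box c d) x *\<^sub>R (indicator (cbox c d) x *\<^sub>R g x)) = h"
        using box_subset_cbox[of c d] by (intro ext) (auto simp: h_def indicator_def)
      then show "integrable lebesgue h"
        using integrable_mult_indicator[OF _ int[OF cd], of "box c d"] by (simp del: scaleR_scaleR)
      show "(\<integral>x. h x \<partial>lebesgue) = 0" unfolding h_def by (rule box[OF cd])
      fix a b
      obtain e f where ef: "box a b \<inter> box c d = box e f" using that[OF box_Int_box] .
      have eq: "(\<integral>x. indicator (box a b) x *\<^sub>R h x \<partial>lebesgue) = (\<integral>x. indicator (box e f) x *\<^sub>R g x \<partial>lebesgue)"
        unfolding h_def ef[symmetric] by (intro Bochner_Integration.integral_cong) (auto simp: indicator_def)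
      show "(\<integral>x. indicator (box a b) x *\<^sub>R h x \<partial>lebesgue) = 0"
      proof (cases "box e f = {}")
        case True
        then show ?thesis unfolding eq by simp
      next
        case False
        \<comment> \<open>Here the open box has to be nonempty: otherwise the closed box with the
          same corners may stick out of \<open>V\<close>.\<close>
        have "cbox e f = closure (box e f)" using closure_box[OF False] by simp
        also have "\<dots> \<subseteq> cbox c d" using ef box_subset_cbox[of c d] by (intro closure_minimal) auto
        finally have "cbox e f \<subseteq> V" using cd by (rule order_trans)
        then show ?thesis unfolding eq by (rule box)
      qed
    qed
    then show ?thesis using AE_cbox_box[of c d] by eventually_elim (auto simp: h_def)
  qed
  obtain \<D> where D: "countable \<D>" "\<D> \<subseteq> Pow V" "\<And>X. X \<in> \<D> \<Longrightarrow> \<exists>a b. X = cbox a b" "\<Union>\<D> = V"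
    by (rule open_countable_Union_open_cbox[OF V], rule that)
  have "AE x in lebesgue. \<forall>X\<in>\<D>. x \<in> X \<longrightarrow> g x = 0"
  proof (subst AE_ball_countable[OF D(1)], intro ballI)
    fix X assume X: "X \<in> \<D>"
    obtain c d where cd: "X = cbox c d" using D(3)[OF X] by (elim exE)
    show "AE x in lebesgue. x \<in> X \<longrightarrow> g x = 0" unfolding cd
      by (rule cb) (use X D(2) cd in auto)
  qed
  then show ?thesis by eventually_elim (use D(4) in blast)
qed

section \<open>The Fourier transform\<close>

lemma
  fixes f :: "'a::euclidean_space \<Rightarrow> real \<Rightarrow> 'b::{real_normed_field, banach, second_countable_topology}"
  assumes int: "\<And>b. b \<in> Basis \<Longrightarrow> integrable lborel (f b)"
  shows integrable_prod_lebesgue: "integrable lebesgue (\<lambda>x::'a. \<Prod>b\<in>Basis. f b (x \<bullet> b))"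
    and integral_prod_lebesgue: "(\<integral>x. (\<Prod>b\<in>Basis. f b (x \<bullet> b)) \<partial>lebesgue) = (\<Prod>b\<in>Basis. \<integral>x. f b x \<partial>lborel)"
proof -
  interpret product_sigma_finite "\<lambda>_::'a. lborel :: real measure" by standard
  let ?P = "\<Pi>\<^sub>M b\<in>(Basis :: 'a set). (lborel :: real measure)"
  let ?T = "\<lambda>g. \<Sum>b\<in>(Basis :: 'a set). g b *\<^sub>R b"
  have T: "?T \<in> ?P \<rightarrow>\<^sub>M borel"
    by (intro borel_measurable_sum borel_measurable_scaleR borel_measurable_const)
       (use measurable_component_singleton[where M="\<lambda>_. lborel :: real measure"] in simp)
  have L: "(lborel :: 'a measure) = distr ?P borel ?T" by (rule lborel_eq)
  have [measurable]: "b \<in> Basis \<Longrightarrow> f b \<in> borel_measurable borel" for b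
    using borel_measurable_integrable[OF int] by simp
  have m: "(\<lambda>x::'a. \<Prod>b\<in>Basis. f b (x \<bullet> b)) \<in> borel_measurable borel"
  proof (rule borel_measurable_prod)
    fix b :: 'a assume "b \<in> Basis"
    then have "f b \<in> borel_measurable borel" by measurable
    from measurable_compose[OF _ this, of "\<lambda>x. x \<bullet> b" borel]
    show "(\<lambda>x. f b (x \<bullet> b)) \<in> borel_measurable borel" by simp
  qed
  have eq: "(\<Prod>b\<in>Basis. f b (?T g \<bullet> b)) = (\<Prod>b\<in>Basis. f b (g b))" for g
    by (intro prod.cong) (auto simp: inner_sum_left inner_Basis if_distrib[of "\<lambda>x. _ * x"] cong: if_cong)
  have "integrable ?P (\<lambda>g. \<Prod>b\<in>Basis. f b (g b))"
    by (rule product_integrable_prod) (use int in auto)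
  then have i: "integrable lborel (\<lambda>x::'a. \<Prod>b\<in>Basis. f b (x \<bullet> b))"
    unfolding L by (subst integrable_distr_eq[OF T m]) (simp only: eq)
  then show "integrable lebesgue (\<lambda>x::'a. \<Prod>b\<in>Basis. f b (x \<bullet> b))"
    using m by (subst integrable_completion) auto
  have "(\<integral>x. (\<Prod>b\<in>Basis. f b (x \<bullet> b)) \<partial>lebesgue) = (\<integral>x. (\<Prod>b\<in>Basis. f b (x \<bullet> b)) \<partial>lborel)"
    using m by (subst integral_completion) auto
  also have "\<dots> = (\<integral>g. (\<Prod>b\<in>Basis. f b (g b)) \<partial>?P)"
    unfolding L by (subst integral_distr[OF T m]) (simp only: eq)
  also have "\<dots> = (\<Prod>b\<in>Basis. \<integral>x. f b x \<partial>lborel)"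
    by (rule product_integral_prod) (use int in auto)
  finally show "(\<integral>x. (\<Prod>b\<in>Basis. f b (x \<bullet> b)) \<partial>lebesgue) = (\<Prod>b\<in>Basis. \<integral>x. f b x \<partial>lborel)" .
qed

text \<open>Up to scaling this is the characteristic function of the standard normal
  distribution.\<close>

lemma
  fixes t u :: real
  assumes t: "t > 0"
  shows gaussian_fourier_1d_integrable: "integrable lborel (\<lambda>x. cis (- (x * u)) * of_real (exp (- t * x\<^sup>2)))"
    and gaussian_fourier_1d: "(\<integral>x. cis (- (x * u)) * of_real (exp (- t * x\<^sup>2)) \<partial>lborel)
      = of_real (sqrt (pi / t) * exp (- (u\<^sup>2 / (4 * t))))"
proof -
  \<comment> \<open>This scaling turns the exponent x^2/2 of the normal density into t x^2.\<close>
  define c where "c = sqrt (2 * t)"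
  have c: "c > 0" "c\<^sup>2 = 2 * t" using t by (auto simp: c_def)
  define v where "v = - u / c"
  define f where "f x = std_normal_density x *\<^sub>R iexp (v * x)" for x
  have fm: "f \<in> borel_measurable borel" unfolding f_def by measurable
  have fi: "integrable lborel f"
  proof (rule Bochner_Integration.integrable_bound[of _ std_normal_density])
    show "integrable lborel std_normal_density" by (rule integrable_normal_density) simp
    show "AE x in lborel. norm (f x) \<le> norm (std_normal_density x)" by (simp add: f_def norm_mult)
  qed (use fm in simp)
  have "(\<integral>x. f x \<partial>lborel) = char std_normal_distribution v"
    unfolding char_def f_def by (subst integral_density) auto
  also have "\<dots> = of_real (exp (- (v\<^sup>2 / 2)))" by (simp add: char_std_normal_distribution)
  finally have 1: "(\<integral>x. f x \<partial>lborel) = of_real (exp (- (v\<^sup>2 / 2)))" .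
  have 2: "(\<integral>x. f x \<partial>lborel) = \<bar>c\<bar> *\<^sub>R (\<integral>x. f (0 + c * x) \<partial>lborel)"
    by (rule lborel_integral_real_affine) (use c in simp)
  have 3: "f (0 + c * x) = of_real (1 / sqrt (2 * pi)) * (cis (- (x * u)) * of_real (exp (- t * x\<^sup>2)))" for x
  proof -
    have "v * (c * x) = - (x * u)" using c by (simp add: v_def)
    moreover have "(c * x)\<^sup>2 / 2 = t * x\<^sup>2" using c by (simp add: power_mult_distrib)
    ultimately show ?thesis
      by (simp add: f_def std_normal_density_def cis_conv_exp scaleR_conv_of_real mult_ac)
  qed
  have "integrable lborel (\<lambda>x. f (0 + c * x))"
    using lborel_integrable_real_affine[OF fi, of c 0] c by simp
  then have i: "integrable lborel (\<lambda>x. of_real (1 / sqrt (2 * pi)) * (cis (- (x * u)) * of_real (exp (- t * x\<^sup>2))))"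
    by (simp only: 3)
  have "integrable lborel (\<lambda>x. of_real (sqrt (2 * pi)) * (of_real (1 / sqrt (2 * pi)) * (cis (- (x * u)) * of_real (exp (- t * x\<^sup>2)))))"
    by (rule integrable_mult_right[OF i])
  then show "integrable lborel (\<lambda>x. cis (- (x * u)) * of_real (exp (- t * x\<^sup>2)))"
    by (simp add: mult.assoc[symmetric] flip: of_real_mult)
  have v2: "v\<^sup>2 / 2 = u\<^sup>2 / (4 * t)" using c t by (simp add: v_def power_divide)
  have "of_real (exp (- (u\<^sup>2 / (4 * t)))) = of_real c * (of_real (1 / sqrt (2 * pi)) * (\<integral>x. cis (- (x * u)) * of_real (exp (- t * x\<^sup>2)) \<partial>lborel))"
    using 1 2 c unfolding 3 v2 by (simp add: scaleR_conv_of_real)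
  then have "(\<integral>x. cis (- (x * u)) * of_real (exp (- t * x\<^sup>2)) \<partial>lborel) = of_real (sqrt (2 * pi) / c * exp (- (u\<^sup>2 / (4 * t))))"
    using c by (simp add: field_simps)
  moreover have "sqrt (2 * pi) / c = sqrt (pi / t)" by (simp add: c_def real_sqrt_divide[symmetric])
  ultimately show "(\<integral>x. cis (- (x * u)) * of_real (exp (- t * x\<^sup>2)) \<partial>lborel)
      = of_real (sqrt (pi / t) * exp (- (u\<^sup>2 / (4 * t))))" by simp
qed

lemma cis_sum: "finite I \<Longrightarrow> cis (\<Sum>i\<in>I. f i) = (\<Prod>i\<in>I. cis (f i))"
  by (induction I rule: finite_induct) (auto simp: cis_mult[symmetric])

lemma norm_power2_Basis: "(norm (x::'a::euclidean_space))\<^sup>2 = (\<Sum>b\<in>Basis. (x \<bullet> b)\<^sup>2)"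
  unfolding power2_norm_eq_inner euclidean_inner[of x x] by (simp add: power2_eq_square)

lemma
  fixes \<xi> :: "'a::euclidean_space"
  assumes t: "t > 0"
  shows gaussian_fourier_integrable: "integrable lebesgue (\<lambda>x. cis (- (x \<bullet> \<xi>)) * of_real (exp (- t * (norm x)\<^sup>2)))"
    and gaussian_fourier: "(\<integral>x. cis (- (x \<bullet> \<xi>)) * of_real (exp (- t * (norm x)\<^sup>2)) \<partial>lebesgue)
      = of_real (sqrt (pi / t) ^ DIM('a) * exp (- ((norm \<xi>)\<^sup>2 / (4 * t))))"
proof -
  have eq: "cis (- (x \<bullet> \<xi>)) * of_real (exp (- t * (norm x)\<^sup>2))
      = (\<Prod>b\<in>Basis. cis (- ((x \<bullet> b) * (\<xi> \<bullet> b))) * of_real (exp (- t * (x \<bullet> b)\<^sup>2)))" for x :: 'a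
    by (simp add: prod.distrib euclidean_inner[of x \<xi>] norm_power2_Basis sum_distrib_left sum_negf[symmetric]
        cis_sum exp_sum of_real_prod del: of_real_exp)
  show "integrable lebesgue (\<lambda>x. cis (- (x \<bullet> \<xi>)) * of_real (exp (- t * (norm x)\<^sup>2)))"
    unfolding eq by (rule integrable_prod_lebesgue) (rule gaussian_fourier_1d_integrable[OF t])
  have "(\<integral>x. cis (- (x \<bullet> \<xi>)) * of_real (exp (- t * (norm x)\<^sup>2)) \<partial>lebesgue)
      = (\<Prod>b\<in>Basis. of_real (sqrt (pi / t) * exp (- ((\<xi> \<bullet> b)\<^sup>2 / (4 * t)))))"
    unfolding eq
    by (subst integral_prod_lebesgue) (simp_all only: gaussian_fourier_1d_integrable[OF t] gaussian_fourier_1d[OF t])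
  also have "\<dots> = of_real (sqrt (pi / t) ^ DIM('a) * exp (- ((norm \<xi>)\<^sup>2 / (4 * t))))"
    by (simp add: prod.distrib norm_power2_Basis sum_divide_distrib sum_negf[symmetric] exp_sum
       del: of_real_exp flip: of_real_prod)
  finally show "(\<integral>x. cis (- (x \<bullet> \<xi>)) * of_real (exp (- t * (norm x)\<^sup>2)) \<partial>lebesgue)
      = of_real (sqrt (pi / t) ^ DIM('a) * exp (- ((norm \<xi>)\<^sup>2 / (4 * t))))" .
qed

lemma gaussian_integrable: "t > 0 \<Longrightarrow> integrable lebesgue (\<lambda>x::'a::euclidean_space. exp (- t * (norm x)\<^sup>2))"
  using gaussian_fourier_integrable[of t 0, THEN integrable_Re] by simp

lemma gaussian_integral: "t > 0 \<Longrightarrow> (\<integral>x. exp (- t * (norm (x::'a::euclidean_space))\<^sup>2) \<partial>lebesgue) = sqrt (pi / t) ^ DIM('a)"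
proof -
  assume t: "t > 0"
  have "complex_of_real (\<integral>x. exp (- t * (norm (x::'a))\<^sup>2) \<partial>lebesgue) = of_real (sqrt (pi / t) ^ DIM('a))"
    using gaussian_fourier[OF t, of "0::'a"] by (simp flip: integral_complex_of_real)
  then show ?thesis unfolding of_real_eq_iff .
qed

lemma cis_measurable [measurable]: "cis \<in> borel_measurable borel"
  by (intro borel_measurable_continuous_onI continuous_intros continuous_on_cis)

lemma integrable_cis_mult:
  assumes "integrable lebesgue f"
  shows "integrable lebesgue (\<lambda>x. cis (- (x \<bullet> \<xi>)) * f x)"
proof (rule Bochner_Integration.integrable_bound[OF assms])
  have [measurable]: "f \<in> borel_measurable lebesgue" using assms by simp
  show "(\<lambda>x. cis (- (x \<bullet> \<xi>)) * f x) \<in> borel_measurable lebesgue" by measurable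
qed (simp add: norm_mult)

lemma norm_fourier_le: "integrable lebesgue f \<Longrightarrow> norm (fourier f \<xi>) \<le> (\<integral>x. norm (f x) \<partial>lebesgue)"
  unfolding fourier_def
  by (rule order_trans[OF integral_norm_bound]) (simp add: norm_mult)

lemma fourier_measurable [measurable]:
  assumes "integrable lebesgue f"
  shows "fourier f \<in> borel_measurable lebesgue"
proof -
  have [measurable]: "f \<in> borel_measurable lebesgue" using assms by simp
  show ?thesis unfolding fourier_def[abs_def] by measurable
qed

lemma fourier_cong_AE:
  assumes "AE x in lebesgue. f x = g x" "f \<in> borel_measurable lebesgue" "g \<in> borel_measurable lebesgue"
  shows "fourier f = fourier g"
proof
  fix \<xi>
  have [measurable]: "f \<in> borel_measurable lebesgue" "g \<in> borel_measurable lebesgue" by fact+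
  show "fourier f \<xi> = fourier g \<xi>" unfolding fourier_def
    by (rule integral_cong_AE) (use assms(1) in auto)
qed

text \<open>Fubini's theorem. Extended to L2 it becomes \<open>pair_fourier_l2\<close>, the duality
  by which the transform of a distribution is defined.\<close>

lemma fourier_multiplication_formula:
  assumes f: "integrable lebesgue f" and g: "integrable lebesgue g"
  shows "(\<integral>\<xi>. fourier f \<xi> * g \<xi> \<partial>lebesgue) = (\<integral>x. f x * fourier g x \<partial>lebesgue)"
proof -
  have [measurable]: "f \<in> borel_measurable lebesgue" "g \<in> borel_measurable lebesgue" using f g by auto
  have "(\<integral>\<xi>. fourier f \<xi> * g \<xi> \<partial>lebesgue) = (\<integral>\<xi>. (\<integral>x. cis (- (x \<bullet> \<xi>)) * f x * g \<xi> \<partial>lebesgue) \<partial>lebesgue)"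
    unfolding fourier_def by simp
  also have "\<dots> = (\<integral>x. (\<integral>\<xi>. cis (- (x \<bullet> \<xi>)) * f x * g \<xi> \<partial>lebesgue) \<partial>lebesgue)"
    by (rule lebesgue_pair.Fubini_integral,
        rule lebesgue_pair.integrable_bound_product[OF _ integrable_norm[OF f] integrable_norm[OF g]])
       (auto simp: norm_mult)
  also have "\<dots> = (\<integral>x. f x * (\<integral>\<xi>. cis (- (\<xi> \<bullet> x)) * g \<xi> \<partial>lebesgue) \<partial>lebesgue)"
    by (simp add: mult_ac inner_commute flip: integral_mult_right_zero)
  finally show ?thesis unfolding fourier_def .
qed

text \<open>Large enough to contain the Schwartz functions and small enough for classical arguments:
  integrability makes the transform a convergent integral, while boundedness and continuity let
  Gaussian averages converge pointwise under domination.\<close>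

definition nice :: "('a::euclidean_space \<Rightarrow> complex) \<Rightarrow> bool" where
  "nice f \<longleftrightarrow> continuous_on UNIV f \<and> (\<exists>C. \<forall>x. norm (f x) \<le> C) \<and> integrable lebesgue f"

lemma nice_integrable: "nice f \<Longrightarrow> integrable lebesgue f"
  by (simp add: nice_def)

lemma nice_borel: "nice f \<Longrightarrow> f \<in> borel_measurable borel"
  by (simp add: nice_def borel_measurable_continuous_onI)

lemma nice_measurable: "nice f \<Longrightarrow> f \<in> borel_measurable lebesgue"
  by (rule borel_measurable_integrable[OF nice_integrable])

lemma nice_L2:
  assumes "nice f"
  shows "f \<in> L2_space lebesgue"
proof -
  obtain C where C: "\<And>x. norm (f x) \<le> C" using assms by (auto simp: nice_def)
  show ?thesis
  proof (rule L2_spaceI[OF nice_measurable[OF assms]])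
    show "integrable lebesgue (\<lambda>x. (norm (f x))\<^sup>2)"
    proof (rule Bochner_Integration.integrable_bound)
      show "integrable lebesgue (\<lambda>x. C * norm (f x))"
        using nice_integrable[OF assms] by (intro integrable_mult_right integrable_norm)
      show "AE x in lebesgue. norm ((norm (f x))\<^sup>2) \<le> norm (C * norm (f x))"
      proof (rule AE_I2)
        fix x
        have "0 \<le> C" using C[of x] norm_ge_zero order_trans by blast
        then show "norm ((norm (f x))\<^sup>2) \<le> norm (C * norm (f x))"
          using C[of x] by (simp add: power2_eq_square mult_right_mono)
      qed
    qed (use nice_measurable[OF assms] in measurable)
  qed
qed

lemma nice_add: "nice f \<Longrightarrow> nice g \<Longrightarrow> nice (\<lambda>x. f x + g x)"
  unfolding nice_def by (auto intro!: continuous_intros intro: order_trans[OF norm_triangle_ineq add_mono])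

lemma nice_scaleR:
  assumes "nice f" shows "nice (\<lambda>x. c *\<^sub>R f x)"
proof -
  obtain C where C: "\<And>x. norm (f x) \<le> C" using assms by (auto simp: nice_def)
  have "norm (c *\<^sub>R f x) \<le> \<bar>c\<bar> * C" for x using C[of x] by (simp add: mult_left_mono)
  then show ?thesis using assms unfolding nice_def
    by (intro conjI continuous_intros exI[of _ "\<bar>c\<bar> * C"] integrable_scaleR_right) auto
qed

lemma nice_cnj: "nice f \<Longrightarrow> nice (\<lambda>x. cnj (f x))"
  unfolding nice_def by (auto intro!: continuous_intros)

section \<open>Plancherel's theorem\<close>

lemma fourier_cnj: "fourier (\<lambda>x. cnj (f x)) \<xi> = cnj (fourier f (- \<xi>))"
  unfolding fourier_def by (subst Bochner_Integration.integral_cnj[symmetric]) (simp add: cis_cnj)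

lemma cnj_fourier: "cnj (fourier f \<xi>) = (\<integral>x. cis (x \<bullet> \<xi>) * cnj (f x) \<partial>lebesgue)"
  unfolding fourier_def by (subst Bochner_Integration.integral_cnj[symmetric]) (simp add: cis_cnj)

text \<open>Damping makes the double integral absolutely convergent; the inner integral is the
  transform of a Gaussian, and the substitution y = x + c w leaves the fixed weight exp(-|w|^2).
  Letting \<open>c\<close> tend to 0 gives Plancherel's theorem, and c = 2 sqrt t gives the heat
  kernel at time t.\<close>

lemma fourier_gaussian_damped:
  assumes f: "nice f" and c: "c > 0"
  shows "fourier (\<lambda>\<xi>. cnj (fourier f \<xi>) * of_real (exp (- (c\<^sup>2 / 4) * (norm \<xi>)\<^sup>2))) (x :: 'a::euclidean_space)
    = of_real ((2 * sqrt pi) ^ DIM('a)) * (\<integral>w. cnj (f (x + c *\<^sub>R w)) * of_real (exp (- (norm w)\<^sup>2)) \<partial>lebesgue)"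
proof -
  define t where "t = c\<^sup>2 / 4"
  have t: "t > 0" using c by (simp add: t_def)
  note [measurable] = nice_measurable[OF f]
  have fi: "integrable lebesgue f" by (rule nice_integrable[OF f])
  define G where "G \<xi> = exp (- t * (norm \<xi>)\<^sup>2)" for \<xi> :: 'a
  have Gi: "integrable lebesgue G" unfolding G_def by (rule gaussian_integrable[OF t])
  have [measurable]: "G \<in> borel_measurable lebesgue" using Gi by simp
  have "fourier (\<lambda>\<xi>. cnj (fourier f \<xi>) * of_real (G \<xi>)) x
      = (\<integral>\<xi>. (\<integral>y. cis (- (x \<bullet> \<xi>)) * cis (y \<bullet> \<xi>) * cnj (f y) * of_real (G \<xi>) \<partial>lebesgue) \<partial>lebesgue)"
    unfolding cnj_fourier unfolding fourier_def
    by (subst integral_mult_left_zero[symmetric], subst integral_mult_right_zero[symmetric])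
       (simp add: inner_commute mult_ac)
  also have "\<dots> = (\<integral>y. (\<integral>\<xi>. cis (- (x \<bullet> \<xi>)) * cis (y \<bullet> \<xi>) * cnj (f y) * of_real (G \<xi>) \<partial>lebesgue) \<partial>lebesgue)"
    by (rule lebesgue_pair.Fubini_integral,
        rule lebesgue_pair.integrable_bound_product[OF _ integrable_norm[OF fi] integrable_norm[OF Gi]])
       (auto simp: norm_mult)
  also have "\<dots> = (\<integral>y. cnj (f y) * of_real (sqrt (pi / t) ^ DIM('a) * exp (- ((norm (y - x))\<^sup>2 / (4 * t)))) \<partial>lebesgue)"
  proof (rule Bochner_Integration.integral_cong[OF refl])
    fix y
    have "(\<integral>\<xi>. cis (- (x \<bullet> \<xi>)) * cis (y \<bullet> \<xi>) * cnj (f y) * of_real (G \<xi>) \<partial>lebesgue)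
        = cnj (f y) * (\<integral>\<xi>. cis (- (\<xi> \<bullet> (x - y))) * of_real (exp (- t * (norm \<xi>)\<^sup>2)) \<partial>lebesgue)"
      unfolding G_def
      by (simp add: cis_mult inner_diff_right inner_commute mult_ac flip: integral_mult_right_zero)
    also have "\<dots> = cnj (f y) * of_real (sqrt (pi / t) ^ DIM('a) * exp (- ((norm (y - x))\<^sup>2 / (4 * t))))"
      unfolding gaussian_fourier[OF t] by (simp add: norm_minus_commute)
    finally show "(\<integral>\<xi>. cis (- (x \<bullet> \<xi>)) * cis (y \<bullet> \<xi>) * cnj (f y) * of_real (G \<xi>) \<partial>lebesgue) = \<dots>" .
  qed
  also have "\<dots> = \<bar>c\<bar> ^ DIM('a) *\<^sub>R (\<integral>w. cnj (f (x + c *\<^sub>R w)) *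
      of_real (sqrt (pi / t) ^ DIM('a) * exp (- ((norm ((x + c *\<^sub>R w) - x))\<^sup>2 / (4 * t)))) \<partial>lebesgue)"
    by (rule integral_affine_lebesgue) (use c in \<open>simp, measurable\<close>)
  also have "\<dots> = \<bar>c\<bar> ^ DIM('a) *\<^sub>R (\<integral>w. of_real (sqrt (pi / t) ^ DIM('a)) * (cnj (f (x + c *\<^sub>R w)) *
      of_real (exp (- (norm w)\<^sup>2))) \<partial>lebesgue)"
    using c by (simp add: t_def power_mult_distrib mult_ac)
  also have "\<dots> = of_real ((c * sqrt (pi / t)) ^ DIM('a)) * (\<integral>w. cnj (f (x + c *\<^sub>R w)) * of_real (exp (- (norm w)\<^sup>2)) \<partial>lebesgue)"
    using c by (simp add: scaleR_conv_of_real power_mult_distrib)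
  also have "c * sqrt (pi / t) = 2 * sqrt pi"
    using c by (simp add: t_def real_sqrt_divide real_sqrt_mult)
  finally show ?thesis unfolding G_def t_def .
qed

text \<open>The Gaussian damping is removed in the limit. On the frequency side the damped integrals
  increase, so monotone convergence yields square integrability together with the value; on the
  space side the Gaussian averages converge under domination.\<close>

lemma
  fixes f :: "'a::euclidean_space \<Rightarrow> complex"
  assumes f: "nice f"
  shows nice_fourier_L2: "fourier f \<in> L2_space lebesgue"
    and nice_plancherel: "(\<integral>\<xi>. (norm (fourier f \<xi>))\<^sup>2 \<partial>lebesgue) = (2 * pi) ^ DIM('a) * (\<integral>x. (norm (f x))\<^sup>2 \<partial>lebesgue)"
proof -
  obtain C where C: "\<And>x. norm (f x) \<le> C" using f by (auto simp: nice_def)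
  have C0: "0 \<le> C" using C[of 0] norm_ge_zero order_trans by blast
  note [measurable] = nice_measurable[OF f] nice_borel[OF f]
  have fi: "integrable lebesgue f" by (rule nice_integrable[OF f])
  note [measurable] = fourier_measurable[OF fi]
  define c where "c k = 1 / real (Suc k)" for k
  have c: "c k > 0" for k by (simp add: c_def)
  have clim: "c \<longlonglongrightarrow> 0" unfolding c_def by (rule LIMSEQ_Suc[OF lim_1_over_n])
  define G where "G k \<xi> = exp (- ((c k)\<^sup>2 / 4) * (norm \<xi>)\<^sup>2)" for k and \<xi> :: 'a
  have Gi: "integrable lebesgue (G k)" for k unfolding G_def using c[of k] by (intro gaussian_integrable) simp
  have [measurable]: "G k \<in> borel_measurable lebesgue" for k using Gi by simp
  have fb: "norm (fourier f \<xi>) \<le> (\<integral>x. norm (f x) \<partial>lebesgue)" for \<xi> by (rule norm_fourier_le[OF fi])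
  have i1: "integrable lebesgue (\<lambda>\<xi>. cnj (fourier f \<xi>) * of_real (G k \<xi>))" for k
  proof (rule Bochner_Integration.integrable_bound)
    show "integrable lebesgue (\<lambda>\<xi>. (\<integral>x. norm (f x) \<partial>lebesgue) * G k \<xi>)" using Gi by simp
    show "AE \<xi> in lebesgue. norm (cnj (fourier f \<xi>) * of_real (G k \<xi>)) \<le> norm ((\<integral>x. norm (f x) \<partial>lebesgue) * G k \<xi>)"
      using fb by (auto simp: norm_mult abs_mult intro!: AE_I2 mult_right_mono)
  qed measurable
  have i2: "integrable lebesgue (\<lambda>\<xi>. (norm (fourier f \<xi>))\<^sup>2 * G k \<xi>)" for k
  proof (rule Bochner_Integration.integrable_bound)
    show "integrable lebesgue (\<lambda>\<xi>. (\<integral>x. norm (f x) \<partial>lebesgue)\<^sup>2 * G k \<xi>)" using Gi by simp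
    show "AE \<xi> in lebesgue. norm ((norm (fourier f \<xi>))\<^sup>2 * G k \<xi>) \<le> norm ((\<integral>x. norm (f x) \<partial>lebesgue)\<^sup>2 * G k \<xi>)"
      using fb by (auto simp: norm_mult abs_mult power_mono intro!: AE_I2 mult_right_mono)
  qed measurable
  define I where "I k x = (\<integral>w. cnj (f (x + c k *\<^sub>R w)) * of_real (exp (- (norm w)\<^sup>2)) \<partial>lebesgue)" for k x
  have gi: "integrable lebesgue (\<lambda>w::'a. exp (- (norm w)\<^sup>2))" using gaussian_integrable[of 1] by simp
  have gint: "(\<integral>w. exp (- (norm (w::'a))\<^sup>2) \<partial>lebesgue) = sqrt pi ^ DIM('a)" using gaussian_integral[of 1] by simp
  have mm: "(\<lambda>w. cnj (f (x + r *\<^sub>R w)) * of_real (exp (- (norm w)\<^sup>2))) \<in> borel_measurable lebesgue" for x r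
  proof -
    have "(\<lambda>w. f (x + r *\<^sub>R w)) \<in> borel_measurable borel" by measurable
    then have [measurable]: "(\<lambda>w. f (x + r *\<^sub>R w)) \<in> borel_measurable lebesgue" by (intro measurable_completion) simp
    show ?thesis by measurable
  qed
  have Ilim: "(\<lambda>k. I k x) \<longlonglongrightarrow> cnj (f x) * of_real (sqrt pi ^ DIM('a))" for x
  proof -
    have "(\<lambda>k. I k x) \<longlonglongrightarrow> (\<integral>w. cnj (f (x + 0 *\<^sub>R w)) * of_real (exp (- (norm w)\<^sup>2)) \<partial>lebesgue)"
      unfolding I_def
    proof (rule integral_dominated_convergence[where w="\<lambda>w. C * exp (- (norm w)\<^sup>2)", OF mm mm])
      show "integrable lebesgue (\<lambda>w::'a. C * exp (- (norm w)\<^sup>2))" using gi by simp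
      have "continuous (at y) f" for y using f by (simp add: nice_def continuous_on_eq_continuous_at)
      then have "(\<lambda>k. f (x + c k *\<^sub>R w)) \<longlonglongrightarrow> f (x + 0 *\<^sub>R w)" for w
        by (intro isCont_tendsto_compose[of _ f] tendsto_intros clim)
      then show "AE w in lebesgue. (\<lambda>k. cnj (f (x + c k *\<^sub>R w)) * of_real (exp (- (norm w)\<^sup>2)))
          \<longlonglongrightarrow> cnj (f (x + 0 *\<^sub>R w)) * of_real (exp (- (norm w)\<^sup>2))"
        by (intro AE_I2 tendsto_intros)
      show "\<And>k. AE w in lebesgue. norm (cnj (f (x + c k *\<^sub>R w)) * of_real (exp (- (norm w)\<^sup>2))) \<le> C * exp (- (norm w)\<^sup>2)"
        using C by (auto simp: norm_mult intro!: AE_I2 mult_right_mono)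
    qed
    also have "(\<integral>w. cnj (f (x + 0 *\<^sub>R w)) * of_real (exp (- (norm w)\<^sup>2)) \<partial>lebesgue) = cnj (f x) * of_real (sqrt pi ^ DIM('a))"
      using gint integral_complex_of_real[of lebesgue "\<lambda>w::'a. exp (- (norm w)\<^sup>2)"] by simp
    finally show ?thesis .
  qed
  have Ib: "norm (I k x) \<le> C * sqrt pi ^ DIM('a)" for k x
  proof -
    have "norm (I k x) \<le> (\<integral>w. norm (cnj (f (x + c k *\<^sub>R w)) * of_real (exp (- (norm w)\<^sup>2))) \<partial>lebesgue)"
      unfolding I_def by (rule integral_norm_bound)
    also have "\<dots> \<le> (\<integral>w. C * exp (- (norm (w::'a))\<^sup>2) \<partial>lebesgue)"
      by (rule integral_mono') (use C gi C0 in \<open>auto simp: norm_mult intro!: mult_right_mono\<close>)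
    also have "\<dots> = C * sqrt pi ^ DIM('a)" using gint by simp
    finally show ?thesis .
  qed
  have Im: "I k \<in> borel_measurable lebesgue" for k
  proof -
    \<comment> \<open>Measurability of the averages is inherited from the Fourier transform that
      they come from.\<close>
    have eq: "I k x = fourier (\<lambda>\<xi>. cnj (fourier f \<xi>) * of_real (G k \<xi>)) x / of_real ((2 * sqrt pi) ^ DIM('a))" for x
      unfolding I_def G_def fourier_gaussian_damped[OF f c] by simp
    note [measurable] = fourier_measurable[OF i1]
    show ?thesis unfolding eq[abs_def] by measurable
  qed
  define A where "A k = (\<integral>\<xi>. (norm (fourier f \<xi>))\<^sup>2 * G k \<xi> \<partial>lebesgue)" for k
  have A: "complex_of_real (A k) = of_real ((2 * sqrt pi) ^ DIM('a)) * (\<integral>x. f x * I k x \<partial>lebesgue)" for k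
  proof -
    have "complex_of_real (A k) = (\<integral>\<xi>. fourier f \<xi> * (cnj (fourier f \<xi>) * of_real (G k \<xi>)) \<partial>lebesgue)"
      unfolding A_def integral_complex_of_real[symmetric]
      by (simp add: complex_norm_square mult.assoc flip: of_real_power)
    also have "\<dots> = (\<integral>x. f x * fourier (\<lambda>\<xi>. cnj (fourier f \<xi>) * of_real (G k \<xi>)) x \<partial>lebesgue)"
      by (rule fourier_multiplication_formula[OF fi i1])
    also have "\<dots> = (\<integral>x. of_real ((2 * sqrt pi) ^ DIM('a)) * (f x * I k x) \<partial>lebesgue)"
      unfolding G_def fourier_gaussian_damped[OF f c] I_def by (simp add: mult_ac)
    finally show ?thesis by simp
  qed
  have "(\<lambda>k. \<integral>x. f x * I k x \<partial>lebesgue) \<longlonglongrightarrow> (\<integral>x. f x * (cnj (f x) * of_real (sqrt pi ^ DIM('a))) \<partial>lebesgue)"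
  proof (rule integral_dominated_convergence[where w="\<lambda>x. norm (f x) * (C * sqrt pi ^ DIM('a))"])
    show "integrable lebesgue (\<lambda>x. norm (f x) * (C * sqrt pi ^ DIM('a)))" using fi by simp
    show "AE x in lebesgue. (\<lambda>k. f x * I k x) \<longlonglongrightarrow> f x * (cnj (f x) * of_real (sqrt pi ^ DIM('a)))"
      by (intro AE_I2 tendsto_intros Ilim)
    show "\<And>k. AE x in lebesgue. norm (f x * I k x) \<le> norm (f x) * (C * sqrt pi ^ DIM('a))"
      using Ib by (auto simp: norm_mult intro!: AE_I2 mult_left_mono)
  qed (use Im in measurable)
  then have "(\<lambda>k. complex_of_real (A k)) \<longlonglongrightarrow> of_real ((2 * sqrt pi) ^ DIM('a)) * (\<integral>x. f x * (cnj (f x) * of_real (sqrt pi ^ DIM('a))) \<partial>lebesgue)"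
    unfolding A by (intro tendsto_intros)
  also have "(\<integral>x. f x * (cnj (f x) * of_real (sqrt pi ^ DIM('a))) \<partial>lebesgue)
      = of_real (sqrt pi ^ DIM('a) * (\<integral>x. (norm (f x))\<^sup>2 \<partial>lebesgue))"
  proof -
    have "f x * (cnj (f x) * of_real (sqrt pi ^ DIM('a))) = of_real (sqrt pi ^ DIM('a) * (norm (f x))\<^sup>2)" for x
      by (simp only: of_real_mult complex_norm_square of_real_power[symmetric]) (simp add: mult_ac)
    then show ?thesis by (simp only: integral_complex_of_real integral_mult_right_zero)
  qed
  \<comment> \<open>One factor stems from the damping formula, the other is the mass of the Gaussian
    weight; together they make (2 pi)^n.\<close>
  also have "complex_of_real ((2 * sqrt pi) ^ DIM('a)) * of_real (sqrt pi ^ DIM('a) * (\<integral>x. (norm (f x))\<^sup>2 \<partial>lebesgue))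
      = of_real ((2 * pi) ^ DIM('a) * (\<integral>x. (norm (f x))\<^sup>2 \<partial>lebesgue))"
  proof -
    have "(2 * sqrt pi) ^ DIM('a) * sqrt pi ^ DIM('a) = (2 * pi) ^ DIM('a)"
      unfolding power_mult_distrib[symmetric] by (simp only: mult.assoc real_sqrt_mult_self abs_of_nonneg pi_ge_zero)
    then show ?thesis by (simp only: of_real_mult[symmetric] mult.assoc[symmetric])
  qed
  finally have Alim: "A \<longlonglongrightarrow> (2 * pi) ^ DIM('a) * (\<integral>x. (norm (f x))\<^sup>2 \<partial>lebesgue)"
    by (simp only: tendsto_of_real_iff)
  have mono: "AE \<xi> in lebesgue. mono (\<lambda>k. (norm (fourier f \<xi>))\<^sup>2 * G k \<xi>)"
  proof (rule AE_I2, rule monoI)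
    fix \<xi> :: 'a and j k :: nat assume jk: "j \<le> k"
    have "c k \<le> c j" using jk by (simp add: c_def frac_le)
    then have "(c k)\<^sup>2 \<le> (c j)\<^sup>2" using c[of k] by (intro power_mono) auto
    then have "G j \<xi> \<le> G k \<xi>" unfolding G_def by (simp add: mult_right_mono divide_right_mono)
    then show "(norm (fourier f \<xi>))\<^sup>2 * G j \<xi> \<le> (norm (fourier f \<xi>))\<^sup>2 * G k \<xi>" by (intro mult_left_mono) auto
  qed
  have lim: "AE \<xi> in lebesgue. (\<lambda>k. (norm (fourier f \<xi>))\<^sup>2 * G k \<xi>) \<longlonglongrightarrow> (norm (fourier f \<xi>))\<^sup>2"
  proof (rule AE_I2)
    fix \<xi> :: 'a
    have "(\<lambda>k. (norm (fourier f \<xi>))\<^sup>2 * G k \<xi>) \<longlonglongrightarrow> (norm (fourier f \<xi>))\<^sup>2 * exp (- (0\<^sup>2 / 4) * (norm \<xi>)\<^sup>2)"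
      unfolding G_def by (intro tendsto_intros clim) simp
    then show "(\<lambda>k. (norm (fourier f \<xi>))\<^sup>2 * G k \<xi>) \<longlonglongrightarrow> (norm (fourier f \<xi>))\<^sup>2" by simp
  qed
  have m: "(\<lambda>\<xi>. (norm (fourier f \<xi>))\<^sup>2) \<in> borel_measurable lebesgue" by measurable
  show "fourier f \<in> L2_space lebesgue"
    using integrable_monotone_convergence[OF i2 mono lim Alim[unfolded A_def[abs_def]] m]
    by (intro L2_spaceI) measurable
  show "(\<integral>\<xi>. (norm (fourier f \<xi>))\<^sup>2 \<partial>lebesgue) = (2 * pi) ^ DIM('a) * (\<integral>x. (norm (f x))\<^sup>2 \<partial>lebesgue)"
    by (rule integral_monotone_convergence[OF i2 mono lim Alim[unfolded A_def[abs_def]] m])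
qed

instance l2 :: (euclidean_space) banach ..

text \<open>\<open>T\<close> is linear on \<open>D\<close> only, as happens when it is defined
  through chosen representatives; its values elsewhere are discarded.\<close>

lemma bounded_linear_extension:
  fixes T :: "'v::real_normed_vector \<Rightarrow> 'w::banach"
  assumes D: "subspace D" "closure D = UNIV"
    and add: "\<And>x y. x \<in> D \<Longrightarrow> y \<in> D \<Longrightarrow> T (x + y) = T x + T y"
    and scale: "\<And>r x. x \<in> D \<Longrightarrow> T (r *\<^sub>R x) = r *\<^sub>R T x"
    and bound: "\<And>x. x \<in> D \<Longrightarrow> norm (T x) \<le> norm x * C"
  shows "\<exists>S. bounded_linear S \<and> (\<forall>x\<in>D. S x = T x)"
proof -
  define B where "B = \<bar>C\<bar> + 1"
  have B: "B > 0" "C \<le> B" unfolding B_def by auto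
  have bound: "norm (T x) \<le> norm x * B" if "x \<in> D" for x
    by (rule order_trans[OF bound[OF that]]) (use B in \<open>simp add: mult_left_mono\<close>)
  have diff: "T (x - y) = T x - T y" if "x \<in> D" "y \<in> D" for x y
    using add[OF that(1) subspace_scale[OF D(1) that(2), of "-1"]] scale[OF that(2), of "-1"] by simp
  have "uniformly_continuous_on D T" unfolding uniformly_continuous_on_def
  proof (intro allI impI)
    fix e :: real assume "e > 0"
    show "\<exists>d>0. \<forall>x\<in>D. \<forall>x'\<in>D. dist x' x < d \<longrightarrow> dist (T x') (T x) < e"
    proof (intro exI[of _ "e / B"] conjI ballI impI)
      show "e / B > 0" using \<open>e > 0\<close> B by simp
      fix x x' assume x: "x \<in> D" "x' \<in> D" "dist x' x < e / B"
      have "dist (T x') (T x) = norm (T (x' - x))" using x by (simp add: dist_norm diff)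
      also have "\<dots> \<le> norm (x' - x) * B" using D(1) x by (intro bound subspace_diff)
      also have "\<dots> < e" using x(3) B by (simp add: dist_norm field_simps)
      finally show "dist (T x') (T x) < e" .
    qed
  qed
  then obtain S where S: "uniformly_continuous_on (closure D) S" "\<And>x. x \<in> D \<Longrightarrow> T x = S x"
    by (rule uniformly_continuous_on_extension_on_closure) blast
  have cont: "continuous_on UNIV S" using uniformly_continuous_imp_continuous[OF S(1)] D(2) by simp
  have seq: "\<exists>f. (\<forall>n. f n \<in> D) \<and> f \<longlonglongrightarrow> x" for x using D(2) closure_sequential[of x D] by auto
  have lim: "(\<lambda>n. S (f n)) \<longlonglongrightarrow> S x" if "f \<longlonglongrightarrow> x" for f x
    using continuous_on_tendsto_compose[OF cont that] by simp
  have "bounded_linear S"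
  proof (rule bounded_linear_intro[of _ B])
    fix x y :: 'v and r :: real
    obtain f where f: "\<And>n. f n \<in> D" "f \<longlonglongrightarrow> x" using seq[of x] by blast
    obtain g where g: "\<And>n. g n \<in> D" "g \<longlonglongrightarrow> y" using seq[of y] by blast
    have "(\<lambda>n. S (f n + g n)) \<longlonglongrightarrow> S (x + y)" by (intro lim tendsto_add f g)
    moreover have "S (f n + g n) = S (f n) + S (g n)" for n
      using add[OF f(1) g(1), of n n] S(2)[OF f(1)] S(2)[OF g(1)] S(2)[OF subspace_add[OF D(1) f(1) g(1)]] by simp
    ultimately have "(\<lambda>n. S (f n) + S (g n)) \<longlonglongrightarrow> S (x + y)" by simp
    moreover have "(\<lambda>n. S (f n) + S (g n)) \<longlonglongrightarrow> S x + S y" by (intro tendsto_add lim f g)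
    ultimately show "S (x + y) = S x + S y" by (rule LIMSEQ_unique)
    have "(\<lambda>n. S (r *\<^sub>R f n)) \<longlonglongrightarrow> S (r *\<^sub>R x)" by (intro lim tendsto_intros f)
    moreover have "S (r *\<^sub>R f n) = r *\<^sub>R S (f n)" for n
      using scale[OF f(1), of r n] S(2)[OF f(1)] S(2)[OF subspace_scale[OF D(1) f(1)]] by simp
    ultimately have "(\<lambda>n. r *\<^sub>R S (f n)) \<longlonglongrightarrow> S (r *\<^sub>R x)" by simp
    moreover have "(\<lambda>n. r *\<^sub>R S (f n)) \<longlonglongrightarrow> r *\<^sub>R S x" by (intro tendsto_intros lim f)
    ultimately show "S (r *\<^sub>R x) = r *\<^sub>R S x" by (rule LIMSEQ_unique)
    show "norm (S x) \<le> norm x * B"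
    proof (rule LIMSEQ_le)
      show "(\<lambda>n. norm (S (f n))) \<longlonglongrightarrow> norm (S x)" "(\<lambda>n. norm (f n) * B) \<longlonglongrightarrow> norm x * B"
        by (intro tendsto_intros lim f)+
      show "\<exists>N. \<forall>n\<ge>N. norm (S (f n)) \<le> norm (f n) * B" using bound[OF f(1)] S(2)[OF f(1)] by auto
    qed
  qed
  then show ?thesis using S(2) by auto
qed

lemma nice_compact_support:
  assumes "continuous_on UNIV f" "compact K" "\<And>x. x \<notin> K \<Longrightarrow> f x = 0"
  shows "nice f"
  unfolding nice_def
proof (intro conjI)
  have "bounded (f ` K)" using assms by (intro compact_imp_bounded compact_continuous_image) (auto intro: continuous_on_subset)
  then obtain C where C: "\<And>x. x \<in> K \<Longrightarrow> norm (f x) \<le> C" by (auto simp: bounded_iff)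
  show "\<exists>C. \<forall>x. norm (f x) \<le> C"
  proof (intro exI allI)
    show "norm (f x) \<le> max C 0" for x using C[of x] assms(3)[of x] by (cases "x \<in> K") auto
  qed
  have "integrable lborel (\<lambda>x. indicator K x *\<^sub>R f x)"
    using assms by (intro borel_integrable_compact) (auto intro: continuous_on_subset)
  moreover have "(\<lambda>x. indicator K x *\<^sub>R f x) = f" using assms(3) by (auto simp: indicator_def)
  ultimately have "integrable lborel f" by simp
  then show "integrable lebesgue f"
    using assms(1) by (subst integrable_completion) (auto intro: borel_measurable_continuous_onI)
qed fact

lemma test_functionsD:
  assumes "\<phi> \<in> test_functions V"
  shows "smooth \<phi>" "compact (closure {x. \<phi> x \<noteq> 0})" "closure {x. \<phi> x \<noteq> 0} \<subseteq> V"
    "\<And>x. x \<notin> closure {x. \<phi> x \<noteq> 0} \<Longrightarrow> \<phi> x = 0" "\<And>x. x \<notin> V \<Longrightarrow> \<phi> x = 0"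
proof -
  show 3: "smooth \<phi>" "compact (closure {x. \<phi> x \<noteq> 0})" "closure {x. \<phi> x \<noteq> 0} \<subseteq> V"
    using assms unfolding test_functions_def mem_Collect_eq by - (elim conjE, assumption)+
  show 4: "\<phi> x = 0" if "x \<notin> closure {x. \<phi> x \<noteq> 0}" for x
    using that closure_subset[of "{x. \<phi> x \<noteq> 0}"] by (metis (mono_tags) mem_Collect_eq subsetD)
  show "\<phi> x = 0" if "x \<notin> V" for x using 4[of x] 3(3) that by (metis subsetD)
qed

lemma nice_test_function_mult:
  assumes "\<phi> \<in> test_functions V"
  shows "nice (\<lambda>x. c * complex_of_real (\<phi> x))"
proof (rule nice_compact_support[OF _ test_functionsD(2)[OF assms]])
  show "continuous_on UNIV (\<lambda>x. c * complex_of_real (\<phi> x))"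
    using smooth_continuous[OF test_functionsD(1)[OF assms]] by (intro continuous_intros)
  show "c * complex_of_real (\<phi> x) = 0" if "x \<notin> closure {x. \<phi> x \<noteq> 0}" for x
    unfolding test_functionsD(4)[OF assms that] by simp
qed

lemma nice_test_function: "\<phi> \<in> test_functions V \<Longrightarrow> nice (\<lambda>x. complex_of_real (\<phi> x))"
  using nice_test_function_mult[of \<phi> V 1] by simp

lemma L2_indicator:
  assumes "bounded A" "A \<in> sets lebesgue"
  shows "(indicator A :: 'a::euclidean_space \<Rightarrow> real) \<in> L2_space lebesgue"
proof (rule L2_spaceI)
  have "emeasure lebesgue A < \<infinity>"
    using bounded_set_imp_lmeasurable[OF assms] unfolding fmeasurable_def by blast
  then have "integrable lebesgue (indicator A :: 'a \<Rightarrow> real)" using assms by (intro integrable_real_indicator)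
  moreover have "(norm (indicator A x :: real))\<^sup>2 = indicator A x" for x :: 'a by (simp add: indicator_def)
  ultimately show "integrable lebesgue (\<lambda>x. (norm (indicator A x :: real))\<^sup>2)" by simp
qed (use assms in auto)

lemma L2_integrable_bounded:
  fixes g :: "'a::euclidean_space \<Rightarrow> complex"
  assumes g: "g \<in> L2_space lebesgue" and A: "bounded A" "A \<in> sets lebesgue"
  shows "integrable lebesgue (\<lambda>x. indicator A x *\<^sub>R g x)"
  by (rule L2_space_integrable_bilinear[OF L2_indicator[OF A] g])
     (use g A in \<open>auto simp: L2_space_def intro!: borel_measurable_scaleR borel_measurable_indicator\<close>)

lemma l2_AE_zero_if_test:
  fixes g :: "'a::euclidean_space \<Rightarrow> complex"
  assumes V: "open V" and g: "g \<in> L2_space lebesgue"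
    and t: "\<And>\<phi>. \<phi> \<in> test_functions V \<Longrightarrow> (\<integral>x. g x * of_real (\<phi> x) \<partial>lebesgue) = 0"
  shows "AE x in lebesgue. x \<in> V \<longrightarrow> g x = 0"
proof (rule AE_zero_if_test_integrals_zero[OF V _ t])
  show "integrable lebesgue (\<lambda>x. indicator (cbox a b) x *\<^sub>R g x)" for a b
    by (rule L2_integrable_bounded[OF g]) auto
qed

section \<open>The Fourier transform on classes of square integrable functions\<close>

definition nice_classes :: "'a::euclidean_space l2 set" where
  "nice_classes = {cl f | f. nice f}"

lemma subspace_nice_classes: "subspace nice_classes"
  unfolding subspace_def
proof (intro conjI ballI allI)
  have "nice (\<lambda>x::'a. 0 :: complex)" by (auto simp: nice_def)
  then show "0 \<in> (nice_classes :: 'a l2 set)" using cl_zero by (force simp: nice_classes_def)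
next
  fix v w :: "'a l2" assume "v \<in> nice_classes" "w \<in> nice_classes"
  then obtain f g where "v = cl f" "w = cl g" "nice f" "nice g" by (auto simp: nice_classes_def)
  moreover from this have "v + w = cl (\<lambda>x. f x + g x)" by (simp add: cl_add nice_L2)
  ultimately show "v + w \<in> nice_classes" using nice_add[of f g] unfolding nice_classes_def by blast
next
  fix r and v :: "'a l2" assume "v \<in> nice_classes"
  then obtain f where "v = cl f" "nice f" by (auto simp: nice_classes_def)
  moreover from this have "r *\<^sub>R v = cl (\<lambda>x. r *\<^sub>R f x)" by (simp add: cl_scaleR nice_L2)
  ultimately show "r *\<^sub>R v \<in> nice_classes" using nice_scaleR[of f r] unfolding nice_classes_def by blast
qed

lemma closure_nice_classes: "closure nice_classes = (UNIV :: 'a::euclidean_space l2 set)"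
proof (rule closure_subspace_eq_if_orthogonal[OF subspace_nice_classes])
  fix v :: "'a l2" assume orth: "\<And>w. w \<in> nice_classes \<Longrightarrow> inner v w = 0"
  obtain g where g: "g \<in> L2_space lebesgue" "v = cl g" by (rule l2_cases)
  have "(\<integral>x. g x * of_real (\<phi> x) \<partial>lebesgue) = 0" if \<phi>: "\<phi> \<in> test_functions UNIV" for \<phi>
  proof -
    have L: "(\<lambda>x. c * complex_of_real (\<phi> x)) \<in> L2_space lebesgue" for c
      by (rule nice_L2[OF nice_test_function_mult[OF \<phi>]])
    \<comment> \<open>The inner product is real, so the multiples of a real test function by 1 and
      by \<open>\<i>\<close> are both needed to reach real and imaginary part.\<close>
    have z: "(\<integral>x. inner (g x) (c * of_real (\<phi> x)) \<partial>lebesgue) = 0" for c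
      using orth[of "cl (\<lambda>x. c * of_real (\<phi> x))"] nice_test_function_mult[OF \<phi>, of c]
      unfolding g(2) inner_cl[OF g(1) L] by (auto simp: nice_classes_def)
    have i: "integrable lebesgue (\<lambda>x. g x * of_real (\<phi> x))"
      using L2_space_integrable_mult[OF g(1) L[of 1]] by simp
    show ?thesis
    proof (rule complex_eqI)
      show "Re (\<integral>x. g x * of_real (\<phi> x) \<partial>lebesgue) = Re 0"
        using z[of 1] integral_Re[OF i] by (simp add: inner_complex_def)
      show "Im (\<integral>x. g x * of_real (\<phi> x) \<partial>lebesgue) = Im 0"
        using z[of \<i>] integral_Im[OF i] by (simp add: inner_complex_def)
    qed
  qed
  then have "AE x in lebesgue. g x = 0" using l2_AE_zero_if_test[OF open_UNIV g(1)] by simp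
  then show "v = 0" unfolding g(2) cl_zero[symmetric] using g(1) by (subst cl_eq_iff) (auto simp: L2_space_zero)
qed auto

text \<open>The choice is determined, since a bounded map is fixed by its values on the dense set of
  nice functions.\<close>

definition fourier_l2 :: "'a::euclidean_space l2 \<Rightarrow> 'a l2" where
  "fourier_l2 = (SOME F. bounded_linear F \<and> (\<forall>f. nice f \<longrightarrow> F (cl f) = cl (fourier f)))"

lemma fourier_l2_aux:
  "bounded_linear (fourier_l2 :: 'a::euclidean_space l2 \<Rightarrow> 'a l2) \<and> (\<forall>f::'a \<Rightarrow> complex. nice f \<longrightarrow> fourier_l2 (cl f) = cl (fourier f))"
proof -
  define T :: "'a l2 \<Rightarrow> 'a l2" where "T v = cl (fourier (rp v))" for v
  have T: "T (cl f) = cl (fourier f)" if "nice f" for f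
  proof -
    have "fourier (rp (cl f)) = fourier f"
      by (rule fourier_cong_AE[OF rp_cl[OF nice_L2[OF that]] L2_space_measurable[OF rp_L2] nice_measurable[OF that]])
    then show ?thesis by (simp add: T_def)
  qed
  have "\<exists>F. bounded_linear F \<and> (\<forall>v\<in>nice_classes. F v = T v)"
  proof (rule bounded_linear_extension[OF subspace_nice_classes closure_nice_classes])
    fix v w :: "'a l2" and r assume v: "v \<in> nice_classes"
    then obtain f where f: "v = cl f" "nice f" by (auto simp: nice_classes_def)
    note fi = nice_integrable[OF f(2)]
    have "fourier (\<lambda>x. r *\<^sub>R f x) = (\<lambda>\<xi>. r *\<^sub>R fourier f \<xi>)"
      unfolding fourier_def by (simp flip: integral_scaleR_right)
    then show "T (r *\<^sub>R v) = r *\<^sub>R T v" unfolding f(1) cl_scaleR[OF nice_L2[OF f(2)], symmetric]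
      by (simp add: T f nice_scaleR cl_scaleR nice_fourier_L2)
    have "(norm (T v))\<^sup>2 = (2 * pi) ^ DIM('a) * (norm v)\<^sup>2"
      by (simp add: f T norm_cl_power2 nice_L2 nice_fourier_L2 nice_plancherel)
    then have "sqrt ((norm (T v))\<^sup>2) = sqrt ((2 * pi) ^ DIM('a) * (norm v)\<^sup>2)" by (rule arg_cong)
    then show "norm (T v) \<le> norm v * sqrt ((2 * pi) ^ DIM('a))"
      by (simp add: real_sqrt_mult del: real_sqrt_eq_iff)
    assume "w \<in> nice_classes"
    then obtain g where g: "w = cl g" "nice g" by (auto simp: nice_classes_def)
    note gi = nice_integrable[OF g(2)]
    have "fourier (\<lambda>x. f x + g x) = (\<lambda>\<xi>. fourier f \<xi> + fourier g \<xi>)"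
      unfolding fourier_def by (simp add: distrib_left integrable_cis_mult[OF fi] integrable_cis_mult[OF gi])
    then show "T (v + w) = T v + T w" unfolding f(1) g(1) cl_add[OF nice_L2[OF f(2)] nice_L2[OF g(2)], symmetric]
      by (simp add: T f g nice_add cl_add nice_fourier_L2)
  qed
  then have "\<exists>F. bounded_linear F \<and> (\<forall>f::'a \<Rightarrow> complex. nice f \<longrightarrow> F (cl f) = cl (fourier f))"
  proof (elim exE conjE)
    fix F :: "'a l2 \<Rightarrow> 'a l2" assume F: "bounded_linear F" "\<forall>v\<in>nice_classes. F v = T v"
    have "F (cl f) = cl (fourier f)" if "nice f" for f
      using bspec[OF F(2), of "cl f"] T[OF that] that by (auto simp: nice_classes_def)
    then show ?thesis using F(1) by blast
  qed
  then show ?thesis unfolding fourier_l2_def by (rule someI_ex)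
qed

lemma bounded_linear_fourier_l2: "bounded_linear fourier_l2"
  and fourier_l2_nice: "nice f \<Longrightarrow> fourier_l2 (cl f) = cl (fourier f)"
  by (rule conjunct1[OF fourier_l2_aux], rule conjunct2[OF fourier_l2_aux, rule_format])

lemmas fourier_l2_simps = linear_simps[OF bounded_linear_fourier_l2]
lemmas cnj_l2_simps = linear_simps[OF bounded_linear_cnj_l2]
lemmas refl_l2_simps = linear_simps[OF bounded_linear_refl_l2]
lemmas fourier_l2_continuous_on = bounded_linear.continuous_on[OF bounded_linear_fourier_l2]
lemmas cnj_l2_continuous_on = bounded_linear.continuous_on[OF bounded_linear_cnj_l2]
lemmas refl_l2_continuous_on = bounded_linear.continuous_on[OF bounded_linear_refl_l2]
lemmas pair_l2_continuous_on = bounded_bilinear.continuous_on[OF bounded_bilinear_pair_l2]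

text \<open>An identity between continuous maps has to be checked only on a dense set, where the
  transforms are absolutely convergent integrals.\<close>

lemma l2_nice_induct:
  fixes P :: "'a::euclidean_space l2 \<Rightarrow> bool"
  assumes "closed {v. P v}" "\<And>f. nice f \<Longrightarrow> P (cl f)"
  shows "P v"
proof -
  have "closure nice_classes \<subseteq> {v. P v}" by (rule closure_minimal) (use assms in \<open>auto simp: nice_classes_def\<close>)
  then show ?thesis by (auto simp: closure_nice_classes)
qed

lemma norm_fourier_l2: "(norm (fourier_l2 v))\<^sup>2 = (2 * pi) ^ DIM('a) * (norm (v :: 'a::euclidean_space l2))\<^sup>2"
proof (rule l2_nice_induct[where v=v])
  show "closed {v :: 'a l2. (norm (fourier_l2 v))\<^sup>2 = (2 * pi) ^ DIM('a) * (norm v)\<^sup>2}"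
    by (intro closed_Collect_eq continuous_intros fourier_l2_continuous_on)
qed (simp add: fourier_l2_nice norm_cl_power2 nice_L2 nice_fourier_L2 nice_plancherel)

lemma inner_fourier_l2: "inner (fourier_l2 v) (fourier_l2 w) = (2 * pi) ^ DIM('a) * inner v (w :: 'a::euclidean_space l2)"
  using norm_fourier_l2[of "v + w"] norm_fourier_l2[of v] norm_fourier_l2[of w]
  by (simp add: power2_norm_eq_inner fourier_l2_simps inner_add_left inner_add_right inner_commute algebra_simps)

lemma pair_fourier_l2: "pair_l2 (fourier_l2 v) w = pair_l2 v (fourier_l2 (w :: 'a::euclidean_space l2))"
proof (rule l2_nice_induct[where v=v])
  show "closed {v :: 'a l2. pair_l2 (fourier_l2 v) w = pair_l2 v (fourier_l2 w)}"
    by (intro closed_Collect_eq continuous_intros fourier_l2_continuous_on pair_l2_continuous_on)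
  fix f :: "'a \<Rightarrow> complex" assume f: "nice f"
  show "pair_l2 (fourier_l2 (cl f)) w = pair_l2 (cl f) (fourier_l2 w)"
  proof (rule l2_nice_induct[where v=w])
    show "closed {w :: 'a l2. pair_l2 (fourier_l2 (cl f)) w = pair_l2 (cl f) (fourier_l2 w)}"
      by (intro closed_Collect_eq continuous_intros fourier_l2_continuous_on pair_l2_continuous_on)
    show "pair_l2 (fourier_l2 (cl f)) (cl g) = pair_l2 (cl f) (fourier_l2 (cl g))" if "nice g" for g
      using f that by (simp add: fourier_l2_nice pair_l2_cl nice_L2 nice_fourier_L2
          fourier_multiplication_formula[OF nice_integrable nice_integrable])
  qed
qed

lemma fourier_cnj_l2: "fourier_l2 (cnj_l2 v) = cnj_l2 (refl_l2 (fourier_l2 (v :: 'a::euclidean_space l2)))"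
proof (rule l2_nice_induct[where v=v])
  show "closed {v :: 'a l2. fourier_l2 (cnj_l2 v) = cnj_l2 (refl_l2 (fourier_l2 v))}"
    by (intro closed_Collect_eq fourier_l2_continuous_on cnj_l2_continuous_on refl_l2_continuous_on continuous_on_id)
  show "fourier_l2 (cnj_l2 (cl f)) = cnj_l2 (refl_l2 (fourier_l2 (cl f)))" if "nice f" for f :: "'a \<Rightarrow> complex"
    using that by (simp add: cnj_l2_cl refl_l2_cl fourier_l2_nice nice_L2 nice_cnj nice_fourier_L2 L2_refl
        fourier_cnj[abs_def])
qed

lemma inner_fourier_adjoint: "inner (fourier_l2 v) w = inner v (refl_l2 (fourier_l2 w))"
proof -
  have "inner (fourier_l2 v) w = Re (pair_l2 (fourier_l2 v) (cnj_l2 w))" by (simp add: Re_pair_l2)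
  also have "\<dots> = inner v (cnj_l2 (fourier_l2 (cnj_l2 w)))" by (simp add: pair_fourier_l2 Re_pair_l2)
  also have "cnj_l2 (fourier_l2 (cnj_l2 w)) = refl_l2 (fourier_l2 w)" by (simp add: fourier_cnj_l2)
  finally show ?thesis .
qed

text \<open>Inversion without an inversion integral: by \<open>inner_fourier_adjoint\<close> the
  adjoint of the transform is reflection after the transform, and by Plancherel the adjoint composed
  with the transform is (2 pi)^n.\<close>

lemma refl_fourier_fourier_l2: "refl_l2 (fourier_l2 (fourier_l2 v)) = (2 * pi) ^ DIM('a) *\<^sub>R (v :: 'a::euclidean_space l2)"
proof -
  define d where "d = refl_l2 (fourier_l2 (fourier_l2 v)) - (2 * pi) ^ DIM('a) *\<^sub>R v"
  have "inner d d = 0"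
    using inner_fourier_adjoint[of d "fourier_l2 v"] inner_fourier_l2[of d v]
    by (subst (2) d_def) (simp add: inner_diff_right)
  then show ?thesis by (simp add: d_def)
qed

definition inv_fourier_l2 :: "'a::euclidean_space l2 \<Rightarrow> 'a l2" where
  "inv_fourier_l2 v = (1 / (2 * pi) ^ DIM('a)) *\<^sub>R refl_l2 (fourier_l2 v)"

lemma inv_fourier_fourier_l2 [simp]: "inv_fourier_l2 (fourier_l2 v) = v"
  by (simp add: inv_fourier_l2_def refl_fourier_fourier_l2)

lemma fourier_inv_fourier_l2 [simp]: "fourier_l2 (inv_fourier_l2 v) = v"
proof -
  have 1: "fourier_l2 (fourier_l2 w) = (2 * pi) ^ DIM('a) *\<^sub>R refl_l2 w" for w :: "'a l2"
    using arg_cong[OF refl_fourier_fourier_l2[of w], of refl_l2] by (simp add: refl_l2_simps)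
  have rf: "refl_l2 (fourier_l2 w) = fourier_l2 (refl_l2 w)" for w :: "'a l2"
  proof -
    have "(2 * pi) ^ DIM('a) *\<^sub>R fourier_l2 (refl_l2 w) = fourier_l2 (fourier_l2 (fourier_l2 w))"
      by (simp add: 1[of w] fourier_l2_simps)
    also have "\<dots> = (2 * pi) ^ DIM('a) *\<^sub>R refl_l2 (fourier_l2 w)" by (rule 1)
    finally show ?thesis by simp
  qed
  show ?thesis unfolding inv_fourier_l2_def rf by (simp add: fourier_l2_simps 1)
qed

lemma bounded_linear_inv_fourier_l2: "bounded_linear inv_fourier_l2"
  unfolding inv_fourier_l2_def[abs_def]
  by (intro bounded_linear_scaleR_right bounded_linear_compose[OF bounded_linear_scaleR_right]
      bounded_linear_compose[OF bounded_linear_refl_l2 bounded_linear_fourier_l2])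

text \<open>Identifies the transform with a function that is only known to be locally integrable,
  and yields its square integrability as well. It serves where the transform is given by an integral
  or by a choice instead of a limit.\<close>

lemma fourier_l2_eqI:
  fixes g :: "'a::euclidean_space \<Rightarrow> complex"
  assumes gm: "g \<in> borel_measurable lebesgue" and gi: "\<And>a b. integrable lebesgue (\<lambda>x. indicator (cbox a b) x *\<^sub>R g x)"
    and t: "\<And>\<phi>. \<phi> \<in> test_functions UNIV \<Longrightarrow> (\<integral>\<xi>. g \<xi> * of_real (\<phi> \<xi>) \<partial>lebesgue) = pair_l2 v (cl (fourier (\<lambda>x. of_real (\<phi> x))))"
  shows "g \<in> L2_space lebesgue \<and> fourier_l2 v = cl g"
proof -
  obtain h where h: "h \<in> L2_space lebesgue" "fourier_l2 v = cl h" by (rule l2_cases)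
  have "AE x in lebesgue. x \<in> UNIV \<longrightarrow> g x - h x = 0"
  proof (rule AE_zero_if_test_integrals_zero[OF open_UNIV])
    show "integrable lebesgue (\<lambda>x. indicator (cbox a b) x *\<^sub>R (g x - h x))" for a b
      using gi[of a b] L2_integrable_bounded[OF h(1) bounded_cbox, of a b] by (simp add: scaleR_diff_right)
    fix \<phi> :: "'a \<Rightarrow> real" assume \<phi>: "\<phi> \<in> test_functions UNIV"
    note n = nice_test_function[OF \<phi>]
    define K where "K = closure {x. \<phi> x \<noteq> 0}"
    \<comment> \<open>A test function lives on a box, where local integrability of \<open>g\<close>
      suffices.\<close>
    obtain a b where ab: "K \<subseteq> cbox a b"
      using test_functionsD(2)[OF \<phi>] bounded_subset_cbox_symmetric compact_imp_bounded unfolding K_def by metis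
    obtain C where C: "\<And>x. norm (complex_of_real (\<phi> x)) \<le> C" using n by (auto simp: nice_def)
    have "integrable lebesgue (\<lambda>\<xi>. g \<xi> * of_real (\<phi> \<xi>))"
    proof (rule Bochner_Integration.integrable_bound)
      show "integrable lebesgue (\<lambda>\<xi>. C * norm (indicator (cbox a b) \<xi> *\<^sub>R g \<xi>))"
        using gi[of a b] by (intro integrable_mult_right integrable_norm)
      show "AE \<xi> in lebesgue. norm (g \<xi> * of_real (\<phi> \<xi>)) \<le> norm (C * norm (indicator (cbox a b) \<xi> *\<^sub>R g \<xi>))"
      proof (rule AE_I2)
        fix \<xi>
        show "norm (g \<xi> * of_real (\<phi> \<xi>)) \<le> norm (C * norm (indicator (cbox a b) \<xi> *\<^sub>R g \<xi>))"
        proof (cases "\<xi> \<in> K")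
          case True
          have "0 \<le> C" using C[of \<xi>] norm_ge_zero order_trans by blast
          moreover have "norm (g \<xi>) * norm (complex_of_real (\<phi> \<xi>)) \<le> norm (g \<xi>) * C"
            by (intro mult_left_mono C norm_ge_zero)
          ultimately show ?thesis using True ab by (auto simp: norm_mult abs_mult mult.commute)
        next
          case False
          then have "\<phi> \<xi> = 0" unfolding K_def by (rule test_functionsD(4)[OF \<phi>])
          then show ?thesis by simp
        qed
      qed
    qed (use gm nice_measurable[OF n] in measurable)
    moreover have "integrable lebesgue (\<lambda>\<xi>. h \<xi> * of_real (\<phi> \<xi>))"
      by (rule L2_space_integrable_mult[OF h(1) nice_L2[OF n]])
    moreover have "(\<integral>\<xi>. h \<xi> * of_real (\<phi> \<xi>) \<partial>lebesgue) = pair_l2 v (cl (fourier (\<lambda>x. of_real (\<phi> x))))"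
      using pair_fourier_l2[of v "cl (\<lambda>x. of_real (\<phi> x))"] unfolding h(2) fourier_l2_nice[OF n] pair_l2_cl[OF h(1) nice_L2[OF n]] .
    ultimately show "(\<integral>x. (g x - h x) * of_real (\<phi> x) \<partial>lebesgue) = 0"
      using t[OF \<phi>] by (simp add: left_diff_distrib)
  qed
  then have ae: "AE x in lebesgue. h x = g x" by eventually_elim simp
  have g: "g \<in> L2_space lebesgue" by (rule L2_space_AE[OF h(1) gm ae])
  show ?thesis unfolding h(2) cl_eq_iff[OF h(1) g] using g ae by blast
qed

text \<open>Covers functions that are cut off sharply at the boundary of the domain and need not be
  continuous.\<close>

lemma fourier_l2_L1:
  fixes f :: "'a::euclidean_space \<Rightarrow> complex"
  assumes f: "f \<in> L2_space lebesgue" "integrable lebesgue f"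
  shows "fourier f \<in> L2_space lebesgue \<and> fourier_l2 (cl f) = cl (fourier f)"
proof (rule fourier_l2_eqI)
  show "fourier f \<in> borel_measurable lebesgue" by (rule fourier_measurable[OF f(2)])
  show "integrable lebesgue (\<lambda>x. indicator (cbox a b) x *\<^sub>R fourier f x)" for a b
  proof (rule Bochner_Integration.integrable_bound)
    show "integrable lebesgue (\<lambda>x. (\<integral>x. norm (f x) \<partial>lebesgue) * indicator (cbox a b) x)"
      using integrable_real_indicator[of "cbox a b" lebesgue] emeasure_compact_finite[OF compact_cbox, of a b]
      by (intro integrable_mult_right) (auto simp: less_top)
    show "AE x in lebesgue. norm (indicator (cbox a b) x *\<^sub>R fourier f x) \<le> norm ((\<integral>x. norm (f x) \<partial>lebesgue) * indicator (cbox a b) x)"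
      using norm_fourier_le[OF f(2)] by (auto simp: indicator_def intro!: AE_I2)
  qed (use fourier_measurable[OF f(2)] in \<open>auto intro!: borel_measurable_scaleR borel_measurable_indicator\<close>)
  fix \<phi> :: "'a \<Rightarrow> real" assume \<phi>: "\<phi> \<in> test_functions UNIV"
  note n = nice_test_function[OF \<phi>]
  show "(\<integral>\<xi>. fourier f \<xi> * of_real (\<phi> \<xi>) \<partial>lebesgue) = pair_l2 (cl f) (cl (fourier (\<lambda>x. of_real (\<phi> x))))"
    unfolding pair_l2_cl[OF f(1) nice_fourier_L2[OF n]]
    by (rule fourier_multiplication_formula[OF f(2) nice_integrable[OF n]])
qed

section \<open>Schwartz functions and test functions\<close>

lemma prod_1_plus_squares_le:
  fixes x :: "'a::euclidean_space"
  shows "(\<Prod>b\<in>Basis. 1 + (x \<bullet> b)\<^sup>2) \<le> 2 ^ DIM('a) * (1 + norm x ^ (2 * DIM('a)))"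
proof -
  have "(\<Prod>b\<in>Basis. 1 + (x \<bullet> b)\<^sup>2) \<le> (\<Prod>b\<in>(Basis::'a set). 1 + (norm x)\<^sup>2)"
    by (intro prod_mono) (auto intro!: power2_le_iff_abs_le[THEN iffD2] Basis_le_norm)
  also have "\<dots> = (1 + (norm x)\<^sup>2) ^ DIM('a)" by simp
  also have "\<dots> \<le> (2 * max 1 ((norm x)\<^sup>2)) ^ DIM('a)" by (intro power_mono) auto
  also have "\<dots> = 2 ^ DIM('a) * max 1 ((norm x)\<^sup>2) ^ DIM('a)" by (rule power_mult_distrib)
  also have "\<dots> \<le> 2 ^ DIM('a) * (1 + norm x ^ (2 * DIM('a)))"
    by (intro mult_left_mono) (auto simp: max_def power_mult)
  finally show ?thesis .
qed

lemma integrable_lborel_inverse_1_plus_square: "integrable lborel (\<lambda>x::real. inverse (1 + x\<^sup>2))"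
  using integrable_inverse_1_plus_square by (simp add: set_integrable_def)

lemma schwartz_bounded:
  assumes "\<phi> \<in> schwartz"
  shows "\<exists>C. \<forall>x. norm x ^ k * norm (\<phi> x) \<le> C"
proof -
  have "bounded (range (\<lambda>x. norm x ^ k *\<^sub>R \<phi> x))"
    using assms unfolding schwartz_def by (auto dest!: bspec[of _ _ "[]"])
  then show ?thesis by (auto simp: bounded_iff abs_mult)
qed

text \<open>A product of the one-dimensional functions 1/(1 + x^2) is an integrable majorant, which
  reduces integrability in n dimensions to one; decay of order 2n is enough to stay below
  it.\<close>

lemma schwartz_nice:
  fixes \<phi> :: "'a::euclidean_space \<Rightarrow> complex"
  assumes \<phi>: "\<phi> \<in> schwartz"
  shows "nice \<phi>"
proof -
  have cont: "continuous_on UNIV \<phi>" using \<phi> by (auto simp: schwartz_def smooth_continuous)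
  obtain C0 where C0: "\<And>x. norm (\<phi> x) \<le> C0" using schwartz_bounded[OF \<phi>, of 0] by auto
  obtain C1 where C1: "\<And>x. norm x ^ (2 * DIM('a)) * norm (\<phi> x) \<le> C1" using schwartz_bounded[OF \<phi>] by blast
  have "integrable lebesgue \<phi>"
  proof (rule Bochner_Integration.integrable_bound)
    show "integrable lebesgue (\<lambda>x::'a. (2 ^ DIM('a) * (C0 + C1)) * (\<Prod>b\<in>Basis. inverse (1 + (x \<bullet> b)\<^sup>2)))"
      by (intro integrable_mult_right integrable_prod_lebesgue integrable_lborel_inverse_1_plus_square)
    show "AE x in lebesgue. norm (\<phi> x) \<le> norm ((2 ^ DIM('a) * (C0 + C1)) * (\<Prod>b\<in>Basis. inverse (1 + (x \<bullet> b)\<^sup>2)))"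
    proof (rule AE_I2)
      fix x :: 'a
      let ?P = "\<Prod>b\<in>Basis. 1 + (x \<bullet> b)\<^sup>2"
      have pos: "1 + (x \<bullet> b)\<^sup>2 > 0" for b by (rule add_pos_nonneg) auto
      have P: "?P > 0" using pos by (intro prod_pos) blast
      have "norm (\<phi> x) * ?P \<le> norm (\<phi> x) * (2 ^ DIM('a) * (1 + norm x ^ (2 * DIM('a))))"
        by (intro mult_left_mono prod_1_plus_squares_le) auto
      also have "\<dots> = 2 ^ DIM('a) * (norm (\<phi> x) + norm x ^ (2 * DIM('a)) * norm (\<phi> x))" by (simp add: algebra_simps)
      also have "\<dots> \<le> 2 ^ DIM('a) * (C0 + C1)" by (intro mult_left_mono add_mono C0 C1) auto
      finally have "norm (\<phi> x) \<le> (2 ^ DIM('a) * (C0 + C1)) / ?P" using P by (simp add: pos_le_divide_eq)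
      also have "\<dots> = (2 ^ DIM('a) * (C0 + C1)) * (\<Prod>b\<in>Basis. inverse (1 + (x \<bullet> b)\<^sup>2))"
        by (simp add: divide_inverse prod_inversef[symmetric] comp_def)
      finally show "norm (\<phi> x) \<le> norm ((2 ^ DIM('a) * (C0 + C1)) * (\<Prod>b\<in>Basis. inverse (1 + (x \<bullet> b)\<^sup>2)))" by simp
    qed
    show "\<phi> \<in> borel_measurable lebesgue"
      using cont by (intro measurable_completion) (simp add: borel_measurable_continuous_onI)
  qed
  then show ?thesis using cont C0 by (auto simp: nice_def)
qed

lemma test_schwartz:
  assumes \<phi>: "\<phi> \<in> test_functions V"
  shows "(\<lambda>x. complex_of_real (\<phi> x)) \<in> schwartz"
  unfolding schwartz_def mem_Collect_eq
proof (intro conjI ballI allI)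
  note s = test_functionsD(1)[OF \<phi>]
  show sm: "smooth (\<lambda>x. complex_of_real (\<phi> x))"
    by (rule smooth_bounded_linear_compose[OF bounded_linear_of_real s])
  fix "is" :: "'a list" and k :: nat assume is_: "is \<in> lists Basis"
  define K where "K = closure {x. \<phi> x \<noteq> 0}"
  have "nice (\<lambda>x. norm x ^ k *\<^sub>R iterated_partial is (\<lambda>x. complex_of_real (\<phi> x)) x)"
  proof (rule nice_compact_support)
    show "compact K" unfolding K_def by (rule test_functionsD(2)[OF \<phi>])
    show "continuous_on UNIV (\<lambda>x. norm x ^ k *\<^sub>R iterated_partial is (\<lambda>x. complex_of_real (\<phi> x)) x)"
      by (intro continuous_intros smooth_continuous smooth_iterated_partial sm is_)
    fix x assume x: "x \<notin> K"
    have "iterated_partial is (\<lambda>x. complex_of_real (\<phi> x)) x = 0"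
    proof (rule iterated_partial_support[OF is_ _ _ x])
      show "closed K" by (simp add: K_def)
      show "complex_of_real (\<phi> x) = 0" if "x \<notin> K" for x
        using test_functionsD(4)[OF \<phi> that[unfolded K_def]] by simp
    qed
    then show "norm x ^ k *\<^sub>R iterated_partial is (\<lambda>x. complex_of_real (\<phi> x)) x = 0" by simp
  qed
  then show "bounded (range (\<lambda>x. norm x ^ k *\<^sub>R iterated_partial is (\<lambda>x. complex_of_real (\<phi> x)) x))"
    by (auto simp: nice_def bounded_iff)
qed

lemma test_functionsI:
  assumes "smooth \<phi>" "compact K" "K \<subseteq> V" and z: "\<And>x. x \<notin> K \<Longrightarrow> \<phi> x = 0"
  shows "\<phi> \<in> test_functions V"
proof -
  have sub: "closure {x. \<phi> x \<noteq> 0} \<subseteq> K"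
    by (rule closure_minimal) (use z assms(2) compact_imp_closed in blast)+
  have "bounded {x. \<phi> x \<noteq> 0}"
    by (rule bounded_subset[OF compact_imp_bounded[OF assms(2)] order_trans[OF closure_subset sub]])
  then have "compact (closure {x. \<phi> x \<noteq> 0})" by simp
  with assms(1) order_trans[OF sub assms(3)] show ?thesis unfolding test_functions_def by blast
qed

lemma test_functions_partial:
  assumes \<phi>: "\<phi> \<in> test_functions V" and b: "b \<in> Basis"
  shows "(\<lambda>x. frechet_derivative \<phi> (at x) b) \<in> test_functions V"
proof (rule test_functionsI[OF smooth_partial[OF test_functionsD(1)[OF \<phi>] b] test_functionsD(2,3)[OF \<phi>]])
  fix x assume x: "x \<notin> closure {x. \<phi> x \<noteq> 0}"
  show "frechet_derivative \<phi> (at x) b = 0"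
    using iterated_partial_support[of "[b]" _ \<phi>, OF _ closed_closure test_functionsD(4)[OF \<phi>] x] b by simp
qed

lemma subspace_test_functions:
  assumes "\<phi> \<in> test_functions V" "\<psi> \<in> test_functions V"
  shows "(\<lambda>x. \<phi> x + c * \<psi> x) \<in> test_functions V"
proof (rule test_functionsI)
  show "smooth (\<lambda>x. \<phi> x + c * \<psi> x)"
    by (intro smooth_add smooth_mult smooth_const test_functionsD(1)[OF assms(1)] test_functionsD(1)[OF assms(2)])
  show "compact (closure {x. \<phi> x \<noteq> 0} \<union> closure {x. \<psi> x \<noteq> 0})"
    by (rule compact_Un[OF test_functionsD(2)[OF assms(1)] test_functionsD(2)[OF assms(2)]])
  show "closure {x. \<phi> x \<noteq> 0} \<union> closure {x. \<psi> x \<noteq> 0} \<subseteq> V"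
    by (rule Un_least[OF test_functionsD(3)[OF assms(1)] test_functionsD(3)[OF assms(2)]])
  fix x assume "x \<notin> closure {x. \<phi> x \<noteq> 0} \<union> closure {x. \<psi> x \<noteq> 0}"
  then have x: "x \<notin> closure {x. \<phi> x \<noteq> 0}" "x \<notin> closure {x. \<psi> x \<noteq> 0}" by blast+
  show "\<phi> x + c * \<psi> x = 0"
    using test_functionsD(4)[OF assms(1) x(1)] test_functionsD(4)[OF assms(2) x(2)] by simp
qed

lemma test_functions_zero: "(\<lambda>x. 0) \<in> test_functions V"
  by (simp add: test_functions_def smooth_const)

text \<open>Difference quotients take the place of integration by parts: translation multiplies the
  transform by a phase, and the difference quotient of the phase tends to
  \<open>\<i> * of_real (\<xi> \<bullet> b)\<close>.\<close>

lemma fourier_partial: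
  fixes \<phi> :: "'a::euclidean_space \<Rightarrow> real"
  assumes \<phi>: "\<phi> \<in> test_functions V" and b: "b \<in> Basis"
  shows "fourier (\<lambda>x. of_real (frechet_derivative \<phi> (at x) b)) \<xi> = \<i> * of_real (\<xi> \<bullet> b) * fourier (\<lambda>x. of_real (\<phi> x)) \<xi>"
proof -
  let ?d = "\<lambda>x. frechet_derivative \<phi> (at x) b"
  note s = test_functionsD(1)[OF \<phi>]
  have nd: "nice (\<lambda>x. complex_of_real (?d x))" by (rule nice_test_function[OF test_functions_partial[OF \<phi> b]])
  have n: "nice (\<lambda>x. complex_of_real (\<phi> x))" by (rule nice_test_function[OF \<phi>])
  obtain M where M: "\<And>x. \<bar>?d x\<bar> \<le> M" using nd by (auto simp: nice_def)
  have M0: "0 \<le> M" using M[of 0] by linarith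
  define K where "K = closure {x. \<phi> x \<noteq> 0}"
  obtain R where R: "\<And>x. x \<in> K \<Longrightarrow> norm x \<le> R"
    using compact_imp_bounded[OF test_functionsD(2)[OF \<phi>]] unfolding K_def bounded_iff by blast
  have z: "\<phi> x = 0" if "norm x > R" for x
  proof -
    have "x \<notin> closure {x. \<phi> x \<noteq> 0}" using R[of x] that unfolding K_def by linarith
    then show ?thesis by (rule test_functionsD(4)[OF \<phi>])
  qed
  define h where "h k = 1 / real (Suc k)" for k
  have h: "0 < h k" "h k \<le> 1" for k by (auto simp: h_def)
  have hlim: "h \<longlonglongrightarrow> 0" unfolding h_def by (rule LIMSEQ_Suc[OF lim_1_over_n])
  define D where "D k x = (\<phi> (x + h k *\<^sub>R b) - \<phi> x) / h k" for k x
  have dv: "((\<lambda>t. \<phi> (x + t *\<^sub>R b)) has_real_derivative ?d (x + t *\<^sub>R b)) (at t)" for x t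
  proof -
    have "((\<lambda>t. x + t *\<^sub>R b) has_derivative (\<lambda>t. t *\<^sub>R b)) (at t)" by (auto intro!: derivative_eq_intros)
    from has_derivative_compose[OF this smooth_has_derivative[OF s]]
    have "((\<lambda>t. \<phi> (x + t *\<^sub>R b)) has_derivative (\<lambda>r. frechet_derivative \<phi> (at (x + t *\<^sub>R b)) (r *\<^sub>R b))) (at t)" .
    moreover have "frechet_derivative \<phi> (at (x + t *\<^sub>R b)) (r *\<^sub>R b) = ?d (x + t *\<^sub>R b) * r" for r
      using linear_scale[OF has_derivative_linear[OF smooth_has_derivative[OF s]]] by simp
    ultimately show ?thesis by (simp add: has_field_derivative_def)
  qed
  \<comment> \<open>The steps \<open>h k\<close> are at most 1, so outside the enlarged ball both
    values vanish; inside it the mean value theorem applies.\<close>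
  have Db: "\<bar>D k x\<bar> \<le> M * indicator (cball 0 (R + 1)) x" for k x
  proof (cases "norm x \<le> R + 1")
    case True
    obtain t where t: "\<phi> (x + h k *\<^sub>R b) - \<phi> (x + 0 *\<^sub>R b) = (h k - 0) * ?d (x + t *\<^sub>R b)"
      using MVT2[of 0 "h k" "\<lambda>t. \<phi> (x + t *\<^sub>R b)" "\<lambda>t. ?d (x + t *\<^sub>R b)"] h(1)[of k] dv by blast
    have "D k x = ?d (x + t *\<^sub>R b)" using t h(1)[of k] by (simp add: D_def)
    then show ?thesis using M[of "x + t *\<^sub>R b"] True by simp
  next
    case False
    have "norm x \<le> norm (x + h k *\<^sub>R b) + norm (h k *\<^sub>R b)" using norm_triangle_ineq4[of "x + h k *\<^sub>R b" "h k *\<^sub>R b"] by simp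
    then have "norm (x + h k *\<^sub>R b) > R" using False h[of k] b by simp
    then show ?thesis using z[of x] z[of "x + h k *\<^sub>R b"] False by (simp add: D_def)
  qed
  have m\<phi>: "(\<lambda>x. complex_of_real (\<phi> x)) \<in> borel_measurable lebesgue" by (rule nice_measurable[OF n])
  note [measurable] = m\<phi>
  have ms: "(\<lambda>x. complex_of_real (\<phi> (x + r *\<^sub>R b))) \<in> borel_measurable lebesgue" for r
  proof -
    have "(\<lambda>x. \<phi> (x + r *\<^sub>R b)) \<in> borel_measurable borel"
      by (intro borel_measurable_continuous_onI continuous_on_compose2[OF smooth_continuous[OF s, of UNIV]] continuous_intros) auto
    then have "(\<lambda>x. \<phi> (x + r *\<^sub>R b)) \<in> borel_measurable lebesgue" by (intro measurable_completion) simp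
    then show ?thesis by measurable
  qed
  note [measurable] = nice_measurable[OF nd]
  have mD: "(\<lambda>x. complex_of_real (D k x)) \<in> borel_measurable lebesgue" for k
    unfolding D_def using ms[of "h k"] m\<phi> by simp
  have l1: "(\<lambda>k. fourier (\<lambda>x. of_real (D k x)) \<xi>) \<longlonglongrightarrow> fourier (\<lambda>x. of_real (?d x)) \<xi>"
    unfolding fourier_def
  proof (rule integral_dominated_convergence[where w="\<lambda>x. M * indicator (cball 0 (R + 1)) x"])
    show "integrable lebesgue (\<lambda>x::'a. M * indicator (cball 0 (R + 1)) x)"
      using emeasure_compact_finite[OF compact_cball, of "0::'a" "R+1"]
      by (intro integrable_mult_right integrable_real_indicator) (auto simp: less_top)
    have "(\<lambda>k. D k x) \<longlonglongrightarrow> ?d x" for x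
    proof -
      have "((\<lambda>r. (\<phi> (x + (0 + r) *\<^sub>R b) - \<phi> (x + 0 *\<^sub>R b)) / r) \<longlongrightarrow> ?d (x + 0 *\<^sub>R b)) (at 0)"
        using dv[of x 0] unfolding has_field_derivative_def[symmetric] DERIV_def by simp
      moreover have "filterlim h (at 0) sequentially"
        using hlim h(1) by (auto simp: filterlim_at less_imp_neq[THEN not_sym])
      ultimately have "(\<lambda>k. (\<phi> (x + (0 + h k) *\<^sub>R b) - \<phi> (x + 0 *\<^sub>R b)) / h k) \<longlonglongrightarrow> ?d (x + 0 *\<^sub>R b)"
        by (rule filterlim_compose)
      then show ?thesis by (simp add: D_def)
    qed
    then show "AE x in lebesgue. (\<lambda>k. cis (- (x \<bullet> \<xi>)) * complex_of_real (D k x)) \<longlonglongrightarrow> cis (- (x \<bullet> \<xi>)) * of_real (?d x)"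
      by (intro AE_I2 tendsto_intros)
    show "\<And>k. AE x in lebesgue. norm (cis (- (x \<bullet> \<xi>)) * complex_of_real (D k x)) \<le> M * indicator (cball 0 (R + 1)) x"
      using Db by (intro AE_I2) (simp add: norm_mult)
  qed (use mD in measurable)
  have sh: "fourier (\<lambda>x. of_real (\<phi> (x + r *\<^sub>R b))) \<xi> = cis (r * (\<xi> \<bullet> b)) * fourier (\<lambda>x. of_real (\<phi> x)) \<xi>" for r
  proof -
    have "fourier (\<lambda>x. of_real (\<phi> x)) \<xi> = (\<integral>x. cis (- ((r *\<^sub>R b + 1 *\<^sub>R x) \<bullet> \<xi>)) * of_real (\<phi> (r *\<^sub>R b + 1 *\<^sub>R x)) \<partial>lebesgue)"
      unfolding fourier_def by (subst integral_affine_lebesgue[of 1 _ "r *\<^sub>R b"]) auto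
    also have "\<dots> = (\<integral>x. cis (- (r * (\<xi> \<bullet> b))) * (cis (- (x \<bullet> \<xi>)) * of_real (\<phi> (x + r *\<^sub>R b))) \<partial>lebesgue)"
    proof -
      have "cis (- ((r *\<^sub>R b + 1 *\<^sub>R x) \<bullet> \<xi>)) = cis (- (r * (\<xi> \<bullet> b))) * cis (- (x \<bullet> \<xi>))" for x
        unfolding cis_mult by (simp add: inner_add_left inner_commute[of b])
      then show ?thesis by (simp add: add.commute mult.assoc)
    qed
    also have "\<dots> = cis (- (r * (\<xi> \<bullet> b))) * fourier (\<lambda>x. of_real (\<phi> (x + r *\<^sub>R b))) \<xi>"
      unfolding fourier_def by simp
    finally show ?thesis by (simp add: mult.assoc[symmetric] cis_mult)
  qed
  have "fourier (\<lambda>x. of_real (D k x)) \<xi> = ((cis (h k * (\<xi> \<bullet> b)) - 1) / of_real (h k)) * fourier (\<lambda>x. of_real (\<phi> x)) \<xi>" for k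
  proof -
    have i1: "integrable lebesgue (\<lambda>x. complex_of_real (\<phi> x))" by (rule nice_integrable[OF n])
    have i2: "integrable lebesgue (\<lambda>x. complex_of_real (\<phi> (x + h k *\<^sub>R b)))"
      using integrable_affine_lebesgue[of 1 "\<lambda>x. complex_of_real (\<phi> x)" "h k *\<^sub>R b"] i1 m\<phi> by (simp add: add.commute)
    have "fourier (\<lambda>x. of_real (D k x)) \<xi> = (\<integral>x. (cis (- (x \<bullet> \<xi>)) * of_real (\<phi> (x + h k *\<^sub>R b)) - cis (- (x \<bullet> \<xi>)) * of_real (\<phi> x)) / of_real (h k) \<partial>lebesgue)"
      unfolding fourier_def D_def by (simp add: algebra_simps)
    also have "\<dots> = (fourier (\<lambda>x. of_real (\<phi> (x + h k *\<^sub>R b))) \<xi> - fourier (\<lambda>x. of_real (\<phi> x)) \<xi>) / of_real (h k)"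
      unfolding fourier_def using integrable_cis_mult[OF i1, of \<xi>] integrable_cis_mult[OF i2, of \<xi>] by simp
    finally show ?thesis unfolding sh by (simp add: algebra_simps)
  qed
  moreover have "(\<lambda>k. (cis (h k * (\<xi> \<bullet> b)) - 1) / of_real (h k)) \<longlonglongrightarrow> \<i> * of_real (\<xi> \<bullet> b)"
  proof -
    define \<theta> where "\<theta> = \<i> * complex_of_real (\<xi> \<bullet> b)"
    have "((\<lambda>z. exp (\<theta> * z)) has_field_derivative \<theta>) (at 0)"
      by (auto intro!: derivative_eq_intros)
    then have l: "((\<lambda>z. (exp (\<theta> * z) - 1) / z) \<longlongrightarrow> \<theta>) (at 0)" by (simp add: DERIV_def)
    have "filterlim (\<lambda>k. complex_of_real (h k)) (at 0) sequentially"
      using tendsto_of_real[OF hlim, where 'a=complex] h(1) by (auto simp: filterlim_at less_imp_neq[THEN not_sym])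
    from filterlim_compose[OF l this]
    have "(\<lambda>k. (exp (\<theta> * of_real (h k)) - 1) / of_real (h k)) \<longlonglongrightarrow> \<theta>" .
    moreover have "exp (\<theta> * of_real (h k)) = cis (h k * (\<xi> \<bullet> b))" for k
      by (simp add: \<theta>_def cis_conv_exp mult_ac)
    ultimately show ?thesis by (simp add: \<theta>_def)
  qed
  ultimately have "(\<lambda>k. fourier (\<lambda>x. of_real (D k x)) \<xi>) \<longlonglongrightarrow> \<i> * of_real (\<xi> \<bullet> b) * fourier (\<lambda>x. of_real (\<phi> x)) \<xi>"
    by (simp only:) (intro tendsto_intros)
  with l1 show ?thesis by (rule LIMSEQ_unique)
qed

section \<open>Sobolev spaces as weighted spaces\<close>

definition rcl :: "('a::euclidean_space \<Rightarrow> real) \<Rightarrow> 'a l2" where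
  "rcl u = cl (\<lambda>x. complex_of_real (u x))"

lemma L2_of_real: "u \<in> L2_space M \<Longrightarrow> (\<lambda>x. complex_of_real (u x)) \<in> L2_space M"
  by (rule L2_space_bound[of u M _ 1]) (auto simp: L2_space_def)

lemma rcl_diff: "u \<in> L2_space lebesgue \<Longrightarrow> v \<in> L2_space lebesgue \<Longrightarrow> rcl (\<lambda>x. u x - v x) = rcl u - rcl v"
  by (simp add: rcl_def cl_diff L2_of_real)

lemma rcl_eq_iff: "u \<in> L2_space lebesgue \<Longrightarrow> v \<in> L2_space lebesgue \<Longrightarrow>
    rcl u = rcl v \<longleftrightarrow> (AE x in lebesgue. u x = v x)"
  by (simp add: rcl_def cl_eq_iff L2_of_real)

lemma inner_rcl: "u \<in> L2_space lebesgue \<Longrightarrow> v \<in> L2_space lebesgue \<Longrightarrow>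
    inner (rcl u) (rcl v) = (\<integral>x. u x * v x \<partial>lebesgue)"
  by (simp add: rcl_def inner_cl L2_of_real inner_complex_def)

lemma norm_rcl: "u \<in> L2_space lebesgue \<Longrightarrow> norm (rcl u) = L2_seminorm lebesgue u"
  by (simp add: rcl_def norm_cl L2_of_real L2_seminorm_def)

lemma cnj_rcl: "u \<in> L2_space lebesgue \<Longrightarrow> cnj_l2 (rcl u) = rcl u"
  by (simp add: rcl_def cnj_l2_cl L2_of_real)

lemma real_l2_cases:
  assumes "cnj_l2 v = v"
  obtains u where "u \<in> L2_space lebesgue" "v = rcl u"
proof -
  obtain f where f: "f \<in> L2_space lebesgue" "v = cl f" by (rule l2_cases)
  have u: "(\<lambda>x. Re (f x)) \<in> L2_space lebesgue"
  proof (rule L2_space_bound[OF f(1), of _ 1])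
    show "(\<lambda>x. Re (f x)) \<in> borel_measurable lebesgue" using L2_space_measurable[OF f(1)] by measurable
  qed (simp add: abs_Re_le_cmod)
  have "AE x in lebesgue. cnj (f x) = f x"
    using assms f(1) unfolding f(2) cnj_l2_cl[OF f(1)] by (subst (asm) cl_eq_iff) (auto simp: L2_cnj)
  then have "AE x in lebesgue. f x = complex_of_real (Re (f x))" by eventually_elim (simp add: complex_eq_iff)
  then have "v = rcl (\<lambda>x. Re (f x))" unfolding f(2) rcl_def
    by (subst cl_eq_iff) (auto simp: f(1) L2_of_real[OF u])
  then show ?thesis by (rule that[OF u])
qed

lemma pair_rcl: "u \<in> L2_space lebesgue \<Longrightarrow> v \<in> L2_space lebesgue \<Longrightarrow>
    pair_l2 (rcl u) (rcl v) = of_real (inner (rcl u) (rcl v))"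
  unfolding inner_rcl by (simp add: rcl_def pair_l2_cl L2_of_real flip: integral_complex_of_real)

lemma test_L2: "\<phi> \<in> test_functions V \<Longrightarrow> \<phi> \<in> L2_space lebesgue"
proof -
  assume "\<phi> \<in> test_functions V"
  from nice_L2[OF nice_test_function[OF this]]
  have n: "(\<lambda>x. complex_of_real (\<phi> x)) \<in> L2_space lebesgue" .
  from L2_space_measurable[OF this] have "(\<lambda>x. Re (complex_of_real (\<phi> x))) \<in> borel_measurable lebesgue" by measurable
  then show ?thesis by (intro L2_space_bound[OF n, of _ 1]) auto
qed

text \<open>The choice made in \<open>fourier_L2\<close> is determined up to null sets:
  \<open>fourier_l2\<close> supplies a candidate, and test functions, being Schwartz functions,
  separate candidates.\<close>

lemma
  fixes u :: "'a::euclidean_space \<Rightarrow> real"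
  assumes u: "u \<in> L2_space lebesgue"
  shows fourier_L2_in_L2: "fourier_L2 u \<in> L2_space lebesgue"
    and cl_fourier_L2: "cl (fourier_L2 u) = fourier_l2 (rcl u)"
proof -
  note uL = L2_of_real[OF u]
  let ?P = "\<lambda>g. g \<in> L2_space lebesgue \<and> (\<forall>\<phi>\<in>schwartz. (\<integral>\<xi>. g \<xi> * \<phi> \<xi> \<partial>lebesgue) =
                    (\<integral>x. complex_of_real (u x) * fourier \<phi> x \<partial>lebesgue))"
  have "?P (rp (fourier_l2 (rcl u)))"
  proof (intro conjI ballI rp_L2)
    fix \<phi> :: "'a \<Rightarrow> complex" assume "\<phi> \<in> schwartz"
    then have n: "nice \<phi>" by (rule schwartz_nice)
    show "(\<integral>\<xi>. rp (fourier_l2 (rcl u)) \<xi> * \<phi> \<xi> \<partial>lebesgue) = (\<integral>x. complex_of_real (u x) * fourier \<phi> x \<partial>lebesgue)"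
      using pair_fourier_l2[of "rcl u" "cl \<phi>"] pair_l2_cl[OF rp_L2 nice_L2[OF n], of "fourier_l2 (rcl u)"]
      by (simp add: rcl_def fourier_l2_nice[OF n] pair_l2_cl uL nice_fourier_L2[OF n])
  qed
  then have *: "?P (fourier_L2 u)" unfolding fourier_L2_def by (rule someI[of ?P])
  then show gL: "fourier_L2 u \<in> L2_space lebesgue" by blast
  have "fourier_L2 u \<in> L2_space lebesgue \<and> fourier_l2 (rcl u) = cl (fourier_L2 u)"
  proof (rule fourier_l2_eqI[OF L2_space_measurable[OF gL]])
    show "integrable lebesgue (\<lambda>x. indicator (cbox a b) x *\<^sub>R fourier_L2 u x)" for a b
      by (rule L2_integrable_bounded[OF gL]) auto
    fix \<phi> :: "'a \<Rightarrow> real" assume \<phi>: "\<phi> \<in> test_functions UNIV"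
    show "(\<integral>\<xi>. fourier_L2 u \<xi> * of_real (\<phi> \<xi>) \<partial>lebesgue) = pair_l2 (rcl u) (cl (fourier (\<lambda>x. of_real (\<phi> x))))"
      using conjunct2[OF *] test_schwartz[OF \<phi>] nice_fourier_L2[OF nice_test_function[OF \<phi>]]
      by (simp add: rcl_def pair_l2_cl uL)
  qed
  then show "cl (fourier_L2 u) = fourier_l2 (rcl u)" by simp
qed

section \<open>Sobolev spaces through weighted transforms\<close>

abbreviation rmult :: "('a::euclidean_space \<Rightarrow> real) \<Rightarrow> 'a l2 \<Rightarrow> 'a l2" where
  "rmult m \<equiv> mult_l2 (\<lambda>x. complex_of_real (m x))"

text \<open>The symbol of the Bessel potential of order \<open>s\<close>. Composing it with the
  fractional Laplacian of exponent s/2 gives the symbol \<open>riesz\<close>; for nonnegative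
  \<open>s\<close> both are bounded by 1.\<close>

definition bessel :: "real \<Rightarrow> 'a::euclidean_space \<Rightarrow> real" where
  "bessel s \<xi> = (1 + (norm \<xi>)\<^sup>2) powr (- s / 2)"

definition riesz :: "real \<Rightarrow> 'a::euclidean_space \<Rightarrow> real" where
  "riesz s \<xi> = norm \<xi> powr s * bessel s \<xi>"

lemma one_plus_norm_pos: "0 < 1 + (norm (\<xi>::'a::euclidean_space))\<^sup>2"
  by (rule add_pos_nonneg) auto

lemma bessel_pos: "0 < bessel s \<xi>"
  using one_plus_norm_pos[of \<xi>] by (simp add: bessel_def)

lemma bessel_inverse: "(1 + (norm \<xi>)\<^sup>2) powr (s / 2) * bessel s \<xi> = 1"
  using one_plus_norm_pos[of \<xi>] by (simp add: bessel_def flip: powr_add)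

lemma bessel_le_1: "0 \<le> s \<Longrightarrow> bessel s \<xi> \<le> 1"
  using powr_mono[of "- s / 2" 0 "1 + (norm \<xi>)\<^sup>2"] one_plus_norm_pos[of \<xi>] by (simp add: bessel_def)

lemma multiplier_of_real:
  assumes m: "m \<in> borel_measurable lebesgue" and C: "\<And>x. \<bar>m x\<bar> \<le> C"
  shows "multiplier (\<lambda>x. complex_of_real (m x))"
  unfolding multiplier_def
proof (intro conjI exI allI)
  show "(\<lambda>x. complex_of_real (m x)) \<in> borel_measurable lebesgue" using m by measurable
  show "norm (complex_of_real (m x)) \<le> C" for x using C[of x] by simp
qed

lemma multiplier_bessel:
  assumes "0 \<le> s"
  shows "multiplier (\<lambda>\<xi>::'a::euclidean_space. complex_of_real (bessel s \<xi>))"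
proof (rule multiplier_of_real[of _ 1])
  show "(bessel s :: 'a \<Rightarrow> real) \<in> borel_measurable lebesgue" unfolding bessel_def[abs_def] by measurable
  show "\<bar>bessel s \<xi>\<bar> \<le> 1" for \<xi> :: 'a using bessel_le_1[OF assms, of \<xi>] bessel_pos[of s \<xi>] by simp
qed

lemma riesz_nonneg: "0 \<le> riesz s \<xi>"
  using bessel_pos[of s \<xi>] by (simp add: riesz_def)

lemma riesz_le_1: "0 \<le> s \<Longrightarrow> riesz s \<xi> \<le> 1"
proof -
  assume s: "0 \<le> s"
  have "norm \<xi> powr s = ((norm \<xi>)\<^sup>2) powr (s / 2)"
    by (cases "\<xi> = 0") (auto simp: powr_powr simp flip: powr_numeral)
  also have "\<dots> \<le> (1 + (norm \<xi>)\<^sup>2) powr (s / 2)" using s by (intro powr_mono2) auto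
  finally have "riesz s \<xi> \<le> (1 + (norm \<xi>)\<^sup>2) powr (s / 2) * bessel s \<xi>"
    unfolding riesz_def using bessel_pos[of s \<xi>] by (intro mult_right_mono) auto
  then show ?thesis by (simp add: bessel_inverse)
qed

lemma multiplier_riesz:
  assumes "0 \<le> s"
  shows "multiplier (\<lambda>\<xi>::'a::euclidean_space. complex_of_real (riesz s \<xi>))"
proof (rule multiplier_of_real[of _ 1])
  show "(riesz s :: 'a \<Rightarrow> real) \<in> borel_measurable lebesgue" unfolding riesz_def[abs_def] bessel_def by measurable
  show "\<bar>riesz s \<xi>\<bar> \<le> 1" for \<xi> :: 'a using riesz_le_1[OF assms, of \<xi>] riesz_nonneg[of s \<xi>] by simp
qed

text \<open>For \<open>g\<close> the weighted transform \<open>gam s u\<close>,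
  \<open>psi s g\<close> is the class of \<open>u\<close>, and \<open>lam s g\<close> is the class
  of the fractional Laplacian with exponent s/2 applied to \<open>u\<close>. Unbounded operators
  thereby become bounded operators on \<open>l2\<close>.\<close>

definition psi :: "real \<Rightarrow> 'a::euclidean_space l2 \<Rightarrow> 'a l2" where
  "psi s g = inv_fourier_l2 (rmult (bessel s) g)"

definition lam :: "real \<Rightarrow> 'a::euclidean_space l2 \<Rightarrow> 'a l2" where
  "lam s g = inv_fourier_l2 (rmult (riesz s) g)"

definition gam :: "real \<Rightarrow> ('a::euclidean_space \<Rightarrow> real) \<Rightarrow> 'a l2" where
  "gam s u = cl (\<lambda>\<xi>. (1 + (norm \<xi>)\<^sup>2) powr (s / 2) *\<^sub>R fourier_L2 u \<xi>)"

lemma bounded_linear_psi: "0 \<le> s \<Longrightarrow> bounded_linear (psi s)"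
  unfolding psi_def[abs_def]
  by (intro bounded_linear_compose[OF bounded_linear_inv_fourier_l2] bounded_linear_mult_l2 multiplier_bessel)

lemma bounded_linear_lam: "0 \<le> s \<Longrightarrow> bounded_linear (lam s)"
  unfolding lam_def[abs_def]
  by (intro bounded_linear_compose[OF bounded_linear_inv_fourier_l2] bounded_linear_mult_l2 multiplier_riesz)

lemma Hs_L2: "u \<in> Hs s \<Longrightarrow> u \<in> L2_space lebesgue"
  by (simp add: Hs_def)

lemma Hs_weight_L2: "u \<in> Hs s \<Longrightarrow> (\<lambda>\<xi>. (1 + (norm \<xi>)\<^sup>2) powr (s / 2) *\<^sub>R fourier_L2 u \<xi>) \<in> L2_space lebesgue"
  by (simp add: Hs_def del: complex_scaleR)

lemma Hs_seminorm_gam: "u \<in> Hs s \<Longrightarrow> Hs_seminorm s u = norm (gam s u)"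
  unfolding Hs_seminorm_def gam_def by (rule norm_cl[OF Hs_weight_L2, symmetric])

lemma fourier_rcl_gam:
  assumes s: "0 \<le> s" and u: "u \<in> Hs s"
  shows "fourier_l2 (rcl u) = rmult (bessel s) (gam s u)"
proof -
  have eq: "complex_of_real (bessel s \<xi>) * ((1 + (norm \<xi>)\<^sup>2) powr (s / 2) *\<^sub>R fourier_L2 u \<xi>) = fourier_L2 u \<xi>" for \<xi>
    using arg_cong[OF bessel_inverse[of \<xi> s], of complex_of_real]
    by (simp add: scaleR_conv_of_real mult_ac)
  show ?thesis unfolding gam_def mult_l2_cl[OF multiplier_bessel[OF s] Hs_weight_L2[OF u]] eq
    by (simp add: cl_fourier_L2[OF Hs_L2[OF u]])
qed

lemma psi_gam: "0 \<le> s \<Longrightarrow> u \<in> Hs s \<Longrightarrow> psi s (gam s u) = rcl u"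
  unfolding psi_def fourier_rcl_gam[symmetric] by simp

text \<open>Membership in the Sobolev space and the weighted transform are both read off from a
  preimage under \<open>psi\<close>, so that no weighted transform has to be computed later.\<close>

lemma HsI:
  assumes s: "0 \<le> s" and u: "u \<in> L2_space lebesgue" and g: "psi s g = rcl u"
  shows "u \<in> Hs s" "gam s u = g"
proof -
  obtain h where h: "h \<in> L2_space lebesgue" "g = cl h" by (rule l2_cases)
  have "cl (fourier_L2 u) = rmult (bessel s) g"
    using arg_cong[OF g, of fourier_l2] by (simp add: psi_def cl_fourier_L2[OF u])
  then have "AE \<xi> in lebesgue. fourier_L2 u \<xi> = complex_of_real (bessel s \<xi>) * h \<xi>"
    unfolding h(2) mult_l2_cl[OF multiplier_bessel[OF s] h(1)]
    by (subst (asm) cl_eq_iff) (auto simp: fourier_L2_in_L2[OF u] multiplier_L2[OF multiplier_bessel[OF s] h(1)])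
  then have ae: "AE \<xi> in lebesgue. h \<xi> = (1 + (norm \<xi>)\<^sup>2) powr (s / 2) *\<^sub>R fourier_L2 u \<xi>"
  proof eventually_elim
    case (elim \<xi>)
    have "(1 + (norm \<xi>)\<^sup>2) powr (s / 2) *\<^sub>R fourier_L2 u \<xi> = complex_of_real ((1 + (norm \<xi>)\<^sup>2) powr (s / 2) * bessel s \<xi>) * h \<xi>"
      unfolding elim by (simp add: scaleR_conv_of_real mult_ac)
    then show ?case unfolding bessel_inverse by simp
  qed
  have m: "(\<lambda>\<xi>. (1 + (norm \<xi>)\<^sup>2) powr (s / 2) *\<^sub>R fourier_L2 u \<xi>) \<in> borel_measurable lebesgue"
    using L2_space_measurable[OF fourier_L2_in_L2[OF u]] by measurable
  have L: "(\<lambda>\<xi>. (1 + (norm \<xi>)\<^sup>2) powr (s / 2) *\<^sub>R fourier_L2 u \<xi>) \<in> L2_space lebesgue"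
    by (rule L2_space_AE[OF h(1) m ae])
  then show "u \<in> Hs s" using u by (simp add: Hs_def del: complex_scaleR)
  show "gam s u = g" unfolding gam_def h(2) using ae by (subst cl_eq_iff[OF L h(1)]) (auto elim: eventually_mono)
qed

lemma psi_inj: "0 \<le> s \<Longrightarrow> psi s g = psi s h \<Longrightarrow> g = h"
proof -
  assume s: "0 \<le> s" and eq: "psi s g = psi s h"
  obtain g' where g: "g' \<in> L2_space lebesgue" "g = cl g'" by (rule l2_cases)
  obtain h' where h: "h' \<in> L2_space lebesgue" "h = cl h'" by (rule l2_cases)
  have "rmult (bessel s) g = rmult (bessel s) h" using arg_cong[OF eq, of fourier_l2] by (simp add: psi_def)
  then have "AE \<xi> in lebesgue. complex_of_real (bessel s \<xi>) * g' \<xi> = complex_of_real (bessel s \<xi>) * h' \<xi>"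
    unfolding g(2) h(2) mult_l2_cl[OF multiplier_bessel[OF s] g(1)] mult_l2_cl[OF multiplier_bessel[OF s] h(1)]
    by (subst (asm) cl_eq_iff) (auto simp: multiplier_L2[OF multiplier_bessel[OF s]] g h)
  then have "AE \<xi> in lebesgue. g' \<xi> = h' \<xi>"
    by eventually_elim (use bessel_pos[of s] in \<open>auto simp: less_le\<close>)
  then show ?thesis unfolding g(2) h(2) by (subst cl_eq_iff[OF g(1) h(1)])
qed

lemma Hs_combine:
  assumes s: "0 \<le> s" and u: "u \<in> Hs s" and v: "v \<in> Hs s"
  shows "(\<lambda>x. u x + c * v x) \<in> Hs s" "gam s (\<lambda>x. u x + c * v x) = gam s u + c *\<^sub>R gam s v"
proof -
  have L: "(\<lambda>x. u x + c * v x) \<in> L2_space lebesgue"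
    using L2_space_add[OF Hs_L2[OF u] L2_space_scaleR[OF Hs_L2[OF v], of c]] by simp
  have "rcl (\<lambda>x. u x + c * v x) = rcl u + c *\<^sub>R rcl v"
    unfolding rcl_def using L2_of_real[OF Hs_L2[OF u]] L2_of_real[OF Hs_L2[OF v]] L2_space_scaleR[of "\<lambda>x. complex_of_real (v x)" lebesgue c]
    by (simp add: scaleR_conv_of_real flip: cl_add cl_scaleR)
  then have "psi s (gam s u + c *\<^sub>R gam s v) = rcl (\<lambda>x. u x + c * v x)"
    using s u v by (simp add: linear_simps[OF bounded_linear_psi] psi_gam)
  from HsI[OF s L this] show "(\<lambda>x. u x + c * v x) \<in> Hs s" "gam s (\<lambda>x. u x + c * v x) = gam s u + c *\<^sub>R gam s v" .
qed

lemma Hs_diff: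
  assumes "0 \<le> s" "u \<in> Hs s" "v \<in> Hs s"
  shows "(\<lambda>x. u x - v x) \<in> Hs s" "gam s (\<lambda>x. u x - v x) = gam s u - gam s v"
  using Hs_combine[OF assms, of "-1"] by simp_all

lemma L2_space_sum:
  fixes f :: "'i \<Rightarrow> 'a \<Rightarrow> real"
  shows "finite I \<Longrightarrow> (\<And>i. i \<in> I \<Longrightarrow> f i \<in> L2_space M) \<Longrightarrow> (\<lambda>x. \<Sum>i\<in>I. f i x) \<in> L2_space M"
  by (induction I rule: finite_induct) (auto simp: L2_space_zero intro: L2_space_add)

lemma L2_norm: "f \<in> L2_space M \<Longrightarrow> (\<lambda>x. norm (f x)) \<in> L2_space M"
  by (rule L2_space_bound[of f M _ 1]) (auto simp: L2_space_def)

text \<open>For \<open>s \<le> 1\<close> the weight is at most 1 plus the sum of the absolute values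
  of the coordinates, so Plancherel for the function and its first derivatives is enough.\<close>

lemma test_Hs:
  fixes \<phi> :: "'a::euclidean_space \<Rightarrow> real"
  assumes s: "0 \<le> s" "s \<le> 1" and \<phi>: "\<phi> \<in> test_functions V"
  shows "\<phi> \<in> Hs s"
proof -
  note L = test_L2[OF \<phi>]
  note n = nice_test_function[OF \<phi>]
  let ?F = "fourier (\<lambda>x. complex_of_real (\<phi> x))"
  let ?D = "\<lambda>b. fourier (\<lambda>x. complex_of_real (frechet_derivative \<phi> (at x) b))"
  have "cl (fourier_L2 \<phi>) = cl ?F" unfolding cl_fourier_L2[OF L] by (simp add: rcl_def fourier_l2_nice[OF n])
  then have ae: "AE \<xi> in lebesgue. fourier_L2 \<phi> \<xi> = ?F \<xi>"
    by (subst (asm) cl_eq_iff) (simp_all add: fourier_L2_in_L2[OF L] nice_fourier_L2[OF n])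
  have B: "(\<lambda>\<xi>. norm (?F \<xi>) + (\<Sum>b\<in>Basis. norm (?D b \<xi>))) \<in> L2_space lebesgue"
    by (intro L2_space_add L2_space_sum L2_norm nice_fourier_L2 n nice_test_function[OF test_functions_partial[OF \<phi>]]) auto
  have "(\<lambda>\<xi>. (1 + (norm \<xi>)\<^sup>2) powr (s / 2) *\<^sub>R fourier_L2 \<phi> \<xi>) \<in> L2_space lebesgue"
  proof (rule L2_space_bound[OF B, of _ 1])
    show "(\<lambda>\<xi>. (1 + (norm \<xi>)\<^sup>2) powr (s / 2) *\<^sub>R fourier_L2 \<phi> \<xi>) \<in> borel_measurable lebesgue"
      using L2_space_measurable[OF fourier_L2_in_L2[OF L]] by measurable
    show "AE \<xi> in lebesgue. norm ((1 + (norm \<xi>)\<^sup>2) powr (s / 2) *\<^sub>R fourier_L2 \<phi> \<xi>)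
        \<le> 1 * norm (norm (?F \<xi>) + (\<Sum>b\<in>Basis. norm (?D b \<xi>)))"
      using ae
    proof eventually_elim
      case (elim \<xi>)
      have "(1 + (norm \<xi>)\<^sup>2) powr (s / 2) \<le> (1 + (norm \<xi>)\<^sup>2) powr (1 / 2)" using s by (intro powr_mono) auto
      also have "\<dots> = sqrt (1 + (norm \<xi>)\<^sup>2)" using one_plus_norm_pos[of \<xi>] by (simp add: powr_half_sqrt)
      also have "\<dots> \<le> 1 + norm \<xi>" by (rule real_le_lsqrt) (auto simp: power2_sum)
      also have "\<dots> \<le> 1 + (\<Sum>b\<in>Basis. \<bar>\<xi> \<bullet> b\<bar>)" by (intro add_left_mono norm_le_l1)
      finally have "(1 + (norm \<xi>)\<^sup>2) powr (s / 2) * norm (?F \<xi>) \<le> (1 + (\<Sum>b\<in>Basis. \<bar>\<xi> \<bullet> b\<bar>)) * norm (?F \<xi>)"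
        by (intro mult_right_mono) auto
      also have "\<dots> = norm (?F \<xi>) + (\<Sum>b\<in>Basis. norm (?D b \<xi>))"
        by (simp add: fourier_partial[OF \<phi>] norm_mult distrib_right sum_distrib_right)
      finally show ?case unfolding elim by (simp add: sum_nonneg del: complex_scaleR)
    qed
  qed
  then show ?thesis using L by (simp add: Hs_def del: complex_scaleR)
qed

section \<open>The inverse transform, parity and reality\<close>

lemma fourier_fourier_l2: "fourier_l2 (fourier_l2 w) = (2 * pi) ^ DIM('a) *\<^sub>R refl_l2 (w :: 'a::euclidean_space l2)"
  using arg_cong[OF refl_fourier_fourier_l2[of w], of refl_l2] by (simp add: refl_l2_simps)

lemma fourier_refl_l2: "fourier_l2 (refl_l2 w) = refl_l2 (fourier_l2 (w :: 'a::euclidean_space l2))"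
proof -
  have "(2 * pi) ^ DIM('a) *\<^sub>R fourier_l2 (refl_l2 w) = fourier_l2 (fourier_l2 (fourier_l2 w))"
    by (simp add: fourier_fourier_l2[of w] fourier_l2_simps)
  also have "\<dots> = (2 * pi) ^ DIM('a) *\<^sub>R refl_l2 (fourier_l2 w)" by (rule fourier_fourier_l2)
  finally show ?thesis by simp
qed

lemma inv_inv_fourier_l2: "inv_fourier_l2 (inv_fourier_l2 v) = (1 / (2 * pi) ^ DIM('a)) *\<^sub>R refl_l2 (v :: 'a::euclidean_space l2)"
proof -
  have "v = fourier_l2 (fourier_l2 (inv_fourier_l2 (inv_fourier_l2 v)))" by simp
  also have "\<dots> = (2 * pi) ^ DIM('a) *\<^sub>R refl_l2 (inv_fourier_l2 (inv_fourier_l2 v))" by (rule fourier_fourier_l2)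
  finally have "refl_l2 v = refl_l2 ((2 * pi) ^ DIM('a) *\<^sub>R refl_l2 (inv_fourier_l2 (inv_fourier_l2 v)))" by simp
  then show ?thesis by (simp add: refl_l2_simps)
qed

lemma pair_refl_l2: "pair_l2 (refl_l2 v) w = pair_l2 v (refl_l2 w)"
proof -
  obtain f where f: "f \<in> L2_space lebesgue" "v = cl f" by (rule l2_cases)
  obtain g where g: "g \<in> L2_space lebesgue" "w = cl g" by (rule l2_cases)
  have [measurable]: "f \<in> borel_measurable lebesgue" "g \<in> borel_measurable lebesgue"
    using f g by (auto intro: L2_space_measurable)
  have "(\<integral>x. f (- x) * g x \<partial>lebesgue) = (\<integral>x. f (- (- x)) * g (- x) \<partial>lebesgue)"
    by (rule integral_uminus_lebesgue[symmetric]) measurable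
  then show ?thesis using f g by (simp add: refl_l2_cl pair_l2_cl L2_refl)
qed

lemma pair_inv_fourier_l2: "pair_l2 v (inv_fourier_l2 w) = pair_l2 (inv_fourier_l2 v) w"
proof -
  have "pair_l2 v (refl_l2 (fourier_l2 w)) = pair_l2 (refl_l2 (fourier_l2 v)) w"
    by (simp add: pair_refl_l2[symmetric] pair_fourier_l2[symmetric] fourier_refl_l2)
  then show ?thesis unfolding inv_fourier_l2_def
    by (simp only: bounded_bilinear.scaleR_left[OF bounded_bilinear_pair_l2] bounded_bilinear.scaleR_right[OF bounded_bilinear_pair_l2])
qed

lemma cnj_inv_fourier_l2: "cnj_l2 (inv_fourier_l2 v) = inv_fourier_l2 (cnj_l2 (refl_l2 v))"
  unfolding inv_fourier_l2_def
  by (simp add: cnj_l2_simps fourier_cnj_l2 fourier_refl_l2 cnj_refl_l2)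

lemma inner_inv_fourier_l2:
  "inner (inv_fourier_l2 v) (inv_fourier_l2 w) = (1 / (2 * pi) ^ DIM('a)) * inner v (w :: 'a::euclidean_space l2)"
  using inner_fourier_l2[of "inv_fourier_l2 v" "inv_fourier_l2 w"] by simp

lemma inv_fourier_nice:
  fixes f :: "'a::euclidean_space \<Rightarrow> complex"
  assumes f: "nice f"
  shows "inv_fourier f = (\<lambda>x. (1 / (2 * pi) ^ DIM('a)) *\<^sub>R fourier f (- x))"
    and "inv_fourier f \<in> L2_space lebesgue" and "inv_fourier_l2 (cl f) = cl (inv_fourier f)"
proof -
  show 1: "inv_fourier f = (\<lambda>x. (1 / (2 * pi) ^ DIM('a)) *\<^sub>R fourier f (- x))"
    by (rule ext) (simp add: inv_fourier_def fourier_def inner_commute)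
  note L = L2_refl[OF nice_fourier_L2[OF f]]
  show "inv_fourier f \<in> L2_space lebesgue" unfolding 1 by (rule L2_space_scaleR[OF L])
  show "inv_fourier_l2 (cl f) = cl (inv_fourier f)"
    unfolding 1 cl_scaleR[OF L] inv_fourier_l2_def fourier_l2_nice[OF f] refl_l2_cl[OF nice_fourier_L2[OF f]] ..
qed

lemma cnj_rmult:
  assumes "multiplier (\<lambda>x. complex_of_real (m x))"
  shows "cnj_l2 (rmult m v) = rmult m (cnj_l2 v)"
proof (rule l2_cases[of v])
  fix f assume "f \<in> L2_space lebesgue" "v = cl f"
  then show ?thesis using assms by (simp add: mult_l2_cl cnj_l2_cl L2_cnj multiplier_L2)
qed

lemma refl_rmult:
  assumes "multiplier (\<lambda>x. complex_of_real (m x))" "\<And>x. m (- x) = m x"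
  shows "refl_l2 (rmult m v) = rmult m (refl_l2 v)"
proof (rule l2_cases[of v])
  fix f assume "f \<in> L2_space lebesgue" "v = cl f"
  then show ?thesis using assms by (simp add: mult_l2_cl refl_l2_cl L2_refl multiplier_L2)
qed

lemma bessel_even: "bessel s (- x) = bessel s x"
  by (simp add: bessel_def)

lemma riesz_even: "riesz s (- x) = riesz s x"
  by (simp add: riesz_def bessel_def)

lemma cnj_psi: "0 \<le> s \<Longrightarrow> cnj_l2 (psi s g) = psi s (cnj_l2 (refl_l2 g))"
  by (simp add: psi_def cnj_inv_fourier_l2 refl_rmult[OF multiplier_bessel bessel_even] cnj_rmult[OF multiplier_bessel])

lemma cnj_lam: "0 \<le> s \<Longrightarrow> cnj_l2 (lam s g) = lam s (cnj_l2 (refl_l2 g))"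
  by (simp add: lam_def cnj_inv_fourier_l2 refl_rmult[OF multiplier_riesz riesz_even] cnj_rmult[OF multiplier_riesz])

text \<open>Real functions are those with Hermitian symmetric transform, and real even symbols
  preserve this symmetry.\<close>

lemma lam_gam_real:
  assumes s: "0 \<le> s" and u: "u \<in> Hs s"
  shows "cnj_l2 (lam s (gam s u)) = lam s (gam s u)"
proof -
  have "cnj_l2 (psi s (gam s u)) = psi s (gam s u)" unfolding psi_gam[OF s u] by (rule cnj_rcl[OF Hs_L2[OF u]])
  then have "cnj_l2 (refl_l2 (gam s u)) = gam s u" unfolding cnj_psi[OF s] by (rule psi_inj[OF s])
  then show ?thesis unfolding cnj_lam[OF s] by (rule arg_cong)
qed

text \<open>For \<open>s\<close> between 0 and 1 this is the image of \<open>Hs_tilde s V\<close>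
  under \<open>gam s\<close>. Defined as a closure in a complete space, it brings the completeness
  of the Sobolev space with it.\<close>

definition sob :: "real \<Rightarrow> 'a::euclidean_space set \<Rightarrow> 'a l2 set" where
  "sob s V = closure (gam s ` test_functions V)"

lemma closed_sob: "closed (sob s V)"
  by (simp add: sob_def)

lemma gam_test_in_sob: "\<phi> \<in> test_functions V \<Longrightarrow> gam s \<phi> \<in> sob s V"
  unfolding sob_def by (rule subsetD[OF closure_subset imageI])

lemma gam_test_combine:
  assumes "0 \<le> s" "s \<le> 1" "\<phi> \<in> test_functions V" "\<psi> \<in> test_functions V"
  shows "gam s (\<lambda>x. \<phi> x + c * \<psi> x) = gam s \<phi> + c *\<^sub>R gam s \<psi>"
  by (rule Hs_combine[OF assms(1) test_Hs[OF assms(1,2,3)] test_Hs[OF assms(1,2,4)]])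

lemma subspace_sob:
  fixes V :: "'a::euclidean_space set"
  assumes s: "0 \<le> s" "s \<le> 1"
  shows "subspace (sob s V)"
  unfolding sob_def
proof (rule subspace_closure_real_normed)
  note c = gam_test_combine[OF s]
  have z: "gam s (\<lambda>x::'a. 0) = 0"
    using c[OF test_functions_zero[of V] test_functions_zero[of V], of "-1"] by simp
  show "subspace (gam s ` test_functions V)" unfolding subspace_def
  proof (intro conjI ballI allI)
    show "0 \<in> gam s ` test_functions V" by (rule image_eqI[where x="\<lambda>x. 0"]) (simp_all add: z test_functions_zero)
  next
    fix v w assume "v \<in> gam s ` test_functions V" "w \<in> gam s ` test_functions V"
    then obtain \<phi> \<psi> where "v = gam s \<phi>" "w = gam s \<psi>" "\<phi> \<in> test_functions V" "\<psi> \<in> test_functions V" by blast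
    then show "v + w \<in> gam s ` test_functions V"
      using c[of \<phi> V \<psi> 1] imageI[OF subspace_test_functions[of \<phi> V \<psi> 1], of "gam s"] by simp
  next
    fix r and v assume "v \<in> gam s ` test_functions V"
    then obtain \<phi> where "v = gam s \<phi>" "\<phi> \<in> test_functions V" by blast
    then show "r *\<^sub>R v \<in> gam s ` test_functions V"
      using c[OF test_functions_zero, of \<phi> V r] imageI[OF subspace_test_functions[OF test_functions_zero, of \<phi> V r], of "gam s"] z
      by simp
  qed
qed

lemma Hs_tilde_iff:
  assumes s: "0 \<le> s" "s \<le> 1"
  shows "u \<in> Hs_tilde s V \<longleftrightarrow> u \<in> Hs s \<and> gam s u \<in> sob s V"
proof (cases "u \<in> Hs s")
  case True
  have "Hs_seminorm s (\<lambda>x. u x - \<phi> x) = dist (gam s \<phi>) (gam s u)" if "\<phi> \<in> test_functions V" for \<phi>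
    using Hs_diff[OF s(1) True test_Hs[OF s that]] by (simp add: Hs_seminorm_gam dist_norm norm_minus_commute)
  then show ?thesis using True by (auto simp: Hs_tilde_def sob_def closure_approachable)
qed (auto simp: Hs_tilde_def)

lemma sob_real:
  assumes s: "0 \<le> s" "s \<le> 1" and g: "g \<in> sob s V"
  shows "cnj_l2 (psi s g) = psi s g"
proof -
  have "closed {g. cnj_l2 (psi s g) = psi s g}"
    by (intro closed_Collect_eq cnj_l2_continuous_on bounded_linear.continuous_on[OF bounded_linear_psi[OF s(1)]] continuous_on_id)
  then have "sob s V \<subseteq> {g. cnj_l2 (psi s g) = psi s g}" unfolding sob_def
    by (rule closure_minimal[rotated])
       (auto simp: psi_gam[OF s(1) test_Hs[OF s]] cnj_rcl[OF test_L2])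
  then show ?thesis using g by blast
qed

text \<open>Limits of real functions are real, so every element of the closure again comes from a
  real function. This is the passage from classes back to the functions of the problem.\<close>

lemma sob_cases:
  assumes s: "0 \<le> s" "s \<le> 1" and g: "g \<in> sob s V"
  obtains u where "u \<in> Hs_tilde s V" "gam s u = g"
proof -
  obtain u where u: "u \<in> L2_space lebesgue" "psi s g = rcl u"
    using real_l2_cases[OF sob_real[OF s g]] .
  from HsI[OF s(1) u] g show ?thesis by (intro that[of u]) (auto simp: Hs_tilde_iff[OF s])
qed

text \<open>Vanishing almost everywhere outside \<open>V\<close> passes to limits because
  multiplication by the indicator is continuous.\<close>

lemma sob_support:
  assumes s: "0 \<le> s" "s \<le> 1" and g: "g \<in> sob s V" and V: "V \<in> sets lebesgue"
  shows "rmult (indicator V) (psi s g) = psi s g"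
proof -
  have m: "multiplier (\<lambda>x. complex_of_real (indicator V x))"
    by (rule multiplier_of_real[of _ 1]) (use V in \<open>auto simp: indicator_def\<close>)
  have "closed {g. rmult (indicator V) (psi s g) = psi s g}"
    by (intro closed_Collect_eq bounded_linear.continuous_on[OF bounded_linear_mult_l2[OF m]]
        bounded_linear.continuous_on[OF bounded_linear_psi[OF s(1)]] continuous_on_id)
  then have "sob s V \<subseteq> {g. rmult (indicator V) (psi s g) = psi s g}" unfolding sob_def
  proof (rule closure_minimal[rotated], intro image_subsetI CollectI)
    fix \<phi> assume \<phi>: "\<phi> \<in> test_functions V"
    have "complex_of_real (indicator V x) * complex_of_real (\<phi> x) = complex_of_real (\<phi> x)" for x
      using test_functionsD(5)[OF \<phi>, of x] by (cases "x \<in> V") auto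
    then show "rmult (indicator V) (psi s (gam s \<phi>)) = psi s (gam s \<phi>)"
      unfolding psi_gam[OF s(1) test_Hs[OF s \<phi>]] rcl_def mult_l2_cl[OF m L2_of_real[OF test_L2[OF \<phi>]]] by (simp only:)
  qed
  then show ?thesis using g by blast
qed

section \<open>The fractional Laplacian and the dual pairing\<close>

lemma riesz_weight:
  fixes u :: "'a::euclidean_space \<Rightarrow> real"
  assumes s: "0 \<le> s" and u: "u \<in> Hs s"
  shows "(\<lambda>\<xi>. norm \<xi> powr s *\<^sub>R fourier_L2 u \<xi>) \<in> L2_space lebesgue"
    and "cl (\<lambda>\<xi>. norm \<xi> powr s *\<^sub>R fourier_L2 u \<xi>) = rmult (riesz s) (gam s u)"
proof -
  have eq: "norm \<xi> powr s *\<^sub>R fourier_L2 u \<xi> = complex_of_real (riesz s \<xi>) * ((1 + (norm \<xi>)\<^sup>2) powr (s / 2) *\<^sub>R fourier_L2 u \<xi>)" for \<xi>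
    using arg_cong[OF bessel_inverse[of \<xi> s], of "\<lambda>x. complex_of_real (norm \<xi> powr s) * complex_of_real x"]
    by (simp add: riesz_def scaleR_conv_of_real mult_ac)
  show "(\<lambda>\<xi>. norm \<xi> powr s *\<^sub>R fourier_L2 u \<xi>) \<in> L2_space lebesgue"
    unfolding eq by (rule multiplier_L2[OF multiplier_riesz[OF s] Hs_weight_L2[OF u]])
  show "cl (\<lambda>\<xi>. norm \<xi> powr s *\<^sub>R fourier_L2 u \<xi>) = rmult (riesz s) (gam s u)"
    unfolding eq gam_def by (rule mult_l2_cl[OF multiplier_riesz[OF s] Hs_weight_L2[OF u], symmetric])
qed

text \<open>The candidate for the choice is a real representative of \<open>lam s (gam s u)\<close>,
  which exists by the symmetry of the transform; testing makes it unique up to null sets.\<close>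

lemma
  fixes u :: "'a::euclidean_space \<Rightarrow> real"
  assumes s: "0 < s" and u: "u \<in> Hs s"
  shows frac_laplace_L2_in_L2: "frac_laplace_L2 (s / 2) u \<in> L2_space lebesgue"
    and rcl_frac_laplace_L2: "rcl (frac_laplace_L2 (s / 2) u) = lam s (gam s u)"
proof -
  have s0: "0 \<le> s" using s by simp
  have fl: "frac_laplace (s / 2) u \<phi> = pair_l2 (lam s (gam s u)) (cl \<phi>)" if "\<phi> \<in> schwartz" for \<phi>
  proof -
    have n: "nice \<phi>" using that by (rule schwartz_nice)
    have "frac_laplace (s / 2) u \<phi> = (\<integral>\<xi>. (norm \<xi> powr s *\<^sub>R fourier_L2 u \<xi>) * inv_fourier \<phi> \<xi> \<partial>lebesgue)"
      by (simp add: frac_laplace_def)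
    also have "\<dots> = pair_l2 (rmult (riesz s) (gam s u)) (inv_fourier_l2 (cl \<phi>))"
      unfolding inv_fourier_nice(3)[OF n] riesz_weight(2)[OF s0 u, symmetric]
        pair_l2_cl[OF riesz_weight(1)[OF s0 u] inv_fourier_nice(2)[OF n]] ..
    finally show ?thesis by (simp add: pair_inv_fourier_l2 lam_def)
  qed
  obtain v0 where v0: "v0 \<in> L2_space lebesgue" "lam s (gam s u) = rcl v0"
    using real_l2_cases[OF lam_gam_real[OF s0 u]] .
  have pr: "pair_l2 (rcl v) (cl \<phi>) = (\<integral>x. complex_of_real (v x) * \<phi> x \<partial>lebesgue)"
    if "v \<in> L2_space lebesgue" "nice \<phi>" for v :: "'a \<Rightarrow> real" and \<phi>
    unfolding rcl_def by (rule pair_l2_cl[OF L2_of_real[OF that(1)] nice_L2[OF that(2)]])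
  let ?P = "\<lambda>v. v \<in> L2_space lebesgue \<and> (\<forall>\<phi>\<in>schwartz. (\<integral>x. complex_of_real (v x) * \<phi> x \<partial>lebesgue) = frac_laplace (s / 2) u \<phi>)"
  have "?P v0" using v0 fl pr[OF v0(1) schwartz_nice] by simp
  then have *: "?P (frac_laplace_L2 (s / 2) u)" unfolding frac_laplace_L2_def by (rule someI[of ?P])
  then show L: "frac_laplace_L2 (s / 2) u \<in> L2_space lebesgue" by blast
  let ?v = "frac_laplace_L2 (s / 2) u"
  have "AE x in lebesgue. x \<in> UNIV \<longrightarrow> complex_of_real (?v x) - complex_of_real (v0 x) = 0"
  proof (rule l2_AE_zero_if_test[OF open_UNIV L2_space_diff[OF L2_of_real[OF L] L2_of_real[OF v0(1)]]])
    fix \<phi> :: "'a \<Rightarrow> real" assume \<phi>: "\<phi> \<in> test_functions UNIV"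
    have S: "(\<lambda>x. complex_of_real (\<phi> x)) \<in> schwartz" by (rule test_schwartz[OF \<phi>])
    note n = schwartz_nice[OF S]
    have "(\<integral>x. complex_of_real (?v x) * of_real (\<phi> x) \<partial>lebesgue) = (\<integral>x. complex_of_real (v0 x) * of_real (\<phi> x) \<partial>lebesgue)"
      using conjunct2[OF *, rule_format, OF S] fl[OF S] pr[OF v0(1) n] v0(2) by simp
    then show "(\<integral>x. (complex_of_real (?v x) - complex_of_real (v0 x)) * of_real (\<phi> x) \<partial>lebesgue) = 0"
      using L2_space_integrable_mult[OF L2_of_real[OF L] nice_L2[OF n]] L2_space_integrable_mult[OF L2_of_real[OF v0(1)] nice_L2[OF n]]
      by (simp add: left_diff_distrib)
  qed
  then have "AE x in lebesgue. ?v x = v0 x" by eventually_elim simp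
  then show "rcl ?v = lam s (gam s u)" unfolding v0(2) by (subst rcl_eq_iff[OF L v0(1)])
qed

lemma integral_frac_laplace_L2:
  assumes "0 < s" "u \<in> Hs s" "w \<in> Hs s"
  shows "(\<integral>x. frac_laplace_L2 (s / 2) u x * frac_laplace_L2 (s / 2) w x \<partial>lebesgue) = inner (lam s (gam s u)) (lam s (gam s w))"
  using inner_rcl[OF frac_laplace_L2_in_L2[OF assms(1,2)] frac_laplace_L2_in_L2[OF assms(1,3)]]
  by (simp add: rcl_frac_laplace_L2 assms)

text \<open>The symbol |\<xi>|^(2s) is split evenly between the two transforms. The inverse
  transform of a test function is its transform, reflected and divided by (2 pi)^n, which accounts
  for the reflection and the constant.\<close>

lemma frac_laplace_test:
  fixes z :: "'a::euclidean_space \<Rightarrow> real"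
  assumes s: "0 < s" "s \<le> 1" and z: "z \<in> Hs s" and \<phi>: "\<phi> \<in> test_functions V"
  shows "frac_laplace s z (\<lambda>x. complex_of_real (\<phi> x)) = of_real (inner (lam s (gam s z)) (lam s (gam s \<phi>)))"
proof -
  have s0: "0 \<le> s" using s by simp
  note n = nice_test_function[OF \<phi>]
  note pH = test_Hs[OF s0 s(2) \<phi>]
  let ?c = "1 / (2 * pi) ^ DIM('a)"
  let ?F = "fourier (\<lambda>x. complex_of_real (\<phi> x))"
  have "cl (fourier_L2 \<phi>) = cl ?F" unfolding cl_fourier_L2[OF test_L2[OF \<phi>]] by (simp add: rcl_def fourier_l2_nice[OF n])
  then have "AE \<xi> in lebesgue. fourier_L2 \<phi> \<xi> = ?F \<xi>"
    by (subst (asm) cl_eq_iff) (simp_all add: fourier_L2_in_L2[OF test_L2[OF \<phi>]] nice_fourier_L2[OF n])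
  then have ae: "AE \<xi> in lebesgue. fourier_L2 \<phi> (- \<xi>) = ?F (- \<xi>)"
    using AE_affine_lebesgue[of "-1" "\<lambda>\<xi>. fourier_L2 \<phi> \<xi> = ?F \<xi>" 0] by simp
  define A where "A \<xi> = norm \<xi> powr s *\<^sub>R fourier_L2 z \<xi>" for \<xi>
  define B where "B \<xi> = norm \<xi> powr s *\<^sub>R fourier_L2 \<phi> \<xi>" for \<xi>
  have A: "A \<in> L2_space lebesgue" "cl A = rmult (riesz s) (gam s z)"
    unfolding A_def[abs_def] by (rule riesz_weight[OF s0 z])+
  have B: "B \<in> L2_space lebesgue" "cl B = rmult (riesz s) (gam s \<phi>)"
    unfolding B_def[abs_def] by (rule riesz_weight[OF s0 pH])+
  have "frac_laplace s z (\<lambda>x. complex_of_real (\<phi> x)) = (\<integral>\<xi>. A \<xi> * (?c *\<^sub>R B (- \<xi>)) \<partial>lebesgue)"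
    unfolding frac_laplace_def
  proof (rule integral_cong_AE)
    show "AE \<xi> in lebesgue. (norm \<xi> powr (2 * s) *\<^sub>R fourier_L2 z \<xi>) * inv_fourier (\<lambda>x. complex_of_real (\<phi> x)) \<xi>
        = A \<xi> * (?c *\<^sub>R B (- \<xi>))"
      using ae
    proof eventually_elim
      case (elim \<xi>)
      have "norm \<xi> powr (2 * s) = norm \<xi> powr s * norm \<xi> powr s" by (simp flip: powr_add)
      then show ?case unfolding A_def B_def inv_fourier_nice(1)[OF n] elim
        by (simp add: scaleR_conv_of_real mult_ac)
    qed
    note [measurable] = L2_space_measurable[OF fourier_L2_in_L2[OF Hs_L2[OF z]]] L2_space_measurable[OF inv_fourier_nice(2)[OF n]]
      L2_space_measurable[OF A(1)] L2_space_measurable[OF B(1)]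
    show "(\<lambda>\<xi>. (norm \<xi> powr (2 * s) *\<^sub>R fourier_L2 z \<xi>) * inv_fourier (\<lambda>x. complex_of_real (\<phi> x)) \<xi>) \<in> borel_measurable lebesgue"
      by measurable
    show "(\<lambda>\<xi>. A \<xi> * (?c *\<^sub>R B (- \<xi>))) \<in> borel_measurable lebesgue" by measurable
  qed
  also have "\<dots> = pair_l2 (cl A) (?c *\<^sub>R refl_l2 (cl B))"
    unfolding refl_l2_cl[OF B(1)] cl_scaleR[OF L2_refl[OF B(1)], symmetric]
    by (rule pair_l2_cl[OF A(1) L2_space_scaleR[OF L2_refl[OF B(1)]], symmetric])
  also have "\<dots> = pair_l2 (lam s (gam s z)) (lam s (gam s \<phi>))"
    unfolding lam_def pair_inv_fourier_l2[symmetric] inv_inv_fourier_l2 A(2) B(2) ..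
  also have "\<dots> = of_real (inner (lam s (gam s z)) (lam s (gam s \<phi>)))"
  proof -
    obtain v where v: "v \<in> L2_space lebesgue" "lam s (gam s z) = rcl v"
      using real_l2_cases[OF lam_gam_real[OF s0 z]] .
    obtain w where w: "w \<in> L2_space lebesgue" "lam s (gam s \<phi>) = rcl w"
      using real_l2_cases[OF lam_gam_real[OF s0 pH]] .
    show ?thesis unfolding v(2) w(2) by (rule pair_rcl[OF v(1) w(1)])
  qed
  finally show ?thesis .
qed

text \<open>The description by \<open>THE\<close> has a unique solution for two reasons: by
  continuity of \<open>lam\<close> all approximating sequences give the same limit, and at least one
  such sequence exists, without which every \<open>c\<close> would qualify.\<close>

lemma dual_pairing_frac_laplace:
  assumes s: "0 < s" "s \<le> 1" and z: "z \<in> Hs s" and y: "y \<in> Hs_tilde s V"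
  shows "dual_pairing s V y (frac_laplace s z) = inner (lam s (gam s z)) (lam s (gam s y))"
proof -
  have s0: "0 \<le> s" using s by simp
  have yH: "y \<in> Hs s" "gam s y \<in> sob s V" using y unfolding Hs_tilde_iff[OF s0 s(2)] by auto
  have dist: "Hs_seminorm s (\<lambda>x. \<phi> x - y x) = dist (gam s \<phi>) (gam s y)" if "\<phi> \<in> test_functions V" for \<phi>
    using Hs_diff[OF s0 test_Hs[OF s0 s(2) that] yH(1)] by (simp add: Hs_seminorm_gam dist_norm)
  let ?c = "inner (lam s (gam s z)) (lam s (gam s y))"
  have conv: "(\<lambda>k. frac_laplace s z (\<lambda>x. complex_of_real (\<phi> k x))) \<longlonglongrightarrow> complex_of_real ?c"
    if \<phi>: "\<And>k::nat. \<phi> k \<in> test_functions V" and lim: "(\<lambda>k. Hs_seminorm s (\<lambda>x. \<phi> k x - y x)) \<longlonglongrightarrow> 0" for \<phi>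
  proof -
    have "(\<lambda>k. gam s (\<phi> k)) \<longlonglongrightarrow> gam s y" using lim unfolding dist[OF \<phi>] by (simp add: tendsto_dist_iff[symmetric])
    then have "(\<lambda>k. lam s (gam s (\<phi> k))) \<longlonglongrightarrow> lam s (gam s y)" by (rule bounded_linear.tendsto[OF bounded_linear_lam[OF s0]])
    then show ?thesis unfolding frac_laplace_test[OF s z \<phi>] by (intro tendsto_intros)
  qed
  obtain g where g: "\<And>k::nat. g k \<in> gam s ` test_functions V" "g \<longlonglongrightarrow> gam s y"
    using yH(2) unfolding sob_def closure_sequential by blast
  have "\<forall>k. \<exists>\<phi>. \<phi> \<in> test_functions V \<and> g k = gam s \<phi>" using g(1) by blast
  then obtain \<phi> where \<phi>: "\<And>k. \<phi> k \<in> test_functions V" "\<And>k. g k = gam s (\<phi> k)" by metis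
  have lim: "(\<lambda>k. Hs_seminorm s (\<lambda>x. \<phi> k x - y x)) \<longlonglongrightarrow> 0"
    unfolding dist[OF \<phi>(1)] using g(2) unfolding \<phi>(2) by (simp add: tendsto_dist_iff[symmetric])
  show ?thesis unfolding dual_pairing_def
  proof (rule the_equality)
    show "\<forall>\<phi>. (\<forall>k::nat. \<phi> k \<in> test_functions V) \<and> (\<lambda>k. Hs_seminorm s (\<lambda>x. \<phi> k x - y x)) \<longlonglongrightarrow> 0 \<longrightarrow>
       (\<lambda>k. frac_laplace s z (\<lambda>x. complex_of_real (\<phi> k x))) \<longlonglongrightarrow> complex_of_real ?c"
      using conv by blast
    fix c assume "\<forall>\<phi>. (\<forall>k::nat. \<phi> k \<in> test_functions V) \<and> (\<lambda>k. Hs_seminorm s (\<lambda>x. \<phi> k x - y x)) \<longlonglongrightarrow> 0 \<longrightarrow>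
       (\<lambda>k. frac_laplace s z (\<lambda>x. complex_of_real (\<phi> k x))) \<longlonglongrightarrow> complex_of_real c"
    then have "(\<lambda>k. frac_laplace s z (\<lambda>x. complex_of_real (\<phi> k x))) \<longlonglongrightarrow> complex_of_real c"
      using \<phi>(1) lim by blast
    with conv[OF \<phi>(1) lim] have "complex_of_real c = complex_of_real ?c" using LIMSEQ_unique by blast
    then show "c = ?c" by simp
  qed
qed

section \<open>Injectivity of Riesz type potentials\<close>

text \<open>Lists of directions instead of multi-indices: each derivative of the kernel puts one
  more direction in front.\<close>

fun monomial :: "'a::euclidean_space list \<Rightarrow> 'a \<Rightarrow> real" where
  "monomial [] v = 1"
| "monomial (i # is) v = (v \<bullet> i) * monomial is v"

fun monomial_deriv :: "'a::euclidean_space list \<Rightarrow> 'a \<Rightarrow> 'a \<Rightarrow> real" where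
  "monomial_deriv [] v b = 0"
| "monomial_deriv (i # is) v b = (b \<bullet> i) * monomial is v + (v \<bullet> i) * monomial_deriv is v b"

lemma monomial_has_derivative: "(monomial is has_derivative monomial_deriv is v) (at v)"
proof (induction "is")
  case Nil
  have "monomial [] = (\<lambda>v::'a. 1)" "monomial_deriv [] v = (\<lambda>b. 0)" by auto
  then show ?case by simp
next
  case (Cons i "is")
  have "((\<lambda>v. (v \<bullet> i) * monomial is v) has_derivative
      (\<lambda>b. (v \<bullet> i) * monomial_deriv is v b + (b \<bullet> i) * monomial is v)) (at v)"
    by (intro has_derivative_mult Cons bounded_linear.has_derivative[OF bounded_linear_inner_left] has_derivative_ident)
  moreover have "monomial (i # is) = (\<lambda>v. (v \<bullet> i) * monomial is v)"
    "monomial_deriv (i # is) v = (\<lambda>b. (v \<bullet> i) * monomial_deriv is v b + (b \<bullet> i) * monomial is v)" by auto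
  ultimately show ?case by simp
qed

lemma continuous_on_monomial: "continuous_on S (monomial is)"
  using has_derivative_continuous[OF monomial_has_derivative] by (intro continuous_at_imp_continuous_on) blast

lemma continuous_on_monomial_deriv: "continuous_on S (\<lambda>v. monomial_deriv is v b)"
  by (induction "is") (auto intro!: continuous_intros continuous_on_monomial)

lemma monomial_append: "monomial (is @ js) v = monomial is v * monomial js v"
  by (induction "is") auto

lemma monomial_scaleR: "monomial is (c *\<^sub>R v) = c ^ length is * monomial is v"
  by (induction "is") auto

lemma power_has_derivative_inner:
  fixes v :: "'a::euclidean_space"
  assumes "v \<noteq> 0"
  shows "((\<lambda>v. (v \<bullet> v) powr e) has_derivative (\<lambda>b. 2 * e * (v \<bullet> v) powr (e - 1) * (v \<bullet> b))) (at v)"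
proof -
  have pos: "0 < v \<bullet> v" using assms by simp
  have "((\<lambda>v. v \<bullet> v) has_derivative (\<lambda>b. 2 * (v \<bullet> b))) (at v)"
    by (auto intro!: derivative_eq_intros simp: inner_commute)
  moreover have "((\<lambda>r. r powr e) has_derivative (\<lambda>h. e * (v \<bullet> v) powr (e - 1) * h)) (at (v \<bullet> v))"
    using has_real_derivative_powr[OF pos, of e] by (simp add: has_field_derivative_def)
  ultimately have "((\<lambda>v. (v \<bullet> v) powr e) has_derivative (\<lambda>b. e * (v \<bullet> v) powr (e - 1) * (2 * (v \<bullet> b)))) (at v)"
    by (rule has_derivative_compose)
  then show ?thesis by (simp add: mult_ac)
qed

text \<open>Where \<open>u\<close> is nonzero, x - y stays in one compact annulus for all
  \<open>y\<close> in a ball. Kernels singular at 0 are therefore bounded wherever they are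
  evaluated against \<open>u\<close>.\<close>

context
  fixes u :: "'a::euclidean_space \<Rightarrow> real" and y0 :: 'a and r \<delta> R :: real
  assumes u: "integrable lebesgue u" and pos: "0 < r" "0 < \<delta>"
    and dist: "\<And>x y. u x \<noteq> 0 \<Longrightarrow> y \<in> ball y0 r \<Longrightarrow> \<delta> \<le> norm (x - y) \<and> norm (x - y) \<le> R"
begin

definition annulus :: "'a set" where
  "annulus = {v. \<delta> \<le> norm v \<and> norm v \<le> R}"

lemma compact_annulus: "compact annulus"
proof -
  have "annulus = cball 0 R \<inter> - ball 0 \<delta>" by (auto simp: annulus_def)
  moreover have "closed (- ball (0::'a) \<delta>)" by (rule closed_Compl) simp
  ultimately show ?thesis using compact_Int_closed[OF compact_cball] by metis
qed

lemma annulus_nonzero: "annulus \<subseteq> - {0}"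
  using pos by (auto simp: annulus_def)

lemma bounded_on_annulus:
  assumes "continuous_on (- {0}) (h :: 'a \<Rightarrow> real)"
  obtains M where "0 \<le> M" "\<And>v. v \<in> annulus \<Longrightarrow> \<bar>h v\<bar> \<le> M"
proof -
  have "bounded (h ` annulus)"
    by (intro compact_imp_bounded compact_continuous_image compact_annulus continuous_on_subset[OF assms annulus_nonzero])
  then obtain M where "\<And>v. v \<in> annulus \<Longrightarrow> \<bar>h v\<bar> \<le> M" by (auto simp: bounded_iff)
  then show ?thesis by (intro that[of "max M 0"]) (auto simp: le_max_iff_disj)
qed

lemma in_annulus: "u x \<noteq> 0 \<Longrightarrow> y \<in> ball y0 r \<Longrightarrow> x - y \<in> annulus"
  using dist by (simp add: annulus_def)

lemma kernel_measurable:
  assumes "continuous_on (- {0}) (h :: 'a \<Rightarrow> real)" "y \<in> ball y0 r"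
  shows "(\<lambda>x. u x * h (x - y)) \<in> borel_measurable lebesgue"
proof -
  have "(\<lambda>v. indicator (- {0}) v *\<^sub>R h v) \<in> borel_measurable borel"
    using borel_measurable_continuous_on_indicator[OF _ assms(1)] by simp
  moreover have "(\<lambda>x. x - y) \<in> borel_measurable borel" by measurable
  ultimately have "(\<lambda>x. indicator (- {0}) (x - y) *\<^sub>R h (x - y)) \<in> borel_measurable borel"
    by (rule measurable_compose[rotated])
  then have [measurable]: "(\<lambda>x. indicator (- {0}) (x - y) *\<^sub>R h (x - y)) \<in> borel_measurable lebesgue"
    by (intro measurable_completion) simp
  have [measurable]: "u \<in> borel_measurable lebesgue" using u by simp
  have "(\<lambda>x. u x * (indicator (- {0}) (x - y) *\<^sub>R h (x - y))) \<in> borel_measurable lebesgue" by measurable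
  moreover have "u x * (indicator (- {0}) (x - y) *\<^sub>R h (x - y)) = u x * h (x - y)" for x
    using in_annulus[OF _ assms(2), of x] annulus_nonzero by (cases "u x = 0") (auto simp: indicator_def)
  ultimately show ?thesis by (simp only:)
qed

lemma kernel_integrable:
  assumes h: "continuous_on (- {0}) (h :: 'a \<Rightarrow> real)" and y: "y \<in> ball y0 r"
  shows "integrable lebesgue (\<lambda>x. u x * h (x - y))"
proof -
  obtain M where M: "\<And>v. v \<in> annulus \<Longrightarrow> \<bar>h v\<bar> \<le> M" using bounded_on_annulus[OF h] by metis
  show ?thesis
  proof (rule Bochner_Integration.integrable_bound[OF integrable_mult_left[OF integrable_norm[OF u], of M] kernel_measurable[OF h y]])
    show "AE x in lebesgue. norm (u x * h (x - y)) \<le> norm (norm (u x) * M)"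
    proof (rule AE_I2)
      fix x
      show "norm (u x * h (x - y)) \<le> norm (norm (u x) * M)"
        using mult_left_mono[OF order_trans[OF M[OF in_annulus[OF _ y, of x]] abs_ge_self], of "\<bar>u x\<bar>"]
        by (cases "u x = 0") (auto simp: abs_mult)
    qed
  qed
qed

text \<open>The kernels for which the potential of \<open>u\<close> vanishes on the ball. Since the
  ball is open, potentials may be differentiated in \<open>y\<close>, and the space is closed under
  derivatives of the kernel.\<close>

definition ker_space :: "('a \<Rightarrow> real) set" where
  "ker_space = {h. continuous_on (- {0}) h \<and> (\<forall>y\<in>ball y0 r. (\<integral>x. u x * h (x - y) \<partial>lebesgue) = 0)}"

lemma ker_space_add: "f \<in> ker_space \<Longrightarrow> g \<in> ker_space \<Longrightarrow> (\<lambda>v. f v + g v) \<in> ker_space"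
  using kernel_integrable[of f] kernel_integrable[of g]
  by (auto simp: ker_space_def distrib_left intro!: continuous_intros)

lemma ker_space_mult: "f \<in> ker_space \<Longrightarrow> (\<lambda>v. c * f v) \<in> ker_space"
  by (auto simp: ker_space_def mult.left_commute[of _ c] intro!: continuous_intros)

lemma ker_space_sum: "finite I \<Longrightarrow> (\<And>i. i \<in> I \<Longrightarrow> f i \<in> ker_space) \<Longrightarrow> (\<lambda>v. \<Sum>i\<in>I. f i v) \<in> ker_space"
proof (induction I rule: finite_induct)
  case empty
  then show ?case by (simp add: ker_space_def)
qed (auto intro: ker_space_add)

lemma ker_space_cong: "f \<in> ker_space \<Longrightarrow> (\<And>v. v \<noteq> 0 \<Longrightarrow> g v = f v) \<Longrightarrow> g \<in> ker_space"
proof -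
  assume f: "f \<in> ker_space" and eq: "\<And>v. v \<noteq> 0 \<Longrightarrow> g v = f v"
  have "continuous_on (- {0}) g" using f eq by (subst continuous_on_cong[of _ "- {0}" g f]) (auto simp: ker_space_def)
  moreover have "u x * g (x - y) = u x * f (x - y)" if "y \<in> ball y0 r" for x y
  proof (cases "u x = 0")
    case False
    have "x - y \<noteq> 0" using in_annulus[OF False that] annulus_nonzero by auto
    from eq[OF this] show ?thesis by simp
  qed simp
  then have "(\<integral>x. u x * g (x - y) \<partial>lebesgue) = (\<integral>x. u x * f (x - y) \<partial>lebesgue)" if "y \<in> ball y0 r" for y
    using that by (simp only:)
  ultimately show ?thesis using f by (auto simp: ker_space_def)
qed

text \<open>Differentiation under the integral along \<open>y + t *\<^sub>R b\<close>. The mean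
  value theorem and the bound of \<open>h'\<close> on the annulus dominate the difference
  quotients.\<close>

lemma ker_space_deriv:
  assumes h: "h \<in> ker_space" and d: "\<And>v. v \<noteq> 0 \<Longrightarrow> (h has_derivative h' v) (at v)"
    and c: "continuous_on (- {0}) (\<lambda>v. h' v b)"
  shows "(\<lambda>v. h' v b) \<in> ker_space"
  unfolding ker_space_def mem_Collect_eq
proof (intro conjI ballI c)
  fix y assume y: "y \<in> ball y0 r"
  have hc: "continuous_on (- {0}) h" using h by (simp add: ker_space_def)
  obtain M where M: "0 \<le> M" "\<And>v. v \<in> annulus \<Longrightarrow> \<bar>h' v b\<bar> \<le> M" using bounded_on_annulus[OF c] by metis
  \<comment> \<open>Steps up to \<open>\<epsilon>\<close> keep the segment from \<open>y\<close>
    inside the ball; the summand 1 covers \<open>b = 0\<close>.\<close>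
  define \<epsilon> where "\<epsilon> = (r - dist y0 y) / (norm b + 1)"
  have \<epsilon>: "0 < \<epsilon>" using y by (auto simp: \<epsilon>_def intro!: divide_pos_pos add_nonneg_pos)
  have near: "y + t *\<^sub>R b \<in> ball y0 r" if "0 \<le> t" "t \<le> \<epsilon>" for t
  proof -
    have "dist y0 (y + t *\<^sub>R b) \<le> dist y0 y + t * norm b"
      using norm_triangle_ineq[of "y0 - y" "- t *\<^sub>R b"] that by (simp add: dist_norm algebra_simps)
    also have "\<dots> < dist y0 y + \<epsilon> * (norm b + 1)"
    proof -
      have "t * norm b \<le> \<epsilon> * norm b" using that by (intro mult_right_mono) auto
      then show ?thesis using \<epsilon> by (simp add: distrib_left)
    qed
    also have "\<dots> = r" using norm_ge_zero[of b] by (simp add: \<epsilon>_def add_nonneg_eq_0_iff)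
    finally show ?thesis by simp
  qed
  define t where "t k = \<epsilon> * (1 / real (Suc k))" for k
  have t: "0 < t k" "t k \<le> \<epsilon>" for k using \<epsilon> by (auto simp: t_def mult_le_cancel_left1 field_simps)
  have tlim: "t \<longlonglongrightarrow> 0" unfolding t_def using tendsto_mult[OF tendsto_const LIMSEQ_Suc[OF lim_1_over_n], of \<epsilon>] by simp
  define D where "D k x = (h (x - (y + t k *\<^sub>R b)) - h (x - y)) / t k" for k x
  have dv: "((\<lambda>\<tau>. h (x - y + \<tau> *\<^sub>R (- b))) has_real_derivative - h' (x - y + \<tau> *\<^sub>R (- b)) b) (at \<tau>)"
    if "x - y + \<tau> *\<^sub>R (- b) \<noteq> 0" for x \<tau>
  proof -
    have "((\<lambda>\<tau>. x - y + \<tau> *\<^sub>R (- b)) has_derivative (\<lambda>\<tau>. \<tau> *\<^sub>R (- b))) (at \<tau>)" by (auto intro!: derivative_eq_intros)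
    from has_derivative_compose[OF this d[OF that]]
    have 1: "((\<lambda>\<tau>. h (x - y + \<tau> *\<^sub>R (- b))) has_derivative (\<lambda>\<rho>. h' (x - y + \<tau> *\<^sub>R (- b)) (\<rho> *\<^sub>R (- b)))) (at \<tau>)" .
    have lin: "linear (h' (x - y + \<tau> *\<^sub>R (- b)))" by (rule has_derivative_linear[OF d[OF that]])
    have "(\<lambda>\<rho>. h' (x - y + \<tau> *\<^sub>R (- b)) (\<rho> *\<^sub>R (- b))) = (*) (- h' (x - y + \<tau> *\<^sub>R (- b)) b)"
    proof
      show "h' (x - y + \<tau> *\<^sub>R (- b)) (\<rho> *\<^sub>R (- b)) = - h' (x - y + \<tau> *\<^sub>R (- b)) b * \<rho>" for \<rho>
        using linear_scale[OF lin, of "- \<rho>" b] by simp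
    qed
    then show ?thesis using 1 unfolding has_field_derivative_def by (simp only:)
  qed
  have nz: "x - y + \<tau> *\<^sub>R (- b) \<in> annulus" if "u x \<noteq> 0" "0 \<le> \<tau>" "\<tau> \<le> \<epsilon>" for x \<tau>
    using in_annulus[OF that(1) near[OF that(2,3)]] by (simp add: algebra_simps)
  have Deq: "D k x = (h (x - y + t k *\<^sub>R (- b)) - h (x - y + 0 *\<^sub>R (- b))) / t k" for k x
    by (simp add: D_def algebra_simps)
  have Db: "\<bar>u x * D k x\<bar> \<le> \<bar>u x\<bar> * M" for x k
  proof (cases "u x = 0")
    case False
    have "\<exists>\<tau>>0. \<tau> < t k \<and> h (x - y + t k *\<^sub>R (- b)) - h (x - y + 0 *\<^sub>R (- b)) = (t k - 0) * (- h' (x - y + \<tau> *\<^sub>R (- b)) b)"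
    proof (rule MVT2[OF t(1)])
      fix \<tau> assume "0 \<le> \<tau>" "\<tau> \<le> t k"
      then show "((\<lambda>\<tau>. h (x - y + \<tau> *\<^sub>R (- b))) has_real_derivative - h' (x - y + \<tau> *\<^sub>R (- b)) b) (at \<tau>)"
        using nz[OF False, of \<tau>] t(2)[of k] annulus_nonzero by (intro dv) auto
    qed
    then obtain \<tau> where \<tau>: "0 < \<tau>" "\<tau> < t k" "h (x - y + t k *\<^sub>R (- b)) - h (x - y + 0 *\<^sub>R (- b)) = (t k - 0) * (- h' (x - y + \<tau> *\<^sub>R (- b)) b)" by blast
    have "D k x = - h' (x - y + \<tau> *\<^sub>R (- b)) b" unfolding Deq \<tau>(3) using t(1)[of k] by simp
    then have "\<bar>D k x\<bar> \<le> M" using M(2)[OF nz[OF False, of \<tau>]] \<tau> t(2)[of k] by simp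
    then show ?thesis by (simp add: abs_mult mult_left_mono)
  qed simp
  have "(\<lambda>k. \<integral>x. u x * D k x \<partial>lebesgue) \<longlonglongrightarrow> (\<integral>x. u x * (- h' (x - y) b) \<partial>lebesgue)"
  proof (rule integral_dominated_convergence[where w="\<lambda>x. \<bar>u x\<bar> * M"])
    show "integrable lebesgue (\<lambda>x. \<bar>u x\<bar> * M)" using u by simp
    show "(\<lambda>x. u x * (- h' (x - y) b)) \<in> borel_measurable lebesgue"
      using kernel_measurable[OF c y] by simp
    have "(\<lambda>x. u x * D k x) = (\<lambda>x. (u x * h (x - (y + t k *\<^sub>R b)) - u x * h (x - y)) / t k)" for k
      by (auto simp: D_def right_diff_distrib diff_divide_distrib)
    then show "\<And>k. (\<lambda>x. u x * D k x) \<in> borel_measurable lebesgue"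
      using kernel_measurable[OF hc y] kernel_measurable[OF hc near[OF less_imp_le[OF t(1)] t(2)]] by simp
    show "AE x in lebesgue. (\<lambda>k. u x * D k x) \<longlonglongrightarrow> u x * (- h' (x - y) b)"
    proof (rule AE_I2)
      fix x
      show "(\<lambda>k. u x * D k x) \<longlonglongrightarrow> u x * (- h' (x - y) b)"
      proof (cases "u x = 0")
        case False
        have "x - y + 0 *\<^sub>R (- b) \<noteq> 0" using nz[OF False, of 0] \<epsilon> annulus_nonzero by auto
        from dv[OF this] have l: "((\<lambda>\<rho>. (h (x - y + (0 + \<rho>) *\<^sub>R (- b)) - h (x - y + 0 *\<^sub>R (- b))) / \<rho>) \<longlongrightarrow> - h' (x - y + 0 *\<^sub>R (- b)) b) (at 0)"
          unfolding DERIV_def .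
        have "filterlim t (at 0) sequentially"
          using tlim t(1) by (auto simp: filterlim_at less_imp_neq[THEN not_sym])
        from filterlim_compose[OF l this] have "(\<lambda>k. D k x) \<longlonglongrightarrow> - h' (x - y) b" unfolding Deq by simp
        then show ?thesis by (intro tendsto_intros)
      qed simp
    qed
    show "\<And>k. AE x in lebesgue. norm (u x * D k x) \<le> \<bar>u x\<bar> * M" using Db by (intro AE_I2) simp
  qed
  moreover have "(\<integral>x. u x * D k x \<partial>lebesgue) = 0" for k
  proof -
    have y': "y + t k *\<^sub>R b \<in> ball y0 r" by (rule near[OF less_imp_le[OF t(1)] t(2)])
    have "(\<integral>x. u x * D k x \<partial>lebesgue) = (\<integral>x. (u x * h (x - (y + t k *\<^sub>R b)) - u x * h (x - y)) / t k \<partial>lebesgue)"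
      by (intro Bochner_Integration.integral_cong) (auto simp: D_def right_diff_distrib diff_divide_distrib)
    also have "\<dots> = 0" using h y y' kernel_integrable[OF hc y] kernel_integrable[OF hc y'] by (simp add: ker_space_def)
    finally show ?thesis .
  qed
  ultimately have "(\<integral>x. u x * (- h' (x - y) b) \<partial>lebesgue) = 0" by (simp add: LIMSEQ_const_iff)
  then show "(\<integral>x. u x * h' (x - y) b \<partial>lebesgue) = 0" by simp
qed

text \<open>Testing yields vanishing only almost everywhere. The complement of a null set is dense
  in the ball, and the potential is continuous there.\<close>

lemma ker_space_AE:
  assumes c: "continuous_on (- {0}) h" and ae: "AE y in lebesgue. y \<in> ball y0 r \<longrightarrow> (\<integral>x. u x * h (x - y) \<partial>lebesgue) = 0"
  shows "h \<in> ker_space"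
  unfolding ker_space_def mem_Collect_eq
proof (intro conjI ballI c)
  fix y assume y: "y \<in> ball y0 r"
  obtain M where M: "0 \<le> M" "\<And>v. v \<in> annulus \<Longrightarrow> \<bar>h v\<bar> \<le> M" using bounded_on_annulus[OF c] by metis
  have "\<exists>N\<in>null_sets lebesgue. {y \<in> space lebesgue. \<not> (y \<in> ball y0 r \<longrightarrow> (\<integral>x. u x * h (x - y) \<partial>lebesgue) = 0)} \<subseteq> N"
    using ae by (simp only: eventually_ae_filter)
  then obtain N where N: "N \<in> null_sets lebesgue"
    "{y \<in> space lebesgue. \<not> (y \<in> ball y0 r \<longrightarrow> (\<integral>x. u x * h (x - y) \<partial>lebesgue) = 0)} \<subseteq> N" by (elim bexE)
  have "\<exists>z. z \<in> ball y (1 / Suc k) \<inter> ball y0 r \<and> z \<notin> N" for k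
  proof (rule ccontr)
    assume "\<not> ?thesis"
    then have "ball y (1 / Suc k) \<inter> ball y0 r \<subseteq> N" by blast
    then have "negligible (ball y (1 / Suc k) \<inter> ball y0 r)"
      using negligible_subset[of N] N(1) by (simp add: negligible_iff_null_sets)
    moreover have "y \<in> ball y (1 / Suc k) \<inter> ball y0 r" using y by simp
    ultimately show False using open_not_negligible[OF open_Int[OF open_ball open_ball]] by (metis empty_iff)
  qed
  then obtain z where z: "\<And>k. z k \<in> ball y (1 / real (Suc k))" "\<And>k. z k \<in> ball y0 r" "\<And>k. z k \<notin> N"
    unfolding Int_iff by metis
  have zl: "z \<longlonglongrightarrow> y"
  proof (rule metric_tendsto_imp_tendsto[OF LIMSEQ_Suc[OF lim_1_over_n]])
    show "\<forall>\<^sub>F k in sequentially. dist (z k) y \<le> dist (1 / real (Suc k)) 0"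
      using z(1) by (intro always_eventually allI) (auto simp: dist_commute less_imp_le)
  qed
  have "(\<lambda>k. \<integral>x. u x * h (x - z k) \<partial>lebesgue) \<longlonglongrightarrow> (\<integral>x. u x * h (x - y) \<partial>lebesgue)"
  proof (rule integral_dominated_convergence[where w="\<lambda>x. \<bar>u x\<bar> * M"])
    show "integrable lebesgue (\<lambda>x. \<bar>u x\<bar> * M)" using u by simp
    show "AE x in lebesgue. (\<lambda>k. u x * h (x - z k)) \<longlonglongrightarrow> u x * h (x - y)"
    proof (rule AE_I2)
      fix x
      show "(\<lambda>k. u x * h (x - z k)) \<longlonglongrightarrow> u x * h (x - y)"
      proof (cases "u x = 0")
        case False
        have "x - y \<in> - {0}" using in_annulus[OF False y] annulus_nonzero by blast
        then have "isCont h (x - y)" using c by (simp add: continuous_on_eq_continuous_at open_Compl)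
        then show ?thesis by (intro tendsto_intros isCont_tendsto_compose[of _ h] zl)
      qed simp
    qed
    show "\<And>k. AE x in lebesgue. norm (u x * h (x - z k)) \<le> \<bar>u x\<bar> * M"
    proof (rule AE_I2)
      fix k x
      show "norm (u x * h (x - z k)) \<le> \<bar>u x\<bar> * M"
        using M(2)[OF in_annulus[OF _ z(2), of x]] by (cases "u x = 0") (auto simp: abs_mult mult_left_mono)
    qed
  qed (use kernel_measurable[OF c] y z(2) in auto)
  moreover have "(\<integral>x. u x * h (x - z k) \<partial>lebesgue) = 0" for k
    using subsetD[OF N(2), of "z k"] z(2,3)[of k] by (auto simp del: mem_ball)
  ultimately show "(\<integral>x. u x * h (x - y) \<partial>lebesgue) = 0" by (simp add: LIMSEQ_const_iff)
qed

text \<open>The derivative of the power supplies the new direction and lowers the exponent by one;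
  the derivative of the monomial is a lower-order term that has to be removed afterwards.\<close>

lemma monomial_kernel_deriv:
  assumes f: "(\<lambda>v. (v \<bullet> v) powr e * monomial is v) \<in> ker_space"
  shows "(\<lambda>v. 2 * e * ((v \<bullet> v) powr (e - 1) * monomial (b # is) v) + (v \<bullet> v) powr e * monomial_deriv is v b) \<in> ker_space"
proof -
  define h' where "h' v b = (v \<bullet> v) powr e * monomial_deriv is v b
    + (2 * e * (v \<bullet> v) powr (e - 1) * (v \<bullet> b)) * monomial is v" for v b
  have "(\<lambda>v. h' v b) \<in> ker_space"
  proof (rule ker_space_deriv[OF f])
    show "((\<lambda>v. (v \<bullet> v) powr e * monomial is v) has_derivative h' v) (at v)" if "v \<noteq> 0" for v
      unfolding h'_def by (intro has_derivative_mult power_has_derivative_inner that monomial_has_derivative)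
    show "continuous_on (- {0}) (\<lambda>v. h' v b)" unfolding h'_def
      by (intro continuous_intros continuous_on_monomial continuous_on_monomial_deriv) auto
  qed
  then show ?thesis by (rule ker_space_cong) (simp add: h'_def algebra_simps)
qed

text \<open>By the product rule the derivative of a monomial is a combination of monomials with one
  factor less; \<open>js\<close> collects the factors already passed.\<close>

lemma monomial_deriv_kernel:
  assumes "\<And>ks. ks \<in> lists Basis \<Longrightarrow> Suc (length ks) = length js + length is \<Longrightarrow>
      (\<lambda>v. (v \<bullet> v) powr e * monomial ks v) \<in> ker_space"
    and "js \<in> lists Basis" "is \<in> lists Basis"
  shows "(\<lambda>v. (v \<bullet> v) powr e * (monomial js v * monomial_deriv is v b)) \<in> ker_space"
  using assms
proof (induction "is" arbitrary: js)
  case Nil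
  then show ?case by (simp add: ker_space_def)
next
  case (Cons i "is")
  have 1: "(\<lambda>v. (b \<bullet> i) * ((v \<bullet> v) powr e * monomial (js @ is) v)) \<in> ker_space"
    by (intro ker_space_mult Cons.prems(1)) (use Cons.prems in auto)
  have 2: "(\<lambda>v. (v \<bullet> v) powr e * (monomial (js @ [i]) v * monomial_deriv is v b)) \<in> ker_space"
    by (rule Cons.IH) (use Cons.prems in auto)
  show ?case using ker_space_add[OF 1 2]
    by (rule ker_space_cong) (simp add: monomial_append algebra_simps)
qed

text \<open>Pure powers with exponent lowered by \<open>k\<close> come from a gradient followed by a
  divergence, and monomials from further derivatives. The parameter \<open>k\<close> is kept general
  because the lower-order terms of such a derivative have fewer factors at the same
  exponent.\<close>

lemma monomial_kernels:
  fixes s :: real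
  assumes s: "0 < s" and base: "(\<lambda>v. (v \<bullet> v) powr - (DIM('a) / 2 + s)) \<in> ker_space"
    and is_: "is \<in> lists Basis"
  shows "(\<lambda>v. (v \<bullet> v) powr - (DIM('a) / 2 + s + real k + real (length is)) * monomial is v) \<in> ker_space"
proof -
  define e where "e k = - (DIM('a) / 2 + s + real k)" for k :: nat
  have e0: "e k < 0" for k using s by (auto simp: e_def intro!: add_pos_nonneg add_nonneg_pos)
  have e1: "e k - 1 = e (Suc k)" for k by (simp add: e_def)
  have zero: "(\<lambda>v. (v \<bullet> v) powr e k * monomial [] v) \<in> ker_space" for k
  proof (induction k)
    case 0
    then show ?case using base by (simp add: e_def)
  next
    case (Suc k)
    let ?e = "e (Suc k)"
    have one: "(\<lambda>v. (v \<bullet> v) powr ?e * monomial [b] v) \<in> ker_space" for b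
      using ker_space_mult[OF monomial_kernel_deriv[OF Suc, of b], of "1 / (2 * e k)"]
      by (rule ker_space_cong) (use e0[of k] in \<open>simp add: e1\<close>)
    \<comment> \<open>The divergence of the field |v|^(2e) v is (2e + n) |v|^(2e). For the exponent
      at hand the factor is - 2s - 2(k + 1), which is not zero.\<close>
    have "(\<lambda>v. \<Sum>b\<in>Basis. 2 * ?e * ((v \<bullet> v) powr (?e - 1) * monomial [b, b] v) + (v \<bullet> v) powr ?e * monomial_deriv [b] v b) \<in> ker_space"
      by (intro ker_space_sum monomial_kernel_deriv one) auto
    then have "(\<lambda>v. (2 * ?e + DIM('a)) * (v \<bullet> v) powr ?e) \<in> ker_space"
    proof (rule ker_space_cong)
      fix v :: 'a assume v: "v \<noteq> 0"
      have "(\<Sum>b\<in>Basis. 2 * ?e * ((v \<bullet> v) powr (?e - 1) * monomial [b, b] v) + (v \<bullet> v) powr ?e * monomial_deriv [b] v b)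
          = 2 * ?e * ((v \<bullet> v) powr (?e - 1) * (\<Sum>b\<in>Basis. (v \<bullet> b) * (v \<bullet> b))) + DIM('a) * (v \<bullet> v) powr ?e"
        by (simp add: sum.distrib sum_distrib_left)
      also have "(\<Sum>b\<in>Basis. (v \<bullet> b) * (v \<bullet> b)) = v \<bullet> v" by (rule euclidean_inner[symmetric])
      also have "(v \<bullet> v) powr (?e - 1) * (v \<bullet> v) = (v \<bullet> v) powr ?e"
        using v powr_mult_base[of "v \<bullet> v" "?e - 1"] by (simp add: mult.commute)
      finally show "(2 * ?e + DIM('a)) * (v \<bullet> v) powr ?e
          = (\<Sum>b\<in>Basis. 2 * ?e * ((v \<bullet> v) powr (?e - 1) * monomial [b, b] v) + (v \<bullet> v) powr ?e * monomial_deriv [b] v b)"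
        by (simp add: distrib_right)
    qed
    from ker_space_mult[OF this, of "1 / (2 * ?e + DIM('a))"] show ?case
    proof (rule ker_space_cong)
      have "2 * ?e + DIM('a) = - (2 * s + 2 * real (Suc k))" by (simp add: e_def)
      then have "2 * ?e + DIM('a) \<noteq> 0" using s by simp
      then show "(v \<bullet> v) powr ?e * monomial [] v = 1 / (2 * ?e + DIM('a)) * ((2 * ?e + DIM('a)) * (v \<bullet> v) powr ?e)" for v :: 'a
        by simp
    qed
  qed
  have "(\<lambda>v. (v \<bullet> v) powr e (k + length is) * monomial is v) \<in> ker_space" if "is \<in> lists Basis" for k "is"
    using that
  proof (induction "length is" arbitrary: k "is" rule: less_induct)
    case less
    show ?case
    proof (cases "is")
      case Nil
      then show ?thesis using zero[of k] by simp
    next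
      case (Cons b js)
      have js: "js \<in> lists Basis" using less.prems Cons by auto
      let ?e = "e (k + length js)"
      have f: "(\<lambda>v. (v \<bullet> v) powr ?e * monomial js v) \<in> ker_space"
        by (rule less.hyps) (use Cons js in auto)
      have g: "(\<lambda>v. (v \<bullet> v) powr ?e * (monomial [] v * monomial_deriv js v b)) \<in> ker_space"
      proof (rule monomial_deriv_kernel[OF _ _ js])
        fix ks :: "'a list" assume ks: "ks \<in> lists Basis" "Suc (length ks) = length ([] :: 'a list) + length js"
        show "(\<lambda>v. (v \<bullet> v) powr ?e * monomial ks v) \<in> ker_space"
        proof -
          \<comment> \<open>The missing factor is made up by \<open>Suc k\<close>, so the induction
            hypothesis applies at the same exponent.\<close>
          have "k + length js = Suc k + length ks" using ks(2) by simp
          moreover have "length ks < length is" using ks(2) Cons by simp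
          ultimately show ?thesis using less.hyps[of ks "Suc k"] ks(1) by (simp only:)
        qed
      qed simp
      have "(\<lambda>v. 1 / (2 * ?e) * ((2 * ?e * ((v \<bullet> v) powr (?e - 1) * monomial (b # js) v) + (v \<bullet> v) powr ?e * monomial_deriv js v b)
          + (- 1) * ((v \<bullet> v) powr ?e * (monomial [] v * monomial_deriv js v b)))) \<in> ker_space"
        by (intro ker_space_mult ker_space_add[OF monomial_kernel_deriv[OF f] ker_space_mult[OF g]])
      then show ?thesis
        by (rule ker_space_cong) (use e0[of "k + length js"] Cons in \<open>simp add: e1\<close>)
    qed
  qed
  from this[OF is_, of k] show ?thesis by (simp add: e_def add.assoc)
qed

text \<open>The monomials of v/|v|^2 times |v|^(-n-2s) are the kernels of
  \<open>monomial_kernels\<close> with k = 0. So every polynomial in the inverted variable, with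
  this weight, is annihilated by \<open>u\<close>. The inversion maps the annulus onto a compact
  set, on which polynomials approximate the test functions uniformly.\<close>

lemma AE_zero_if_riesz_kernel:
  assumes s: "0 < s" and base: "(\<lambda>v. (v \<bullet> v) powr - (DIM('a) / 2 + s)) \<in> ker_space"
  shows "AE x in lebesgue. u x = 0"
proof -
  define p where "p = DIM('a) / 2 + s"
  define k where "k f v = (v \<bullet> v) powr - p * f ((1 / (v \<bullet> v)) *\<^sub>R v)" for f :: "'a \<Rightarrow> real" and v :: 'a
  have kc: "continuous_on (- {0}) (k f)" if "continuous_on UNIV f" for f
    unfolding k_def
    by (intro continuous_intros continuous_on_compose2[OF that]) auto
  \<comment> \<open>The monomial in front makes \<open>Q\<close> stable under multiplication by
    coordinates, so that polynomial factors are absorbed one at a time.\<close>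
  define Q where "Q = {f. continuous_on UNIV f \<and> (\<forall>js\<in>lists Basis. k (\<lambda>\<eta>. monomial js \<eta> * f \<eta>) \<in> ker_space)}"
  have Q1: "(\<lambda>_. 1) \<in> Q"
  proof -
    have "k (\<lambda>\<eta>. monomial js \<eta> * 1) \<in> ker_space" if "js \<in> lists Basis" for js
    proof (rule ker_space_cong[OF monomial_kernels[OF s base that, of 0]])
      fix v :: 'a assume "v \<noteq> 0"
      then have "0 < v \<bullet> v" by simp
      then have "(v \<bullet> v) powr (- p - real (length js)) = (v \<bullet> v) powr - p * (1 / (v \<bullet> v)) ^ length js"
        by (simp add: powr_diff powr_realpow power_one_over)
      then show "k (\<lambda>\<eta>. monomial js \<eta> * 1) v = (v \<bullet> v) powr - (DIM('a) / 2 + s + real 0 + real (length js)) * monomial js v"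
        by (simp add: k_def p_def monomial_scaleR)
    qed
    then show ?thesis by (simp add: Q_def)
  qed
  have Qadd: "(\<lambda>\<eta>. f \<eta> + g \<eta>) \<in> Q" if "f \<in> Q" "g \<in> Q" for f g
  proof -
    have "k (\<lambda>\<eta>. monomial js \<eta> * (f \<eta> + g \<eta>)) \<in> ker_space" if js: "js \<in> lists Basis" for js
    proof -
      have "k (\<lambda>\<eta>. monomial js \<eta> * f \<eta>) \<in> ker_space" "k (\<lambda>\<eta>. monomial js \<eta> * g \<eta>) \<in> ker_space"
        using \<open>f \<in> Q\<close> \<open>g \<in> Q\<close> js unfolding Q_def by blast+
      from ker_space_add[OF this] show ?thesis by (rule ker_space_cong) (simp add: k_def distrib_left)
    qed
    then show ?thesis using that by (auto simp: Q_def intro!: continuous_intros)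
  qed
  have Qmult: "(\<lambda>\<eta>. c * f \<eta>) \<in> Q" if "f \<in> Q" for c f
  proof -
    have "k (\<lambda>\<eta>. monomial js \<eta> * (c * f \<eta>)) \<in> ker_space" if js: "js \<in> lists Basis" for js
    proof -
      have "k (\<lambda>\<eta>. monomial js \<eta> * f \<eta>) \<in> ker_space"
        using \<open>f \<in> Q\<close> js unfolding Q_def by blast
      from ker_space_mult[OF this, of c] show ?thesis by (rule ker_space_cong) (simp add: k_def mult_ac)
    qed
    then show ?thesis using that by (auto simp: Q_def intro!: continuous_intros)
  qed
  have Qcoord: "(\<lambda>\<eta>. (\<eta> \<bullet> b) * f \<eta>) \<in> Q" if "f \<in> Q" "b \<in> Basis" for b f
  proof -
    have "k (\<lambda>\<eta>. monomial js \<eta> * ((\<eta> \<bullet> b) * f \<eta>)) \<in> ker_space" if js: "js \<in> lists Basis" for js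
    proof -
      have "b # js \<in> lists Basis" using js \<open>b \<in> Basis\<close> by simp
      then have "k (\<lambda>\<eta>. monomial (b # js) \<eta> * f \<eta>) \<in> ker_space" using \<open>f \<in> Q\<close> unfolding Q_def by blast
      then show ?thesis by (simp add: mult_ac)
    qed
    then show ?thesis using that by (auto simp: Q_def intro!: continuous_intros)
  qed
  have Qsum: "finite I \<Longrightarrow> (\<And>i. i \<in> I \<Longrightarrow> f i \<in> Q) \<Longrightarrow> (\<lambda>\<eta>. \<Sum>i\<in>I. f i \<eta>) \<in> Q" for f :: "'a \<Rightarrow> 'a \<Rightarrow> real" and I
  proof (induction I rule: finite_induct)
    case empty
    then show ?case using Qmult[OF Q1, of 0] by simp
  qed (auto intro: Qadd)
  have Qpoly: "\<forall>f\<in>Q. (\<lambda>\<eta>. g \<eta> * f \<eta>) \<in> Q" if "real_polynomial_function g" for g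
    using that
  proof (induction rule: real_polynomial_function.induct)
    case (linear g)
    interpret g: bounded_linear g by fact
    have eq: "g \<eta> = (\<Sum>b\<in>Basis. g b * (\<eta> \<bullet> b))" for \<eta>
      by (subst euclidean_representation[symmetric, of \<eta>]) (simp add: g.sum g.scaleR mult.commute)
    have eq': "(\<lambda>\<eta>. g \<eta> * f \<eta>) = (\<lambda>\<eta>. \<Sum>b\<in>Basis. g b * ((\<eta> \<bullet> b) * f \<eta>))" for f
      by (rule ext) (subst eq, simp add: sum_distrib_right mult.assoc)
    show ?case by (intro ballI, subst eq') (intro Qsum Qmult Qcoord finite_Basis)
  next
    case (const c)
    then show ?case by (auto intro: Qmult)
  next
    case (add g h)
    then show ?case by (auto simp: distrib_right intro: Qadd)
  next
    case (mult g h)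
    then show ?case by (auto simp: mult.assoc)
  qed
  have y0: "y0 \<in> ball y0 r" using pos by simp
  have poly0: "(\<integral>x. u x * k g (x - y0) \<partial>lebesgue) = 0" if "real_polynomial_function g" for g
  proof -
    have "g \<in> Q" using bspec[OF Qpoly[OF that] Q1] by simp
    then have "k (\<lambda>\<eta>. monomial [] \<eta> * g \<eta>) \<in> ker_space" unfolding Q_def by blast
    then show ?thesis using y0 by (simp add: ker_space_def)
  qed
  obtain M where M: "0 \<le> M" "\<And>v. v \<in> annulus \<Longrightarrow> \<bar>k (\<lambda>_. 1) v\<bar> \<le> M"
    by (rule bounded_on_annulus[OF kc[OF continuous_on_const]], rule that)
  have test: "(\<integral>x. u x * \<phi> x \<partial>lebesgue) = 0" if \<phi>: "continuous_on UNIV \<phi>" for \<phi> :: "'a \<Rightarrow> real"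
  proof -
    define K where "K = (\<lambda>v. (1 / (v \<bullet> v)) *\<^sub>R v) ` annulus"
    have Kc: "compact K" unfolding K_def
      by (intro compact_continuous_image compact_annulus continuous_on_subset[OF _ annulus_nonzero] continuous_intros) auto
    \<comment> \<open>The test function in the inverted variable with the weight divided out, so
      that \<open>k H\<close> returns the test function on the annulus.\<close>
    define H where "H \<eta> = \<phi> (y0 + (1 / (\<eta> \<bullet> \<eta>)) *\<^sub>R \<eta>) * (\<eta> \<bullet> \<eta>) powr - p" for \<eta>
    have K0: "0 \<notin> K" using annulus_nonzero by (auto simp: K_def)
    have Hc: "continuous_on K H" unfolding H_def using K0
      by (intro continuous_intros continuous_on_compose2[OF \<phi>]) auto
    have Heq: "k H v = \<phi> (y0 + v)" if "v \<in> annulus" for v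
    proof -
      have pos: "0 < v \<bullet> v" using that annulus_nonzero by auto
      have "(1 / (v \<bullet> v)) *\<^sub>R v \<bullet> (1 / (v \<bullet> v)) *\<^sub>R v = 1 / (v \<bullet> v)" using pos by (simp add: field_simps)
      moreover have "(v \<bullet> v) powr - p * (1 / (v \<bullet> v)) powr - p = 1"
        using pos by (simp add: powr_divide powr_minus field_simps)
      ultimately show ?thesis using pos by (simp add: k_def H_def mult.left_commute)
    qed
    define C where "C = M * (\<integral>x. \<bar>u x\<bar> \<partial>lebesgue)"
    have C0: "0 \<le> C" using M(1) by (simp add: C_def)
    have bound: "\<bar>\<integral>x. u x * \<phi> x \<partial>lebesgue\<bar> \<le> e * C" if e: "0 < e" for e
    proof -
      obtain g where g: "real_polynomial_function g" "\<And>\<eta>. \<eta> \<in> K \<Longrightarrow> \<bar>H \<eta> - g \<eta>\<bar> < e"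
        using Stone_Weierstrass_real_polynomial_function[OF Kc Hc e] by metis
      have gc: "continuous_on UNIV g" using g(1) by (rule continuous_real_polymonial_function[THEN continuous_at_imp_continuous_on[OF ballI]])
      have pw: "\<bar>u x * \<phi> x - u x * k g (x - y0)\<bar> \<le> e * M * \<bar>u x\<bar>" for x
      proof (cases "u x = 0")
        case False
        have v: "x - y0 \<in> annulus" by (rule in_annulus[OF False y0])
        have "\<phi> x - k g (x - y0) = k H (x - y0) - k g (x - y0)" using Heq[OF v] by simp
        also have "\<dots> = k (\<lambda>_. 1) (x - y0) * (H ((1 / ((x - y0) \<bullet> (x - y0))) *\<^sub>R (x - y0)) - g ((1 / ((x - y0) \<bullet> (x - y0))) *\<^sub>R (x - y0)))"
          by (simp add: k_def right_diff_distrib)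
        finally have "\<bar>\<phi> x - k g (x - y0)\<bar> \<le> M * e"
          using M(2)[OF v] g(2)[of "(1 / ((x - y0) \<bullet> (x - y0))) *\<^sub>R (x - y0)"] v M(1)
          by (simp only: abs_mult) (intro mult_mono, auto simp: K_def)
        then have "\<bar>u x\<bar> * \<bar>\<phi> x - k g (x - y0)\<bar> \<le> \<bar>u x\<bar> * (M * e)" by (intro mult_left_mono) auto
        then show ?thesis by (simp add: abs_mult[symmetric] right_diff_distrib mult_ac)
      qed simp
      have i2: "integrable lebesgue (\<lambda>x. u x * k g (x - y0))" by (rule kernel_integrable[OF kc[OF gc] y0])
      have i1: "integrable lebesgue (\<lambda>x. u x * \<phi> x)"
      proof -
        have "continuous_on (- {0}) (\<lambda>v. \<phi> (v + y0))" by (intro continuous_on_compose2[OF \<phi>] continuous_intros) auto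
        from kernel_integrable[OF this y0] show ?thesis by simp
      qed
      have "(\<integral>x. u x * \<phi> x \<partial>lebesgue) = (\<integral>x. u x * \<phi> x - u x * k g (x - y0) \<partial>lebesgue)"
        using i1 i2 poly0[OF g(1)] by simp
      also have "\<bar>\<dots>\<bar> \<le> (\<integral>x. e * M * \<bar>u x\<bar> \<partial>lebesgue)"
      proof (rule order_trans[OF integral_abs_bound integral_mono])
        show "integrable lebesgue (\<lambda>x. \<bar>u x * \<phi> x - u x * k g (x - y0)\<bar>)" using i1 i2 by (intro integrable_abs Bochner_Integration.integrable_diff)
        show "integrable lebesgue (\<lambda>x. e * M * \<bar>u x\<bar>)" using u by simp
      qed (rule pw)
      finally show ?thesis by (simp add: C_def mult.assoc)
    qed
    show ?thesis
    proof (rule ccontr)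
      assume n: "(\<integral>x. u x * \<phi> x \<partial>lebesgue) \<noteq> 0"
      let ?a = "\<bar>\<integral>x. u x * \<phi> x \<partial>lebesgue\<bar>"
      \<comment> \<open>\<open>C\<close> may be 0, so the error is measured against
        \<open>C + 1\<close>.\<close>
      define D where "D = C + 1"
      have D: "0 < D" "C \<le> D" using C0 by (auto simp: D_def)
      have "?a \<le> ?a / (2 * D) * C" by (rule bound) (use n D in simp)
      also have "\<dots> \<le> ?a / (2 * D) * D" using D by (intro mult_left_mono) auto
      also have "\<dots> = ?a / 2" using D by simp
      finally show False using n by simp
    qed
  qed
  have "AE x in lebesgue. x \<in> UNIV \<longrightarrow> complex_of_real (u x) = 0"
  proof (rule AE_zero_if_test_integrals_zero[OF open_UNIV])
    show "integrable lebesgue (\<lambda>x. indicator (cbox a b) x *\<^sub>R complex_of_real (u x))" for a b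
      using u by (intro integrable_mult_indicator) auto
    show "(\<integral>x. complex_of_real (u x) * of_real (\<phi> x) \<partial>lebesgue) = 0" if "\<phi> \<in> test_functions UNIV" for \<phi>
      using test[OF smooth_continuous[OF test_functionsD(1)[OF that]]] by (simp flip: of_real_mult)
  qed
  then show ?thesis by simp
qed

end

section \<open>The kernel of the fractional Laplacian\<close>

lemma integrable_powr_near_0:
  fixes a :: real
  assumes "a > -1"
  shows "integrable lebesgue (\<lambda>t::real. indicator {0..1} t * t powr a)"
proof -
  have "(\<lambda>t. t powr a) integrable_on {0..1}" using assms by (intro integrable_on_powr_from_0) auto
  then have "(\<lambda>t. t powr a) absolutely_integrable_on {0..1}" by (intro nonnegative_absolutely_integrable_1) auto
  then show ?thesis by (simp add: set_integrable_def)
qed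

lemma integrable_powr_at_inf:
  fixes a :: real
  assumes "a < -1"
  shows "integrable lebesgue (\<lambda>t::real. indicator {1..} t * t powr a)"
proof -
  have "(\<lambda>t. t powr a) integrable_on {1..}"
    using has_integral_powr_to_inf[of a 1] assms by (auto simp: integrable_on_def)
  then have "(\<lambda>t. t powr a) absolutely_integrable_on {1..}" by (intro nonnegative_absolutely_integrable_1) auto
  then show ?thesis by (simp add: set_integrable_def)
qed

lemma integral_pos_half_line:
  fixes f :: "real \<Rightarrow> real"
  assumes i: "integrable lebesgue f" and pos: "\<And>t. t > 0 \<Longrightarrow> f t > 0" and z: "\<And>t. t \<le> 0 \<Longrightarrow> f t = 0"
  shows "0 < (\<integral>t. f t \<partial>lebesgue)"
proof -
  have nn: "0 \<le> f t" for t using pos[of t] z[of t] by (cases "t > 0") auto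
  have "(\<integral>t. f t \<partial>lebesgue) \<noteq> 0"
  proof
    assume "(\<integral>t. f t \<partial>lebesgue) = 0"
    then have "AE t in lebesgue. f t = 0" using integral_nonneg_eq_0_iff_AE[OF i] nn by simp
    then have "AE t in lebesgue. t \<notin> box 0 (1::real)"
      by eventually_elim (use pos in \<open>force simp: box_real\<close>)
    then have "box 0 (1::real) \<in> null_sets lebesgue" by (subst (asm) AE_iff_null_sets[symmetric]) auto
    then have "negligible (box 0 (1::real))" by (simp add: negligible_iff_null_sets)
    then show False using open_not_negligible[of "box 0 (1::real)"] by (auto simp: box_real)
  qed
  moreover have "0 \<le> (\<integral>t. f t \<partial>lebesgue)" using nn by simp
  ultimately show ?thesis by simp
qed

text \<open>Integrals over t > 0 are written over the whole line with this cut-off, so that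
  substitutions and Fubini's theorem use one measure throughout.\<close>

definition half :: "real \<Rightarrow> real" where "half = indicator {0<..}"

lemma half_measurable [measurable]: "half \<in> borel_measurable borel"
  by (simp add: half_def)

lemma half_scale: "0 < c \<Longrightarrow> half (c * t) = half t"
  by (auto simp: half_def indicator_def zero_less_mult_iff)

text \<open>Equal to Gamma(1 - s) / s for s between 0 and 1; the constant that arises when
  |\<xi>|^(2s) is written through Gaussians.\<close>

definition power_const :: "real \<Rightarrow> real" where
  "power_const s = (\<integral>t. half t * ((1 - exp (- t)) * t powr (- 1 - s)) \<partial>lebesgue)"

text \<open>Near 0 the bound 1 - exp(-t) \<le> t leaves t^(-s), integrable because s < 1; at
  infinity t^(-1-s) is integrable because s > 0.\<close>

lemma power_kernel_integrable:
  assumes s: "0 < s" "s < 1"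
  shows "integrable lebesgue (\<lambda>t. half t * ((1 - exp (- t)) * t powr (- 1 - s)))"
proof (rule Bochner_Integration.integrable_bound)
  show "integrable lebesgue (\<lambda>t::real. indicator {0..1} t * t powr (- s) + indicator {1..} t * t powr (- 1 - s))"
    using s by (intro Bochner_Integration.integrable_add integrable_powr_near_0 integrable_powr_at_inf) auto
  show "(\<lambda>t. half t * ((1 - exp (- t)) * t powr (- 1 - s))) \<in> borel_measurable lebesgue" by measurable
  show "AE t in lebesgue. norm (half t * ((1 - exp (- t)) * t powr (- 1 - s)))
      \<le> norm (indicator {0..1} t * t powr (- s) + indicator {1..} t * t powr (- 1 - s))"
  proof (rule AE_I2)
    fix t :: real
    show "norm (half t * ((1 - exp (- t)) * t powr (- 1 - s))) \<le> norm (indicator {0..1} t * t powr (- s) + indicator {1..} t * t powr (- 1 - s))"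
    proof (cases "0 < t")
      case t: True
      have e1: "0 \<le> 1 - exp (- t)" "1 - exp (- t) \<le> 1" "1 - exp (- t) \<le> t"
        using t exp_ge_add_one_self[of "- t"] by auto
      have "t * t powr (- 1 - s) = t powr (- s)" using t powr_mult_base[of t "- 1 - s"] by simp
      then have a: "(1 - exp (- t)) * t powr (- 1 - s) \<le> t powr (- s)"
        using mult_right_mono[OF e1(3), of "t powr (- 1 - s)"] by simp
      have b: "(1 - exp (- t)) * t powr (- 1 - s) \<le> t powr (- 1 - s)"
        using mult_right_mono[OF e1(2), of "t powr (- 1 - s)"] by simp
      have "(1 - exp (- t)) * t powr (- 1 - s) \<le> indicator {0..1} t * t powr (- s) + indicator {1..} t * t powr (- 1 - s)"
      proof (cases "t \<le> 1")
        case True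
        then show ?thesis using a t by (simp add: add_increasing2)
      next
        case False
        then show ?thesis using b t by (simp add: add_increasing)
      qed
      moreover have "0 \<le> (1 - exp (- t)) * t powr (- 1 - s)" using e1 by simp
      ultimately show ?thesis using t by (simp add: half_def)
    qed (simp add: half_def)
  qed
qed

text \<open>The substitution of r^2 t for t produces r^(2s). With r = |\<xi>| this represents the
  symbol of the fractional Laplacian by Gaussians.\<close>

lemma
  assumes s: "0 < s" "s < 1" and r: "0 < r"
  shows power_kernel_scaled_integrable: "integrable lebesgue (\<lambda>t. half t * ((1 - exp (- t * r\<^sup>2)) * t powr (- 1 - s)))"
    and power_kernel_scaled: "(\<integral>t. half t * ((1 - exp (- t * r\<^sup>2)) * t powr (- 1 - s)) \<partial>lebesgue) = power_const s * r powr (2 * s)"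
proof -
  let ?k = "\<lambda>t. half t * ((1 - exp (- t)) * t powr (- 1 - s))"
  have r2: "0 < r\<^sup>2" using r by simp
  have km: "?k \<in> borel_measurable lebesgue" by measurable
  have sc: "?k (0 + r\<^sup>2 *\<^sub>R t) = r powr (- 2 - 2 * s) * (half t * ((1 - exp (- t * r\<^sup>2)) * t powr (- 1 - s)))" for t
  proof (cases "0 < t")
    case True
    have "(r\<^sup>2) powr (- 1 - s) = r powr (- 2 - 2 * s)" using r powr_powr[of r 2 "- 1 - s"] by (simp add: algebra_simps)
    then have "(r\<^sup>2 * t) powr (- 1 - s) = r powr (- 2 - 2 * s) * t powr (- 1 - s)"
      using True r by (simp add: powr_mult)
    then show ?thesis using half_scale[OF r2, of t] by (simp add: mult_ac)
  next
    case False
    then have "half t = 0" "half (r\<^sup>2 * t) = 0" using half_scale[OF r2, of t] by (auto simp: half_def)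
    then show ?thesis by simp
  qed
  have rp: "r powr (2 + 2 * s) * r powr (- 2 - 2 * s) = 1" using r by (simp flip: powr_add)
  have "integrable lebesgue (\<lambda>t. ?k (0 + r\<^sup>2 *\<^sub>R t))"
    using integrable_affine_lebesgue[OF _ km, of "r\<^sup>2" 0] power_kernel_integrable[OF s] r2 by simp
  then have i: "integrable lebesgue (\<lambda>t. r powr (2 + 2 * s) * (r powr (- 2 - 2 * s) * (half t * ((1 - exp (- t * r\<^sup>2)) * t powr (- 1 - s)))))"
    unfolding sc by (rule integrable_mult_right)
  then show "integrable lebesgue (\<lambda>t. half t * ((1 - exp (- t * r\<^sup>2)) * t powr (- 1 - s)))"
    unfolding mult.assoc[symmetric, of "r powr (2 + 2 * s)"] rp by simp
  have "power_const s = \<bar>r\<^sup>2\<bar> ^ DIM(real) *\<^sub>R (\<integral>t. ?k (0 + r\<^sup>2 *\<^sub>R t) \<partial>lebesgue)"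
    unfolding power_const_def by (rule integral_affine_lebesgue[OF _ km]) (use r2 in simp)
  then have "power_const s = r\<^sup>2 * (r powr (- 2 - 2 * s) * (\<integral>t. half t * ((1 - exp (- t * r\<^sup>2)) * t powr (- 1 - s)) \<partial>lebesgue))"
    unfolding sc by simp
  then have "power_const s * r powr (2 * s)
      = (r powr (2 * s) * (r\<^sup>2 * r powr (- 2 - 2 * s))) * (\<integral>t. half t * ((1 - exp (- t * r\<^sup>2)) * t powr (- 1 - s)) \<partial>lebesgue)"
    by (simp only: mult_ac)
  moreover have "r powr (2 * s) * (r\<^sup>2 * r powr (- 2 - 2 * s)) = 1"
  proof -
    have "r\<^sup>2 = r powr 2" using r by simp
    then have "r powr (2 * s) * (r\<^sup>2 * r powr (- 2 - 2 * s)) = r powr (2 * s + (2 + (- 2 - 2 * s)))"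
      by (simp only: powr_add)
    then show ?thesis using r by simp
  qed
  ultimately show "(\<integral>t. half t * ((1 - exp (- t * r\<^sup>2)) * t powr (- 1 - s)) \<partial>lebesgue) = power_const s * r powr (2 * s)"
    by simp
qed

text \<open>From (1 + x/m)^m \<le> exp x with x = y/4, the 4 being that of the heat kernel.\<close>

lemma exp_times_power_bounded:
  fixes y :: real
  assumes y: "0 \<le> y" and m: "0 < m"
  shows "y ^ m * exp (- (y / 4)) \<le> (4 * real m) ^ m"
proof -
  have "(y / (4 * real m)) ^ m \<le> (1 + (y / 4) / real m) ^ m" using y by (intro power_mono) auto
  also have "\<dots> \<le> exp (y / 4)" using y m by (intro exp_ge_one_plus_x_over_n_power_n) auto
  finally have "y ^ m \<le> exp (y / 4) * (4 * real m) ^ m" using m by (simp add: power_divide pos_divide_le_eq)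
  then have "y ^ m * exp (- (y / 4)) \<le> (exp (y / 4) * (4 * real m) ^ m) * exp (- (y / 4))" by (intro mult_right_mono) auto
  also have "\<dots> = (4 * real m) ^ m * (exp (y / 4) * exp (- (y / 4)))" by (simp only: mult_ac)
  also have "exp (y / 4) * exp (- (y / 4)) = 1" by (simp flip: exp_add)
  finally show ?thesis by simp
qed

text \<open>Equal to 4^(a-1) Gamma(a - 1) for a > 1. Its positivity allows division by it once the
  power kernel has been recovered.\<close>

definition heat_const :: "real \<Rightarrow> real" where
  "heat_const a = (\<integral>t. half t * (t powr (- a) * exp (- (1 / (4 * t)))) \<partial>lebesgue)"

lemma heat_kernel_integrable:
  assumes a: "1 < a"
  shows "integrable lebesgue (\<lambda>t. half t * (t powr (- a) * exp (- (1 / (4 * t)))))"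
proof -
  obtain m :: nat where m: "a \<le> real m" using real_arch_simple by blast
  define C where "C = (4 * real m) ^ m"
  show ?thesis
  proof (rule Bochner_Integration.integrable_bound)
    show "integrable lebesgue (\<lambda>t::real. C * (indicator {0..1} t * t powr 0) + indicator {1..} t * t powr (- a))"
      using a by (intro Bochner_Integration.integrable_add integrable_mult_right integrable_powr_near_0 integrable_powr_at_inf) auto
    show "(\<lambda>t. half t * (t powr (- a) * exp (- (1 / (4 * t))))) \<in> borel_measurable lebesgue" by measurable
    show "AE t in lebesgue. norm (half t * (t powr (- a) * exp (- (1 / (4 * t)))))
        \<le> norm (C * (indicator {0..1} t * t powr 0) + indicator {1..} t * t powr (- a))"
    proof (rule AE_I2)
      fix t :: real
      show "norm (half t * (t powr (- a) * exp (- (1 / (4 * t))))) \<le> norm (C * (indicator {0..1} t * t powr 0) + indicator {1..} t * t powr (- a))"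
      proof (cases "0 < t")
        case t: True
        have "t powr (- a) * exp (- (1 / (4 * t))) \<le> C * (indicator {0..1} t * t powr 0) + indicator {1..} t * t powr (- a)"
        proof (cases "t \<le> 1")
          case True
          \<comment> \<open>On (0, 1] a larger exponent only increases the power, so
            \<open>a\<close> may be rounded up to an integer.\<close>
          have "t powr (- a) \<le> t powr (- real m)" using t True m by (intro powr_mono') auto
          also have "\<dots> = (1 / t) ^ m" using t by (simp add: powr_minus powr_realpow power_one_over inverse_eq_divide)
          finally have "t powr (- a) * exp (- (1 / (4 * t))) \<le> (1 / t) ^ m * exp (- ((1 / t) / 4))" by (simp add: mult_right_mono mult.commute[of t 4])
          also have "\<dots> \<le> C" unfolding C_def by (rule exp_times_power_bounded) (use t m a in auto)
          finally show ?thesis using t True by (simp add: add_increasing2)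
        next
          case False
          have "t powr (- a) * exp (- (1 / (4 * t))) \<le> t powr (- a) * 1" using t by (intro mult_left_mono) auto
          then show ?thesis using False t by simp
        qed
        then show ?thesis using t by (simp add: half_def)
      qed (simp add: half_def)
    qed
  qed
qed

lemma heat_const_pos: "1 < a \<Longrightarrow> 0 < heat_const a"
  unfolding heat_const_def
  by (rule integral_pos_half_line[OF heat_kernel_integrable]) (auto simp: half_def)

text \<open>The substitution of d t for t. With d = |x - y|^2 and a = 1 + s + n/2 the power becomes
  |x - y|^(-n-2s), the kernel of the fractional Laplacian off the diagonal.\<close>

lemma
  assumes a: "1 < a" and d: "0 < d"
  shows heat_kernel_scaled_integrable: "integrable lebesgue (\<lambda>t. half t * (t powr (- a) * exp (- (d / (4 * t)))))"
    and heat_kernel_scaled: "(\<integral>t. half t * (t powr (- a) * exp (- (d / (4 * t)))) \<partial>lebesgue) = heat_const a * d powr (1 - a)"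
proof -
  let ?k = "\<lambda>t. half t * (t powr (- a) * exp (- (d / (4 * t))))"
  have km: "?k \<in> borel_measurable lebesgue" by measurable
  have sc: "?k (0 + d *\<^sub>R t) = d powr (- a) * (half t * (t powr (- a) * exp (- (1 / (4 * t)))))" for t
  proof (cases "0 < t")
    case True
    then show ?thesis using half_scale[OF d, of t] d by (simp add: powr_mult)
  next
    case False
    then have "half t = 0" "half (d * t) = 0" using half_scale[OF d, of t] by (auto simp: half_def)
    then show ?thesis by simp
  qed
  have "integrable lebesgue (\<lambda>t. ?k (0 + d *\<^sub>R t))" unfolding sc by (intro integrable_mult_right heat_kernel_integrable a)
  then show "integrable lebesgue ?k" using integrable_affine_lebesgue[OF _ km, of d 0] d by simp
  have "(\<integral>t. ?k t \<partial>lebesgue) = \<bar>d\<bar> ^ DIM(real) *\<^sub>R (\<integral>t. ?k (0 + d *\<^sub>R t) \<partial>lebesgue)"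
    by (rule integral_affine_lebesgue[OF _ km]) (use d in simp)
  also have "\<dots> = d * (d powr (- a) * heat_const a)" unfolding sc heat_const_def using d by simp
  also have "\<dots> = heat_const a * d powr (1 - a)"
    using powr_mult_base[of d "- a"] d by simp
  finally show "(\<integral>t. ?k t \<partial>lebesgue) = heat_const a * d powr (1 - a)" .
qed

text \<open>The pairing of \<open>u\<close> with the heat evolution of \<open>\<phi>\<close>,
  computed on the space side. The constant is (2 pi)^n divided by the normalization (4 pi t)^(n/2)
  of the heat kernel.\<close>

lemma gaussian_damped_pairing:
  fixes u \<phi> :: "'a::euclidean_space \<Rightarrow> real"
  assumes u: "integrable lebesgue u" and \<phi>: "nice (\<lambda>x. complex_of_real (\<phi> x))" and t: "0 < t"
  shows "(\<integral>\<xi>. Re (fourier (\<lambda>x. of_real (u x)) \<xi> * cnj (fourier (\<lambda>x. of_real (\<phi> x)) \<xi>)) * exp (- t * (norm \<xi>)\<^sup>2) \<partial>lebesgue)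
    = sqrt (pi / t) ^ DIM('a) * (\<integral>x. (\<integral>y. u x * \<phi> y * exp (- ((norm (y - x))\<^sup>2 / (4 * t))) \<partial>lebesgue) \<partial>lebesgue)"
proof -
  \<comment> \<open>With this \<open>c\<close> the damping exponent c^2/4 equals
    \<open>t\<close>.\<close>
  define c where "c = 2 * sqrt t"
  have c: "0 < c" "c\<^sup>2 / 4 = t" "c\<^sup>2 = 4 * t" using t by (auto simp: c_def power_mult_distrib)
  let ?U = "fourier (\<lambda>x. complex_of_real (u x))" and ?P = "fourier (\<lambda>x. complex_of_real (\<phi> x))"
  have ui: "integrable lebesgue (\<lambda>x. complex_of_real (u x))" using u by simp
  note pi = nice_integrable[OF \<phi>]
  note [measurable] = fourier_measurable[OF ui] fourier_measurable[OF pi]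
  have um[measurable]: "u \<in> borel_measurable lebesgue" using u by simp
  have pm[measurable]: "\<phi> \<in> borel_measurable lebesgue"
    using measurable_compose[OF nice_measurable[OF \<phi>], of Re borel] by simp
  have gi: "integrable lebesgue (\<lambda>\<xi>::'a. exp (- t * (norm \<xi>)\<^sup>2))" by (rule gaussian_integrable[OF t])
  have i1: "integrable lebesgue (\<lambda>\<xi>. cnj (?P \<xi>) * of_real (exp (- t * (norm \<xi>)\<^sup>2)))"
  proof (rule Bochner_Integration.integrable_bound)
    show "integrable lebesgue (\<lambda>\<xi>::'a. (\<integral>x. norm (complex_of_real (\<phi> x)) \<partial>lebesgue) * exp (- t * (norm \<xi>)\<^sup>2))" using gi by simp
    show "AE \<xi> in lebesgue. norm (cnj (?P \<xi>) * of_real (exp (- t * (norm \<xi>)\<^sup>2))) \<le> norm ((\<integral>x. norm (complex_of_real (\<phi> x)) \<partial>lebesgue) * exp (- t * (norm \<xi>)\<^sup>2))"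
      using norm_fourier_le[OF pi] by (auto simp: norm_mult abs_mult intro!: AE_I2 mult_right_mono)
  qed measurable
  have i2: "integrable lebesgue (\<lambda>\<xi>. ?U \<xi> * (cnj (?P \<xi>) * of_real (exp (- t * (norm \<xi>)\<^sup>2))))"
  proof (rule Bochner_Integration.integrable_bound)
    show "integrable lebesgue (\<lambda>\<xi>. (\<integral>x. norm (complex_of_real (u x)) \<partial>lebesgue) * norm (cnj (?P \<xi>) * of_real (exp (- t * (norm \<xi>)\<^sup>2))))"
      by (intro integrable_mult_right integrable_norm i1)
    show "AE \<xi> in lebesgue. norm (?U \<xi> * (cnj (?P \<xi>) * of_real (exp (- t * (norm \<xi>)\<^sup>2))))
        \<le> norm ((\<integral>x. norm (complex_of_real (u x)) \<partial>lebesgue) * norm (cnj (?P \<xi>) * of_real (exp (- t * (norm \<xi>)\<^sup>2))))"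
      using norm_fourier_le[OF ui] by (auto simp: norm_mult abs_mult intro!: AE_I2 mult_right_mono)
  qed measurable
  have inner: "fourier (\<lambda>\<xi>. cnj (?P \<xi>) * of_real (exp (- t * (norm \<xi>)\<^sup>2))) x
      = of_real (sqrt (pi / t) ^ DIM('a) * (\<integral>y. \<phi> y * exp (- ((norm (y - x))\<^sup>2 / (4 * t))) \<partial>lebesgue))" for x
  proof -
    have "fourier (\<lambda>\<xi>. cnj (?P \<xi>) * of_real (exp (- t * (norm \<xi>)\<^sup>2))) x
        = of_real ((2 * sqrt pi) ^ DIM('a)) * (\<integral>w. of_real (\<phi> (x + c *\<^sub>R w) * exp (- (norm w)\<^sup>2)) \<partial>lebesgue)"
      using fourier_gaussian_damped[OF \<phi> c(1), of x] unfolding c(2) by simp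
    also have "\<dots> = of_real ((2 * sqrt pi) ^ DIM('a) * (\<integral>w. \<phi> (x + c *\<^sub>R w) * exp (- (norm w)\<^sup>2) \<partial>lebesgue))"
      by (subst integral_complex_of_real) (simp only: of_real_mult)
    also have "(\<integral>w. \<phi> (x + c *\<^sub>R w) * exp (- (norm w)\<^sup>2) \<partial>lebesgue)
        = (\<integral>w. \<phi> (x + c *\<^sub>R w) * exp (- ((norm ((x + c *\<^sub>R w) - x))\<^sup>2 / (4 * t))) \<partial>lebesgue)"
      using c t by (simp add: power_mult_distrib)
    also have "(2 * sqrt pi) ^ DIM('a) * \<dots> = (sqrt (pi / t) * c) ^ DIM('a) * \<dots>"
      using t by (simp add: c_def real_sqrt_divide)
    also have "\<dots> = sqrt (pi / t) ^ DIM('a) * (\<bar>c\<bar> ^ DIM('a) *\<^sub>R (\<integral>w. \<phi> (x + c *\<^sub>R w) * exp (- ((norm ((x + c *\<^sub>R w) - x))\<^sup>2 / (4 * t))) \<partial>lebesgue))"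
      using c by (simp add: power_mult_distrib)
    also have "\<bar>c\<bar> ^ DIM('a) *\<^sub>R (\<integral>w. \<phi> (x + c *\<^sub>R w) * exp (- ((norm ((x + c *\<^sub>R w) - x))\<^sup>2 / (4 * t))) \<partial>lebesgue)
        = (\<integral>y. \<phi> y * exp (- ((norm (y - x))\<^sup>2 / (4 * t))) \<partial>lebesgue)"
      by (rule integral_affine_lebesgue[symmetric]) (use c in \<open>simp, measurable\<close>)
    finally show ?thesis .
  qed
  have "complex_of_real (\<integral>\<xi>. Re (?U \<xi> * cnj (?P \<xi>)) * exp (- t * (norm \<xi>)\<^sup>2) \<partial>lebesgue)
      = of_real (Re (\<integral>\<xi>. ?U \<xi> * (cnj (?P \<xi>) * of_real (exp (- t * (norm \<xi>)\<^sup>2))) \<partial>lebesgue))"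
    using integral_Re[OF i2] by (simp add: mult.assoc[symmetric])
  also have "(\<integral>\<xi>. ?U \<xi> * (cnj (?P \<xi>) * of_real (exp (- t * (norm \<xi>)\<^sup>2))) \<partial>lebesgue)
      = (\<integral>x. complex_of_real (u x) * fourier (\<lambda>\<xi>. cnj (?P \<xi>) * of_real (exp (- t * (norm \<xi>)\<^sup>2))) x \<partial>lebesgue)"
    by (rule fourier_multiplication_formula[OF ui i1])
  also have "\<dots> = of_real (\<integral>x. u x * (sqrt (pi / t) ^ DIM('a) * (\<integral>y. \<phi> y * exp (- ((norm (y - x))\<^sup>2 / (4 * t))) \<partial>lebesgue)) \<partial>lebesgue)"
    unfolding inner by (simp only: integral_complex_of_real flip: of_real_mult)
  also have "(\<integral>x. u x * (sqrt (pi / t) ^ DIM('a) * (\<integral>y. \<phi> y * exp (- ((norm (y - x))\<^sup>2 / (4 * t))) \<partial>lebesgue)) \<partial>lebesgue)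
      = sqrt (pi / t) ^ DIM('a) * (\<integral>x. (\<integral>y. u x * \<phi> y * exp (- ((norm (y - x))\<^sup>2 / (4 * t))) \<partial>lebesgue) \<partial>lebesgue)"
    by (simp only: mult.assoc mult.left_commute[of _ "sqrt (pi / t) ^ DIM('a)"] integral_mult_right_zero)
  finally show ?thesis by (simp only: of_real_eq_iff Re_complex_of_real)
qed

text \<open>The symbol is replaced by its integral over Gaussians and the \<xi>-integral is done
  first. The term with 1 contributes the integral of \<open>p\<close>, which is zero; the Gaussian
  term contributes heat kernels, whose integral in t is the power kernel. The distance
  \<open>\<delta>\<close> makes this last integral converge.\<close>

lemma riesz_kernel_test_integral_zero:
  fixes u \<phi> :: "'a::euclidean_space \<Rightarrow> real"
  assumes s: "0 < s" "s < 1" and \<delta>: "0 < \<delta>"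
    and u: "integrable lebesgue u" and \<phi>: "nice (\<lambda>x. complex_of_real (\<phi> x))"
    and dist: "\<And>x y. u x \<noteq> 0 \<Longrightarrow> \<phi> y \<noteq> 0 \<Longrightarrow> \<delta> \<le> norm (y - x)"
  defines "p \<equiv> \<lambda>\<xi>. Re (fourier (\<lambda>x. of_real (u x)) \<xi> * cnj (fourier (\<lambda>x. of_real (\<phi> x)) \<xi>))"
  assumes p: "integrable lebesgue p" "(\<integral>\<xi>. p \<xi> \<partial>lebesgue) = 0"
    and ps: "integrable lebesgue (\<lambda>\<xi>. norm \<xi> powr (2 * s) * p \<xi>)" "(\<integral>\<xi>. norm \<xi> powr (2 * s) * p \<xi> \<partial>lebesgue) = 0"
  shows "(\<integral>y. (\<integral>x. u x * ((x - y) \<bullet> (x - y)) powr - (DIM('a) / 2 + s) \<partial>lebesgue) * \<phi> y \<partial>lebesgue) = 0"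
proof -
  have um[measurable]: "u \<in> borel_measurable lebesgue" using u by simp
  have pm[measurable]: "\<phi> \<in> borel_measurable lebesgue"
    using measurable_compose[OF nice_measurable[OF \<phi>], of Re borel] by simp
  have \<phi>i: "integrable lebesgue \<phi>" using integrable_Re[OF nice_integrable[OF \<phi>]] by simp
  have [measurable]: "p \<in> borel_measurable lebesgue" using p(1) by simp
  define k where "k t \<xi> = half t * ((1 - exp (- t * (norm \<xi>)\<^sup>2)) * t powr (- 1 - s))" for t and \<xi> :: 'a
  have k0: "0 \<le> k t \<xi>" for t \<xi> unfolding k_def half_def by (auto simp: indicator_def)
  have ki: "integrable lebesgue (\<lambda>t. k t \<xi>)" "(\<integral>t. k t \<xi> \<partial>lebesgue) = power_const s * norm \<xi> powr (2 * s)" for \<xi> :: 'a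
  proof -
    have "integrable lebesgue (\<lambda>t. k t \<xi>) \<and> (\<integral>t. k t \<xi> \<partial>lebesgue) = power_const s * norm \<xi> powr (2 * s)"
    proof (cases "\<xi> = 0")
      case False
      then have "0 < norm \<xi>" by simp
      from power_kernel_scaled_integrable[OF s this] power_kernel_scaled[OF s this]
      show ?thesis unfolding k_def by blast
    qed (simp add: k_def)
    then show "integrable lebesgue (\<lambda>t. k t \<xi>)" "(\<integral>t. k t \<xi> \<partial>lebesgue) = power_const s * norm \<xi> powr (2 * s)"
      by blast+
  qed
  \<comment> \<open>Integrating in t first reduces absolute integrability to that of |\<xi>|^(2s)
    p(\<xi>).\<close>
  have F: "integrable (lebesgue \<Otimes>\<^sub>M lebesgue) (\<lambda>(\<xi>, t). p \<xi> * k t \<xi>)"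
  proof (rule lebesgue_pair.Fubini_integrable)
    show "(\<lambda>(\<xi>, t). p \<xi> * k t \<xi>) \<in> borel_measurable (lebesgue \<Otimes>\<^sub>M lebesgue)"
      unfolding k_def by measurable
    have "(\<integral>t. norm (p \<xi> * k t \<xi>) \<partial>lebesgue) = power_const s * norm (norm \<xi> powr (2 * s) * p \<xi>)" for \<xi>
      using k0 ki(2)[of \<xi>] by (simp add: abs_mult)
    then show "integrable lebesgue (\<lambda>\<xi>. \<integral>t. norm (case (\<xi>, t) of (\<xi>, t) \<Rightarrow> p \<xi> * k t \<xi>) \<partial>lebesgue)"
      using integrable_norm[OF ps(1)] by simp
    show "AE \<xi> in lebesgue. integrable lebesgue (\<lambda>t. case (\<xi>, t) of (\<xi>, t) \<Rightarrow> p \<xi> * k t \<xi>)"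
      using ki(1) by simp
  qed
  define n2 where "n2 = real DIM('a) / 2"
  \<comment> \<open>1 + s comes from the weight t^(-1-s), and n/2 from the factor t^(-n/2) of the
    heat kernel.\<close>
  define a where "a = 1 + s + n2"
  have a1: "1 < a" using s by (simp add: a_def n2_def)
  \<comment> \<open>A majorant in t: the Gaussian factor is largest at the minimal distance
    \<open>\<delta>\<close>.\<close>
  define A where "A t = half t * (t powr (- a) * exp (- (\<delta>\<^sup>2 / (4 * t))))" for t
  have Ai: "integrable lebesgue A" unfolding A_def by (rule heat_kernel_scaled_integrable[OF a1]) (use \<delta> in simp)
  define g where "g t x y = half t * (t powr (- a) * exp (- ((norm (y - x))\<^sup>2 / (4 * t)))) * (u x * \<phi> y)" for t :: real and x y
  have gb: "norm (g t x y) \<le> A t * (\<bar>u x\<bar> * \<bar>\<phi> y\<bar>)" for t x y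
  proof (cases "0 < t \<and> u x \<noteq> 0 \<and> \<phi> y \<noteq> 0")
    case True
    have "\<delta>\<^sup>2 \<le> (norm (y - x))\<^sup>2" using dist[of x y] True \<delta> by (intro power_mono) auto
    then have "exp (- ((norm (y - x))\<^sup>2 / (4 * t))) \<le> exp (- (\<delta>\<^sup>2 / (4 * t)))" using True by (simp add: divide_right_mono)
    then have "half t * (t powr (- a) * exp (- ((norm (y - x))\<^sup>2 / (4 * t)))) \<le> A t"
      using True unfolding A_def by (simp add: half_def mult_left_mono)
    then have "half t * (t powr (- a) * exp (- ((norm (y - x))\<^sup>2 / (4 * t)))) * (\<bar>u x\<bar> * \<bar>\<phi> y\<bar>) \<le> A t * (\<bar>u x\<bar> * \<bar>\<phi> y\<bar>)"
      by (intro mult_right_mono) auto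
    then show ?thesis using True by (simp add: g_def abs_mult half_def)
  next
    case False
    then show ?thesis by (auto simp: g_def A_def half_def)
  qed
  \<comment> \<open>The minus sign belongs to the Gaussian in 1 - exp; the term with 1 is a multiple
    of the vanishing integral of \<open>p\<close>.\<close>
  have inner: "(\<integral>\<xi>. p \<xi> * k t \<xi> \<partial>lebesgue) = - (sqrt pi ^ DIM('a)) * (\<integral>x. (\<integral>y. g t x y \<partial>lebesgue) \<partial>lebesgue)" for t
  proof (cases "0 < t")
    case t: True
    have gi: "integrable lebesgue (\<lambda>\<xi>. p \<xi> * exp (- t * (norm \<xi>)\<^sup>2))"
    proof (rule Bochner_Integration.integrable_bound[OF p(1)])
      show "AE \<xi> in lebesgue. norm (p \<xi> * exp (- t * (norm \<xi>)\<^sup>2)) \<le> norm (p \<xi>)"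
        using t by (intro AE_I2) (simp add: abs_mult mult_left_le)
    qed measurable
    have "(\<integral>\<xi>. p \<xi> * k t \<xi> \<partial>lebesgue) = (\<integral>\<xi>. t powr (- 1 - s) * (p \<xi> - p \<xi> * exp (- t * (norm \<xi>)\<^sup>2)) \<partial>lebesgue)"
      using t by (simp add: k_def half_def algebra_simps)
    also have "\<dots> = - (t powr (- 1 - s) * (\<integral>\<xi>. p \<xi> * exp (- t * (norm \<xi>)\<^sup>2) \<partial>lebesgue))"
      using p gi by simp
    also have "(\<integral>\<xi>. p \<xi> * exp (- t * (norm \<xi>)\<^sup>2) \<partial>lebesgue)
        = sqrt (pi / t) ^ DIM('a) * (\<integral>x. (\<integral>y. u x * \<phi> y * exp (- ((norm (y - x))\<^sup>2 / (4 * t))) \<partial>lebesgue) \<partial>lebesgue)"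
      unfolding p_def by (rule gaussian_damped_pairing[OF u \<phi> t])
    also have "sqrt (pi / t) ^ DIM('a) = sqrt pi ^ DIM('a) * t powr (- n2)"
    proof -
      have "(1 / sqrt t) ^ DIM('a) = t powr (- n2)"
        using t by (simp add: n2_def powr_half_sqrt[symmetric] powr_realpow[symmetric] powr_powr powr_minus power_one_over inverse_eq_divide)
      moreover have "sqrt (pi / t) ^ DIM('a) = sqrt pi ^ DIM('a) * (1 / sqrt t) ^ DIM('a)"
        by (simp add: real_sqrt_divide power_divide)
      ultimately show ?thesis by (simp only:)
    qed
    also have "- (t powr (- 1 - s) * (sqrt pi ^ DIM('a) * t powr (- n2) *
        (\<integral>x. (\<integral>y. u x * \<phi> y * exp (- ((norm (y - x))\<^sup>2 / (4 * t))) \<partial>lebesgue) \<partial>lebesgue)))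
      = - (sqrt pi ^ DIM('a)) * (t powr (- a) *
        (\<integral>x. (\<integral>y. u x * \<phi> y * exp (- ((norm (y - x))\<^sup>2 / (4 * t))) \<partial>lebesgue) \<partial>lebesgue))"
    proof -
      have "t powr (- a) = t powr (- 1 - s) * t powr (- n2)" by (simp add: a_def flip: powr_add)
      then show ?thesis by simp
    qed
    also have "t powr (- a) * (\<integral>x. (\<integral>y. u x * \<phi> y * exp (- ((norm (y - x))\<^sup>2 / (4 * t))) \<partial>lebesgue) \<partial>lebesgue)
        = (\<integral>x. (\<integral>y. t powr (- a) * (u x * \<phi> y * exp (- ((norm (y - x))\<^sup>2 / (4 * t)))) \<partial>lebesgue) \<partial>lebesgue)"
      by (simp only: integral_mult_right_zero)
    also have "\<dots> = (\<integral>x. (\<integral>y. g t x y \<partial>lebesgue) \<partial>lebesgue)"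
      using t by (simp add: g_def half_def mult_ac)
    finally show ?thesis .
  next
    case False
    then show ?thesis by (simp add: k_def g_def half_def)
  qed
  have gm: "(\<lambda>z. g (fst (fst z)) (snd (fst z)) (snd z)) \<in> borel_measurable ((lebesgue \<Otimes>\<^sub>M lebesgue) \<Otimes>\<^sub>M lebesgue)"
    unfolding g_def by measurable
  have gm2: "(\<lambda>(t, x). \<integral>y. g t x y \<partial>lebesgue) \<in> borel_measurable (lebesgue \<Otimes>\<^sub>M lebesgue)"
    using lebesgue.borel_measurable_lebesgue_integral[of "\<lambda>tx y. g (fst tx) (snd tx) y" "lebesgue \<Otimes>\<^sub>M lebesgue"] gm
    by (simp add: case_prod_beta')
  have gi3: "integrable lebesgue (\<lambda>y. g t x y)" for t x
  proof (rule Bochner_Integration.integrable_bound)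
    show "integrable lebesgue (\<lambda>y. A t * (\<bar>u x\<bar> * \<bar>\<phi> y\<bar>))" using \<phi>i by simp
    show "AE y in lebesgue. norm (g t x y) \<le> norm (A t * (\<bar>u x\<bar> * \<bar>\<phi> y\<bar>))"
      by (intro AE_I2 order_trans[OF gb]) simp
    show "(\<lambda>y. g t x y) \<in> borel_measurable lebesgue" unfolding g_def by measurable
  qed
  define P where "P = (\<integral>y. \<bar>\<phi> y\<bar> \<partial>lebesgue)"
  have gb2: "norm (\<integral>y. g t x y \<partial>lebesgue) \<le> A t * (\<bar>u x\<bar> * P)" for t x
  proof -
    have "norm (\<integral>y. g t x y \<partial>lebesgue) \<le> (\<integral>y. norm (g t x y) \<partial>lebesgue)" by (rule integral_norm_bound)
    also have "\<dots> \<le> (\<integral>y. A t * (\<bar>u x\<bar> * \<bar>\<phi> y\<bar>) \<partial>lebesgue)"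
      by (rule integral_mono[OF integrable_norm[OF gi3]]) (use \<phi>i gb in auto)
    finally show ?thesis by (simp add: P_def)
  qed
  have "power_const s * (\<integral>\<xi>. norm \<xi> powr (2 * s) * p \<xi> \<partial>lebesgue) = (\<integral>\<xi>. (\<integral>t. p \<xi> * k t \<xi> \<partial>lebesgue) \<partial>lebesgue)"
  proof -
    have "(\<integral>t. p \<xi> * k t \<xi> \<partial>lebesgue) = power_const s * (norm \<xi> powr (2 * s) * p \<xi>)" for \<xi>
      by (simp add: ki(2))
    then show ?thesis by (simp only: integral_mult_right_zero)
  qed
  also have "\<dots> = (\<integral>t. (\<integral>\<xi>. p \<xi> * k t \<xi> \<partial>lebesgue) \<partial>lebesgue)"
    by (rule lebesgue_pair.Fubini_integral[OF F, symmetric])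
  also have "\<dots> = - (sqrt pi ^ DIM('a)) * (\<integral>t. (\<integral>x. (\<integral>y. g t x y \<partial>lebesgue) \<partial>lebesgue) \<partial>lebesgue)"
    unfolding inner by simp
  finally have "(\<integral>t. (\<integral>x. (\<integral>y. g t x y \<partial>lebesgue) \<partial>lebesgue) \<partial>lebesgue) = 0" using ps(2) by simp
  also have "(\<integral>t. (\<integral>x. (\<integral>y. g t x y \<partial>lebesgue) \<partial>lebesgue) \<partial>lebesgue) = (\<integral>x. (\<integral>t. (\<integral>y. g t x y \<partial>lebesgue) \<partial>lebesgue) \<partial>lebesgue)"
  proof (rule lebesgue_pair.Fubini_integral[symmetric], rule lebesgue_pair.integrable_bound_product[OF gm2 Ai])
    show "integrable lebesgue (\<lambda>x. \<bar>u x\<bar> * P)" using u by simp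
    show "norm (case (t, x) of (t, x) \<Rightarrow> \<integral>y. g t x y \<partial>lebesgue) \<le> A t * (\<bar>u x\<bar> * P)" for t x using gb2 by simp
  qed
  also have "\<dots> = (\<integral>x. (\<integral>y. (\<integral>t. g t x y \<partial>lebesgue) \<partial>lebesgue) \<partial>lebesgue)"
  proof (rule Bochner_Integration.integral_cong[OF refl])
    fix x :: 'a
    have m: "(\<lambda>(t, y). g t x y) \<in> borel_measurable (lebesgue \<Otimes>\<^sub>M lebesgue)" unfolding g_def by measurable
    show "(\<integral>t. (\<integral>y. g t x y \<partial>lebesgue) \<partial>lebesgue) = (\<integral>y. (\<integral>t. g t x y \<partial>lebesgue) \<partial>lebesgue)"
    proof (rule lebesgue_pair.Fubini_integral[symmetric], rule lebesgue_pair.integrable_bound_product[OF m Ai])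
      show "integrable lebesgue (\<lambda>y. \<bar>u x\<bar> * \<bar>\<phi> y\<bar>)" using \<phi>i by simp
      show "norm (case (t, y) of (t, y) \<Rightarrow> g t x y) \<le> A t * (\<bar>u x\<bar> * \<bar>\<phi> y\<bar>)" for t y using gb by simp
    qed
  qed
  also have "\<dots> = (\<integral>x. (\<integral>y. heat_const a * (u x * ((x - y) \<bullet> (x - y)) powr - (DIM('a) / 2 + s) * \<phi> y) \<partial>lebesgue) \<partial>lebesgue)"
  proof (intro Bochner_Integration.integral_cong refl)
    fix x y :: 'a
    show "(\<integral>t. g t x y \<partial>lebesgue) = heat_const a * (u x * ((x - y) \<bullet> (x - y)) powr - (DIM('a) / 2 + s) * \<phi> y)"
    proof (cases "u x \<noteq> 0 \<and> \<phi> y \<noteq> 0")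
      case True
      then have d: "0 < (norm (y - x))\<^sup>2" using dist[of x y] \<delta> by auto
      have "(x - y) \<bullet> (x - y) = (norm (y - x))\<^sup>2" by (simp add: norm_minus_commute flip: power2_norm_eq_inner)
      moreover have "1 - a = - (DIM('a) / 2 + s)" by (simp add: a_def n2_def)
      ultimately show ?thesis using heat_kernel_scaled[OF a1 d] unfolding g_def by simp
    next
      case False
      then show ?thesis by (auto simp: g_def)
    qed
  qed
  finally have z: "heat_const a * (\<integral>x. (\<integral>y. u x * ((x - y) \<bullet> (x - y)) powr - (DIM('a) / 2 + s) * \<phi> y \<partial>lebesgue) \<partial>lebesgue) = 0"
    by simp
  \<comment> \<open>The last exchange makes the potential of \<open>u\<close> the inner integral,
    with \<open>\<phi>\<close> as test function; \<open>\<delta>\<close> bounds the kernel.\<close>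
  have "(\<integral>y. (\<integral>x. u x * ((x - y) \<bullet> (x - y)) powr - (DIM('a) / 2 + s) * \<phi> y \<partial>lebesgue) \<partial>lebesgue)
      = (\<integral>x. (\<integral>y. u x * ((x - y) \<bullet> (x - y)) powr - (DIM('a) / 2 + s) * \<phi> y \<partial>lebesgue) \<partial>lebesgue)"
  proof (rule lebesgue_pair.Fubini_integral, rule lebesgue_pair.integrable_bound_product[where g="\<lambda>x. \<bar>u x\<bar>" and h="\<lambda>y. (\<delta>\<^sup>2) powr - (DIM('a) / 2 + s) * \<bar>\<phi> y\<bar>"])
    show "(\<lambda>(x, y). u x * ((x - y) \<bullet> (x - y)) powr - (DIM('a) / 2 + s) * \<phi> y) \<in> borel_measurable (lebesgue \<Otimes>\<^sub>M lebesgue)"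
      by measurable
    show "integrable lebesgue (\<lambda>x. \<bar>u x\<bar>)" "integrable lebesgue (\<lambda>y. (\<delta>\<^sup>2) powr - (DIM('a) / 2 + s) * \<bar>\<phi> y\<bar>)" using u \<phi>i by auto
    fix x y :: 'a
    show "norm (case (x, y) of (x, y) \<Rightarrow> u x * ((x - y) \<bullet> (x - y)) powr - (DIM('a) / 2 + s) * \<phi> y) \<le> \<bar>u x\<bar> * ((\<delta>\<^sup>2) powr - (DIM('a) / 2 + s) * \<bar>\<phi> y\<bar>)"
    proof (cases "u x \<noteq> 0 \<and> \<phi> y \<noteq> 0")
      case True
      have "\<delta>\<^sup>2 \<le> (norm (y - x))\<^sup>2" using dist[of x y] True \<delta> by (intro power_mono) auto
      also have "\<dots> = (x - y) \<bullet> (x - y)" by (simp add: norm_minus_commute flip: power2_norm_eq_inner)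
      finally have "((x - y) \<bullet> (x - y)) powr - (DIM('a) / 2 + s) \<le> (\<delta>\<^sup>2) powr - (DIM('a) / 2 + s)"
        using s \<delta> by (intro powr_mono2') auto
      then have "\<bar>u x\<bar> * (((x - y) \<bullet> (x - y)) powr - (DIM('a) / 2 + s) * \<bar>\<phi> y\<bar>) \<le> \<bar>u x\<bar> * ((\<delta>\<^sup>2) powr - (DIM('a) / 2 + s) * \<bar>\<phi> y\<bar>)"
        by (intro mult_left_mono mult_right_mono) auto
      then show ?thesis by (simp add: abs_mult mult.assoc)
    qed auto
  qed
  then show ?thesis using z heat_const_pos[OF a1] by simp
qed

section \<open>Unique continuation and coercivity\<close>

lemma inner_lam:
  "inner (lam s g) (lam s h) = (1 / (2 * pi) ^ DIM('a)) * inner (rmult (riesz s) g) (rmult (riesz s) (h :: 'a::euclidean_space l2))"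
  unfolding lam_def by (rule inner_inv_fourier_l2)

lemma inner_psi:
  "inner (psi s g) (psi s h) = (1 / (2 * pi) ^ DIM('a)) * inner (rmult (bessel s) g) (rmult (bessel s) (h :: 'a::euclidean_space l2))"
  unfolding psi_def by (rule inner_inv_fourier_l2)

text \<open>An element of the closed subspace vanishes off the domain only almost everywhere. The
  cut-off function vanishes there everywhere and is integrable because the domain is bounded, so its
  transform is an integral at every frequency.\<close>

lemma supported_representative:
  fixes u :: "'a::euclidean_space \<Rightarrow> real"
  assumes s: "0 \<le> s" "s \<le> 1" and u: "u \<in> Hs s" "gam s u \<in> sob s \<Omega>"
    and \<Omega>: "bounded \<Omega>" "\<Omega> \<in> sets lebesgue"
  defines "v \<equiv> \<lambda>x. indicator \<Omega> x * u x"
  shows "v \<in> L2_space lebesgue" "rcl v = rcl u" "integrable lebesgue v"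
    "fourier (\<lambda>x. of_real (v x)) \<in> L2_space lebesgue" "AE \<xi> in lebesgue. fourier_L2 u \<xi> = fourier (\<lambda>x. of_real (v x)) \<xi>"
    "fourier_l2 (rcl u) = cl (fourier (\<lambda>x. of_real (v x)))"
proof -
  note uL = Hs_L2[OF u(1)]
  show vL: "v \<in> L2_space lebesgue"
  proof (rule L2_space_bound[OF uL, of _ 1])
    show "v \<in> borel_measurable lebesgue" unfolding v_def
      using L2_space_measurable[OF uL] \<Omega>(2) by (intro borel_measurable_times borel_measurable_indicator)
    show "AE x in lebesgue. norm (v x) \<le> 1 * norm (u x)" by (auto simp: v_def indicator_def)
  qed
  have m: "multiplier (\<lambda>x. complex_of_real (indicator \<Omega> x))"
    by (rule multiplier_of_real[of _ 1]) (use \<Omega> in \<open>auto simp: indicator_def\<close>)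
  show r: "rcl v = rcl u"
    using sob_support[OF s u(2) \<Omega>(2)] unfolding psi_gam[OF s(1) u(1)]
    by (simp add: rcl_def mult_l2_cl[OF m L2_of_real[OF uL]] v_def)
  have "integrable lebesgue (\<lambda>x. indicator \<Omega> x *\<^sub>R complex_of_real (u x))"
    by (rule L2_integrable_bounded[OF L2_of_real[OF uL] \<Omega>])
  from integrable_Re[OF this] show vi: "integrable lebesgue v" by (simp add: v_def)
  have ci: "integrable lebesgue (\<lambda>x. complex_of_real (v x))" using vi by simp
  note F = fourier_l2_L1[OF L2_of_real[OF vL] ci]
  show FL: "fourier (\<lambda>x. of_real (v x)) \<in> L2_space lebesgue" using F by blast
  show eq: "fourier_l2 (rcl u) = cl (fourier (\<lambda>x. of_real (v x)))"
    unfolding r[symmetric] using F by (simp add: rcl_def)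
  then have "cl (fourier_L2 u) = cl (fourier (\<lambda>x. of_real (v x)))" by (simp add: cl_fourier_L2[OF uL])
  then show "AE \<xi> in lebesgue. fourier_L2 u \<xi> = fourier (\<lambda>x. of_real (v x)) \<xi>"
    by (subst (asm) cl_eq_iff[OF fourier_L2_in_L2[OF uL] FL])
qed

lemma weighted_fourier:
  fixes u :: "'a::euclidean_space \<Rightarrow> real"
  assumes s: "0 \<le> s" and u: "u \<in> Hs s" and U: "U \<in> borel_measurable lebesgue" "AE \<xi> in lebesgue. fourier_L2 u \<xi> = U \<xi>"
  shows "(\<lambda>\<xi>. norm \<xi> powr s *\<^sub>R U \<xi>) \<in> L2_space lebesgue"
    "cl (\<lambda>\<xi>. norm \<xi> powr s *\<^sub>R U \<xi>) = rmult (riesz s) (gam s u)"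
proof -
  note [measurable] = U(1)
  have ae: "AE \<xi> in lebesgue. norm \<xi> powr s *\<^sub>R fourier_L2 u \<xi> = norm \<xi> powr s *\<^sub>R U \<xi>"
    using U(2) by eventually_elim simp
  show L: "(\<lambda>\<xi>. norm \<xi> powr s *\<^sub>R U \<xi>) \<in> L2_space lebesgue"
    by (rule L2_space_AE[OF riesz_weight(1)[OF s u] _ ae]) measurable
  show "cl (\<lambda>\<xi>. norm \<xi> powr s *\<^sub>R U \<xi>) = rmult (riesz s) (gam s u)"
    unfolding riesz_weight(2)[OF s u, symmetric] using ae
    by (subst cl_eq_iff[OF L riesz_weight(1)[OF s u]]) (auto elim: eventually_mono)
qed

lemma test_functions_mono: "\<phi> \<in> test_functions V \<Longrightarrow> V \<subseteq> W \<Longrightarrow> \<phi> \<in> test_functions W"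
  unfolding test_functions_def by blast

text \<open>For functions supported in a bounded set away from \<open>W\<close>, unique continuation reduces to injectivity
  of a Riesz type potential, so no connectedness and no Carleman estimate is involved.\<close>

lemma fractional_unique_continuation:
  fixes u :: "'a::euclidean_space \<Rightarrow> real"
  assumes s: "0 < s" "s < 1" and u: "u \<in> Hs s" "gam s u \<in> sob s \<Omega>"
    and \<Omega>: "bounded \<Omega>" "\<Omega> \<in> sets lebesgue" and W: "open W" "W \<noteq> {}" "W \<inter> \<Omega> = {}"
    and orth: "\<And>\<phi>. \<phi> \<in> test_functions W \<Longrightarrow> inner (lam s (gam s u)) (lam s (gam s \<phi>)) = 0"
  shows "rcl u = 0"
proof -
  have s0: "0 \<le> s" "s \<le> 1" using s by auto
  define v where "v x = indicator \<Omega> x * u x" for x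
  note rep = supported_representative[OF s0 u \<Omega>, folded v_def]
  have [measurable]: "v \<in> borel_measurable lebesgue" using rep(3) by simp
  obtain y0 where y0: "y0 \<in> W" using W(2) by blast
  obtain e where e: "0 < e" "ball y0 e \<subseteq> W" using W(1) y0 openE by blast
  obtain B where B: "\<And>x. x \<in> \<Omega> \<Longrightarrow> norm x \<le> B" using \<Omega>(1) by (auto simp: bounded_iff)
  \<comment> \<open>Half the radius, so that all points of the smaller ball keep distance
    \<open>r\<close> from the domain.\<close>
  define r where "r = e / 2"
  define R where "R = B + norm y0 + r"
  have r: "0 < r" using e by (simp add: r_def)
  have dist: "r \<le> norm (x - y) \<and> norm (x - y) \<le> R" if "v x \<noteq> 0" "y \<in> ball y0 r" for x y
  proof
    have x: "x \<in> \<Omega>" using that(1) by (auto simp: v_def indicator_def split: if_splits)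
    then have "x \<notin> ball y0 e" using e(2) W(3) by blast
    then have "2 * r \<le> dist y0 x" by (simp add: r_def)
    also have "dist y0 x \<le> dist y0 y + dist y x" by (rule dist_triangle)
    finally show "r \<le> norm (x - y)" using that(2) by (simp add: dist_norm norm_minus_commute)
    have "norm (x - y) \<le> norm x + norm y" by (rule norm_triangle_ineq4)
    also have "norm y \<le> norm y0 + dist y0 y" using norm_triangle_ineq2[of y y0] by (simp add: dist_norm norm_minus_commute)
    finally show "norm (x - y) \<le> R" using B[OF x] that(2) by (simp add: R_def)
  qed
  define K where "K w = (w \<bullet> w) powr - (DIM('a) / 2 + s)" for w :: 'a
  define N where "N y = (\<integral>x. v x * K (x - y) \<partial>lebesgue)" for y
  let ?U = "fourier (\<lambda>x. complex_of_real (v x))"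
  have test: "(\<integral>y. N y * \<phi> y \<partial>lebesgue) = 0" if \<phi>: "\<phi> \<in> test_functions (ball y0 r)" for \<phi>
  proof -
    have bW: "ball y0 r \<subseteq> W" using e by (auto simp: r_def)
    have \<phi>W: "\<phi> \<in> test_functions W" by (rule test_functions_mono[OF \<phi> bW])
    note n = nice_test_function[OF \<phi>]
    note pH = test_Hs[OF s0 \<phi>]
    note pL = test_L2[OF \<phi>]
    let ?P = "fourier (\<lambda>x. complex_of_real (\<phi> x))"
    note PL = nice_fourier_L2[OF n]
    have Peq: "fourier_l2 (rcl \<phi>) = cl ?P" by (simp add: rcl_def fourier_l2_nice[OF n])
    then have "cl (fourier_L2 \<phi>) = cl ?P" by (simp add: cl_fourier_L2[OF pL])
    then have Pae: "AE \<xi> in lebesgue. fourier_L2 \<phi> \<xi> = ?P \<xi>" by (subst (asm) cl_eq_iff[OF fourier_L2_in_L2[OF pL] PL])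
    note WU = weighted_fourier[OF s0(1) u(1) L2_space_measurable[OF rep(4)] rep(5)]
    note WP = weighted_fourier[OF s0(1) pH L2_space_measurable[OF PL] Pae]
    have pe: "Re (?U \<xi> * cnj (?P \<xi>)) = inner (?U \<xi>) (?P \<xi>)" for \<xi> by (simp add: inner_complex_def)
    have we: "norm \<xi> powr (2 * s) * Re (?U \<xi> * cnj (?P \<xi>)) = inner (norm \<xi> powr s *\<^sub>R ?U \<xi>) (norm \<xi> powr s *\<^sub>R ?P \<xi>)" for \<xi>
    proof -
      have "norm \<xi> powr (2 * s) = norm \<xi> powr s * norm \<xi> powr s" by (simp flip: powr_add)
      then show ?thesis unfolding pe by (simp only: inner_scaleR_left inner_scaleR_right mult.assoc)
    qed
    have "(\<integral>y. (\<integral>x. v x * ((x - y) \<bullet> (x - y)) powr - (DIM('a) / 2 + s) \<partial>lebesgue) * \<phi> y \<partial>lebesgue) = 0"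
    proof (rule riesz_kernel_test_integral_zero[OF s r rep(3) n])
      show "r \<le> norm (y - x)" if "v x \<noteq> 0" "\<phi> y \<noteq> 0" for x y
      proof -
        have "y \<in> ball y0 r" using test_functionsD(5)[OF \<phi>, of y] that(2) by blast
        from conjunct1[OF dist[OF that(1) this]] show ?thesis by (simp only: norm_minus_commute)
      qed
      show "integrable lebesgue (\<lambda>\<xi>. Re (?U \<xi> * cnj (?P \<xi>)))" unfolding pe by (rule L2_space_integrable_inner[OF rep(4) PL])
      have "(\<integral>\<xi>. Re (?U \<xi> * cnj (?P \<xi>)) \<partial>lebesgue) = inner (fourier_l2 (rcl u)) (fourier_l2 (rcl \<phi>))"
        unfolding pe rep(6) Peq by (rule inner_cl[OF rep(4) PL, symmetric])
      also have "\<dots> = (2 * pi) ^ DIM('a) * (\<integral>x. v x * \<phi> x \<partial>lebesgue)"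
        unfolding inner_fourier_l2 rep(2)[symmetric] inner_rcl[OF rep(1) pL] ..
      \<comment> \<open>Disjoint supports; by Plancherel this removes the contribution of the 1 in 1
        - exp.\<close>
      also have "(\<lambda>x. v x * \<phi> x) = (\<lambda>x. 0)"
      proof
        fix x
        show "v x * \<phi> x = 0"
          using test_functionsD(5)[OF \<phi>W, of x] W(3) by (cases "x \<in> \<Omega>") (auto simp: v_def)
      qed
      finally show "(\<integral>\<xi>. Re (?U \<xi> * cnj (?P \<xi>)) \<partial>lebesgue) = 0" by simp
      show "integrable lebesgue (\<lambda>\<xi>. norm \<xi> powr (2 * s) * Re (?U \<xi> * cnj (?P \<xi>)))"
        unfolding we by (rule L2_space_integrable_inner[OF WU(1) WP(1)])
      have "(\<integral>\<xi>. norm \<xi> powr (2 * s) * Re (?U \<xi> * cnj (?P \<xi>)) \<partial>lebesgue) = inner (rmult (riesz s) (gam s u)) (rmult (riesz s) (gam s \<phi>))"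
        unfolding we WU(2)[symmetric] WP(2)[symmetric] by (rule inner_cl[OF WU(1) WP(1), symmetric])
      also have "\<dots> = 0" using orth[OF \<phi>W] unfolding inner_lam by simp
      finally show "(\<integral>\<xi>. norm \<xi> powr (2 * s) * Re (?U \<xi> * cnj (?P \<xi>)) \<partial>lebesgue) = 0" .
    qed
    then show ?thesis by (simp only: N_def K_def)
  qed
  have Nm: "N \<in> borel_measurable lebesgue" unfolding N_def[abs_def] K_def by measurable
  define C where "C = (\<integral>x. \<bar>v x\<bar> \<partial>lebesgue) * (r\<^sup>2) powr - (DIM('a) / 2 + s)"
  have Nb: "\<bar>N y\<bar> \<le> C" if y: "y \<in> ball y0 r" for y
  proof -
    have "\<bar>N y\<bar> \<le> (\<integral>x. \<bar>v x * K (x - y)\<bar> \<partial>lebesgue)" unfolding N_def by (rule integral_abs_bound)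
    also have "\<dots> \<le> (\<integral>x. \<bar>v x\<bar> * (r\<^sup>2) powr - (DIM('a) / 2 + s) \<partial>lebesgue)"
    proof (rule integral_mono')
      show "integrable lebesgue (\<lambda>x. \<bar>v x\<bar> * (r\<^sup>2) powr - (DIM('a) / 2 + s))" using rep(3) by simp
      fix x
      show "\<bar>v x * K (x - y)\<bar> \<le> \<bar>v x\<bar> * (r\<^sup>2) powr - (DIM('a) / 2 + s)"
      proof (cases "v x = 0")
        case False
        have "r\<^sup>2 \<le> (norm (x - y))\<^sup>2" using dist[OF False y] r by (intro power_mono) auto
        also have "\<dots> = (x - y) \<bullet> (x - y)" by (rule power2_norm_eq_inner)
        finally have "K (x - y) \<le> (r\<^sup>2) powr - (DIM('a) / 2 + s)" unfolding K_def
          using s r by (intro powr_mono2') auto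
        then have "\<bar>v x\<bar> * K (x - y) \<le> \<bar>v x\<bar> * (r\<^sup>2) powr - (DIM('a) / 2 + s)" by (intro mult_left_mono) auto
        then show ?thesis by (simp add: abs_mult K_def)
      qed simp
    qed simp
    finally show ?thesis by (simp add: C_def)
  qed
  \<comment> \<open>So far the potential \<open>N\<close> vanishes in the weak sense only; the bound
    \<open>Nb\<close> makes it locally integrable, as the fundamental lemma requires.\<close>
  have "AE y in lebesgue. y \<in> ball y0 r \<longrightarrow> complex_of_real (N y) = 0"
  proof (rule AE_zero_if_test_integrals_zero[OF open_ball])
    fix a b assume ab: "cbox a b \<subseteq> ball y0 r"
    show "integrable lebesgue (\<lambda>x. indicator (cbox a b) x *\<^sub>R complex_of_real (N x))"
    proof (rule Bochner_Integration.integrable_bound)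
      show "integrable lebesgue (\<lambda>x. C * indicator (cbox a b) x)"
        using emeasure_compact_finite[OF compact_cbox, of a b]
        by (intro integrable_mult_right integrable_real_indicator) (auto simp: less_top)
      show "(\<lambda>x. indicator (cbox a b) x *\<^sub>R complex_of_real (N x)) \<in> borel_measurable lebesgue"
        using Nm by (intro borel_measurable_scaleR borel_measurable_indicator borel_measurable_of_real) auto
      show "AE x in lebesgue. norm (indicator (cbox a b) x *\<^sub>R complex_of_real (N x)) \<le> norm (C * indicator (cbox a b) x)"
      proof (rule AE_I2)
        fix x
        show "norm (indicator (cbox a b) x *\<^sub>R complex_of_real (N x)) \<le> norm (C * indicator (cbox a b) x)"
          using Nb[of x] ab by (cases "x \<in> cbox a b") auto
      qed
    qed
  next
    fix \<phi> assume \<phi>: "\<phi> \<in> test_functions (ball y0 r)"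
    show "(\<integral>x. complex_of_real (N x) * of_real (\<phi> x) \<partial>lebesgue) = 0"
      using test[OF \<phi>] integral_complex_of_real[of lebesgue "\<lambda>x. N x * \<phi> x"] by simp
  qed
  then have ae: "AE y in lebesgue. y \<in> ball y0 r \<longrightarrow> (\<integral>x. v x * (\<lambda>w. (w \<bullet> w) powr - (DIM('a) / 2 + s)) (x - y) \<partial>lebesgue) = 0"
    by (simp add: N_def K_def)
  have cont: "continuous_on (- {0}) (\<lambda>w::'a. (w \<bullet> w) powr - (DIM('a) / 2 + s))"
    by (intro continuous_intros) auto
  have "AE x in lebesgue. v x = 0"
    by (rule AE_zero_if_riesz_kernel[OF rep(3) r r dist s(1) ker_space_AE[OF rep(3) r r dist cont ae]])
  then have "rcl v = rcl (\<lambda>x. 0)" by (subst rcl_eq_iff[OF rep(1) L2_space_zero]) simp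
  then show ?thesis using rep(2) by (simp add: rcl_def cl_zero)
qed

section \<open>Compactness by sampling the Fourier transform\<close>

lemma cis_diff_le: "cmod (cis a - cis b) \<le> \<bar>a - b\<bar>"
proof -
  have "cis a - cis b = cis b * (cis (a - b) - 1)" by (simp add: right_diff_distrib cis_mult)
  then have "cmod (cis a - cis b) = cmod (iexp (a - b) - 1)" by (simp add: norm_mult cis_conv_exp)
  also have "\<dots> \<le> \<bar>a - b\<bar>" using iexp_approx1[of "a - b" 0] by simp
  finally show ?thesis .
qed

text \<open>Real functionals that sample the transform at a point: the factor 1 gives its real part,
  the factor \<open>\<i>\<close> minus its imaginary part.\<close>

definition fourier_functional :: "'a::euclidean_space set \<Rightarrow> real \<Rightarrow> 'a \<times> complex \<Rightarrow> 'a l2 \<Rightarrow> real" where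
  "fourier_functional \<Omega> s i g =
     Re (snd i * pair_l2 (cl (\<lambda>x. indicator \<Omega> x *\<^sub>R cis (- (x \<bullet> fst i)))) (psi s g))"

lemma bounded_linear_fourier_functional:
  assumes "0 \<le> s"
  shows "bounded_linear (fourier_functional \<Omega> s i)"
  unfolding fourier_functional_def
  by (intro bounded_linear_compose[OF bounded_linear_Re] bounded_linear_compose[OF bounded_linear_mult_right]
      bounded_linear_compose[OF bounded_bilinear.bounded_linear_right[OF bounded_bilinear_pair_l2] bounded_linear_psi[OF assms]])

lemma fourier_functional_zero:
  fixes u :: "'a::euclidean_space \<Rightarrow> real"
  assumes s: "0 \<le> s" "s \<le> 1" and u: "u \<in> Hs s" "gam s u \<in> sob s \<Omega>"
    and \<Omega>: "bounded \<Omega>" "\<Omega> \<in> sets lebesgue"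
    and z: "fourier_functional \<Omega> s (\<xi>, 1) (gam s u) = 0" "fourier_functional \<Omega> s (\<xi>, \<i>) (gam s u) = 0"
  shows "fourier (\<lambda>x. of_real (indicator \<Omega> x * u x)) \<xi> = 0"
proof -
  have L: "(\<lambda>x. indicator \<Omega> x *\<^sub>R cis (- (x \<bullet> \<xi>))) \<in> L2_space lebesgue"
  proof (rule L2_space_bound[OF L2_indicator[OF \<Omega>], of _ 1])
    show "(\<lambda>x. indicator \<Omega> x *\<^sub>R cis (- (x \<bullet> \<xi>))) \<in> borel_measurable lebesgue"
      using \<Omega>(2) by (intro borel_measurable_scaleR borel_measurable_indicator) (auto intro!: measurable_compose[OF _ cis_measurable])
  qed simp
  have "pair_l2 (cl (\<lambda>x. indicator \<Omega> x *\<^sub>R cis (- (x \<bullet> \<xi>)))) (psi s (gam s u))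
      = (\<integral>x. indicator \<Omega> x *\<^sub>R cis (- (x \<bullet> \<xi>)) * complex_of_real (u x) \<partial>lebesgue)"
    unfolding psi_gam[OF s(1) u(1)] rcl_def by (rule pair_l2_cl[OF L L2_of_real[OF Hs_L2[OF u(1)]]])
  also have "\<dots> = fourier (\<lambda>x. of_real (indicator \<Omega> x * u x)) \<xi>"
    unfolding fourier_def by (intro Bochner_Integration.integral_cong) (auto simp: scaleR_conv_of_real)
  finally show ?thesis using z by (simp add: fourier_functional_def complex_eq_iff)
qed

text \<open>High frequencies are controlled by the decay of \<open>bessel\<close>. At low ones the
  Lipschitz transform is small on a ball as soon as it vanishes on a fine net of it. This quantifies
  the compactness of the embedding into L2 by finitely many conditions.\<close>

lemma rellich:
  fixes \<Omega> :: "'a::euclidean_space set"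
  assumes s: "0 < s" "s \<le> 1" and \<Omega>: "bounded \<Omega>" "\<Omega> \<in> sets lebesgue" and \<epsilon>: "0 < \<epsilon>"
  shows "\<exists>I. finite I \<and> (\<forall>g\<in>sob s \<Omega>. (\<forall>i\<in>I. fourier_functional \<Omega> s i g = 0) \<longrightarrow> (norm (psi s g))\<^sup>2 \<le> \<epsilon> * (norm g)\<^sup>2)"
proof -
  have s0: "0 \<le> s" using s by simp
  obtain B where B: "0 < B" "\<And>x. x \<in> \<Omega> \<Longrightarrow> norm x \<le> B" using \<Omega>(1) by (auto simp: bounded_pos)
  obtain M where M: "0 < M" "\<And>g::'a l2. norm (psi s g) \<le> norm g * M"
    using bounded_linear.pos_bounded[OF bounded_linear_psi[OF s0, where 'a='a]] by blast
  have oL: "(\<lambda>x. complex_of_real (indicator \<Omega> x)) \<in> L2_space lebesgue" by (rule L2_of_real[OF L2_indicator[OF \<Omega>]])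
  define m where "m = norm (cl (\<lambda>x. complex_of_real (indicator \<Omega> x)))"
  \<comment> \<open>\<open>B\<close> is a Lipschitz bound for the phases on the domain, and
    \<open>m * M\<close> bounds the L1 norm of the function in terms of \<open>norm g\<close>; the
    summand 1 keeps \<open>D\<close> positive.\<close>
  define D where "D = B * m * M + 1"
  have D: "0 < D" using B(1) M(1) by (simp add: D_def m_def add_nonneg_pos)
  \<comment> \<open>The radius \<open>R\<close> is taken so large that beyond it the squared Bessel
    symbol is below \<epsilon>/2.\<close>
  have "filterlim (\<lambda>R::real. 1 + R\<^sup>2) at_top at_top"
    by (intro filterlim_tendsto_add_at_top[OF tendsto_const] filterlim_pow_at_top filterlim_ident) simp
  then have "((\<lambda>R::real. (1 + R\<^sup>2) powr (- s)) \<longlongrightarrow> 0) at_top"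
    by (rule tendsto_neg_powr[rotated]) (use s in simp)
  then have "\<forall>\<^sub>F R in at_top. (1 + R\<^sup>2) powr (- s) < \<epsilon> / 2" by (rule order_tendstoD) (use \<epsilon> in simp)
  then have "\<forall>\<^sub>F R::real in at_top. (1 + R\<^sup>2) powr (- s) < \<epsilon> / 2 \<and> 0 < R"
    by (rule eventually_conj[OF _ eventually_gt_at_top])
  from eventually_happens'[OF trivial_limit_at_top_linorder this]
  obtain R :: real where R: "(1 + R\<^sup>2) powr (- s) < \<epsilon> / 2" "0 < R" by (elim exE conjE)
  define V where "V = measure lebesgue (cball (0::'a) R)"
  \<comment> \<open>Chosen so that (\<delta> D)^2 times the volume \<open>V\<close> of the ball is
    at most \<epsilon>/2; \<open>V + 1\<close> keeps the quotient meaningful.\<close>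
  define \<delta> where "\<delta> = sqrt (\<epsilon> / (2 * (V + 1))) / D"
  have V0: "0 \<le> V" by (simp add: V_def)
  have \<delta>: "0 < \<delta>" using \<epsilon> V0 D by (simp add: \<delta>_def)
  have "cball (0::'a) R \<subseteq> (\<Union>x\<in>UNIV. ball x \<delta>)"
  proof
    fix x show "x \<in> (\<Union>x\<in>UNIV. ball x \<delta>)" using \<delta> by (intro UN_I[of x]) auto
  qed
  then obtain J where "J \<subseteq> UNIV" and J: "finite J" "cball (0::'a) R \<subseteq> (\<Union>x\<in>J. ball x \<delta>)"
    by (rule compactE_image[OF compact_cball open_ball])
  show ?thesis
  proof (intro exI[of _ "J \<times> {1, \<i>}"] conjI ballI impI)
    show "finite (J \<times> {1, \<i>})" using J(1) by simp
    fix g assume g: "g \<in> sob s \<Omega>" and z: "\<forall>i\<in>J \<times> {1, \<i>}. fourier_functional \<Omega> s i g = 0"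
    obtain u where u: "u \<in> Hs_tilde s \<Omega>" "gam s u = g" using sob_cases[OF s0 s(2) g] .
    have uH: "u \<in> Hs s" "gam s u \<in> sob s \<Omega>" using u(1) Hs_tilde_iff[OF s0 s(2)] by auto
    define v where "v x = indicator \<Omega> x * u x" for x
    note rep = supported_representative[OF s0 s(2) uH \<Omega>, folded v_def]
    let ?U = "fourier (\<lambda>x. complex_of_real (v x))"
    have psig: "psi s g = rcl v" using psi_gam[OF s0 uH(1)] rep(2) u(2) by simp
    have v1: "(\<integral>x. \<bar>v x\<bar> \<partial>lebesgue) \<le> m * (M * norm g)"
    proof -
      have aL: "(\<lambda>x. complex_of_real \<bar>v x\<bar>) \<in> L2_space lebesgue"
        using L2_of_real[OF L2_norm[OF rep(1)]] by simp
      have "(\<integral>x. \<bar>v x\<bar> \<partial>lebesgue) = inner (cl (\<lambda>x. complex_of_real (indicator \<Omega> x))) (cl (\<lambda>x. complex_of_real \<bar>v x\<bar>))"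
        unfolding inner_cl[OF oL aL] by (intro Bochner_Integration.integral_cong) (auto simp: v_def indicator_def inner_complex_def)
      also have "\<dots> \<le> m * norm (cl (\<lambda>x. complex_of_real \<bar>v x\<bar>))" unfolding m_def by (rule norm_cauchy_schwarz)
      also have "norm (cl (\<lambda>x. complex_of_real \<bar>v x\<bar>)) = norm (psi s g)"
        unfolding psig rcl_def norm_cl[OF aL] norm_cl[OF L2_of_real[OF rep(1)]] by (simp add: L2_seminorm_def)
      also have "m * norm (psi s g) \<le> m * (M * norm g)"
        using M(2)[of g] by (intro mult_left_mono) (auto simp: m_def mult.commute)
      finally show ?thesis .
    qed
    have low: "norm (?U \<xi>) \<le> \<delta> * D * norm g" if "\<xi> \<in> cball 0 R" for \<xi>
    proof -
      from subsetD[OF J(2) that] obtain \<eta> where \<eta>: "\<eta> \<in> J" "dist \<eta> \<xi> < \<delta>"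
        by (elim UN_E) (simp only: mem_ball)
      have "?U \<eta> = 0" unfolding v_def
        by (rule fourier_functional_zero[OF s0 s(2) uH \<Omega>]) (use z \<eta>(1) u(2) in auto)
      have ci: "integrable lebesgue (\<lambda>x. complex_of_real (v x))" using rep(3) by simp
      have "?U \<xi> = ?U \<xi> - ?U \<eta>" using \<open>?U \<eta> = 0\<close> by simp
      also have "\<dots> = (\<integral>x. (cis (- (x \<bullet> \<xi>)) - cis (- (x \<bullet> \<eta>))) * complex_of_real (v x) \<partial>lebesgue)"
        unfolding fourier_def left_diff_distrib
        using integrable_cis_mult[OF ci, of \<xi>] integrable_cis_mult[OF ci, of \<eta>] by simp
      also have "norm \<dots> \<le> (\<integral>x. norm ((cis (- (x \<bullet> \<xi>)) - cis (- (x \<bullet> \<eta>))) * complex_of_real (v x)) \<partial>lebesgue)"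
        by (rule integral_norm_bound)
      also have "\<dots> \<le> (\<integral>x. (B * \<delta>) * \<bar>v x\<bar> \<partial>lebesgue)"
      proof (rule integral_mono')
        show "integrable lebesgue (\<lambda>x. (B * \<delta>) * \<bar>v x\<bar>)" using rep(3) by simp
        fix x
        show "norm ((cis (- (x \<bullet> \<xi>)) - cis (- (x \<bullet> \<eta>))) * complex_of_real (v x)) \<le> (B * \<delta>) * \<bar>v x\<bar>"
        proof (cases "x \<in> \<Omega>")
          case True
          have "cmod (cis (- (x \<bullet> \<xi>)) - cis (- (x \<bullet> \<eta>))) \<le> \<bar>x \<bullet> (\<eta> - \<xi>)\<bar>"
            using cis_diff_le[of "- (x \<bullet> \<xi>)" "- (x \<bullet> \<eta>)"] by (simp add: inner_diff_right)
          also have "\<dots> \<le> norm x * norm (\<eta> - \<xi>)" by (rule Cauchy_Schwarz_ineq2)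
          also have "\<dots> \<le> B * \<delta>" using B True \<eta>(2) by (intro mult_mono) (auto simp: dist_norm)
          finally show ?thesis unfolding norm_mult norm_of_real by (intro mult_right_mono) auto
        qed (simp add: v_def)
      qed (use B \<delta> in simp)
      also have "\<dots> \<le> (B * \<delta>) * (m * (M * norm g))" using v1 B \<delta> by (simp add: mult_left_mono)
      also have "\<dots> \<le> \<delta> * D * norm g" using \<delta> by (simp add: D_def algebra_simps)
      finally show ?thesis .
    qed
    obtain h where h: "h \<in> L2_space lebesgue" "g = cl h" by (rule l2_cases)
    have "cl ?U = rmult (bessel s) (cl h)" using rep(6) fourier_rcl_gam[OF s0 uH(1)] u(2) h(2) by simp
    then have Uh: "AE \<xi> in lebesgue. ?U \<xi> = complex_of_real (bessel s \<xi>) * h \<xi>"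
      unfolding mult_l2_cl[OF multiplier_bessel[OF s0] h(1)]
      by (subst (asm) cl_eq_iff[OF rep(4) multiplier_L2[OF multiplier_bessel[OF s0] h(1)]])
    have "(norm (cl ?U))\<^sup>2 = (\<integral>\<xi>. (norm (?U \<xi>))\<^sup>2 \<partial>lebesgue)" by (rule norm_cl_power2[OF rep(4)])
    also have "\<dots> \<le> (\<integral>\<xi>. (\<delta> * D * norm g)\<^sup>2 * indicator (cball 0 R) \<xi> + \<epsilon> / 2 * (norm (h \<xi>))\<^sup>2 \<partial>lebesgue)"
    proof (rule integral_mono_AE)
      show "integrable lebesgue (\<lambda>\<xi>. (norm (?U \<xi>))\<^sup>2)" by (rule L2_space_integrable_square[OF rep(4)])
      show "integrable lebesgue (\<lambda>\<xi>. (\<delta> * D * norm g)\<^sup>2 * indicator (cball 0 R) \<xi> + \<epsilon> / 2 * (norm (h \<xi>))\<^sup>2)"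
        using L2_space_integrable_square[OF h(1)] emeasure_compact_finite[OF compact_cball, of "0::'a" R]
        by (intro Bochner_Integration.integrable_add integrable_mult_right integrable_real_indicator) (auto simp: less_top)
      show "AE \<xi> in lebesgue. (norm (?U \<xi>))\<^sup>2 \<le> (\<delta> * D * norm g)\<^sup>2 * indicator (cball 0 R) \<xi> + \<epsilon> / 2 * (norm (h \<xi>))\<^sup>2"
        using Uh
      proof eventually_elim
        case (elim \<xi>)
        show ?case
        proof (cases "\<xi> \<in> cball 0 R")
          case True
          have "(norm (?U \<xi>))\<^sup>2 \<le> (\<delta> * D * norm g)\<^sup>2" using low[OF True] by (intro power_mono) auto
          then show ?thesis using True \<epsilon> by (simp add: add_increasing2)
        next
          case False
          have "(bessel s \<xi>)\<^sup>2 = (1 + (norm \<xi>)\<^sup>2) powr (- s)"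
            by (simp add: bessel_def power2_eq_square flip: powr_add)
          also have "\<dots> \<le> (1 + R\<^sup>2) powr (- s)"
          proof (rule powr_mono2')
            show "1 + R\<^sup>2 \<le> 1 + (norm \<xi>)\<^sup>2" using False R(2) by (intro add_left_mono power_mono) auto
          qed (use s in \<open>auto intro: add_pos_nonneg\<close>)
          also have "\<dots> \<le> \<epsilon> / 2" using R(1) by simp
          finally have "(bessel s \<xi>)\<^sup>2 * (norm (h \<xi>))\<^sup>2 \<le> \<epsilon> / 2 * (norm (h \<xi>))\<^sup>2" by (intro mult_right_mono) auto
          then show ?thesis using False unfolding elim by (simp add: norm_mult power_mult_distrib)
        qed
      qed
    qed
    also have "\<dots> = (\<delta> * D * norm g)\<^sup>2 * V + \<epsilon> / 2 * (norm g)\<^sup>2"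
      using L2_space_integrable_square[OF h(1)] emeasure_compact_finite[OF compact_cball, of "0::'a" R]
      unfolding h(2) norm_cl_power2[OF h(1)] V_def
      by (subst Bochner_Integration.integral_add) (auto simp: less_top intro!: integrable_real_indicator)
    also have "(\<delta> * D * norm g)\<^sup>2 * V \<le> \<epsilon> / 2 * (norm g)\<^sup>2"
    proof -
      have "(\<delta> * D)\<^sup>2 = \<epsilon> / (2 * (V + 1))" using D \<epsilon> V0 by (simp add: \<delta>_def)
      then have "(\<delta> * D)\<^sup>2 * V = \<epsilon> / 2 * (V / (V + 1))" using V0 by (simp add: field_simps)
      also have "\<dots> \<le> \<epsilon> / 2 * 1" using \<epsilon> V0 by (intro mult_left_mono) auto
      finally have "((\<delta> * D)\<^sup>2 * V) * (norm g)\<^sup>2 \<le> \<epsilon> / 2 * (norm g)\<^sup>2" by (intro mult_right_mono) auto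
      then show ?thesis by (simp add: power_mult_distrib mult_ac)
    qed
    finally have "(norm (cl ?U))\<^sup>2 \<le> \<epsilon> * (norm g)\<^sup>2" by (simp add: field_simps)
    moreover have "(norm (cl ?U))\<^sup>2 = (2 * pi) ^ DIM('a) * (norm (psi s g))\<^sup>2"
      using norm_fourier_l2[of "rcl u"] unfolding rep(6)[symmetric] psig rep(2) .
    \<comment> \<open>The Plancherel factor is at least 1 and may be dropped.\<close>
    moreover have "1 * (norm (psi s g))\<^sup>2 \<le> (2 * pi) ^ DIM('a) * (norm (psi s g))\<^sup>2"
      using pi_ge_two by (intro mult_right_mono one_le_power) auto
    ultimately show "(norm (psi s g))\<^sup>2 \<le> \<epsilon> * (norm g)\<^sup>2" by linarith
  qed
qed

text \<open>With a = 1/(1 + |\<xi>|^2) the two squares are a^s and (1 - a)^s, each at least its base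
  because the bases lie in [0, 1] and s \<le> 1.\<close>

lemma bessel_riesz_ge_1:
  assumes s: "0 < s" "s \<le> 1"
  shows "1 \<le> (bessel s \<xi>)\<^sup>2 + (riesz s \<xi>)\<^sup>2"
proof -
  define a where "a = 1 / (1 + (norm \<xi>)\<^sup>2)"
  have p: "0 < 1 + (norm \<xi>)\<^sup>2" by (rule one_plus_norm_pos)
  have a: "0 < a" "a \<le> 1" using p by (auto simp: a_def divide_le_eq)
  have b: "0 \<le> 1 - a" "1 - a \<le> 1" using a by auto
  have le: "x \<le> x powr s" if "0 \<le> x" "x \<le> 1" for x :: real
    using powr_mono'[OF s(2) that] that by simp
  have bs: "(bessel s \<xi>)\<^sup>2 = a powr s"
  proof -
    have "(bessel s \<xi>)\<^sup>2 = (1 + (norm \<xi>)\<^sup>2) powr (- s)" by (simp add: bessel_def power2_eq_square flip: powr_add)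
    then show ?thesis using p by (simp add: a_def powr_minus_divide powr_divide)
  qed
  have "(riesz s \<xi>)\<^sup>2 = (norm \<xi> powr s)\<^sup>2 * a powr s" by (simp add: riesz_def power_mult_distrib bs)
  also have "(norm \<xi> powr s)\<^sup>2 = ((norm \<xi>)\<^sup>2) powr s"
    by (simp add: power2_eq_square powr_mult)
  also have "((norm \<xi>)\<^sup>2) powr s * a powr s = (1 - a) powr s"
  proof -
    have "(norm \<xi>)\<^sup>2 * a = 1 - a" using p by (simp add: a_def field_simps)
    then show ?thesis using a by (simp add: powr_mult[symmetric])
  qed
  finally show ?thesis using le[of a] le[of "1 - a"] a b bs by simp
qed

text \<open>The pointwise inequality of symbols, integrated; the factor is that of
  Plancherel.\<close>

lemma garding:
  assumes s: "0 < s" "s \<le> 1"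
  shows "(norm g)\<^sup>2 \<le> (2 * pi) ^ DIM('a) * ((norm (lam s g))\<^sup>2 + (norm (psi s (g :: 'a::euclidean_space l2)))\<^sup>2)"
proof -
  have s0: "0 \<le> s" using s by simp
  obtain h where h: "h \<in> L2_space lebesgue" "g = cl h" by (rule l2_cases)
  note B = multiplier_L2[OF multiplier_bessel[OF s0] h(1)]
  note R = multiplier_L2[OF multiplier_riesz[OF s0] h(1)]
  have "(norm g)\<^sup>2 = (\<integral>\<xi>. (norm (h \<xi>))\<^sup>2 \<partial>lebesgue)" unfolding h(2) by (rule norm_cl_power2[OF h(1)])
  also have "\<dots> \<le> (\<integral>\<xi>. (norm (complex_of_real (riesz s \<xi>) * h \<xi>))\<^sup>2 + (norm (complex_of_real (bessel s \<xi>) * h \<xi>))\<^sup>2 \<partial>lebesgue)"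
  proof (rule integral_mono)
    show "integrable lebesgue (\<lambda>\<xi>. (norm (h \<xi>))\<^sup>2)" by (rule L2_space_integrable_square[OF h(1)])
    show "integrable lebesgue (\<lambda>\<xi>. (norm (complex_of_real (riesz s \<xi>) * h \<xi>))\<^sup>2 + (norm (complex_of_real (bessel s \<xi>) * h \<xi>))\<^sup>2)"
      by (intro Bochner_Integration.integrable_add L2_space_integrable_square[OF B] L2_space_integrable_square[OF R])
    fix \<xi>
    have "1 * (norm (h \<xi>))\<^sup>2 \<le> ((bessel s \<xi>)\<^sup>2 + (riesz s \<xi>)\<^sup>2) * (norm (h \<xi>))\<^sup>2"
      by (intro mult_right_mono bessel_riesz_ge_1 s) auto
    then show "(norm (h \<xi>))\<^sup>2 \<le> (norm (complex_of_real (riesz s \<xi>) * h \<xi>))\<^sup>2 + (norm (complex_of_real (bessel s \<xi>) * h \<xi>))\<^sup>2"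
      by (simp add: norm_mult power_mult_distrib algebra_simps)
  qed
  also have "\<dots> = (norm (rmult (riesz s) g))\<^sup>2 + (norm (rmult (bessel s) g))\<^sup>2"
    unfolding h(2) mult_l2_cl[OF multiplier_bessel[OF s0] h(1)] mult_l2_cl[OF multiplier_riesz[OF s0] h(1)]
      norm_cl_power2[OF B] norm_cl_power2[OF R]
    by (rule Bochner_Integration.integral_add[OF L2_space_integrable_square[OF R] L2_space_integrable_square[OF B]])
  also have "\<dots> = (2 * pi) ^ DIM('a) * ((norm (lam s g))\<^sup>2 + (norm (psi s g))\<^sup>2)"
    unfolding power2_norm_eq_inner inner_lam inner_psi by (simp add: field_simps)
  finally show ?thesis .
qed

section \<open>The exterior Dirichlet problem\<close>

lemma bounded_bilinear_add:
  assumes "bounded_bilinear f" "bounded_bilinear g"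
  shows "bounded_bilinear (\<lambda>x y. f x y + g x y)"
proof -
  interpret f: bounded_bilinear f by fact
  interpret g: bounded_bilinear g by fact
  obtain K where K: "\<forall>x y. norm (f x y) \<le> norm x * norm y * K" using f.bounded by (elim exE)
  obtain L where L: "\<forall>x y. norm (g x y) \<le> norm x * norm y * L" using g.bounded by (elim exE)
  show ?thesis
  proof
    show "\<exists>K. \<forall>x y. norm (f x y + g x y) \<le> norm x * norm y * K"
    proof (intro exI[of _ "K + L"] allI)
      fix x y show "norm (f x y + g x y) \<le> norm x * norm y * (K + L)"
        using norm_triangle_le[OF add_mono[OF K[rule_format, of x y] L[rule_format, of x y]]] by (simp only: distrib_left)
    qed
  qed (simp_all add: f.add_left f.add_right f.scaleR_left f.scaleR_right
      g.add_left g.add_right g.scaleR_left g.scaleR_right scaleR_add_right)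
qed

lemma rmult_rmult:
  assumes "multiplier (\<lambda>x. complex_of_real (m x))" "multiplier (\<lambda>x. complex_of_real (m' x))"
    "multiplier (\<lambda>x. complex_of_real (n x))" "\<And>x. m x * m' x = n x"
  shows "rmult m (rmult m' v) = rmult n v"
proof (rule l2_cases[of v])
  fix f assume f: "f \<in> L2_space lebesgue" "v = cl f"
  have "complex_of_real (m x) * (complex_of_real (m' x) * f x) = complex_of_real (n x) * f x" for x
    using assms(4)[of x] by (simp add: mult.assoc[symmetric] flip: of_real_mult)
  then show ?thesis unfolding f(2) mult_l2_cl[OF assms(2) f(1)] mult_l2_cl[OF assms(3) f(1)]
      mult_l2_cl[OF assms(1) multiplier_L2[OF assms(2) f(1)]] by (simp only:)
qed

lemma norm_rmult_le:
  fixes v :: "'a::euclidean_space l2"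
  assumes m: "multiplier (\<lambda>x. complex_of_real (m x))" and C: "\<And>x. \<bar>m x\<bar> \<le> C"
  shows "norm (rmult m v) \<le> C * norm v"
proof (rule l2_cases[of v])
  fix f assume f: "f \<in> L2_space lebesgue" "v = cl f"
  have C0: "0 \<le> C" using C[of undefined] by simp
  have "(norm (rmult m v))\<^sup>2 = (\<integral>x. (norm (complex_of_real (m x) * f x))\<^sup>2 \<partial>lebesgue)"
    unfolding f(2) mult_l2_cl[OF m f(1)] by (rule norm_cl_power2[OF multiplier_L2[OF m f(1)]])
  also have "\<dots> \<le> (\<integral>x. C\<^sup>2 * (norm (f x))\<^sup>2 \<partial>lebesgue)"
  proof (rule integral_mono)
    show "integrable lebesgue (\<lambda>x. (norm (complex_of_real (m x) * f x))\<^sup>2)"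
      by (rule L2_space_integrable_square[OF multiplier_L2[OF m f(1)]])
    show "integrable lebesgue (\<lambda>x. C\<^sup>2 * (norm (f x))\<^sup>2)"
      by (rule integrable_mult_right[OF L2_space_integrable_square[OF f(1)]])
    show "(norm (complex_of_real (m x) * f x))\<^sup>2 \<le> C\<^sup>2 * (norm (f x))\<^sup>2" for x
      unfolding norm_mult norm_of_real power_mult_distrib
      using C[of x] by (intro mult_right_mono power_mono) auto
  qed
  also have "\<dots> = (C * norm v)\<^sup>2" unfolding f(2) power_mult_distrib norm_cl_power2[OF f(1)] by simp
  finally show ?thesis by (rule power2_le_imp_le) (use C0 in simp)
qed

lemma L2_space_cong: "(\<And>x. x \<in> space M \<Longrightarrow> f x = g x) \<Longrightarrow> f \<in> L2_space M \<longleftrightarrow> g \<in> L2_space M"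
  unfolding L2_space_def mem_Collect_eq
  by (intro conj_cong measurable_cong Bochner_Integration.integrable_cong) auto

lemma L2_space_lebesgue_on:
  fixes v :: "'a::euclidean_space \<Rightarrow> real"
  assumes S: "S \<in> sets lebesgue"
  shows "v \<in> L2_space (lebesgue_on S) \<longleftrightarrow> (\<lambda>x. indicator S x * v x) \<in> L2_space lebesgue"
proof -
  have sq: "(norm (indicator S x * v x))\<^sup>2 = indicator S x *\<^sub>R (norm (v x))\<^sup>2" for x
    by (auto simp: indicator_def)
  show ?thesis using S unfolding L2_space_def mem_Collect_eq sq
    by (simp add: borel_measurable_restrict_space_iff integrable_restrict_space)
qed

lemma L2_space_indicator:
  fixes u :: "'a::euclidean_space \<Rightarrow> real"
  assumes "u \<in> L2_space lebesgue" "S \<in> sets lebesgue"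
  shows "(\<lambda>x. indicator S x * u x) \<in> L2_space lebesgue"
proof (rule L2_space_bound[OF assms(1), of _ 1])
  show "(\<lambda>x. indicator S x * u x) \<in> borel_measurable lebesgue"
    using L2_space_measurable[OF assms(1)] assms(2) by (intro borel_measurable_times borel_measurable_indicator)
qed (auto simp: indicator_def)

text \<open>\<open>p\<close> represents \<open>q\<close>, extended by 0, and is bounded everywhere:
  \<open>multiplier\<close> asks for a pointwise bound, whereas membership in L-infinity gives one
  almost everywhere.\<close>

locale exterior_problem =
  fixes s C :: real and \<Omega> W :: "'a::euclidean_space set" and q p :: "'a \<Rightarrow> real"
  assumes s: "0 < s" "s < 1"
    and \<Omega>: "open \<Omega>" "bounded \<Omega>"
    and W: "open W" "W \<noteq> {}" "W \<inter> \<Omega> = {}"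
    and q: "q \<in> borel_measurable (lebesgue_on \<Omega>)" "AE x in lebesgue. x \<in> \<Omega> \<longrightarrow> p x = q x"
    and p: "p \<in> borel_measurable lebesgue" "\<And>x. \<bar>p x\<bar> \<le> C" "\<And>x. x \<notin> \<Omega> \<Longrightarrow> p x = 0"
begin

lemma s0: "0 \<le> s" and s1: "s \<le> 1"
  using s by auto

lemma \<Omega>_sets: "\<Omega> \<in> sets lebesgue" and W_sets: "W \<in> sets lebesgue"
  using \<Omega>(1) W(1) by (auto simp: borel_open)

lemma multiplier_\<Omega>: "multiplier (\<lambda>x. complex_of_real (indicator \<Omega> x))"
  by (rule multiplier_of_real[of _ 1]) (use \<Omega>_sets in \<open>auto simp: indicator_def\<close>)

lemma multiplier_W: "multiplier (\<lambda>x. complex_of_real (indicator W x))"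
  by (rule multiplier_of_real[of _ 1]) (use W_sets in \<open>auto simp: indicator_def\<close>)

lemma multiplier_p: "multiplier (\<lambda>x. complex_of_real (p x))"
  by (rule multiplier_of_real[OF p(1,2)])

text \<open>The bilinear form of the weak equation carried over to weighted transforms, where it is
  bounded.\<close>

definition form :: "'a l2 \<Rightarrow> 'a l2 \<Rightarrow> real" where
  "form g h = inner (lam s g) (lam s h) + inner (rmult p (psi s g)) (psi s h)"

definition local_part :: "'a l2 \<Rightarrow> 'a l2" where
  "local_part g = rmult (indicator \<Omega>) (psi s g)"

lemma bounded_bilinear_form: "bounded_bilinear form"
  unfolding form_def[abs_def]
  by (intro bounded_bilinear_add bounded_bilinear.comp[OF bounded_bilinear_inner] bounded_linear_lam[OF s0] bounded_linear_psi[OF s0]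
    bounded_linear_compose[OF bounded_linear_mult_l2[OF multiplier_p]])

lemma form_commute: "form g h = form h g"
  using inner_mult_l2[OF multiplier_p, of "psi s g" "psi s h"] by (simp add: form_def inner_commute)

lemma bounded_linear_local_part: "bounded_linear local_part"
  unfolding local_part_def[abs_def]
  by (intro bounded_linear_compose[OF bounded_linear_mult_l2[OF multiplier_\<Omega>]] bounded_linear_psi[OF s0])

lemma local_part_gam: "u \<in> Hs s \<Longrightarrow> local_part (gam s u) = rcl (\<lambda>x. indicator \<Omega> x * u x)"
  by (simp add: local_part_def psi_gam[OF s0] rcl_def mult_l2_cl[OF multiplier_\<Omega>] L2_of_real Hs_L2)

lemma local_part_interior: "g \<in> sob s \<Omega> \<Longrightarrow> local_part g = psi s g"
  unfolding local_part_def by (rule sob_support[OF s0 s1 _ \<Omega>_sets])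

lemma rmult_exterior:
  assumes m: "multiplier (\<lambda>x. complex_of_real (m x))" "\<And>x. x \<notin> \<Omega> \<Longrightarrow> m x = 0" and y: "y \<in> sob s W"
  shows "rmult m (psi s y) = 0"
proof -
  have "rmult m (psi s y) = rmult m (rmult (indicator W) (psi s y))"
    by (subst sob_support[OF s0 s1 y W_sets]) (rule refl)
  also have "\<dots> = rmult (\<lambda>x. 0) (psi s y)"
  proof (rule rmult_rmult[OF m(1) multiplier_W])
    show "multiplier (\<lambda>x::'a. complex_of_real 0)" by (rule multiplier_of_real[of _ 0]) auto
    show "m x * indicator W x = 0" for x using m(2)[of x] W(3) by (cases "x \<in> \<Omega>") (auto simp: disjoint_iff indicator_def)
  qed
  also have "\<dots> = 0" by (simp add: mult_l2_def cl_zero)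
  finally show ?thesis .
qed

lemma local_part_exterior: "y \<in> sob s W \<Longrightarrow> local_part y = 0"
  unfolding local_part_def by (rule rmult_exterior[OF multiplier_\<Omega>]) auto

text \<open>The potential lives on the domain, so against exterior data only the nonlocal term
  remains. This identifies the form with the dual pairing in \<open>H1\<close>.\<close>

lemma form_exterior: "y \<in> sob s W \<Longrightarrow> form g y = inner (lam s g) (lam s y)"
  unfolding form_def inner_mult_l2[OF multiplier_p] by (simp add: rmult_exterior[OF multiplier_p p(3)])

lemma inner_local_part:
  assumes "u \<in> Hs s" "w \<in> Hs s"
  shows "inner (local_part (gam s u)) (local_part (gam s w)) = (\<integral>x. u x * w x \<partial>lebesgue_on \<Omega>)"
proof -
  have "inner (local_part (gam s u)) (local_part (gam s w)) = (\<integral>x. (indicator \<Omega> x * u x) * (indicator \<Omega> x * w x) \<partial>lebesgue)"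
    unfolding local_part_gam[OF assms(1)] local_part_gam[OF assms(2)]
    by (rule inner_rcl[OF L2_space_indicator[OF Hs_L2[OF assms(1)] \<Omega>_sets] L2_space_indicator[OF Hs_L2[OF assms(2)] \<Omega>_sets]])
  also have "\<dots> = (\<integral>x. indicator \<Omega> x *\<^sub>R (u x * w x) \<partial>lebesgue)"
    by (intro Bochner_Integration.integral_cong) (auto simp: indicator_def)
  also have "\<dots> = (\<integral>x. u x * w x \<partial>lebesgue_on \<Omega>)"
    using \<Omega>_sets by (subst integral_restrict_space) auto
  finally show ?thesis .
qed

lemma potential_term:
  assumes "u \<in> Hs s" "w \<in> Hs s"
  shows "(\<integral>x. q x * u x * w x \<partial>lebesgue_on \<Omega>) = inner (rmult p (psi s (gam s u))) (psi s (gam s w))"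
proof -
  have [measurable]: "u \<in> borel_measurable lebesgue" "w \<in> borel_measurable lebesgue" "p \<in> borel_measurable lebesgue"
    using Hs_L2[THEN L2_space_measurable] assms p(1) by auto
  have q': "(\<lambda>x. indicator \<Omega> x *\<^sub>R q x) \<in> borel_measurable lebesgue"
    using q(1) \<Omega>_sets by (subst (asm) borel_measurable_restrict_space_iff) auto
  have L: "(\<lambda>x. p x * u x) \<in> L2_space lebesgue"
    by (rule L2_space_bound[OF Hs_L2[OF assms(1)], of _ C]) (auto simp: abs_mult intro!: mult_right_mono p(2))
  have "(\<integral>x. q x * u x * w x \<partial>lebesgue_on \<Omega>) = (\<integral>x. indicator \<Omega> x *\<^sub>R (q x * u x * w x) \<partial>lebesgue)"
    using \<Omega>_sets by (subst integral_restrict_space) auto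
  also have "\<dots> = (\<integral>x. (indicator \<Omega> x *\<^sub>R q x) * (u x * w x) \<partial>lebesgue)"
    by (intro Bochner_Integration.integral_cong) auto
  also have "\<dots> = (\<integral>x. p x * u x * w x \<partial>lebesgue)"
  proof (rule integral_cong_AE)
    show "(\<lambda>x. (indicator \<Omega> x *\<^sub>R q x) * (u x * w x)) \<in> borel_measurable lebesgue"
      by (intro borel_measurable_times q') measurable
    show "AE x in lebesgue. (indicator \<Omega> x *\<^sub>R q x) * (u x * w x) = p x * u x * w x"
      using q(2)
    proof eventually_elim
      case (elim x)
      then show ?case using p(3)[of x] by (cases "x \<in> \<Omega>") auto
    qed
  qed measurable
  also have "\<dots> = inner (rcl (\<lambda>x. p x * u x)) (rcl w)" by (rule inner_rcl[OF L Hs_L2[OF assms(2)], symmetric])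
  also have "rcl (\<lambda>x. p x * u x) = rmult p (psi s (gam s u))"
    by (simp add: psi_gam[OF s0 assms(1)] rcl_def mult_l2_cl[OF multiplier_p] L2_of_real Hs_L2[OF assms(1)])
  finally show ?thesis by (simp add: psi_gam[OF s0 assms(2)])
qed

text \<open>Every element of the closed subspace is the transform of an admissible test function, so
  testing with functions and with classes is the same.\<close>

lemma weak_equation_form:
  assumes u: "u \<in> Hs s"
  shows "weak_equation s \<Omega> q u \<longleftrightarrow> (\<forall>h\<in>sob s \<Omega>. form (gam s u) h = 0)"
proof -
  have eq: "(\<integral>x. frac_laplace_L2 (s / 2) u x * frac_laplace_L2 (s / 2) w x \<partial>lebesgue) + (\<integral>x. q x * u x * w x \<partial>lebesgue_on \<Omega>)
      = form (gam s u) (gam s w)" if "w \<in> Hs s" for w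
    unfolding form_def by (simp add: integral_frac_laplace_L2[OF s(1) u that] potential_term[OF u that])
  show ?thesis
  proof
    assume w: "weak_equation s \<Omega> q u"
    show "\<forall>h\<in>sob s \<Omega>. form (gam s u) h = 0"
    proof
      fix h assume "h \<in> sob s \<Omega>"
      then obtain w where "w \<in> Hs_tilde s \<Omega>" "gam s w = h" by (rule sob_cases[OF s0 s1])
      then show "form (gam s u) h = 0" using w eq[of w] by (simp add: weak_equation_def Hs_tilde_iff[OF s0 s1])
    qed
  next
    assume "\<forall>h\<in>sob s \<Omega>. form (gam s u) h = 0"
    then show "weak_equation s \<Omega> q u" unfolding weak_equation_def by (auto simp: Hs_tilde_iff[OF s0 s1] eq)
  qed
qed

lemma form_coercive:
  "\<exists>I c. finite I \<and> 0 < c \<and> (\<forall>g\<in>sob s \<Omega>. (\<forall>i\<in>I. fourier_functional \<Omega> s i g = 0) \<longrightarrow> c * (norm g)\<^sup>2 \<le> form g g)"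
proof -
  have C0: "0 \<le> C" using p(2)[of undefined] by simp
  define N where "N = (2 * pi) ^ DIM('a)"
  have N: "0 < N" by (simp add: N_def)
  \<comment> \<open>Makes N (1 + C) \<epsilon> equal to 1/2: the lower-order term costs N in
    Garding's inequality and another N C through the potential, and half of the squared norm
    survives.\<close>
  define \<epsilon> where "\<epsilon> = 1 / (2 * (N * (1 + C)))"
  have half: "0 < 1 / (2 * x) \<and> x * (1 / (2 * x)) = 1 / 2" if "0 < x" for x :: real using that by simp
  have "0 < N * (1 + C)" by (rule mult_pos_pos[OF N]) (use C0 in simp)
  then have "0 < \<epsilon> \<and> N * (1 + C) * \<epsilon> = 1 / 2" unfolding \<epsilon>_def by (rule half)
  note \<epsilon> = conjunct1[OF this] conjunct2[OF this]
  obtain I where I: "finite I" "\<forall>g\<in>sob s \<Omega>. (\<forall>i\<in>I. fourier_functional \<Omega> s i g = 0) \<longrightarrow> (norm (psi s g))\<^sup>2 \<le> \<epsilon> * (norm g)\<^sup>2"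
    using rellich[OF s(1) s1 \<Omega>(2) \<Omega>_sets \<epsilon>(1)] by (elim exE conjE)
  show ?thesis
  proof (intro exI conjI ballI impI)
    show "finite I" by fact
    show "0 < 1 / (2 * N)" using N by simp
    fix g assume g: "g \<in> sob s \<Omega>" "\<forall>i\<in>I. fourier_functional \<Omega> s i g = 0"
    have small: "(norm (psi s g))\<^sup>2 \<le> \<epsilon> * (norm g)\<^sup>2" using I(2) g by simp
    have "\<bar>inner (rmult p (psi s g)) (psi s g)\<bar> \<le> norm (rmult p (psi s g)) * norm (psi s g)"
      by (rule Cauchy_Schwarz_ineq2)
    also have "\<dots> \<le> (C * norm (psi s g)) * norm (psi s g)"
      by (intro mult_right_mono norm_rmult_le[OF multiplier_p p(2)]) auto
    finally have "\<bar>inner (rmult p (psi s g)) (psi s g)\<bar> \<le> C * (norm (psi s g))\<^sup>2"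
      by (simp add: power2_eq_square mult.assoc)
    then have "(norm (lam s g))\<^sup>2 - C * (norm (psi s g))\<^sup>2 \<le> form g g"
      unfolding form_def power2_norm_eq_inner[of "lam s g"] by linarith
    then have "N * ((norm (lam s g))\<^sup>2 - C * (norm (psi s g))\<^sup>2) \<le> N * form g g" using N by (intro mult_left_mono) auto
    moreover have "(norm g)\<^sup>2 \<le> N * ((norm (lam s g))\<^sup>2 + (norm (psi s g))\<^sup>2)"
      unfolding N_def by (rule garding[OF s(1) s1])
    moreover have "N * (1 + C) * (norm (psi s g))\<^sup>2 \<le> N * (1 + C) * (\<epsilon> * (norm g)\<^sup>2)"
      using small N C0 by (intro mult_left_mono) auto
    moreover have "N * (1 + C) * (\<epsilon> * (norm g)\<^sup>2) = 1 / 2 * (norm g)\<^sup>2" by (simp only: mult.assoc[symmetric] \<epsilon>(2))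
    ultimately have "1 / 2 * (norm g)\<^sup>2 \<le> N * form g g" by (simp add: algebra_simps)
    then show "1 / (2 * N) * (norm g)\<^sup>2 \<le> form g g" using N by (simp add: field_simps)
  qed
qed

text \<open>The real L2 space of the domain, extended by 0, as a closed subspace of the complex
  functions on the whole space; it is the space that solutions have to fill.\<close>

definition local_space :: "'a l2 set" where
  "local_space = {v. cnj_l2 v = v \<and> rmult (indicator \<Omega>) v = v}"

lemma subspace_local_space: "subspace local_space"
  unfolding local_space_def subspace_def
  by (simp add: linear_simps[OF bounded_linear_cnj_l2] linear_simps[OF bounded_linear_mult_l2[OF multiplier_\<Omega>]])

lemma closed_local_space: "closed local_space"
  unfolding local_space_def
  by (intro closed_Collect_conj closed_Collect_eq continuous_on_id
      bounded_linear.continuous_on[OF bounded_linear_cnj_l2] bounded_linear.continuous_on[OF bounded_linear_mult_l2[OF multiplier_\<Omega>]])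

lemma rcl_in_local_space:
  assumes u: "u \<in> L2_space lebesgue"
  shows "rcl (\<lambda>x. indicator \<Omega> x * u x) \<in> local_space"
proof -
  have L: "(\<lambda>x. indicator \<Omega> x * u x) \<in> L2_space lebesgue" by (rule L2_space_indicator[OF u \<Omega>_sets])
  have "complex_of_real (indicator \<Omega> x) * complex_of_real (indicator \<Omega> x * u x) = complex_of_real (indicator \<Omega> x * u x)" for x
    by (simp add: indicator_def)
  then show ?thesis unfolding local_space_def mem_Collect_eq
    by (intro conjI cnj_rcl[OF L]) (simp only: rcl_def mult_l2_cl[OF multiplier_\<Omega> L2_of_real[OF L]])
qed

lemma local_part_in_local_space: "local_part ` sob s \<Omega> \<subseteq> local_space"
proof (rule image_subsetI)
  fix g assume "g \<in> sob s \<Omega>"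
  then obtain u where u: "u \<in> Hs_tilde s \<Omega>" "gam s u = g" by (rule sob_cases[OF s0 s1])
  have uH: "u \<in> Hs s" using u(1) by (simp add: Hs_tilde_iff[OF s0 s1])
  show "local_part g \<in> local_space"
    unfolding u(2)[symmetric] local_part_gam[OF uH] by (rule rcl_in_local_space[OF Hs_L2[OF uH]])
qed

text \<open>Test functions on the domain are among the admissible \<open>x\<close>, so orthogonality
  is the hypothesis of the fundamental lemma.\<close>

lemma local_space_nondegenerate:
  assumes v: "v \<in> local_space" and orth: "\<And>x. x \<in> sob s \<Omega> \<Longrightarrow> inner v (local_part x) = 0"
  shows "v = 0"
proof -
  have v': "cnj_l2 v = v" "rmult (indicator \<Omega>) v = v" using v by (auto simp: local_space_def)
  obtain u where u: "u \<in> L2_space lebesgue" "v = rcl u" by (rule real_l2_cases[OF v'(1)])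
  have "AE x in lebesgue. x \<in> \<Omega> \<longrightarrow> complex_of_real (u x) = 0"
  proof (rule l2_AE_zero_if_test[OF \<Omega>(1) L2_of_real[OF u(1)]])
    fix \<phi> assume \<phi>: "\<phi> \<in> test_functions \<Omega>"
    have "0 = inner v (local_part (gam s \<phi>))" by (rule orth[OF gam_test_in_sob[OF \<phi>], symmetric])
    also have "\<dots> = inner (rcl u) (rcl \<phi>)"
      unfolding local_part_interior[OF gam_test_in_sob[OF \<phi>]] psi_gam[OF s0 test_Hs[OF s0 s1 \<phi>]] u(2) ..
    also have "\<dots> = (\<integral>x. u x * \<phi> x \<partial>lebesgue)" by (rule inner_rcl[OF u(1) test_L2[OF \<phi>]])
    finally show "(\<integral>x. complex_of_real (u x) * of_real (\<phi> x) \<partial>lebesgue) = 0"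
      using integral_complex_of_real[of lebesgue "\<lambda>x. u x * \<phi> x"] by simp
  qed
  then have "AE x in lebesgue. indicator \<Omega> x * u x = 0" by eventually_elim (auto simp: indicator_def)
  then have "rcl (\<lambda>x. indicator \<Omega> x * u x) = rcl (\<lambda>x. 0)"
    by (subst rcl_eq_iff[OF L2_space_indicator[OF u(1) \<Omega>_sets] L2_space_zero])
  moreover have "rcl (\<lambda>x. indicator \<Omega> x * u x) = v"
    using v'(2) by (simp add: u(2) rcl_def mult_l2_cl[OF multiplier_\<Omega>] L2_of_real u(1))
  ultimately show ?thesis by (simp add: rcl_def cl_zero)
qed

text \<open>Against exterior data the form is the fractional Laplacian alone, so unique continuation
  applies; injectivity of \<open>psi\<close> carries the vanishing of the function over to its
  weighted transform.\<close>

lemma form_unique_continuation: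
  assumes x: "x \<in> sob s \<Omega>" and orth: "\<And>y. y \<in> sob s W \<Longrightarrow> form x y = 0"
  shows "x = 0"
proof -
  obtain u where u: "u \<in> Hs_tilde s \<Omega>" "gam s u = x" by (rule sob_cases[OF s0 s1 x])
  have uH: "u \<in> Hs s" "gam s u \<in> sob s \<Omega>" using u(1) by (simp_all add: Hs_tilde_iff[OF s0 s1])
  have "rcl u = 0"
  proof (rule fractional_unique_continuation[OF s uH \<Omega>(2) \<Omega>_sets W])
    fix \<phi> assume "\<phi> \<in> test_functions W"
    then have y: "gam s \<phi> \<in> sob s W" by (rule gam_test_in_sob)
    show "inner (lam s (gam s u)) (lam s (gam s \<phi>)) = 0"
      using orth[OF y] by (simp add: form_exterior[OF y] u(2))
  qed
  then have "psi s x = psi s 0"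
    using psi_gam[OF s0 uH(1)] by (simp add: u(2) linear_simps[OF bounded_linear_psi[OF s0]])
  then show ?thesis by (rule psi_inj[OF s0])
qed

definition kernel :: "'a l2 set" where
  "kernel = {x \<in> sob s \<Omega>. \<forall>y\<in>sob s \<Omega>. form x y = 0}"

definition data :: "'a l2 set" where
  "data = {y \<in> sob s W. \<forall>z\<in>kernel. form z y = 0}"

lemma
  shows runge_solution: "y \<in> data \<Longrightarrow> \<exists>u. u - y \<in> sob s \<Omega> \<and> (\<forall>x\<in>sob s \<Omega>. form u x = 0) \<and> (\<forall>z\<in>kernel. inner (local_part u) (local_part z) = 0)"
    and runge_closure: "closure {local_part u | u y. y \<in> data \<and> u - y \<in> sob s \<Omega> \<and> (\<forall>x\<in>sob s \<Omega>. form u x = 0)} = local_space"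
proof -
  obtain I c where I: "finite I" "0 < c"
    "\<forall>g\<in>sob s \<Omega>. (\<forall>i\<in>I. fourier_functional \<Omega> s i g = 0) \<longrightarrow> c * (norm g)\<^sup>2 \<le> form g g"
    using form_coercive by (elim exE conjE)
  have co: "c * (norm x)\<^sup>2 \<le> form x x" if "x \<in> sob s \<Omega>" "\<And>i. i \<in> I \<Longrightarrow> fourier_functional \<Omega> s i x = 0" for x
    using I(3) that by simp
  note R = abstract_runge[OF subspace_sob[OF s0 s1] closed_sob subspace_sob[OF s0 s1] bounded_bilinear_form form_commute I(1)
      bounded_linear_fourier_functional[OF s0] I(2) co bounded_linear_local_part local_part_exterior
      subspace_local_space closed_local_space local_part_in_local_space local_space_nondegenerate form_unique_continuation]
  show "y \<in> data \<Longrightarrow> \<exists>u. u - y \<in> sob s \<Omega> \<and> (\<forall>x\<in>sob s \<Omega>. form u x = 0) \<and> (\<forall>z\<in>kernel. inner (local_part u) (local_part z) = 0)"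
    unfolding data_def kernel_def by (rule R(1))
  show "closure {local_part u | u y. y \<in> data \<and> u - y \<in> sob s \<Omega> \<and> (\<forall>x\<in>sob s \<Omega>. form u x = 0)} = local_space"
    unfolding data_def kernel_def by (rule R(2))
qed

section \<open>Return from classes to functions\<close>

lemma Z2_iff: "z \<in> Z2 s \<Omega> q \<longleftrightarrow> z \<in> Hs s \<and> gam s z \<in> kernel"
  unfolding Z2_def kernel_def mem_Collect_eq Hs_tilde_iff[OF s0 s1] using weak_equation_form[of z] by (simp add: conj_assoc cong: conj_cong)

lemma kernel_cases:
  assumes "x \<in> kernel"
  obtains z where "z \<in> Z2 s \<Omega> q" "gam s z = x"
proof -
  have "x \<in> sob s \<Omega>" using assms by (simp add: kernel_def)
  then obtain z where "z \<in> Hs_tilde s \<Omega>" "gam s z = x" by (rule sob_cases[OF s0 s1])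
  then show ?thesis using assms by (intro that[of z]) (auto simp: Z2_iff Hs_tilde_iff[OF s0 s1])
qed

lemma H1_iff: "f \<in> H1 s \<Omega> W q \<longleftrightarrow> f \<in> Hs s \<and> gam s f \<in> data"
proof -
  have eq: "dual_pairing s W f (frac_laplace s z) = form (gam s z) (gam s f)" if "z \<in> Z2 s \<Omega> q" "f \<in> Hs_tilde s W" for z
  proof -
    have "gam s f \<in> sob s W" "z \<in> Hs s" using that by (simp_all add: Hs_tilde_iff[OF s0 s1] Z2_iff)
    then show ?thesis by (simp add: dual_pairing_frac_laplace[OF s(1) s1 _ that(2)] form_exterior)
  qed
  show ?thesis
  proof
    assume f: "f \<in> H1 s \<Omega> W q"
    then have fW: "f \<in> Hs_tilde s W" by (simp add: H1_def)
    have "form z (gam s f) = 0" if "z \<in> kernel" for z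
    proof -
      from that obtain w where "w \<in> Z2 s \<Omega> q" "gam s w = z" by (rule kernel_cases)
      then show ?thesis using f eq[of w] fW by (simp add: H1_def)
    qed
    then show "f \<in> Hs s \<and> gam s f \<in> data" using fW by (simp add: data_def Hs_tilde_iff[OF s0 s1])
  next
    assume f: "f \<in> Hs s \<and> gam s f \<in> data"
    then have fW: "f \<in> Hs_tilde s W" by (simp add: data_def Hs_tilde_iff[OF s0 s1])
    have "dual_pairing s W f (frac_laplace s z) = 0" if "z \<in> Z2 s \<Omega> q" for z
      using f that by (simp add: eq[OF that fW] data_def Z2_iff)
    then show "f \<in> H1 s \<Omega> W q" using fW by (simp add: H1_def)
  qed
qed

lemma weak_solution_iff:
  assumes "f \<in> Hs s"
  shows "weak_solution s \<Omega> q f u \<longleftrightarrow> u \<in> Hs s \<and> gam s u - gam s f \<in> sob s \<Omega> \<and> (\<forall>h\<in>sob s \<Omega>. form (gam s u) h = 0)"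
  using weak_equation_form[of u] Hs_diff[OF s0 _ assms, of u]
  by (auto simp: weak_solution_def Hs_tilde_iff[OF s0 s1])

lemma Hs_in_L2_lebesgue_on: "u \<in> Hs s \<Longrightarrow> u \<in> L2_space (lebesgue_on \<Omega>)"
  unfolding L2_space_lebesgue_on[OF \<Omega>_sets] by (rule L2_space_indicator[OF Hs_L2 \<Omega>_sets])

lemma restrict_in_H2_iff:
  assumes u: "u \<in> Hs s"
  shows "restrict u \<Omega> \<in> H2 s \<Omega> q \<longleftrightarrow> (\<forall>z\<in>kernel. inner (local_part (gam s u)) (local_part z) = 0)"
proof -
  \<comment> \<open>\<open>restrict\<close> takes the value \<open>undefined\<close> off the domain,
    that is, outside the space of \<open>lebesgue_on \<Omega>\<close>.\<close>
  have "restrict u \<Omega> \<in> L2_space (lebesgue_on \<Omega>) \<longleftrightarrow> u \<in> L2_space (lebesgue_on \<Omega>)"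
    by (rule L2_space_cong) simp
  then have L: "restrict u \<Omega> \<in> L2_space (lebesgue_on \<Omega>)" using Hs_in_L2_lebesgue_on[OF u] by simp
  have eq: "(\<integral>x. restrict u \<Omega> x * z x \<partial>lebesgue_on \<Omega>) = inner (local_part (gam s u)) (local_part (gam s z))"
    if "z \<in> Z2 s \<Omega> q" for z
  proof -
    have z: "z \<in> Hs s" using that by (simp add: Z2_iff)
    show ?thesis unfolding inner_local_part[OF u z] by (intro Bochner_Integration.integral_cong) auto
  qed
  show ?thesis
  proof
    assume H: "restrict u \<Omega> \<in> H2 s \<Omega> q"
    show "\<forall>z\<in>kernel. inner (local_part (gam s u)) (local_part z) = 0"
    proof
      fix z assume "z \<in> kernel"
      then obtain w where w: "w \<in> Z2 s \<Omega> q" "gam s w = z" by (rule kernel_cases)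
      then show "inner (local_part (gam s u)) (local_part z) = 0" using H eq[OF w(1)] by (simp add: H2_def)
    qed
  next
    assume "\<forall>z\<in>kernel. inner (local_part (gam s u)) (local_part z) = 0"
    then have "(\<integral>x. restrict u \<Omega> x * z x \<partial>lebesgue_on \<Omega>) = 0" if "z \<in> Z2 s \<Omega> q" for z
      using eq[OF that] that by (simp add: Z2_iff)
    then show "restrict u \<Omega> \<in> H2 s \<Omega> q" using L by (simp add: H2_def)
  qed
qed

text \<open>A class that differs from the data by an element of the interior space has a function
  behind it, because both summands have one.\<close>

lemma gam_representative:
  assumes f: "f \<in> Hs s" and g: "g - gam s f \<in> sob s \<Omega>"
  obtains u where "u \<in> Hs s" "gam s u = g"
proof -
  obtain u where u: "u \<in> Hs_tilde s \<Omega>" "gam s u = g - gam s f" by (rule sob_cases[OF s0 s1 g])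
  have uH: "u \<in> Hs s" using u(1) by (simp add: Hs_tilde_iff[OF s0 s1])
  show ?thesis by (rule that[OF Hs_combine(1)[OF s0 uH f, of 1]]) (simp only: Hs_combine(2)[OF s0 uH f] u(2), simp)
qed

text \<open>The choice in \<open>poisson\<close> is made from a nonempty set: the normalized
  solution exists as a class and lifts to a function.\<close>

lemma poisson_solution:
  assumes f: "f \<in> H1 s \<Omega> W q"
  shows "weak_solution s \<Omega> q f (poisson s \<Omega> q f)" "restrict (poisson s \<Omega> q f) \<Omega> \<in> H2 s \<Omega> q"
proof -
  have f': "f \<in> Hs s" "gam s f \<in> data" using f by (simp_all add: H1_iff)
  obtain g where g: "g - gam s f \<in> sob s \<Omega>" "\<forall>x\<in>sob s \<Omega>. form g x = 0" "\<forall>z\<in>kernel. inner (local_part g) (local_part z) = 0"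
    using runge_solution[OF f'(2)] by (elim exE conjE)
  obtain u where u: "u \<in> Hs s" "gam s u = g" by (rule gam_representative[OF f'(1) g(1)])
  have "u \<in> poisson_class s \<Omega> q f \<and> restrict u \<Omega> \<in> H2 s \<Omega> q"
    unfolding poisson_class_def mem_Collect_eq weak_solution_iff[OF f'(1)] restrict_in_H2_iff[OF u(1)] using u g by simp
  then have "poisson s \<Omega> q f \<in> poisson_class s \<Omega> q f \<and> restrict (poisson s \<Omega> q f) \<Omega> \<in> H2 s \<Omega> q"
    unfolding poisson_def
    by (rule someI[of "\<lambda>u. u \<in> poisson_class s \<Omega> q f \<and> restrict u \<Omega> \<in> H2 s \<Omega> q"])
  then show "weak_solution s \<Omega> q f (poisson s \<Omega> q f)" "restrict (poisson s \<Omega> q f) \<Omega> \<in> H2 s \<Omega> q"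
    by (simp_all add: poisson_class_def)
qed

lemma L2_seminorm_lebesgue_on:
  assumes v: "(\<lambda>x. indicator \<Omega> x * v x) \<in> L2_space lebesgue" and u: "u \<in> Hs s"
  shows "L2_seminorm (lebesgue_on \<Omega>) (\<lambda>x. v x - u x) = dist (local_part (gam s u)) (rcl (\<lambda>x. indicator \<Omega> x * v x))"
proof -
  have L: "(\<lambda>x. indicator \<Omega> x * u x) \<in> L2_space lebesgue" by (rule L2_space_indicator[OF Hs_L2[OF u] \<Omega>_sets])
  have "(\<integral>x. (norm (v x - u x))\<^sup>2 \<partial>lebesgue_on \<Omega>) = (\<integral>x. indicator \<Omega> x *\<^sub>R (norm (v x - u x))\<^sup>2 \<partial>lebesgue)"
    using \<Omega>_sets by (subst integral_restrict_space) auto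
  also have "\<dots> = (\<integral>x. (norm (indicator \<Omega> x * u x - indicator \<Omega> x * v x))\<^sup>2 \<partial>lebesgue)"
    by (intro Bochner_Integration.integral_cong) (auto simp: indicator_def power2_commute)
  finally have "L2_seminorm (lebesgue_on \<Omega>) (\<lambda>x. v x - u x) = L2_seminorm lebesgue (\<lambda>x. indicator \<Omega> x * u x - indicator \<Omega> x * v x)"
    by (simp only: L2_seminorm_def)
  also have "\<dots> = norm (rcl (\<lambda>x. indicator \<Omega> x * u x) - rcl (\<lambda>x. indicator \<Omega> x * v x))"
    unfolding rcl_diff[OF L v, symmetric] by (rule norm_rcl[OF L2_space_diff[OF L v], symmetric])
  finally show ?thesis by (simp only: local_part_gam[OF u] dist_norm)
qed

text \<open>The approximating solution need not be the normalized one. Its difference from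
  \<open>poisson s \<Omega> q f\<close> solves the homogeneous problem and is taken as
  \<open>z\<close>.\<close>

lemma approximation:
  assumes v: "v \<in> L2_space (lebesgue_on \<Omega>)" and e: "0 < e"
  shows "\<exists>f z. f \<in> H1 s \<Omega> W q \<and> z \<in> Z2 s \<Omega> q \<and>
    L2_seminorm (lebesgue_on \<Omega>) (\<lambda>x. v x - (restrict (poisson s \<Omega> q f) \<Omega> x + z x)) < e"
proof -
  have L: "(\<lambda>x. indicator \<Omega> x * v x) \<in> L2_space lebesgue" using v by (simp add: L2_space_lebesgue_on[OF \<Omega>_sets])
  have "(\<lambda>x. indicator \<Omega> x * (indicator \<Omega> x * v x)) = (\<lambda>x. indicator \<Omega> x * v x)" by (auto simp: indicator_def)
  with rcl_in_local_space[OF L] have "rcl (\<lambda>x. indicator \<Omega> x * v x) \<in> local_space" by (simp only:)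
  then obtain y where y: "y \<in> {local_part u | u y. y \<in> data \<and> u - y \<in> sob s \<Omega> \<and> (\<forall>x\<in>sob s \<Omega>. form u x = 0)}"
    "dist y (rcl (\<lambda>x. indicator \<Omega> x * v x)) < e"
    unfolding runge_closure[symmetric] closure_approachable using e by (elim allE impE bexE)
  from y(1) obtain g d where g: "y = local_part g" "d \<in> data" "g - d \<in> sob s \<Omega>" "\<forall>x\<in>sob s \<Omega>. form g x = 0"
    unfolding mem_Collect_eq by (elim exE conjE)
  have "d \<in> sob s W" using g(2) by (simp add: data_def)
  then obtain f where f: "f \<in> Hs_tilde s W" "gam s f = d" by (rule sob_cases[OF s0 s1])
  have fH: "f \<in> Hs s" using f(1) by (simp add: Hs_tilde_iff[OF s0 s1])
  have f1: "f \<in> H1 s \<Omega> W q" using fH g(2) f(2) by (simp add: H1_iff)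
  obtain u where u: "u \<in> Hs s" "gam s u = g" by (rule gam_representative[OF fH g(3)[folded f(2)]])
  let ?P = "poisson s \<Omega> q f"
  define z where "z x = u x - ?P x" for x
  have P: "?P \<in> Hs s" "gam s ?P - gam s f \<in> sob s \<Omega>" "\<forall>h\<in>sob s \<Omega>. form (gam s ?P) h = 0"
    using poisson_solution(1)[OF f1] unfolding weak_solution_iff[OF fH] by auto
  \<comment> \<open>Both solutions have the data \<open>f\<close>, so their difference lies in the
    interior space.\<close>
  have "(g - gam s f) - (gam s ?P - gam s f) \<in> sob s \<Omega>"
    by (rule subspace_diff[OF subspace_sob[OF s0 s1]]) (use g(3) f(2) P(2) in auto)
  then have "g - gam s ?P \<in> kernel"
    using g(4) P(3) by (simp add: kernel_def bounded_bilinear.diff_left[OF bounded_bilinear_form])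
  then have "z \<in> Z2 s \<Omega> q"
    using Hs_diff[OF s0 u(1) P(1)] by (simp add: Z2_iff z_def[abs_def] u(2))
  moreover have "L2_seminorm (lebesgue_on \<Omega>) (\<lambda>x. v x - (restrict ?P \<Omega> x + z x)) = L2_seminorm (lebesgue_on \<Omega>) (\<lambda>x. v x - u x)"
    unfolding L2_seminorm_def by (intro arg_cong[where f=sqrt] Bochner_Integration.integral_cong) (auto simp: z_def)
  moreover have "\<dots> < e" unfolding L2_seminorm_lebesgue_on[OF L u(1)] u(2) using y(2) g(1) by simp
  ultimately show ?thesis using f1 by (intro exI[of _ f] exI[of _ z] conjI) simp_all
qed

lemma dense_range:
  "dense_in_L2 (lebesgue_on \<Omega>)
    {\<lambda>x. restrict (poisson s \<Omega> q f) \<Omega> x + z x | f z. f \<in> H1 s \<Omega> W q \<and> z \<in> Z2 s \<Omega> q}" (is "dense_in_L2 _ ?R")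
  unfolding dense_in_L2_def
proof (intro conjI ballI allI impI subsetI)
  fix r assume "r \<in> ?R"
  then obtain f z where r: "r = (\<lambda>x. restrict (poisson s \<Omega> q f) \<Omega> x + z x)" "f \<in> H1 s \<Omega> W q" "z \<in> Z2 s \<Omega> q"
    unfolding mem_Collect_eq by (elim exE conjE)
  have "restrict (poisson s \<Omega> q f) \<Omega> \<in> L2_space (lebesgue_on \<Omega>)" using poisson_solution(2)[OF r(2)] by (simp add: H2_def)
  moreover have "z \<in> L2_space (lebesgue_on \<Omega>)" using r(3) by (intro Hs_in_L2_lebesgue_on) (simp add: Z2_iff)
  ultimately show "r \<in> L2_space (lebesgue_on \<Omega>)" unfolding r(1) by (rule L2_space_add)
next
  fix v :: "'a \<Rightarrow> real" and e :: real assume ve: "v \<in> L2_space (lebesgue_on \<Omega>)" "0 < e"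
  obtain f z where fz: "f \<in> H1 s \<Omega> W q" "z \<in> Z2 s \<Omega> q"
    "L2_seminorm (lebesgue_on \<Omega>) (\<lambda>x. v x - (restrict (poisson s \<Omega> q f) \<Omega> x + z x)) < e"
    using approximation[OF ve] by (elim exE conjE)
  show "\<exists>r\<in>?R. L2_seminorm (lebesgue_on \<Omega>) (\<lambda>x. v x - r x) < e"
    by (rule bexI[of _ "\<lambda>x. restrict (poisson s \<Omega> q f) \<Omega> x + z x"]) (use fz in auto)
qed

end

theorem lemma4p3:
  fixes s :: real and \<Omega> W :: "(real ^ 'n) set" and q :: "real ^ 'n \<Rightarrow> real"
  assumes "0 < s" and "s < 1"
    and "open \<Omega>" and "connected \<Omega>" and "\<Omega> \<noteq> {}" and "bounded \<Omega>" and "smooth_boundary \<Omega>"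
    and "open W" and "W \<noteq> {}" and "W \<subseteq> - closure \<Omega>" and "closure \<Omega> \<inter> closure W = {}"
    and "q \<in> Linfty_space (lebesgue_on \<Omega>)"
  shows "dense_in_L2 (lebesgue_on \<Omega>)
    {\<lambda>x. restrict (poisson s \<Omega> q f) \<Omega> x + z x | f z. f \<in> H1 s \<Omega> W q \<and> z \<in> Z2 s \<Omega> q}"
proof -
  have \<Omega>: "\<Omega> \<in> sets lebesgue" using assms(3) by (simp add: borel_open)
  obtain C where q: "q \<in> borel_measurable (lebesgue_on \<Omega>)" "AE x in lebesgue_on \<Omega>. \<bar>q x\<bar> \<le> C"
    using assms(12) by (auto simp: Linfty_space_def)
  have [measurable]: "(\<lambda>x. indicator \<Omega> x *\<^sub>R q x) \<in> borel_measurable lebesgue"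
    using q(1) \<Omega> by (subst (asm) borel_measurable_restrict_space_iff) auto
  have bound: "AE x in lebesgue. x \<in> \<Omega> \<longrightarrow> \<bar>q x\<bar> \<le> C"
    using q(2) \<Omega> by (subst (asm) AE_restrict_space_iff) auto
  \<comment> \<open>Values of \<open>q\<close> beyond the essential bound, taken on a null set only,
    are replaced by 0, so that the bound holds everywhere.\<close>
  define p where "p x = (if \<bar>indicator \<Omega> x *\<^sub>R q x\<bar> \<le> C then indicator \<Omega> x *\<^sub>R q x else 0)" for x
  interpret exterior_problem s "\<bar>C\<bar>" \<Omega> W q p
  proof
    show "W \<inter> \<Omega> = {}" using assms(10) closure_subset[of \<Omega>] by auto
    show "AE x in lebesgue. x \<in> \<Omega> \<longrightarrow> p x = q x" using bound by eventually_elim (simp add: p_def)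
    show "p \<in> borel_measurable lebesgue" unfolding p_def[abs_def] by measurable
    show "\<bar>p x\<bar> \<le> \<bar>C\<bar>" for x by (auto simp: p_def)
    show "p x = 0" if "x \<notin> \<Omega>" for x using that by (simp add: p_def)
  qed (fact assms q)+
  show ?thesis by (rule dense_range)
qed

end
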